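(* For every real $R_0$ with $0<R_0<1$ and every constant $\varepsilon>0$, the following holds for infinitely many integers $\mathbf{q}$ that are powers of two: there is a code of rate at least $R_0$ over an alphabet of size $\mathbf{q}$, with block length $N \ge 2^{\mathbf{q}^{\Omega(\varepsilon^2/\log(1/R_0))}}$, that can be list decoded up to a fraction $1-R_0-\varepsilon$ of errors in time bounded by $(N\log(1/R_0)/\varepsilon^2)^{O(1/(R_0\varepsilon)^2)}$.
   Context: A code of block length $N$ over an alphabet $\Sigma$ is a subset $C\subseteq\Sigma^N$; its rate is $\log_{|\Sigma|}|C|/N$. List decoding $C$ up to a fraction $\rho$ of errors means: given any received word $y\in\Sigma^N$, output the list of all codewords $c\in C$ that differ from $y$ in at most $\rho N$ positions. The implied constants in $\Omega(\cdot)$ and $O(\cdot)$ are absolute. *)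

theory Defs
  imports Complex_Main
begin

section \<open>Codes\<close>

definition words :: "'a set \<Rightarrow> nat \<Rightarrow> 'a list set" where
  "words \<Sigma> N = {y. set y \<subseteq> \<Sigma> \<and> length y = N}"

definition is_code :: "'a set \<Rightarrow> nat \<Rightarrow> 'a list set \<Rightarrow> bool" where
  "is_code \<Sigma> N C \<longleftrightarrow> C \<subseteq> words \<Sigma> N"

definition rate :: "'a set \<Rightarrow> nat \<Rightarrow> 'a list set \<Rightarrow> real" where
  "rate \<Sigma> N C = log (real (card \<Sigma>)) (real (card C)) / real N"

definition hamming_dist :: "'a list \<Rightarrow> 'a list \<Rightarrow> nat" where
  "hamming_dist x y = card {i. i < length x \<and> x ! i \<noteq> y ! i}"

text \<open>For a negative fraction \<open>\<rho>\<close> this set is empty.\<close>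

definition close_codewords :: "'a list set \<Rightarrow> nat \<Rightarrow> real \<Rightarrow> 'a list \<Rightarrow> 'a list set" where
  "close_codewords C N \<rho> y = {c \<in> C. real (hamming_dist c y) \<le> \<rho> * real N}"

section \<open>Model of computation\<close>

text \<open>
  Running time is measured on a deterministic random access machine with unit cost, presented as a
  structured language.  A state consists of registers and of a memory that is addressed indirectly,
  both holding natural numbers.  The only arithmetic operations are addition and truncated
  subtraction: without multiplication, unit-cost time is polynomially related to Turing machine time
  (Cook and Reckhow).  Every assignment and every test costs one step.
\<close>

datatype prog =
    Skip
  | Const nat nat
  | Copy nat nat
  | Add nat nat nat
  | Sub nat nat nat
  | Load nat nat
  | Store nat nat
  | Seq prog prog
  | If_Pos nat prog prog
  | While_Pos nat prog

type_synonym state = "(nat \<Rightarrow> nat) \<times> (nat \<Rightarrow> nat)"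

text \<open>\<open>exec p s t s'\<close>: started in state \<open>s\<close>, the program \<open>p\<close> halts after \<open>t\<close> steps in state \<open>s'\<close>.\<close>

inductive exec :: "prog \<Rightarrow> state \<Rightarrow> nat \<Rightarrow> state \<Rightarrow> bool" where
  Skip: "exec Skip s 1 s"
| Const: "exec (Const i n) (r, m) 1 (r(i := n), m)"
| Copy: "exec (Copy i j) (r, m) 1 (r(i := r j), m)"
| Add: "exec (Add i j k) (r, m) 1 (r(i := r j + r k), m)"
| Sub: "exec (Sub i j k) (r, m) 1 (r(i := r j - r k), m)"
| Load: "exec (Load i j) (r, m) 1 (r(i := m (r j)), m)"
| Store: "exec (Store i j) (r, m) 1 (r, m(r i := r j))"
| Seq: "exec p s t s' \<Longrightarrow> exec p' s' t' s'' \<Longrightarrow> exec (Seq p p') s (t + t') s''"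
| If_True: "fst s i > 0 \<Longrightarrow> exec p s t s' \<Longrightarrow> exec (If_Pos i p p') s (Suc t) s'"
| If_False: "fst s i = 0 \<Longrightarrow> exec p' s t s' \<Longrightarrow> exec (If_Pos i p p') s (Suc t) s'"
| While_True: "fst s i > 0 \<Longrightarrow> exec p s t s' \<Longrightarrow> exec (While_Pos i p) s' t' s'' \<Longrightarrow>
    exec (While_Pos i p) s (Suc (t + t')) s''"
| While_False: "fst s i = 0 \<Longrightarrow> exec (While_Pos i p) s 1 s"

lemma exec_deterministic:
  assumes "exec p s t s'" "exec p s u s''"
  shows "t = u \<and> s' = s''"
  using assms
proof (induction arbitrary: u s'' rule: exec.induct)
  case (Skip s)
  from Skip.prems show ?case by cases simp_all
next
  case (Const i n r m)
  from Const.prems show ?case by cases simp_all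
next
  case (Copy i j r m)
  from Copy.prems show ?case by cases simp_all
next
  case (Add i j k r m)
  from Add.prems show ?case by cases simp_all
next
  case (Sub i j k r m)
  from Sub.prems show ?case by cases simp_all
next
  case (Load i j r m)
  from Load.prems show ?case by cases simp_all
next
  case (Store i j r m)
  from Store.prems show ?case by cases simp_all
next
  case (Seq p s t s' p' t' s2)
  note IH = Seq.IH
  from Seq.prems show ?case
  proof cases
    case (Seq v s1 v')
    have "t = v" "s' = s1" using IH(1)[OF Seq(2)] by auto
    moreover have "t' = v'" "s2 = s''" using IH(2)[of v' s''] Seq(3) \<open>s' = s1\<close> by auto
    ultimately show ?thesis using Seq(1) by simp
  qed
next
  case (If_True s i p t s' p')
  note IH = If_True.IH
  from If_True.prems show ?case
  proof cases
    case (If_True v)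
    show ?thesis using IH[OF If_True(3)] If_True(1) by simp
  next
    case If_False
    with \<open>fst s i > 0\<close> show ?thesis by simp
  qed
next
  case (If_False s i p' t s' p)
  note IH = If_False.IH
  from If_False.prems show ?case
  proof cases
    case If_True
    with \<open>fst s i = 0\<close> show ?thesis by simp
  next
    case (If_False v)
    show ?thesis using IH[OF If_False(3)] If_False(1) by simp
  qed
next
  case (While_True s i p t s' t' s2)
  note IH = While_True.IH
  from While_True.prems show ?case
  proof cases
    case (While_True v s1 v')
    have "t = v" "s' = s1" using IH(1)[OF While_True(3)] by auto
    moreover have "t' = v'" "s2 = s''"
      using IH(2)[of v' s''] While_True(4) \<open>s' = s1\<close> by auto
    ultimately show ?thesis using While_True(1) by simp
  next
    case While_False
    with \<open>fst s i > 0\<close> show ?thesis by simp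
  qed
next
  case (While_False s i p)
  from While_False.prems show ?case
    by cases (use While_False.hyps in \<open>simp_all\<close>)
qed

text \<open>
  The alphabet of size \<open>q\<close> is \<open>{..<q}\<close>.  Register 0 initially holds \<open>q\<close>, register 1 the block
  length, and the memory the received word, one symbol per cell.
\<close>

definition input_state :: "nat \<Rightarrow> nat list \<Rightarrow> state" where
  "input_state q y =
     ((\<lambda>_. 0)(0 := q, 1 := length y), (\<lambda>i. if i < length y then y ! i else 0))"

text \<open>
  On halting, register 0 holds the number of listed words; these words, each of length \<open>N\<close>, stand
  one after the other from the beginning of the memory.
\<close>

definition output_list :: "nat \<Rightarrow> state \<Rightarrow> nat list list" where
  "output_list N s = map (\<lambda>j. map (\<lambda>i. snd s (j * N + i)) [0..<N]) [0..<fst s 0]"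

definition list_decodes_within ::
  "prog \<Rightarrow> nat \<Rightarrow> nat \<Rightarrow> nat list set \<Rightarrow> real \<Rightarrow> real \<Rightarrow> bool" where
  "list_decodes_within p q N C \<rho> T \<longleftrightarrow>
     (\<forall>y \<in> words {..<q} N. \<exists>t s.
        exec p (input_state q y) t s \<and> real t \<le> T \<and>
        distinct (output_list N s) \<and> set (output_list N s) = close_codewords C N \<rho> y)"

text \<open>
  Time bounds are to be used with one program for infinitely many \<open>q\<close>.  If the program could depend
  on the code, running time would say little: a program can contain the answers for all received
  words of one finite code as a search tree and then list them in time linear in input and output.
\<close>

end

theory Submission
  imports Defs "HOL-Library.FuncSet" "HOL-Library.Indicator_Function" "HOL-Analysis.Convex" "HOL-Analysis.L2_Norm"
begin

text \<open>
  Take an expander of constant degree \<open>D\<close> (a power of the Gabber--Galil graph), a Tanner code on it as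
  outer code over a constant alphabet, and encode each left symbol by a random-like inner code of
  length \<open>D\<close> whose digits are sent along the edges; the digits arriving at a right vertex form one
  symbol.  A received word makes few inner codewords plausible at each left vertex, so
  agreement with the received word is a sparse linear operator \<open>M\<close> on functions of the right vertices.
  A weak regularity lemma partitions the right vertices into constantly many classes such that \<open>M\<close> sees of
  every set of right vertices only its densities on the classes: as long as it sees more, power
  iteration finds a level set that refines the partition and increases an energy.  Guessing the densities
  of the agreement set then yields most left symbols of the codeword, and bipartite unique decoding
  corrects the rest.  All constants depend on \<open>R\<^sub>0\<close> and \<open>\<epsilon>\<close> only; interleaving gives
  infinitely many alphabets, and \<open>N\<close> may be chosen as large as required.  The exponent of the time bound
  is at least \<open>16 * c\<^sub>2\<close>, so any running time that is polynomial in \<open>N\<close> with absolute degree suffices.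
\<close>

section \<open>Regularity with respect to the agreement operator\<close>

text \<open>The agreement set of a codeword with the received word is unknown, so no step of the
  refinement may use it. The partitions are refined by level sets that depend on the received word
  alone, and all codewords inside the radius share the same sequence of partitions: for each of them
  either its densities already decode it, or the energy has grown in every round so far.
  Interleaving multiplies the lists of the \<open>z\<close> components. Each component gets at most
  \<open>q0\<close> slots, with \<open>q0\<close> a constant, so one slot per component is a number
  below \<open>q0 ^ z = q <= N\<close>, and all choices can be tested one by one. One program must
  serve infinitely many \<open>q\<close>, and it learns only \<open>q\<close>, the block length and
  the received word, while the radius is a real number. The length is therefore \<open>2 ^ L\<close>
  plus the integer part of \<open>2 ^ L\<close> times the fraction of errors, and the program
  recovers the fraction from it. The rounding error takes at most three values; one of them occurs
  infinitely often and is fixed in the program text.\<close>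

locale reg =
  fixes n D :: nat and nbf :: "nat => nat => nat" and lam :: real and kap K :: nat
    and mm :: "nat => nat => nat => real"
  assumes n0: "n > 0" and D0: "D > 0"
    and nbf_less: "\<And>v w. v < n ==> w < D ==> nbf w v < n"
    and nbf_inj: "\<And>w. w < D ==> inj_on (nbf w) {..<n}"
    and expander: "\<And>f :: nat => real. (\<Sum>v<n. f v) = 0 ==>
      (\<Sum>v<n. (\<Sum>w<D. f (nbf w v))^2) <= lam^2 * (\<Sum>v<n. (f v)^2)"
    and mm01: "\<And>l c w. mm l c w \<in> {0, 1}"
    and few: "\<And>l. l < n ==> card {c. c < kap & (\<exists>w<D. mm l c w ~= 0)} <= K"
begin

section \<open>Spectral bounds for neighbour sums\<close>

lemma nbf_bij: "w < D ==> bij_betw (nbf w) {..<n} {..<n}"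
  using nbf_inj nbf_less unfolding bij_betw_def
  by (metis (no_types, lifting) card_image card_subset_eq finite_lessThan image_subsetI lessThan_iff)

lemma nbf_sum: fixes f :: "nat => real" shows "w < D ==> (\<Sum>v<n. f (nbf w v)) = (\<Sum>v<n. f v)"
  by (rule sum.reindex_bij_betw[OF nbf_bij])

lemma deg_sum: fixes f :: "nat => real" shows "(\<Sum>v<n. \<Sum>w<D. f (nbf w v)) = real D * (\<Sum>v<n. f v)"
  by (subst sum.swap) (simp add: nbf_sum)

text \<open>Split \<open>f\<close> into its mean \<open>a\<close> and a part of sum zero. The cross
  term vanishes because neighbour sums of a function of sum zero add up to zero; the mean gives the
  first summand and the spectral gap bounds the rest.\<close>

lemma G_norm: fixes f :: "nat => real" shows "(\<Sum>v<n. (\<Sum>w<D. f (nbf w v))^2) <= D^2 * (\<Sum>v<n. f v)^2 / n + lam^2 * (\<Sum>v<n. (f v)^2)"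
proof -
  define a where "a = (\<Sum>v<n. f v) / n"
  define h where "h v = f v - a" for v
  have na: "real n * a = (\<Sum>v<n. f v)" using n0 by (simp add: a_def)
  have hz: "(\<Sum>v<n. h v) = 0" by (simp add: h_def sum_subtractf na)
  let ?H = "%v. \<Sum>w<D. h (nbf w v)"
  have e: "(\<Sum>w<D. f (nbf w v)) = D * a + ?H v" for v by (simp add: h_def sum_subtractf)
  have "(\<Sum>v<n. (\<Sum>w<D. f (nbf w v))^2) = (\<Sum>v<n. (D * a)^2 + 2 * (D * a) * ?H v + (?H v)^2)"
    unfolding e by (simp add: power2_sum algebra_simps)
  also have "... = n * (D * a)^2 + 2 * (D * a) * (\<Sum>v<n. ?H v) + (\<Sum>v<n. (?H v)^2)"
    by (simp add: sum.distrib sum_distrib_left)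
  also have "(\<Sum>v<n. ?H v) = 0" by (simp add: deg_sum hz)
  also have "n * (D * a)^2 = D^2 * (\<Sum>v<n. f v)^2 / n"
    using n0 by (simp add: a_def power2_eq_square)
  also have "(\<Sum>v<n. (?H v)^2) <= lam^2 * (\<Sum>v<n. (h v)^2)" by (rule expander[OF hz])
  also have "(\<Sum>v<n. (h v)^2) <= (\<Sum>v<n. (f v)^2)"
  proof -
    have "(\<Sum>v<n. (h v)^2) = (\<Sum>v<n. (f v)^2 - 2 * a * f v + a^2)"
      by (simp add: h_def power2_diff algebra_simps)
    also have "... = (\<Sum>v<n. (f v)^2) - 2 * a * (real n * a) + n * a^2"
      by (simp add: sum.distrib sum_subtractf na sum_distrib_left)
    also have "... = (\<Sum>v<n. (f v)^2) - n * a^2" by (simp add: power2_eq_square)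
    finally show ?thesis by simp
  qed
  finally show ?thesis by (simp add: mult_left_mono)
qed

section \<open>The agreement operator\<close>

definition ip :: "(nat => real) => (nat => real) => real" where
  "ip x y = (\<Sum>r<n. x r * y r)"
definition nsq :: "(nat => real) => real" where
  "nsq x = (\<Sum>r<n. (x r)^2)"
text \<open>As \<open>mm l c w\<close> will say that symbol \<open>c\<close> is plausible at left
  vertex \<open>l\<close> and matches the received word along edge \<open>w\<close>,
  \<open>M (indicator A) l c\<close> counts the edges into \<open>A\<close> that speak for
  \<open>c\<close>.\<close>

definition M :: "(nat => real) => nat => nat => real" where
  "M x l c = (\<Sum>w<D. mm l c w * x (nbf w l))"
definition mip :: "(nat => real) => (nat => real) => real" where
  "mip x y = (\<Sum>l<n. \<Sum>c<kap. M x l c * M y l c)"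
definition msq :: "(nat => real) => real" where
  "msq x = (\<Sum>l<n. \<Sum>c<kap. (M x l c)^2)"
text \<open>The program tests this norm instead of \<open>msq\<close>: its products clamp the first
  factor at the block length, which entries scaled by factorials may exceed, so they are not
  squared.\<close>

definition mone :: "(nat => real) => real" where
  "mone x = (\<Sum>l<n. \<Sum>c<kap. \<bar>M x l c\<bar>)"
definition MT :: "(nat => nat => real) => nat => real" where
  "MT z r = (\<Sum>l<n. \<Sum>w<D. \<Sum>c<kap. (if nbf w l = r then mm l c w * z l c else 0))"
definition cl :: "(nat => nat) => nat => nat set" where
  "cl lab r = {s. s < n & lab s = lab r}"
definition av :: "(nat => nat) => (nat => real) => nat => real" where
  "av lab x r = (\<Sum>s\<in>cl lab r. x s) / card (cl lab r)"
definition Pr :: "(nat => nat) => (nat => real) => nat => real" where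
  "Pr lab x r = x r - av lab x r"
text \<open>The Gram operator of \<open>M\<close> compressed to the functions with mean zero on
  every class; \<open>ip (Bop lab x) x\<close> is what \<open>M\<close> sees of \<open>x\<close>
  beyond its class densities.\<close>

definition Bop :: "(nat => nat) => (nat => real) => nat => real" where
  "Bop lab x = Pr lab (MT (M (Pr lab x)))"

lemma ip_comm: "ip x y = ip y x" by (simp add: ip_def mult.commute)
lemma ip_self: "ip x x = nsq x" by (simp add: ip_def nsq_def power2_eq_square)
lemma nsq_nonneg: "nsq x \<ge> 0" by (simp add: nsq_def sum_nonneg)
lemma msq_nonneg: "msq x \<ge> 0" by (simp add: msq_def sum_nonneg)
lemma ip_cong: "(\<And>r. r < n ==> x r = x' r) ==> (\<And>r. r < n ==> y r = y' r) ==> ip x y = ip x' y'"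
  by (simp add: ip_def)
lemma nsq_cong: "(\<And>r. r < n ==> x r = x' r) ==> nsq x = nsq x'"
  by (simp add: nsq_def)
lemma M_cong: "(\<And>r. r < n ==> x r = x' r) ==> l < n ==> M x l c = M x' l c"
  by (simp add: M_def nbf_less)
lemma msq_cong: "(\<And>r. r < n ==> x r = x' r) ==> msq x = msq x'"
  unfolding msq_def using M_cong[of x x'] by simp
lemma ip_diff: "ip (%r. x r - y r) z = ip x z - ip y z"
  by (simp add: ip_def left_diff_distrib sum_subtractf)

lemma ip_CS: "(ip x y)^2 <= nsq x * nsq y"
  unfolding ip_def nsq_def by (rule Cauchy_Schwarz_ineq_sum)

lemma mip_CS: "(mip x y)^2 <= msq x * msq y"
  unfolding mip_def msq_def sum.cartesian_product by (simp add: case_prod_beta Cauchy_Schwarz_ineq_sum)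

lemma ip_MT: "ip (MT z) y = (\<Sum>l<n. \<Sum>c<kap. z l c * M y l c)"
proof -
  have "ip (MT z) y = (\<Sum>r<n. \<Sum>l<n. \<Sum>w<D. \<Sum>c<kap. (if nbf w l = r then mm l c w * z l c * y r else 0))"
    unfolding ip_def MT_def sum_distrib_right by (intro sum.cong refl) simp
  also have "... = (\<Sum>l<n. \<Sum>w<D. \<Sum>c<kap. \<Sum>r<n. (if nbf w l = r then mm l c w * z l c * y r else 0))"
    by (rule trans[OF sum.swap], rule sum.cong[OF refl], rule trans[OF sum.swap], rule sum.cong[OF refl], rule sum.swap)
  also have "... = (\<Sum>l<n. \<Sum>w<D. \<Sum>c<kap. mm l c w * z l c * y (nbf w l))"
    by (intro sum.cong refl) (simp add: sum.delta nbf_less)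
  also have "... = (\<Sum>l<n. \<Sum>c<kap. z l c * M y l c)"
    unfolding M_def sum_distrib_left
    by (rule sum.cong[OF refl], rule trans[OF sum.swap]) (simp add: mult_ac)
  finally show ?thesis .
qed

lemma M_abs_le: fixes x :: "nat => real" shows "l < n ==> \<bar>M x l c\<bar> <= (\<Sum>w<D. \<bar>x (nbf w l)\<bar>)"
  unfolding M_def
proof (rule order_trans[OF sum_abs], rule sum_mono)
  fix w show "\<bar>mm l c w * x (nbf w l)\<bar> <= \<bar>x (nbf w l)\<bar>" using mm01[of l c w] by auto
qed

lemma M_zero: "\<not> (\<exists>w<D. mm l c w ~= 0) ==> M x l c = 0"
  unfolding M_def by (intro sum.neutral) auto

lemma sum_few:
  fixes g :: "nat => real" and b :: real
  assumes l: "l < n" and z: "\<And>c. \<not> (\<exists>w<D. mm l c w ~= 0) ==> g c = 0" and b: "\<And>c. g c <= b" and b0: "b \<ge> (0::real)"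
  shows "(\<Sum>c<kap. g c) <= K * b"
proof -
  let ?A = "{c. c < kap & (\<exists>w<D. mm l c w ~= 0)}"
  have "(\<Sum>c<kap. g c) = (\<Sum>c\<in>?A. g c)" by (intro sum.mono_neutral_right) (auto intro: z)
  also have "... <= (\<Sum>c\<in>?A. b)" by (intro sum_mono b)
  also have "... = card ?A * b" by simp
  also have "... <= K * b" using few[OF l] b0 by (intro mult_right_mono) auto
  finally show ?thesis .
qed

text \<open>Every entry of \<open>M x\<close> at \<open>l\<close> is dominated by the neighbour sum
  of absolute values, and at most \<open>K\<close> of them are nonzero, so \<open>G_norm\<close>
  carries over at the cost of a factor \<open>K\<close>.\<close>

lemma msq_le: fixes x :: "nat => real" shows "msq x <= K * (D^2 * (\<Sum>r<n. \<bar>x r\<bar>)^2 / n + lam^2 * nsq x)"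
proof -
  have "msq x <= (\<Sum>l<n. K * (\<Sum>w<D. \<bar>x (nbf w l)\<bar>)^2)"
    unfolding msq_def
  proof (intro sum_mono)
    fix l assume "l \<in> {..<n}"
    then have l: "l < n" by simp
    have "(M x l c)^2 <= (\<Sum>w<D. \<bar>x (nbf w l)\<bar>)^2" for c
      using M_abs_le[OF l, of x c] by (metis abs_ge_zero power2_abs power_mono)
    then show "(\<Sum>c<kap. (M x l c)^2) <= K * (\<Sum>w<D. \<bar>x (nbf w l)\<bar>)^2"
      by (intro sum_few[OF l]) (auto simp: M_zero)
  qed
  also have "... = K * (\<Sum>l<n. (\<Sum>w<D. \<bar>x (nbf w l)\<bar>)^2)" by (simp add: sum_distrib_left)
  also have "... <= K * (D^2 * (\<Sum>r<n. \<bar>x r\<bar>)^2 / n + lam^2 * nsq x)"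
    using G_norm[of "%r. \<bar>x r\<bar>"] by (intro mult_left_mono) (auto simp: nsq_def)
  finally show ?thesis .
qed

text \<open>Cauchy-Schwarz against the indicator of the active entries, of which there are at most
  \<open>K * n\<close>. It turns a large test value into a large quadratic form.\<close>

lemma mone_sq_le: "(mone x)^2 <= K * n * msq x"
proof -
  let ?i = "%l c. if \<exists>w<D. mm l c w ~= 0 then 1 else (0::real)"
  have "mone x = (\<Sum>(l, c)\<in>{..<n} \<times> {..<kap}. ?i l c * \<bar>M x l c\<bar>)"
    unfolding mone_def sum.cartesian_product[symmetric] by (intro sum.cong refl) (simp add: M_zero)
  then have "(mone x)^2 <= (\<Sum>(l, c)\<in>{..<n} \<times> {..<kap}. (?i l c)^2) * (\<Sum>(l, c)\<in>{..<n} \<times> {..<kap}. \<bar>M x l c\<bar>^2)"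
    using Cauchy_Schwarz_ineq_sum[of "%p. ?i (fst p) (snd p)" "%p. \<bar>M x (fst p) (snd p)\<bar>" "{..<n} \<times> {..<kap}"]
    by (simp add: case_prod_beta)
  also have "(\<Sum>(l, c)\<in>{..<n} \<times> {..<kap}. \<bar>M x l c\<bar>^2) = msq x"
    by (simp add: msq_def sum.cartesian_product)
  also have "(\<Sum>(l, c)\<in>{..<n} \<times> {..<kap}. (?i l c)^2) <= (\<Sum>l<n. real K * 1)"
    unfolding sum.cartesian_product[symmetric]
  proof (rule sum_mono)
    fix l assume "l \<in> {..<n}"
    then have "l < n" by simp
    then show "(\<Sum>c<kap. (?i l c)^2) <= real K * 1" by (rule sum_few) auto
  qed
  also have "... = K * n" by simp
  finally show ?thesis by (simp add: mult_right_mono msq_nonneg)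
qed

lemma msq_le_mone:
  assumes "\<And>r. r < n ==> \<bar>x r\<bar> <= 1"
  shows "msq x <= D * mone x"
  unfolding msq_def mone_def sum_distrib_left
proof (intro sum_mono)
  fix l c assume "l \<in> {..<n}"
  then have l: "l < n" by simp
  have "\<bar>M x l c\<bar> <= (\<Sum>w<D. \<bar>x (nbf w l)\<bar>)" by (rule M_abs_le[OF l])
  also have "... <= (\<Sum>w<D. 1)" using assms nbf_less[OF l] by (intro sum_mono) auto
  finally have "\<bar>M x l c\<bar> <= D" by simp
  then show "(M x l c)^2 <= D * \<bar>M x l c\<bar>"
    by (metis abs_ge_zero mult_right_mono power2_abs power2_eq_square)
qed

section \<open>Averaging over the classes of a partition\<close>

lemma finite_cl [simp]: "finite (cl lab r)" by (simp add: cl_def)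
lemma self_cl: "r < n ==> r \<in> cl lab r" by (simp add: cl_def)
lemma card_cl: "r < n ==> card (cl lab r) > 0" using self_cl[of r lab] card_gt_0_iff by fastforce
lemma cl_eq: "lab r = lab s ==> cl lab r = cl lab s" by (simp add: cl_def)

lemma av_eq: "lab r = lab s ==> av lab x r = av lab x s"
  unfolding av_def by (drule cl_eq) simp

lemma sum_cl: "(\<Sum>s\<in>cl lab r. f s) = (\<Sum>s<n. if lab s = lab r then f s else (0::real))"
proof -
  have "cl lab r = {s \<in> {..<n}. lab s = lab r}" by (auto simp: cl_def)
  then show ?thesis using sum.inter_filter[OF finite_lessThan, where g = f and P = "%s. lab s = lab r"] by (simp only:)
qed

lemma av_sum: "av lab x r = (\<Sum>s<n. if lab s = lab r then x s / card (cl lab r) else 0)"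
  unfolding av_def sum_divide_distrib by (rule sum_cl)

lemma av_sym: "ip (av lab x) y = ip x (av lab y)"
proof -
  have "ip (av lab x) y = (\<Sum>r<n. \<Sum>s<n. if lab s = lab r then x s * y r / card (cl lab r) else 0)"
    unfolding ip_def av_sum sum_distrib_right by (intro sum.cong refl) simp
  also have "... = (\<Sum>s<n. \<Sum>r<n. if lab s = lab r then x s * y r / card (cl lab r) else 0)" by (rule sum.swap)
  also have "... = ip x (av lab y)"
    unfolding ip_def av_sum sum_distrib_left
  proof (intro sum.cong refl)
    fix s r
    show "(if lab s = lab r then x s * y r / card (cl lab r) else 0) = x s * (if lab r = lab s then y r / card (cl lab s) else 0)"
      using cl_eq[of lab s r] by auto
  qed
  finally show ?thesis .
qed

lemma av_fix:
  assumes "\<And>s. s < n ==> lab s = lab r ==> y s = y r" "r < n"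
  shows "av lab y r = y r"
proof -
  have "(\<Sum>s\<in>cl lab r. y s) = (\<Sum>s\<in>cl lab r. y r)" by (intro sum.cong refl assms(1)) (auto simp: cl_def)
  then show ?thesis using card_cl[OF assms(2), of lab] by (simp add: av_def card_gt_0_iff)
qed

lemma av_av: "r < n ==> av lab (av lab x) r = av lab x r"
  by (rule av_fix) (auto intro: av_eq)

lemma av_cong: "(\<And>s. s < n ==> x s = y s) ==> av lab x r = av lab y r"
  unfolding av_def by (intro arg_cong2[where f = "(/)"] sum.cong refl) (auto simp: cl_def)

lemma av_diff: "av lab (%r. x r - y r) r = av lab x r - av lab y r"
  by (simp add: av_def sum_subtractf diff_divide_distrib)

lemma av_add: "av lab (%r. x r + y r) r = av lab x r + av lab y r"
  by (simp add: av_def sum.distrib add_divide_distrib)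

lemma av_scale: "av lab (%r. a * x r) r = a * av lab x r"
  by (simp add: av_def sum_distrib_left[symmetric])

lemma av_Pr: "r < n ==> av lab (Pr lab x) r = 0"
  unfolding Pr_def by (simp add: av_diff av_av)

lemma Pr_sym: "ip (Pr lab x) y = ip x (Pr lab y)"
proof -
  have "ip (Pr lab x) y = ip x y - ip (av lab x) y" unfolding Pr_def by (rule ip_diff)
  moreover have "ip x (Pr lab y) = ip x y - ip x (av lab y)"
    using ip_diff[of y "av lab y" x] unfolding Pr_def by (simp add: ip_comm)
  ultimately show ?thesis by (simp add: av_sym)
qed

lemma nsq_av_le: "nsq (av lab x) <= nsq x"
proof -
  have "nsq (av lab x) = ip x (av lab (av lab x))" by (simp add: ip_self[symmetric] av_sym)
  also have "... = ip x (av lab x)" by (rule ip_cong) (auto simp: av_av)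
  finally have "(nsq (av lab x))^2 <= nsq x * nsq (av lab x)" using ip_CS[of x "av lab x"] by simp
  then show ?thesis using nsq_nonneg[of "av lab x"] nsq_nonneg[of x]
    by (cases "nsq (av lab x) = 0") (auto simp: power2_eq_square)
qed

lemma sum_av_le: fixes x :: "nat => real" shows "(\<Sum>r<n. \<bar>av lab x r\<bar>) <= (\<Sum>r<n. \<bar>x r\<bar>)"
proof -
  have "(\<Sum>r<n. \<bar>av lab x r\<bar>) <= (\<Sum>r<n. av lab (%s. \<bar>x s\<bar>) r)"
    unfolding av_def by (intro sum_mono) (simp add: divide_right_mono abs_divide)
  also have "... = ip (av lab (%s. \<bar>x s\<bar>)) (%_. 1)" by (simp add: ip_def)
  also have "... = ip (%s. \<bar>x s\<bar>) (av lab (%_. 1))" by (rule av_sym)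
  also have "... = ip (%s. \<bar>x s\<bar>) (%_. 1)" by (intro ip_cong refl av_fix) auto
  finally show ?thesis by (simp add: ip_def)
qed

text \<open>Let \<open>d\<close> be the fine average of \<open>u\<close> minus the coarse one. Since
  \<open>g\<close> is constant on fine classes and has mean zero on coarse ones,
  \<open>ip d g = ip u g\<close>; since the averages are nested orthogonal projections,
  \<open>nsq d\<close> is the difference of their squared norms. Cauchy-Schwarz does the
  rest.\<close>

lemma energy_step:
  assumes ref: "\<And>r s. r < n ==> s < n ==> lab' r = lab' s ==> lab r = lab s"
    and g: "\<And>r s. r < n ==> s < n ==> lab' r = lab' s ==> g r = g s"
    and g0: "\<And>r. r < n ==> av lab g r = 0"
  shows "(ip u g)^2 <= (nsq (av lab' u) - nsq (av lab u)) * nsq g"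
proof -
  let ?d = "%r. av lab' u r - av lab u r"
  have "ip (av lab' u) g = ip u (av lab' g)" by (rule av_sym)
  also have "... = ip u g" by (intro ip_cong refl av_fix) (auto intro: g)
  finally have 1: "ip (av lab' u) g = ip u g" .
  have "ip (av lab u) g = ip u (av lab g)" by (rule av_sym)
  also have "... = 0" using g0 by (simp add: ip_def)
  finally have 2: "ip ?d g = ip u g" using 1 by (simp add: ip_diff)
  have "ip (av lab' u) (av lab u) = ip u (av lab' (av lab u))" by (rule av_sym)
  also have "... = ip u (av lab u)" by (intro ip_cong refl av_fix) (auto intro: av_eq ref)
  finally have 3: "ip (av lab' u) (av lab u) = ip u (av lab u)" .
  have "nsq (av lab u) = ip u (av lab (av lab u))" by (simp add: ip_self[symmetric] av_sym)
  also have "... = ip u (av lab u)" by (intro ip_cong refl) (simp add: av_av)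
  finally have 4: "nsq (av lab u) = ip u (av lab u)" .
  have "nsq ?d = nsq (av lab' u) - 2 * ip (av lab' u) (av lab u) + nsq (av lab u)"
    unfolding nsq_def ip_def by (simp add: power2_diff sum.distrib sum_subtractf sum_distrib_left mult.assoc)
  then have "nsq ?d = nsq (av lab' u) - nsq (av lab u)" using 3 4 by simp
  then show ?thesis using ip_CS[of ?d g] 2 by simp
qed

section \<open>Energy of a partition\<close>

definition row :: "nat => nat => nat => real" where
  "row l c r = (\<Sum>w<D. if nbf w l = r then mm l c w else 0)"

lemma M_row: "l < n ==> M x l c = ip (row l c) x"
proof -
  assume l: "l < n"
  have "ip (row l c) x = (\<Sum>w<D. \<Sum>r<n. if nbf w l = r then mm l c w * x r else 0)"
    unfolding ip_def row_def sum_distrib_right by (subst sum.swap) (intro sum.cong refl, simp)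
  also have "... = M x l c" unfolding M_def by (intro sum.cong refl) (simp add: nbf_less[OF l])
  finally show ?thesis by simp
qed

text \<open>The squared Hilbert-Schmidt norm of \<open>M\<close> composed with averaging: how much
  of \<open>M\<close> the partition captures.\<close>

definition Phi :: "(nat => nat) => real" where
  "Phi lab = (\<Sum>l<n. \<Sum>c<kap. nsq (av lab (row l c)))"

lemma Phi_nonneg: "Phi lab \<ge> 0" by (simp add: Phi_def sum_nonneg nsq_nonneg)

text \<open>\<open>energy_step\<close> for every row of \<open>M\<close> with
  \<open>g = Pr lab S\<close>, summed up; \<open>nsq g <= n\<close> because a value in
  \<open>[0, 1]\<close> differs from its class average by at most 1.\<close>

lemma Phi_step:
  assumes ref: "\<And>r s. r < n ==> s < n ==> lab' r = lab' s ==> lab r = lab s"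
    and S: "\<And>r s. r < n ==> s < n ==> lab' r = lab' s ==> S r = S s"
    and S01: "\<And>r. 0 <= S r & S r <= 1"
  shows "msq (Pr lab S) <= (Phi lab' - Phi lab) * n"
proof -
  let ?g = "Pr lab S"
  have g1: "\<bar>?g r\<bar> <= 1" if "r < n" for r
  proof -
    have "(\<Sum>s\<in>cl lab r. S s) <= (\<Sum>s\<in>cl lab r. 1)" by (rule sum_mono) (use S01 in auto)
    moreover have "0 <= (\<Sum>s\<in>cl lab r. S s)" using S01 by (auto intro!: sum_nonneg)
    ultimately have "0 <= av lab S r" "av lab S r <= 1" using card_cl[OF that, of lab] by (auto simp: av_def)
    then show ?thesis using S01[of r] unfolding Pr_def by linarith
  qed
  have gn: "nsq ?g <= n"
  proof -
    have "nsq ?g <= (\<Sum>r<n. 1)" unfolding nsq_def using g1 by (intro sum_mono) (simp add: abs_square_le_1)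
    then show ?thesis by simp
  qed
  have st: "(M ?g l c)^2 <= (nsq (av lab' (row l c)) - nsq (av lab (row l c))) * n" if "l < n" for l c
  proof -
    have g: "?g r = ?g s" if "r < n" "s < n" "lab' r = lab' s" for r s
      using S[OF that] av_eq[of lab r s S] ref[OF that] by (simp add: Pr_def)
    have le: "(M ?g l c)^2 <= (nsq (av lab' (row l c)) - nsq (av lab (row l c))) * nsq ?g"
      unfolding M_row[OF that] by (rule energy_step[OF ref g]) (auto simp: av_Pr)
    show ?thesis
    proof (cases "nsq (av lab' (row l c)) - nsq (av lab (row l c)) \<ge> 0")
      case True
      then show ?thesis using le gn by (meson mult_left_mono order_trans)
    next
      \<comment> \<open>Replacing the factor \<open>nsq g\<close> by \<open>n\<close> is sound only
        if the gain is nonnegative; refinement makes it so.\<close>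
      case False
      have "nsq (av lab (row l c)) <= nsq (av lab' (row l c))"
      proof -
        have "nsq (av lab (row l c)) = nsq (av lab (av lab' (row l c)))"
        proof (rule nsq_cong)
          fix r assume r: "r < n"
          \<comment> \<open>An average over one class is the inner product with its normalised
            indicator \<open>e\<close>, which the finer averaging fixes.\<close>
          define e where "e s = (if s \<in> cl lab r then 1 / real (card (cl lab r)) else 0)" for s
          have ae: "av lab x r = ip x e" for x
            unfolding av_def ip_def e_def cl_def sum_divide_distrib
            by (simp add: if_distrib sum.inter_filter[symmetric] cong: if_cong)
          have "av lab (av lab' (row l c)) r = ip (av lab' (row l c)) e" by (rule ae)
          also have "... = ip (row l c) (av lab' e)" by (rule av_sym)
          also have "... = ip (row l c) e"
          proof (intro ip_cong refl av_fix)
            fix s t assume "s < n" "t < n" "lab' s = lab' t"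
            then show "e s = e t" using ref[of s t] by (auto simp: e_def cl_def)
          qed auto
          finally show "av lab (row l c) r = av lab (av lab' (row l c)) r" using ae by simp
        qed
        also have "... <= nsq (av lab' (row l c))" by (rule nsq_av_le)
        finally show ?thesis .
      qed
      then show ?thesis using False by simp
    qed
  qed
  have "msq ?g <= (\<Sum>l<n. \<Sum>c<kap. (nsq (av lab' (row l c)) - nsq (av lab (row l c))) * n)"
    unfolding msq_def by (intro sum_mono) (use st in auto)
  also have "... = (Phi lab' - Phi lab) * n"
    unfolding Phi_def by (simp add: sum_subtractf sum_distrib_right[symmetric])
  finally show ?thesis .
qed

lemma nsq_av_labels:
  fixes L :: nat
  assumes L: "\<And>r. r < n ==> lab r < L"
  shows "nsq (av lab u) = (\<Sum>p<L. (ip u (%r. if lab r = p then 1 else 0))^2 / card {s. s < n & lab s = p})"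
proof -
  let ?C = "%p. {s. s < n & lab s = p}"
  let ?T = "%p. ip u (%r. if lab r = p then 1 else 0)"
  have T: "?T p = (\<Sum>s\<in>?C p. u s)" for p
    unfolding ip_def by (simp add: sum.inter_filter[symmetric] if_distrib cong: if_cong)
  have "nsq (av lab u) = (\<Sum>p<L. \<Sum>r\<in>?C p. (av lab u r)^2)"
    unfolding nsq_def
    by (subst sum.group[of "{..<n}" "{..<L}" lab, symmetric]) (auto simp: L intro!: sum.cong)
  also have "... = (\<Sum>p<L. \<Sum>r\<in>?C p. (?T p / card (?C p))^2)"
    by (intro sum.cong refl) (auto simp: av_def cl_def T)
  also have "... = (\<Sum>p<L. (?T p)^2 / card (?C p))"
    by (intro sum.cong refl) (simp add: power2_eq_square)
  finally show ?thesis .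
qed

text \<open>Apply \<open>msq_le\<close> to the class indicators and divide by the class sizes: the
  terms with \<open>D^2\<close> add up to \<open>K * D^2\<close> whatever the number of classes, and
  each class costs only \<open>K * lam^2\<close>. The energy is thus bounded independently of
  \<open>n\<close>.\<close>

lemma Phi_bound:
  fixes L :: nat
  assumes L: "\<And>r. r < n ==> lab r < L"
  shows "Phi lab <= K * (D^2 + lam^2 * L)"
proof -
  let ?C = "%p. {s. s < n & lab s = p}"
  let ?i = "%p r. if lab r = p then 1 else (0::real)"
  have "Phi lab = (\<Sum>l<n. \<Sum>c<kap. \<Sum>p<L. (M (?i p) l c)^2 / card (?C p))"
    unfolding Phi_def by (intro sum.cong refl) (simp only: nsq_av_labels[OF L] M_row lessThan_iff)
  also have "... = (\<Sum>p<L. msq (?i p) / card (?C p))"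
    unfolding msq_def sum_divide_distrib
    by (rule trans[OF sum.cong[OF refl sum.swap] sum.swap])
  also have "... <= (\<Sum>p<L. K * (D^2 * card (?C p) / n + lam^2))"
  proof (intro sum_mono)
    fix p
    have s: "(\<Sum>r<n. \<bar>?i p r\<bar>) = card (?C p)" "nsq (?i p) = card (?C p)"
    proof -
      have "?C p = {..<n} \<inter> {r. lab r = p}" by auto
      then have c: "(\<Sum>r<n. ?i p r) = card (?C p)" by (simp add: sum.If_cases)
      have "\<bar>?i p r\<bar> = ?i p r" "(?i p r)^2 = ?i p r" for r by auto
      then show "(\<Sum>r<n. \<bar>?i p r\<bar>) = card (?C p)" "nsq (?i p) = card (?C p)"
        unfolding nsq_def c[symmetric] by simp_all
    qed
    show "msq (?i p) / card (?C p) <= K * (D^2 * card (?C p) / n + lam^2)"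
    proof (cases "card (?C p) = 0")
      case False
      then have "msq (?i p) / card (?C p) <= K * (D^2 * (card (?C p))^2 / n + lam^2 * card (?C p)) / card (?C p)"
        using msq_le[of "?i p"] unfolding s by (intro divide_right_mono) auto
      also have "... = K * (D^2 * card (?C p) / n + lam^2)"
        using False by (simp add: field_simps power2_eq_square)
      finally show ?thesis .
    next
      \<comment> \<open>An empty class: division by zero yields 0.\<close>
      case True
      have "0 <= K * (D^2 * card (?C p) / n + lam^2)" by simp
      then show ?thesis unfolding True by simp
    qed
  qed
  also have "... = K * (D^2 * (\<Sum>p<L. real (card (?C p))) / n + lam^2 * L)"
    by (simp add: sum.distrib sum_distrib_left[symmetric] sum_divide_distrib[symmetric] distrib_left)
  also have "(\<Sum>p<L. real (card (?C p))) = n"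
  proof -
    have "(\<Sum>p<L. \<Sum>r\<in>?C p. (1::real)) = (\<Sum>r<n. 1)"
      using sum.group[of "{..<n}" "{..<L}" lab "%_. 1::real"] L by auto
    then show ?thesis by simp
  qed
  finally show ?thesis using n0 by simp
qed

section \<open>Power iteration through moments\<close>

lemma mip_B: "ip (Bop lab x) y = mip (Pr lab x) (Pr lab y)"
  unfolding Bop_def Pr_sym ip_MT mip_def ..

lemma B_sym: "ip (Bop lab x) y = ip x (Bop lab y)"
proof -
  have "mip a b = mip b a" for a b by (simp add: mip_def mult.commute)
  then show ?thesis by (metis mip_B ip_comm)
qed

lemma Bpow_sym: "ip ((Bop lab ^^ j) x) y = ip x ((Bop lab ^^ j) y)"
proof (induction j arbitrary: x y)
  case (Suc j)
  have "ip ((Bop lab ^^ Suc j) x) y = ip (Bop lab ((Bop lab ^^ j) x)) y" by simp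
  also have "... = ip x ((Bop lab ^^ j) (Bop lab y))" by (simp add: B_sym Suc)
  also have "(Bop lab ^^ j) (Bop lab y) = (Bop lab ^^ Suc j) y" by (simp only: funpow_swap1 funpow.simps comp_apply)
  finally show ?case .
qed simp

definition nu :: "(nat => nat) => (nat => real) => nat => real" where
  "nu lab x j = ip x ((Bop lab ^^ j) x)"

lemma nu_add: "ip ((Bop lab ^^ i) x) ((Bop lab ^^ j) x) = nu lab x (i + j)"
  unfolding nu_def Bpow_sym by (simp add: funpow_add)

lemma nu_even: "nsq ((Bop lab ^^ i) x) = nu lab x (2 * i)"
  using nu_add[of i lab x i] by (simp add: ip_self mult_2)

lemma nu_odd: "msq (Pr lab ((Bop lab ^^ i) x)) = nu lab x (Suc (2 * i))"
proof -
  have "msq (Pr lab z) = ip (Bop lab z) z" for z by (simp add: mip_B mip_def msq_def power2_eq_square)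
  then show ?thesis using nu_add[of "Suc i" lab x i] by (simp add: mult_2)
qed

lemma nu_nonneg: "nu lab x j \<ge> 0"
  by (metis nu_even nu_odd nsq_nonneg msq_nonneg parity_cases oddE evenE Suc_eq_plus1)

text \<open>Cauchy-Schwarz: for \<open>ip\<close> between consecutive iterates if \<open>j\<close>
  is even, for the form \<open>mip\<close> if \<open>j\<close> is odd. Through log-convexity the
  moments carry all the spectral information used below.\<close>

lemma nu_logconvex: "(nu lab x (Suc j))^2 <= nu lab x j * nu lab x (Suc (Suc j))"
proof (cases "even j")
  case True
  then obtain i where j: "j = 2 * i" by (rule evenE)
  have "(ip ((Bop lab ^^ i) x) ((Bop lab ^^ Suc i) x))^2 <= nsq ((Bop lab ^^ i) x) * nsq ((Bop lab ^^ Suc i) x)"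
    by (rule ip_CS)
  then show ?thesis unfolding nu_add nu_even j by (simp add: mult_2)
next
  case False
  then obtain i where j: "j = 2 * i + 1" by (rule oddE)
  have "ip ((Bop lab ^^ Suc i) x) ((Bop lab ^^ Suc i) x) = mip (Pr lab ((Bop lab ^^ i) x)) (Pr lab ((Bop lab ^^ Suc i) x))"
    by (simp add: mip_B)
  then have "(nu lab x (2 * Suc i))^2 <= msq (Pr lab ((Bop lab ^^ i) x)) * msq (Pr lab ((Bop lab ^^ Suc i) x))"
    using mip_CS unfolding nu_add by (simp add: mult_2)
  then show ?thesis unfolding nu_odd j by simp
qed

text \<open>The ratios of consecutive terms increase, so the first ratio bounds all later ones from
  below.\<close>

lemma logconvex_up:
  fixes f :: "nat => real"
  assumes lc: "\<And>j. (f (Suc j))^2 <= f j * f (Suc (Suc j))" and pos: "\<And>j. f j \<ge> 0"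
    and 0: "f 1 \<ge> thx * f 0" "f 0 > 0" "thx > 0"
  shows "f k \<ge> thx ^ k * f 0"
proof -
  have step: "f (Suc j) \<ge> thx * f j & f j > 0" for j
  proof (induction j)
    case (Suc j)
    then have p: "f (Suc j) > 0" using 0 by (metis mult_pos_pos order_less_le_trans)
    have "thx * f j * f (Suc j) <= f (Suc j) * f (Suc j)" using Suc p by (intro mult_right_mono) auto
    also have "... <= f j * f (Suc (Suc j))" using lc[of j] by (simp add: power2_eq_square)
    finally have "f j * (thx * f (Suc j)) <= f j * f (Suc (Suc j))" by (simp add: mult_ac)
    then show ?case using Suc p by simp
  qed (use 0 in auto)
  show ?thesis
  proof (induction k)
    case (Suc k)
    have "thx ^ Suc k * f 0 <= thx * f k" using Suc 0 by (simp add: mult.assoc)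
    then show ?case using step[of k] by linarith
  qed simp
qed

text \<open>Increasing ratios read backwards: the ratio at \<open>k\<close> bounds all earlier ones
  from above.\<close>

lemma logconvex_down:
  fixes f :: "nat => real"
  assumes lc: "\<And>j. (f (Suc j))^2 <= f j * f (Suc (Suc j))" and pos: "\<And>j. f j \<ge> 0"
    and k: "f (Suc k) <= rh * f k" and r: "rh \<ge> 0"
  shows "f k <= rh ^ k * f 0"
proof -
  have step: "f (Suc j) <= rh * f j" if "j <= k" for j
    using that
  proof (induction rule: inc_induct)
    case base
    then show ?case using k by simp
  next
    case (step j)
    show ?case
    proof (cases "f (Suc j) = 0")
      case True
      then show ?thesis using pos[of j] r by simp
    next
      case False
      then have p: "f (Suc j) > 0" using pos[of "Suc j"] by simp
      have "f (Suc j) * f (Suc j) <= f j * f (Suc (Suc j))" using lc[of j] by (simp add: power2_eq_square)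
      also have "... <= f j * (rh * f (Suc j))" using step.IH pos[of j] by (intro mult_left_mono) auto
      finally have "f (Suc j) * f (Suc j) <= (rh * f j) * f (Suc j)" by (simp add: mult_ac)
      then show ?thesis using p by simp
    qed
  qed
  have "j <= k ==> f j <= rh ^ j * f 0" for j
  proof (induction j)
    case (Suc j)
    have "f (Suc j) <= rh * f j" using step[of j] Suc by simp
    also have "... <= rh * (rh ^ j * f 0)" using Suc r by (intro mult_left_mono) auto
    finally show ?case by (simp add: mult.assoc)
  qed simp
  then show ?thesis by simp
qed

definition ind :: "nat => nat => real" where
  "ind r s = (if s = r then 1 else 0)"

lemma ip_ind: "r < n ==> ip (ind r) y = y r"
  by (simp add: ip_def ind_def if_distrib[of "%x. x * _"] cong: if_cong)

text \<open>
  Power iteration: some basis vector has large enough overlap with the top of the spectrum, and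
  log-convexity of the moments makes the Rayleigh quotient after \<open>n\<close> steps at least half the optimum.
\<close>

lemma power_iteration:
  assumes f: "\<And>r. r < n ==> av lab f r = 0" and th: "thx > 0" and big: "msq f \<ge> thx * nsq f" "msq f > 0"
  shows "\<exists>r<n. msq (Pr lab ((Bop lab ^^ n) (ind r))) \<ge> thx / 2 * nsq ((Bop lab ^^ n) (ind r)) &
     nsq ((Bop lab ^^ n) (ind r)) > 0"
proof -
  have f1: "nu lab f 1 = msq f"
    using nu_odd[of lab 0 f] f by (simp add: msq_cong[of "Pr lab f" f] Pr_def)
  have f0: "nu lab f 0 = nsq f" using nu_even[of 0 lab f] by simp
  have "nu lab f 0 ~= 0"
  proof
    assume "nu lab f 0 = 0"
    then have "(nu lab f 1)^2 <= 0" using nu_logconvex[of lab f 0] by simp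
    then show False using f1 big(2) by simp
  qed
  then have p: "nsq f > 0" using f0 nsq_nonneg[of f] by simp
  have "thx ^ (2 * n) * nsq f <= nu lab f (2 * n)"
    using logconvex_up[of "nu lab f" thx "2 * n"] nu_logconvex nu_nonneg f1 f0 big p th by simp
  also have "... = nsq ((Bop lab ^^ n) f)" by (simp add: nu_even)
  \<comment> \<open>Symmetry moves the operator from \<open>f\<close>, which is unknown to the
    program, to the basis vectors.\<close>
  also have "... = (\<Sum>r<n. (ip ((Bop lab ^^ n) (ind r)) f)^2)"
    unfolding nsq_def by (intro sum.cong refl) (simp add: Bpow_sym ip_ind)
  also have "... <= (\<Sum>r<n. nsq ((Bop lab ^^ n) (ind r)) * nsq f)" by (intro sum_mono ip_CS)
  also have "... = (\<Sum>r<n. nsq ((Bop lab ^^ n) (ind r))) * nsq f" by (simp add: sum_distrib_right)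
  finally have tot: "thx ^ (2 * n) <= (\<Sum>r<n. nsq ((Bop lab ^^ n) (ind r)))" using p by simp
  \<comment> \<open>The factor \<open>4 ^ n\<close> exceeds the number \<open>n\<close> of basis
    vectors and is the loss of a factor 2 in each of \<open>2 * n\<close> moments: hence the half in
    the claim, and hence \<open>n\<close> iterations.\<close>
  have "\<exists>r<n. nsq ((Bop lab ^^ n) (ind r)) > thx ^ (2 * n) / 4 ^ n"
  proof (rule ccontr)
    assume "\<not> ?thesis"
    then have "(\<Sum>r<n. nsq ((Bop lab ^^ n) (ind r))) <= (\<Sum>r<n. thx ^ (2 * n) / 4 ^ n)" by (intro sum_mono) force
    also have "... = thx ^ (2 * n) * (real n / 4 ^ n)" by simp
    also have "... < thx ^ (2 * n) * 1"
    proof (rule mult_strict_left_mono)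
      have "n < 4 ^ n" by (rule less_le_trans[OF less_exp]) (simp add: power_mono)
      then have "real n < 4 ^ n" by (metis of_nat_less_iff of_nat_numeral of_nat_power)
      then show "real n / 4 ^ n < 1" by simp
    qed (use th in simp)
    finally show False using tot by simp
  qed
  then obtain r where r: "r < n" "nsq ((Bop lab ^^ n) (ind r)) > thx ^ (2 * n) / 4 ^ n" by blast
  have p': "nsq ((Bop lab ^^ n) (ind r)) > 0"
    using r(2) th by (meson divide_pos_pos order_less_trans zero_less_numeral zero_less_power)
  have "nu lab (ind r) (Suc (2 * n)) \<ge> thx / 2 * nu lab (ind r) (2 * n)"
  proof (rule ccontr)
    assume "\<not> ?thesis"
    then have "nu lab (ind r) (2 * n) <= (thx / 2) ^ (2 * n) * nu lab (ind r) 0"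
      using th by (intro logconvex_down nu_logconvex nu_nonneg) auto
    also have "nu lab (ind r) 0 = 1" using ip_ind[OF r(1), of "ind r"] by (simp add: nu_def ind_def)
    also have "(thx / 2) ^ (2 * n) = thx ^ (2 * n) / 4 ^ n" by (simp add: power_divide power_mult)
    finally show False using r(2) by (simp add: nu_even)
  qed
  then show ?thesis using r(1) p' by (auto simp: nu_odd nu_even)
qed

section \<open>From the iterate to one of its level sets\<close>

definition N :: "(nat => nat) => (nat => real) => real" where
  "N lab x = L2_set (%p. M (Pr lab x) (fst p) (snd p)) ({..<n} \<times> {..<kap})"

lemma N_sq: "(N lab x)^2 = msq (Pr lab x)"
proof -
  have "(N lab x)^2 = (\<Sum>p\<in>{..<n} \<times> {..<kap}. (M (Pr lab x) (fst p) (snd p))^2)"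
    unfolding N_def L2_set_def by (intro real_sqrt_pow2 sum_nonneg) auto
  then show ?thesis by (simp add: msq_def sum.cartesian_product case_prod_beta)
qed

lemma N_nonneg: "N lab x \<ge> 0" by (simp add: N_def L2_set_nonneg)

lemma N_cong: "(\<And>r. r < n ==> x r = y r) ==> N lab x = N lab y"
proof -
  assume h: "\<And>r. r < n ==> x r = y r"
  then have "Pr lab x r = Pr lab y r" if "r < n" for r using that av_cong[of x y lab r] by (simp add: Pr_def)
  then have "msq (Pr lab x) = msq (Pr lab y)" by (rule msq_cong)
  then show ?thesis by (metis N_sq N_nonneg power2_eq_iff_nonneg)
qed

lemma N_add: "N lab (%r. x r + y r) <= N lab x + N lab y"
proof -
  have "M (Pr lab (%r. x r + y r)) l c = M (Pr lab x) l c + M (Pr lab y) l c" for l c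
    by (simp add: M_def Pr_def av_add algebra_simps sum.distrib sum_subtractf)
  then show ?thesis unfolding N_def
    using L2_set_triangle_ineq[of "%p. M (Pr lab x) (fst p) (snd p)" "%p. M (Pr lab y) (fst p) (snd p)"] by simp
qed

lemma N_scale: "a \<ge> 0 ==> N lab (%r. a * x r) = a * N lab x"
proof -
  assume a: "a \<ge> 0"
  have "M (Pr lab (%r. a * x r)) l c = a * M (Pr lab x) l c" for l c
    by (simp add: M_def Pr_def av_scale algebra_simps sum_distrib_left sum_subtractf)
  then show ?thesis unfolding N_def by (simp add: L2_set_right_distrib[OF a])
qed

lemma N_const: "N lab (%_. a) = 0"
proof -
  have "msq (Pr lab (%_. a)) = msq (%_. 0)"
    by (rule msq_cong) (simp add: Pr_def av_fix)
  also have "... = 0" by (simp add: msq_def M_def)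
  finally show ?thesis using N_sq[of lab "%_. a"] by simp
qed

text \<open>Layer cake: a function with values in \<open>[0, b]\<close> is a combination of its
  superlevel sets with total weight at most \<open>b\<close>, and \<open>N\<close> is a seminorm.
  The induction peels off the least positive value.\<close>

lemma N_layers:
  assumes "\<And>r. r < n ==> 0 <= h r & h r <= b"
    and "\<And>s. s < n ==> h s > 0 ==> N lab (%r. if h r \<ge> h s then 1 else 0) <= q"
    and "b \<ge> 0" "q \<ge> 0"
  shows "N lab h <= q * b"
  using assms
proof (induction "card (h ` {..<n} - {0})" arbitrary: h b rule: less_induct)
  case less
  show ?case
  proof (cases "h ` {..<n} - {0} = {}")
    case True
    then have "N lab h = N lab (%_. 0)" by (intro N_cong) auto
    then show ?thesis using N_const[of lab 0] less.prems by simp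
  next
    case False
    let ?V = "h ` {..<n} - {0}"
    define m where "m = Min ?V"
    have mV: "m \<in> ?V" unfolding m_def using False by (intro Min_in) auto
    then obtain s where s: "s < n" "h s = m" by auto
    have m0: "m > 0" using mV less.prems(1) by force
    have mb: "m <= b" using s less.prems(1)[of s] by simp
    have mmin: "h r = 0 \<or> m <= h r" if "r < n" for r
    proof (cases "h r = 0")
      case False
      then have "h r \<in> ?V" using that by simp
      then show ?thesis unfolding m_def by (simp del: Diff_iff)
    qed simp
    define i where "i r = (if h r \<ge> m then 1 else (0::real))" for r
    define h' where "h' r = h r - m * i r" for r
    have hv: "h' r = (if h r = 0 then 0 else h r - m)" if "r < n" for r
      using mmin[OF that] m0 by (auto simp: h'_def i_def)
    have lt: "card (h' ` {..<n} - {0}) < card ?V"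
    proof -
      have "h' ` {..<n} - {0} \<subseteq> (%v. v - m) ` (?V - {m})" using hv by force
      then have "card (h' ` {..<n} - {0}) <= card (?V - {m})"
        by (meson card_image_le card_mono finite_Diff finite_imageI finite_lessThan order_trans)
      also have "... < card ?V" using mV by (intro card_Diff1_less) auto
      finally show ?thesis .
    qed
    have "N lab h' <= q * (b - m)"
    proof (rule less.hyps[OF lt])
      fix r assume r: "r < n"
      show "0 <= h' r & h' r <= b - m" using hv[OF r] mmin[OF r] less.prems(1)[OF r] mb by auto
    next
      fix t assume t: "t < n" "h' t > 0"
      then have ht: "h t > 0" "h' t = h t - m" using hv[OF t(1)] mmin[OF t(1)] m0 by (auto split: if_splits)
      have "N lab (%r. if h' r \<ge> h' t then 1 else 0) = N lab (%r. if h r \<ge> h t then 1 else 0)"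
      proof (rule N_cong)
        fix r assume r: "r < n"
        show "(if h' r \<ge> h' t then 1 else 0) = (if h r \<ge> h t then 1 else (0::real))"
          using hv[OF r] ht t by (auto split: if_splits)
      qed
      then show "N lab (%r. if h' r \<ge> h' t then 1 else 0) <= q" using less.prems(2)[OF t(1) ht(1)] by simp
    qed (use mb less.prems in auto)
    moreover have "N lab h <= N lab h' + N lab (%r. m * i r)"
      using N_add[of lab h' "%r. m * i r"] by (simp add: h'_def)
    moreover have "N lab (%r. m * i r) <= m * q"
      using less.prems(2)[OF s(1)] s(2) m0 unfolding i_def by (subst N_scale) auto
    ultimately show ?thesis by (simp add: algebra_simps)
  qed
qed

lemma sq_diff_le: "(x - y)^2 <= 2 * x^2 + 2 * (y :: real)^2"
  using zero_le_power2[of "x + y"] by (simp add: power2_eq_square algebra_simps)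

text \<open>By \<open>dom\<close> the function \<open>s\<close> behaves like the part of
  \<open>x\<close> beyond \<open>C\<close> times its root mean square, so its l1 norm is at most
  \<open>1 / C\<close> times what Cauchy-Schwarz gives for \<open>x\<close>. Both \<open>s\<close>
  and its average then fall under \<open>msq_le\<close>; the factor 4 comes from squaring their
  difference.\<close>

lemma N_small:
  assumes C: "C > 0" and dom: "\<And>r. r < n ==> \<bar>s r\<bar> * (C * sqrt (nsq x / n)) <= (x r)^2" and le: "\<And>r. r < n ==> \<bar>s r\<bar> <= \<bar>x r\<bar>"
    and pos: "nsq x > 0"
  shows "(N lab s)^2 <= 4 * (K * (D^2 / C^2 + lam^2) * nsq x)"
proof -
  have ns: "nsq s <= nsq x" unfolding nsq_def using le by (intro sum_mono) (simp add: abs_le_square_iff)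
  let ?c = "C * sqrt (nsq x / n)"
  have cp: "?c > 0" using C pos n0 by simp
  have "(\<Sum>r<n. \<bar>s r\<bar>) * ?c <= nsq x" 
  proof -
    have "(\<Sum>r<n. \<bar>s r\<bar> * ?c) <= (\<Sum>r<n. (x r)^2)" using dom by (intro sum_mono) auto
    then show ?thesis by (simp only: sum_distrib_right nsq_def[symmetric])
  qed
  moreover have "0 <= (\<Sum>r<n. \<bar>s r\<bar>) * ?c"
    by (intro mult_nonneg_nonneg[OF _ less_imp_le[OF cp]] sum_nonneg) auto
  ultimately have "((\<Sum>r<n. \<bar>s r\<bar>) * ?c)^2 <= (nsq x)^2" by (intro power_mono)
  then have "(\<Sum>r<n. \<bar>s r\<bar>)^2 * (C^2 * (nsq x / n)) <= (nsq x)^2"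
    using pos n0 by (simp add: power_mult_distrib)
  then have l1: "(\<Sum>r<n. \<bar>s r\<bar>)^2 / n <= nsq x / C^2"
    using pos n0 C by (simp add: field_simps power2_eq_square)
  have key: "msq y <= K * (D^2 / C^2 + lam^2) * nsq x"
    if "(\<Sum>r<n. \<bar>y r\<bar>) <= (\<Sum>r<n. \<bar>s r\<bar>)" "nsq y <= nsq s" for y
  proof -
    have "(\<Sum>r<n. \<bar>y r\<bar>)^2 <= (\<Sum>r<n. \<bar>s r\<bar>)^2" using that(1) by (intro power_mono sum_nonneg) auto
    then have "(\<Sum>r<n. \<bar>y r\<bar>)^2 / n <= nsq x / C^2" using l1 by (meson divide_right_mono of_nat_0_le_iff order_trans)
    then have "D^2 * ((\<Sum>r<n. \<bar>y r\<bar>)^2 / n) + lam^2 * nsq y <= D^2 * (nsq x / C^2) + lam^2 * nsq x"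
      using that(2) ns by (intro add_mono mult_left_mono) auto
    then have "K * (D^2 * (\<Sum>r<n. \<bar>y r\<bar>)^2 / n + lam^2 * nsq y) <= K * (D^2 * (nsq x / C^2) + lam^2 * nsq x)"
      by (intro mult_left_mono) auto
    then show ?thesis using msq_le[of y] by (simp add: algebra_simps)
  qed
  have k1: "msq s <= K * (D^2 / C^2 + lam^2) * nsq x" by (rule key) auto
  have k2: "msq (av lab s) <= K * (D^2 / C^2 + lam^2) * nsq x" by (rule key) (auto simp: nsq_av_le sum_av_le)
  have "(M (Pr lab s) l c)^2 <= 2 * (M s l c)^2 + 2 * (M (av lab s) l c)^2" for l c
  proof -
    have "M (Pr lab s) l c = M s l c - M (av lab s) l c"
      by (simp add: M_def Pr_def algebra_simps sum_subtractf)
    then show ?thesis by (simp only: sq_diff_le)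
  qed
  then have "msq (Pr lab s) <= 2 * msq s + 2 * msq (av lab s)"
    unfolding msq_def sum_distrib_left sum.distrib[symmetric] by (intro sum_mono) auto
  moreover define X where "X = K * (D^2 / C^2 + lam^2) * nsq x"
  ultimately show ?thesis using k1 k2 unfolding N_sq X_def[symmetric] by linarith
qed

definition lev :: "(nat => real) => nat => nat => real" where
  "lev x s r = (if x r \<ge> x s then 1 else 0)"

text \<open>The iterate may be dominated by few large values. Truncate it at \<open>C\<close> times
  its root mean square: the tail carries at most half of the guaranteed seminorm by
  \<open>N_small\<close>, and the truncated function, shifted into \<open>[0, 2 * a]\<close>, has a
  level set with a proportional share by \<open>N_layers\<close>.\<close>

lemma threshold:
  fixes dl :: real
  assumes dl: "dl > 0" "dl <= 1" and K: "K > 0" and lam: "lam^2 <= dl * D^2 / (128 * K)"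
    and x: "msq (Pr lab x) \<ge> dl * D^2 / 2 * nsq x" "nsq x > 0"
  shows "\<exists>s<n. msq (Pr lab (lev x s)) \<ge> dl^2 * D^2 * n / (8192 * K)"
proof -
  \<comment> \<open>With this \<open>C\<close> the term \<open>D^2 / C^2\<close> of
    \<open>N_small\<close> equals the assumed bound on \<open>lam^2\<close>.\<close>
  define C where "C = sqrt (128 * K / dl)"
  have C2: "C^2 = 128 * K / dl" "C > 0" using dl K by (simp_all add: C_def)
  define a where "a = C * sqrt (nsq x / n)"
  have a0: "a > 0" using C2 x n0 by (simp add: a_def)
  define y where "y r = max (- a) (min a (x r))" for r
  define s where "s r = x r - y r" for r
  have ys: "x r = y r + s r" for r by (simp add: s_def)
  have s1: "\<bar>s r\<bar> * a <= (x r)^2 & \<bar>s r\<bar> <= \<bar>x r\<bar>" for r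
  proof -
    have "\<bar>s r\<bar> <= \<bar>x r\<bar>" "s r = 0 \<or> a <= \<bar>x r\<bar>" using a0 by (auto simp: s_def y_def min_def max_def)
    then show ?thesis using a0 by (auto simp: power2_eq_square abs_mult[symmetric] intro: mult_mono order_trans[OF mult_mono[of "\<bar>s r\<bar>" "\<bar>x r\<bar>" a "\<bar>x r\<bar>"]])
  qed
  have "(N lab s)^2 <= 4 * (K * (D^2 / C^2 + lam^2) * nsq x)"
    by (rule N_small[OF C2(2)]) (use s1 x in \<open>auto simp: a_def\<close>)
  also have "... <= 4 * (K * (dl * D^2 / (64 * K)) * nsq x)"
    using lam x C2 by (intro mult_left_mono mult_right_mono) (auto simp: field_simps)
  also have "... = dl * D^2 / 16 * nsq x" using K by simp
  finally have Ns: "(N lab s)^2 <= dl * D^2 / 16 * nsq x" .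
  have Nx: "(N lab x)^2 \<ge> dl * D^2 / 2 * nsq x" using x by (simp add: N_sq)
  define v where "v = sqrt (dl * nsq x) * D"
  have v0: "v > 0" using dl x D0 by (simp add: v_def)
  have v2: "v^2 = dl * D^2 * nsq x" using dl x by (simp add: v_def power_mult_distrib)
  have "N lab s <= v / 4" by (rule power2_le_imp_le) (use Ns v2 v0 in \<open>auto simp: power_divide\<close>)
  moreover have "N lab x \<ge> v / 2"
  proof (rule power2_le_imp_le[OF _ N_nonneg])
    have "v^2 <= 2 * (N lab x)^2" using Nx v2 by simp
    moreover have "(v / 2)^2 = v^2 / 4" by (simp add: power_divide)
    ultimately show "(v / 2)^2 <= (N lab x)^2" using zero_le_power2[of "N lab x"] by linarith
  qed
  moreover have "N lab x <= N lab y + N lab s" using N_add[of lab y s] by (simp add: ys[symmetric])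
  ultimately have Ny: "N lab y \<ge> v / 4" by simp
  define q where "q = Max ((%s. N lab (lev x s)) ` {..<n})"
  have q: "N lab (lev x s) <= q" if "s < n" for s using that by (simp add: q_def)
  have q0: "q \<ge> 0" using q[OF n0] N_nonneg[of lab "lev x 0"] by simp
  have "N lab (%r. y r + a) <= q * (2 * a)"
  proof (rule N_layers)
    fix r assume "r < n"
    show "0 <= y r + a & y r + a <= 2 * a" using a0 by (auto simp: y_def)
  next
    fix t assume t: "t < n" "y t + a > 0"
    \<comment> \<open>Truncation is monotone, so a level set of \<open>y\<close> is the level set of
      \<open>x\<close> at that vertex of \<open>?U\<close> where \<open>x\<close> is least.\<close>
    let ?U = "{r. r < n & y r \<ge> y t}"
    have fin: "finite (x ` ?U)" "x ` ?U ~= {}" using t by auto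
    obtain u where u: "u \<in> ?U" "x u = Min (x ` ?U)" using Min_in[OF fin] by auto
    have "N lab (%r. if y r + a \<ge> y t + a then 1 else 0) = N lab (lev x u)"
    proof (rule N_cong)
      fix r assume r: "r < n"
      have "y r \<ge> y t \<longleftrightarrow> x r \<ge> x u"
      proof
        assume "y r \<ge> y t"
        then show "x r \<ge> x u" using u(2) fin r by simp
      next
        assume "x r \<ge> x u"
        then have "y r \<ge> y u" by (auto simp: y_def)
        then show "y r \<ge> y t" using u(1) by simp
      qed
      then show "(if y r + a \<ge> y t + a then 1 else 0) = lev x u r" by (simp add: lev_def)
    qed
    then show "N lab (%r. if y r + a \<ge> y t + a then 1 else 0) <= q" using q u(1) by simp
  qed (use a0 q0 in auto)
  moreover have "N lab y <= N lab (%r. y r + a)"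
    using N_add[of lab "%r. y r + a" "%_. - a"] N_const[of lab "- a"] by simp
  ultimately have "v / 4 <= q * (2 * a)" using Ny by simp
  then have "(v / 4)^2 <= (q * (2 * a))^2" using v0 by (intro power_mono) auto
  \<comment> \<open>The factors 16 and 4 here and the 128 in \<open>C^2\<close> make up the 8192 of
    the claim.\<close>
  then have "dl * D^2 * nsq x / 16 <= q^2 * 4 * (C^2 * (nsq x / n))"
    using x n0 v2 by (simp add: power_mult_distrib power_divide a_def)
  then have "dl * D^2 * nsq x / 16 <= (q^2 * 4 * C^2 / n) * nsq x" by simp
  then have "dl * D^2 / 16 <= q^2 * 4 * C^2 / n" using x
    by (metis (no_types, opaque_lifting) mult_le_cancel_right_pos times_divide_eq_left)
  then have "dl^2 * D^2 * n / (4096 * K) <= q^2 * 2"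
    using n0 K dl unfolding C2 by (simp add: field_simps power2_eq_square)
  have fin2: "dl^2 * D^2 * n / (8192 * K) <= q^2"
    using \<open>dl^2 * D^2 * n / (4096 * K) <= q^2 * 2\<close> by simp
  have "q \<in> (%s. N lab (lev x s)) ` {..<n}" unfolding q_def using n0 by (intro Max_in) auto
  then obtain s where "s < n" "q = N lab (lev x s)" by auto
  then show ?thesis using fin2 N_sq[of lab "lev x s"] by auto
qed

lemma av_01:
  assumes "\<And>s. s < n ==> 0 <= S s & S s <= 1" "r < n"
  shows "0 <= av lab S r" "av lab S r <= 1"
proof -
  have "(\<Sum>s\<in>cl lab r. S s) <= (\<Sum>s\<in>cl lab r. 1)" by (rule sum_mono) (use assms(1) in \<open>auto simp: cl_def\<close>)
  moreover have "0 <= (\<Sum>s\<in>cl lab r. S s)" using assms(1) by (intro sum_nonneg) (auto simp: cl_def)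
  ultimately show "0 <= av lab S r" "av lab S r <= 1" using card_cl[OF assms(2), of lab] by (auto simp: av_def)
qed

lemma Pr_01: "(\<And>s. s < n ==> 0 <= S s & S s <= 1) ==> r < n ==> \<bar>Pr lab S r\<bar> <= 1"
  using av_01[of S r lab] unfolding Pr_def by (smt (verit))

lemma lev_01: "0 <= lev x s r & lev x s r <= 1"
  by (simp add: lev_def)

text \<open>If \<open>M\<close> sees more of the unknown set \<open>A\<close> than its densities,
  then power iteration from some basis vector has a level set that shows it in the l1 norm. These
  \<open>n * n\<close> candidates do not depend on \<open>A\<close>, so a program can try them
  all.\<close>

theorem irregular_found:
  fixes dl :: real
  assumes dl: "dl > 0" "dl <= 1" and K: "K > 0" and lam: "lam^2 <= dl * D^2 / (128 * K)"
    and big: "msq (Pr lab (indicator A)) \<ge> dl * D^2 * n"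
  shows "\<exists>r<n. \<exists>s<n. mone (Pr lab (lev ((Bop lab ^^ n) (ind r)) s)) \<ge> dl^2 * D * n / (8192 * K)"
proof -
  define f where "f = Pr lab (indicator A :: nat => real)"
  have f1: "\<bar>f r\<bar> <= 1" if "r < n" for r
    unfolding f_def by (rule Pr_01[OF _ that]) (auto simp: indicator_def)
  have "nsq f <= (\<Sum>r<n. 1)" unfolding nsq_def using f1 by (intro sum_mono) (simp add: abs_square_le_1)
  then have "nsq f <= n" by simp
  then have "dl * D^2 * nsq f <= dl * D^2 * n" using dl by (intro mult_left_mono) auto
  then have 1: "msq f \<ge> dl * D^2 * nsq f" using big by (simp add: f_def)
  have d: "dl * D^2 > 0" using dl D0 by simp
  then have "dl * D^2 * n > 0" using n0 by simp
  then have 2: "msq f > 0" using big by (simp add: f_def)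
  have 0: "av lab f r = 0" if "r < n" for r unfolding f_def by (rule av_Pr[OF that])
  obtain r where r: "r < n" "msq (Pr lab ((Bop lab ^^ n) (ind r))) \<ge> dl * D^2 / 2 * nsq ((Bop lab ^^ n) (ind r))"
     "nsq ((Bop lab ^^ n) (ind r)) > 0"
    using power_iteration[OF 0 d 1 2] by blast
  obtain s where s: "s < n" "msq (Pr lab (lev ((Bop lab ^^ n) (ind r)) s)) \<ge> dl^2 * D^2 * n / (8192 * K)"
    using threshold[OF dl K lam r(2,3)] by blast
  let ?g = "Pr lab (lev ((Bop lab ^^ n) (ind r)) s)"
  have "msq ?g <= D * mone ?g" by (rule msq_le_mone) (rule Pr_01[OF lev_01])
  then have "D * (dl^2 * D * n / (8192 * K)) <= D * mone ?g" using s(2) by (simp add: power2_eq_square mult_ac)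
  then have "dl^2 * D * n / (8192 * K) <= mone ?g"
    by (simp only: mult_le_cancel_left_pos of_nat_0_less_iff D0)
  then show ?thesis using r(1) s(1) by blast
qed

text \<open>A large l1 norm forces a large quadratic form by \<open>mone_sq_le\<close>, and
  \<open>Phi_step\<close> turns it into energy once the labels separate \<open>S\<close>. The gain
  does not depend on \<open>n\<close>, so it can occur only a constant number of times.\<close>

theorem energy_gain:
  assumes ref: "\<And>r s. r < n ==> s < n ==> lab' r = lab' s ==> lab r = lab s & S r = S s"
    and S01: "\<And>r. 0 <= S r & S r <= 1"
    and G: "G > 0" and K: "K > 0" and big: "G * mone (Pr lab S) \<ge> D * n"
  shows "Phi lab' \<ge> Phi lab + D^2 / (G^2 * K)"
proof -
  have ps: "msq (Pr lab S) <= (Phi lab' - Phi lab) * n"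
    by (rule Phi_step) (use ref S01 in blast)+
  have "(real D * real n)^2 <= (G * mone (Pr lab S))^2" using big by (intro power_mono) auto
  also have "... = G^2 * (mone (Pr lab S))^2" by (simp add: power_mult_distrib)
  also have "... <= G^2 * (K * n * msq (Pr lab S))" by (intro mult_left_mono mone_sq_le) auto
  also have "... <= G^2 * (K * n * ((Phi lab' - Phi lab) * n))"
    using ps by (intro mult_left_mono) auto
  finally have "D^2 * (n * n) <= (G^2 * K * (Phi lab' - Phi lab)) * (n * n)" by (simp add: power2_eq_square mult_ac)
  moreover have "real (n * n) > 0" using n0 by simp
  ultimately have "D^2 <= G^2 * K * (Phi lab' - Phi lab)" by (metis mult_le_cancel_right_pos of_nat_mult)
  then show ?thesis using G K by (simp add: field_simps)
qed

section \<open>Decoding from rounded densities, and expansion\<close>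

definition dens :: "nat => (nat => nat) => nat set => nat => nat" where
  "dens m lab A p = (m * card {s. s < n & lab s = p & s \<in> A}) div card {s. s < n & lab s = p}"

lemma dens_le: "dens m lab A p <= m"
proof -
  have "card {s. s < n & lab s = p & s \<in> A} <= card {s. s < n & lab s = p}" by (intro card_mono) auto
  then have "dens m lab A p <= (m * card {s. s < n & lab s = p}) div card {s. s < n & lab s = p}"
    unfolding dens_def by (intro div_le_mono mult_le_mono2)
  also have "... <= m" by (cases "card {s. s < n & lab s = p} = 0") auto
  finally show ?thesis .
qed

text \<open>The indicator differs from the rounded densities by its irregular part and a rounding
  error of at most \<open>1 / m\<close>. Both have a small quadratic form, and Chebyshev's
  inequality counts the left vertices where some entry is off by \<open>ta\<close>.\<close>

theorem decode_regular:
  fixes ta thx :: real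
  assumes small: "msq (Pr lab (indicator A)) <= thx * n" and m: "m > 0" and lam: "lam^2 <= D^2" and ta: "ta > 0"
  shows "card {l. l < n & (\<exists>c<kap. ta <= \<bar>M (indicator A) l c - M (%r. dens m lab A (lab r) / m) l c\<bar>)} * ta^2
     <= (2 * thx + 4 * K * D^2 / m^2) * n"
proof -
  let ?i = "indicator A :: nat => real"
  let ?d = "%r. dens m lab A (lab r) / real m"
  define e where "e r = av lab ?i r - ?d r" for r
  define h where "h r = Pr lab ?i r + e r" for r
  have h: "h r = ?i r - ?d r" for r by (simp add: h_def e_def Pr_def)
  have eb: "\<bar>e r\<bar> <= 1 / m" if r: "r < n" for r
  proof -
    let ?C = "card {s. s < n & lab s = lab r}" and ?B = "card {s. s < n & lab s = lab r & s \<in> A}"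
    have C: "?C > 0" using card_cl[OF r, of lab] by (simp add: cl_def)
    have "(\<Sum>s\<in>cl lab r. ?i s) = real ?B"
      by (simp add: sum.If_cases indicator_def cl_def) (rule arg_cong[where f = card], auto)
    then have a: "av lab ?i r = ?B / ?C" by (simp add: av_def cl_def)
    have "real (m * ?B) / ?C - 1 <= real (m * ?B div ?C)" "real (m * ?B div ?C) <= real (m * ?B) / ?C"
      using floor_divide_of_nat_eq[of "m * ?B" ?C, where ?'a = real] by linarith+
    then have "\<bar>m * (?B / ?C) - dens m lab A (lab r)\<bar> <= 1" by (simp add: dens_def)
    then have "\<bar>m * e r\<bar> <= 1" using m by (simp add: e_def a algebra_simps)
    then show ?thesis using m by (simp add: abs_mult field_simps)
  qed
  have "(M h l c)^2 <= 2 * (M (Pr lab ?i) l c)^2 + 2 * (M e l c)^2" for l c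
  proof -
    have "M h l c = M (Pr lab ?i) l c + M e l c" by (simp add: M_def h_def algebra_simps sum.distrib)
    then show ?thesis using sq_diff_le[of "M (Pr lab ?i) l c" "- M e l c"] by simp
  qed
  then have h2: "msq h <= 2 * msq (Pr lab ?i) + 2 * msq e"
    unfolding msq_def sum_distrib_left sum.distrib[symmetric] by (intro sum_mono) auto
  have e2: "msq e <= K * (2 * D^2 / m^2 * n)"
  proof -
    have "(\<Sum>r<n. \<bar>e r\<bar>) <= (\<Sum>r<n. 1 / m)" using eb by (intro sum_mono) auto
    then have "(\<Sum>r<n. \<bar>e r\<bar>)^2 <= (n * (1 / m))^2" by (intro power_mono sum_nonneg) auto
    then have "D^2 * (\<Sum>r<n. \<bar>e r\<bar>)^2 / n <= D^2 * (n * (1 / m))^2 / n" by (intro divide_right_mono mult_left_mono) auto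
    also have "... = D^2 / m^2 * n" using n0 by (simp add: power2_eq_square)
    finally have 1: "D^2 * (\<Sum>r<n. \<bar>e r\<bar>)^2 / n <= D^2 / m^2 * n" .
    have "nsq e <= (\<Sum>r<n. (1 / m)^2)" unfolding nsq_def
    proof (intro sum_mono)
      fix r assume "r \<in> {..<n}"
      then show "(e r)^2 <= (1 / m)^2" using eb[of r] by (simp add: abs_le_square_iff[symmetric])
    qed
    then have "nsq e <= n / m^2" by (simp add: power_divide)
    then have "lam^2 * nsq e <= D^2 * (n / m^2)" using lam by (intro mult_mono) (auto simp: nsq_nonneg)
    then have "D^2 * (\<Sum>r<n. \<bar>e r\<bar>)^2 / n + lam^2 * nsq e <= 2 * D^2 / m^2 * n" using 1 by simp
    then show ?thesis using msq_le[of e] by (meson mult_left_mono of_nat_0_le_iff order_trans)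
  qed
  have tot: "msq h <= (2 * thx + 4 * K * D^2 / m^2) * n"
  proof -
    have "(2 * thx + 4 * K * D^2 / m^2) * n = 2 * (thx * n) + 2 * (K * (2 * D^2 / m^2 * n))"
      by (simp add: algebra_simps)
    then show ?thesis using small h2 e2 by linarith
  qed
  let ?S = "{l. l < n & (\<exists>c<kap. ta <= \<bar>M ?i l c - M ?d l c\<bar>)}"
  have Mh: "M h l c = M ?i l c - M ?d l c" for l c by (simp add: M_def h algebra_simps sum_subtractf)
  have "card ?S * ta^2 = (\<Sum>l\<in>?S. ta^2)" by simp
  also have "... <= (\<Sum>l\<in>?S. \<Sum>c<kap. (M h l c)^2)"
  proof (intro sum_mono)
    fix l assume "l \<in> ?S"
    then obtain c where c: "c < kap" "ta <= \<bar>M h l c\<bar>" by (auto simp: Mh)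
    then have "ta^2 <= \<bar>M h l c\<bar>^2" using ta by (intro power_mono) auto
    also have "... = (M h l c)^2" by simp
    also have "... <= (\<Sum>c<kap. (M h l c)^2)" using c by (intro member_le_sum) auto
    finally show "ta^2 <= (\<Sum>c<kap. (M h l c)^2)" .
  qed
  also have "... <= msq h" unfolding msq_def by (rule sum_mono2) (auto intro: sum_nonneg)
  finally show ?thesis using tot by simp
qed

text \<open>Chebyshev's inequality for the neighbour sums of \<open>indicator A\<close> minus its
  mean: almost every left vertex has nearly its fair share of neighbours in
  \<open>A\<close>.\<close>

theorem degree_deviation:
  fixes ta :: real
  assumes A: "A \<subseteq> {..<n}" and ta: "ta > 0"
  shows "card {l. l < n & ta <= \<bar>(\<Sum>w<D. indicator A (nbf w l)) - D * card A / n\<bar>} * ta^2 <= lam^2 * n"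
proof -
  define a where "a = card A / real n"
  define f where "f r = indicator A r - a" for r
  have sA: "(\<Sum>r<n. indicator A r) = real (card A)"
    using A by (simp add: indicator_def sum.If_cases Int_absorb1)
  have f0: "(\<Sum>r<n. f r) = 0" using n0 by (simp add: f_def sum_subtractf sA a_def)
  have a01: "0 <= a" "a <= 1"
    using card_mono[OF _ A] n0 by (auto simp: a_def)
  have "(\<Sum>r<n. (f r)^2) <= (\<Sum>r<n. 1)"
    using a01 by (intro sum_mono) (auto simp: f_def indicator_def abs_square_le_1)
  then have "lam^2 * (\<Sum>r<n. (f r)^2) <= lam^2 * n" by (intro mult_left_mono) auto
  then have tot: "(\<Sum>l<n. (\<Sum>w<D. f (nbf w l))^2) <= lam^2 * n" using expander[OF f0] by simp
  let ?S = "{l. l < n & ta <= \<bar>(\<Sum>w<D. indicator A (nbf w l)) - D * card A / n\<bar>}"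
  have F: "(\<Sum>w<D. f (nbf w l)) = (\<Sum>w<D. indicator A (nbf w l)) - D * card A / n" for l
    by (simp add: f_def sum_subtractf a_def)
  have "card ?S * ta^2 = (\<Sum>l\<in>?S. ta^2)" by simp
  also have "... <= (\<Sum>l\<in>?S. (\<Sum>w<D. f (nbf w l))^2)"
  proof (intro sum_mono)
    fix l assume "l \<in> ?S"
    then have "ta <= \<bar>\<Sum>w<D. f (nbf w l)\<bar>" by (simp add: F)
    then have "ta^2 <= \<bar>\<Sum>w<D. f (nbf w l)\<bar>^2" using ta by (intro power_mono) auto
    then show "ta^2 <= (\<Sum>w<D. f (nbf w l))^2" by simp
  qed
  also have "... <= (\<Sum>l<n. (\<Sum>w<D. f (nbf w l))^2)" by (rule sum_mono2) auto
  finally show ?thesis using tot by simp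
qed

text \<open>A form of the expander mixing lemma: Cauchy-Schwarz over \<open>S\<close>, then
  \<open>G_norm\<close> for the indicator of \<open>T\<close>.\<close>

lemma edges_sq:
  assumes S: "S \<subseteq> {..<n}" and T: "T \<subseteq> {..<n}"
  shows "(\<Sum>l\<in>S. \<Sum>w<D. (indicator T (nbf w l) :: real))^2 <= card S * (D^2 * (card T)^2 / n + lam^2 * card T)"
proof -
  have sT: "(\<Sum>r<n. indicator T r) = real (card T)"
    using T by (simp add: indicator_def sum.If_cases Int_absorb1)
  then have sT2: "(\<Sum>r<n. (indicator T r)^2) = real (card T)" by (simp add: indicator_def power2_eq_square)
  have "(\<Sum>l\<in>S. \<Sum>w<D. indicator T (nbf w l) :: real)^2 <= (\<Sum>l\<in>S. 1^2) * (\<Sum>l\<in>S. (\<Sum>w<D. indicator T (nbf w l))^2)"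
    using Cauchy_Schwarz_ineq_sum[of "%_. 1" "%l. \<Sum>w<D. indicator T (nbf w l) :: real" S] by simp
  also have "... <= card S * (\<Sum>l<n. (\<Sum>w<D. indicator T (nbf w l) :: real)^2)"
    using S by (simp, intro mult_left_mono sum_mono2) auto
  also have "... <= card S * (D^2 * (card T)^2 / n + lam^2 * card T)"
    using G_norm[of "indicator T"] unfolding sT sT2 by (intro mult_left_mono) auto
  finally show ?thesis .
qed

text \<open>In Zemor's decoder \<open>S\<close> are the wrong left symbols and \<open>T\<close> the
  right vertices that decode wrongly, each met by at least \<open>E\<close> edges from
  \<open>S\<close>. While \<open>S\<close> is small, mixing allows that many edges only if
  \<open>T\<close> is much smaller than \<open>S\<close>.\<close>

theorem zemor_right:
  assumes S: "S \<subseteq> {..<n}" and T: "T \<subseteq> {..<n}" and E: "E > 0"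
    and deg: "\<And>r. r \<in> T ==> real E <= (\<Sum>l\<in>S. \<Sum>w<D. if nbf w l = r then 1 else 0)"
    and small: "2 * D^2 * real (card S) <= E^2 * n" and lam: "8 * lam^2 <= E^2"
  shows "4 * card T <= card S"
proof (cases "card T = 0")
  case False
  have fT: "finite T" using T finite_subset by blast
  have "card T * real E <= (\<Sum>r\<in>T. \<Sum>l\<in>S. \<Sum>w<D. if nbf w l = r then 1 else 0)"
    using deg sum_mono[of T "%_. real E"] by simp
  also have "... = (\<Sum>l\<in>S. \<Sum>w<D. \<Sum>r\<in>T. if nbf w l = r then 1 else 0)"
    by (rule trans[OF sum.swap sum.cong[OF refl sum.swap]])
  also have "... = (\<Sum>l\<in>S. \<Sum>w<D. indicator T (nbf w l))"
    using fT by (intro sum.cong refl) (simp add: indicator_def)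
  finally have "(card T * real E)^2 <= (\<Sum>l\<in>S. \<Sum>w<D. indicator T (nbf w l))^2" by (intro power_mono) auto
  also note edges_sq[OF S T]
  finally have "card T * (card T * (real E)^2) <= card T * (card S * (D^2 * card T / n + lam^2))"
    by (simp add: power2_eq_square algebra_simps)
  then have "card T * (real E)^2 <= card S * (D^2 * card T / n + lam^2)" using False by simp
  also have "... = (D^2 * card S / n) * card T + lam^2 * card S" by (simp add: algebra_simps)
  also have "... <= (E^2 / 2) * card T + (E^2 / 8) * card S"
    using small lam n0 by (intro add_mono mult_right_mono) (auto simp: field_simps)
  finally have "(real E)^2 * (4 * card T) <= (real E)^2 * card S" by (simp add: algebra_simps)
  then have "real (4 * card T) <= real (card S)" using E by simp
  then show ?thesis by (simp only: of_nat_le_iff)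
qed simp

theorem zemor_left:
  assumes S: "S \<subseteq> {..<n}" and T: "T \<subseteq> {..<n}" and E: "E > 0"
    and deg: "\<And>l. l \<in> S ==> real E <= (\<Sum>w<D. indicator T (nbf w l))"
    and small: "2 * D^2 * real (card T) <= E^2 * n" and lam: "8 * lam^2 <= E^2"
  shows "card S <= card T"
proof (cases "card S = 0")
  case False
  have "card S * real E <= (\<Sum>l\<in>S. \<Sum>w<D. indicator T (nbf w l))"
    using deg sum_mono[of S "%_. real E"] by simp
  then have "(card S * real E)^2 <= (\<Sum>l\<in>S. \<Sum>w<D. indicator T (nbf w l))^2" by (intro power_mono) auto
  also note edges_sq[OF S T]
  finally have "card S * (card S * (real E)^2) <= card S * (D^2 * (card T)^2 / n + lam^2 * card T)"
    by (simp only: power_mult_distrib power2_eq_square[of "real (card S)"] mult.assoc)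
  then have "card S * (real E)^2 <= D^2 * (card T)^2 / n + lam^2 * card T" using False by simp
  also have "... = (D^2 * card T / n + lam^2) * card T" by (simp add: power2_eq_square algebra_simps)
  also have "... <= (E^2 / 2 + E^2 / 8) * card T"
    using small lam n0 by (intro add_mono mult_right_mono) (auto simp: field_simps)
  also have "... <= (real E)^2 * card T" by (intro mult_right_mono) auto
  finally have "(real E)^2 * card S <= (real E)^2 * card T" by (simp add: mult.commute)
  then show ?thesis using E by simp
qed simp

end

section \<open>Existence of the component codes\<close>

abbreviation sd :: "'a set => 'a set => 'a set" where "sd A B \<equiv> (A - B) \<union> (B - A)"

lemma sd_self_assoc: "sd A (sd A B) = B" by auto
lemma sd_eq_iff: "sd A B = sd A C \<longleftrightarrow> B = C" by auto

definition wt :: "(nat \<times> nat) set => nat" where "wt c = card (fst ` c)"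

text \<open>Words are bit matrices with \<open>D\<close> rows of \<open>y\<close> bits, given by the
  set of their ones; addition over the field with two elements is symmetric difference, and the
  weight counts nonzero rows.\<close>

definition lin_code :: "nat => nat => nat => (nat \<times> nat) set set => bool" where
  "lin_code D y d C \<longleftrightarrow> C \<subseteq> Pow ({..<D} \<times> {..<y}) & {} \<in> C & (\<forall>a\<in>C. \<forall>b\<in>C. sd a b \<in> C) &
     (\<forall>a\<in>C. a ~= {} --> d <= wt a)"

text \<open>Union bound over the sets of nonzero rows: at most \<open>2 ^ D\<close> of them, each
  filled in at most \<open>2 ^ (y * (d - 1))\<close> ways.\<close>

lemma card_light:
  assumes "d > 0"
  shows "card {c \<in> Pow ({..<D} \<times> {..<y}). wt c < d} <= 2 ^ D * 2 ^ (y * (d - 1))"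
proof -
  let ?W = "{W \<in> Pow {..<D}. card W < d}"
  have "{c \<in> Pow ({..<D} \<times> {..<y}). wt c < d} \<subseteq> (\<Union>W\<in>?W. Pow (W \<times> {..<y}))"
  proof
    fix c assume c: "c \<in> {c \<in> Pow ({..<D} \<times> {..<y}). wt c < d}"
    then have "fst ` c \<in> ?W" "c \<in> Pow (fst ` c \<times> {..<y})" by (force simp: wt_def)+
    then show "c \<in> (\<Union>W\<in>?W. Pow (W \<times> {..<y}))" by blast
  qed
  then have "card {c \<in> Pow ({..<D} \<times> {..<y}). wt c < d} <= card (\<Union>W\<in>?W. Pow (W \<times> {..<y}))"
    by (intro card_mono) (auto intro: finite_subset)
  also have "... <= (\<Sum>W\<in>?W. card (Pow (W \<times> {..<y})))" by (rule card_UN_le) simp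
  also have "... <= (\<Sum>W\<in>?W. 2 ^ (y * (d - 1)))"
  proof (rule sum_mono)
    fix W assume W: "W \<in> ?W"
    then have "finite W" "card W <= d - 1" by (auto intro: finite_subset)
    then have "card W * y <= y * (d - 1)" by (simp add: mult.commute)
    then show "card (Pow (W \<times> {..<y})) <= 2 ^ (y * (d - 1))"
      using \<open>finite W\<close> by (simp add: card_Pow card_cartesian_product power_increasing)
  qed
  also have "... = card ?W * 2 ^ (y * (d - 1))" by simp
  also have "card ?W <= card (Pow {..<D})" by (intro card_mono) auto
  also have "card (Pow {..<D}) = 2 ^ D" by (simp add: card_Pow)
  finally show ?thesis by simp
qed

text \<open>A code of maximal size is covering: otherwise a coset of it could be added.\<close>

lemma gv_code:
  assumes d: "d > 0"
  shows "\<exists>C. lin_code D y d C & 2 ^ (y * D) <= card C * (2 ^ D * 2 ^ (y * (d - 1)))"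
proof -
  let ?U = "{..<D} \<times> {..<y}"
  let ?codes = "{C. lin_code D y d C}"
  have sub: "?codes \<subseteq> Pow (Pow ?U)" by (auto simp: lin_code_def)
  have fin: "finite ?codes" by (rule finite_subset[OF sub]) simp
  have "{{}} \<in> ?codes" by (simp add: lin_code_def)
  then have "Max (card ` ?codes) \<in> card ` ?codes" using fin by (intro Max_in) auto
  then obtain C where C: "lin_code D y d C" "card C = Max (card ` ?codes)" by auto
  have mx: "card C' <= card C" if "lin_code D y d C'" for C' using that fin C(2) by simp
  have finC: "finite C" using C(1) unfolding lin_code_def by (meson finite_Pow_iff finite_SigmaI finite_lessThan finite_subset)
  have cov: "\<exists>c\<in>C. wt (sd c v) < d" if v: "v \<subseteq> ?U" for v
  proof (rule ccontr)
    assume no: "\<not> ?thesis"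
    have c0: "{} \<in> C" and cl: "\<And>a b. a \<in> C ==> b \<in> C ==> sd a b \<in> C" and cU: "\<And>a. a \<in> C ==> a \<subseteq> ?U"
      and cw: "\<And>a. a \<in> C ==> a ~= {} ==> d <= wt a" using C(1) unfolding lin_code_def by blast+
    have vC: "v \<notin> C"
    proof
      assume "v \<in> C"
      then show False using no d by (auto simp: wt_def)
    qed
    let ?C' = "C \<union> (%c. sd c v) ` C"
    have "lin_code D y d ?C'"
      unfolding lin_code_def
    proof (intro conjI ballI impI)
      show "?C' \<subseteq> Pow ?U" using cU v by blast
      show "{} \<in> ?C'" using c0 by simp
      fix a b assume "a \<in> ?C'" "b \<in> ?C'"
      then consider "a \<in> C" "b \<in> C" | a' where "a = sd a' v" "a' \<in> C" "b \<in> C" | b' where "a \<in> C" "b = sd b' v" "b' \<in> C"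
        | a' b' where "a = sd a' v" "b = sd b' v" "a' \<in> C" "b' \<in> C" by blast
      then show "sd a b \<in> ?C'"
      proof cases
        case 1
        then show ?thesis using cl by blast
      next
        case 2
        then have "sd a b = sd (sd a' b) v" by blast
        then show ?thesis using cl[OF 2(2,3)] by blast
      next
        case 3
        then have "sd a b = sd (sd a b') v" by blast
        then show ?thesis using cl[OF 3(1,3)] by blast
      next
        case 4
        then have "sd a b = sd a' b'" by blast
        then show ?thesis using cl[OF 4(3,4)] by simp
      qed
    next
      fix a assume "a \<in> ?C'" "a ~= {}"
      then show "d <= wt a" using cw no by (auto simp: not_less)
    qed
    moreover have "card C < card ?C'"
    proof (rule psubset_card_mono)
      have "v \<in> (%c. sd c v) ` C" using c0 by (intro image_eqI[of _ _ "{}"]) auto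
      then show "C \<subset> ?C'" using vC by blast
    qed (use finC in simp)
    ultimately show False using mx by fastforce
  qed
  let ?L = "{c \<in> Pow ?U. wt c < d}"
  have "Pow ?U \<subseteq> (%(c, l). sd c l) ` (C \<times> ?L)"
  proof
    fix v assume v: "v \<in> Pow ?U"
    then obtain c where c: "c \<in> C" "wt (sd c v) < d" using cov by auto
    then have "sd c v \<in> ?L" using v C(1) unfolding lin_code_def by blast
    moreover have "v = sd c (sd c v)" by (simp add: sd_self_assoc)
    ultimately show "v \<in> (%(c, l). sd c l) ` (C \<times> ?L)" using c(1)
      by (intro image_eqI[of _ _ "(c, sd c v)"]) (simp_all only: case_prod_conv mem_Sigma_iff)
  qed
  then have "card (Pow ?U) <= card (C \<times> ?L)"
    by (rule surj_card_le[rotated]) (use finC in \<open>auto intro: finite_subset\<close>)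
  also have "... = card C * card ?L" by (simp add: card_cartesian_product)
  also have "... <= card C * (2 ^ D * 2 ^ (y * (d - 1)))" by (intro mult_le_mono2 card_light[OF d])
  finally show ?thesis using C(1) by (auto simp: card_Pow card_cartesian_product mult.commute)
qed

text \<open>Two pairs with equal sum differ by one element that lies in both subgroups, so no fibre
  of the sum map is larger than \<open>A \<inter> B\<close>. Over the field with two elements this
  is the dimension formula.\<close>

lemma card_inter_subgroups:
  fixes A B G :: "'a set set"
  assumes fin: "finite G" and sub: "A \<subseteq> G" "B \<subseteq> G" and G: "\<And>a b. a \<in> G ==> b \<in> G ==> sd a b \<in> G"
    and A: "\<And>a b. a \<in> A ==> b \<in> A ==> sd a b \<in> A" and B: "\<And>a b. a \<in> B ==> b \<in> B ==> sd a b \<in> B"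
  shows "card A * card B <= card (A \<inter> B) * card G"
proof -
  let ?f = "%(a, b). sd a b"
  have finA: "finite A" "finite B" using fin sub by (auto intro: finite_subset)
  have "card A * card B = card (A \<times> B)" by (simp add: card_cartesian_product)
  also have "A \<times> B = (\<Union>g\<in>G. {p \<in> A \<times> B. ?f p = g})"
  proof
    show "A \<times> B \<subseteq> (\<Union>g\<in>G. {p \<in> A \<times> B. ?f p = g})"
    proof
      fix p assume p: "p \<in> A \<times> B"
      then have "?f p \<in> G" using G sub by auto
      then show "p \<in> (\<Union>g\<in>G. {p \<in> A \<times> B. ?f p = g})" using p by blast
    qed
  qed auto
  also have "card ... <= (\<Sum>g\<in>G. card {p \<in> A \<times> B. ?f p = g})" by (rule card_UN_le[OF fin])
  also have "... <= (\<Sum>g\<in>G. card (A \<inter> B))"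
  proof (rule sum_mono)
    fix g assume "g \<in> G"
    show "card {p \<in> A \<times> B. ?f p = g} <= card (A \<inter> B)"
    proof (cases "{p \<in> A \<times> B. ?f p = g} = {}")
      case False
      then obtain a0 b0 where 0: "a0 \<in> A" "b0 \<in> B" "sd a0 b0 = g" by auto
      show ?thesis
      proof (rule card_inj_on_le[where f = "%p. sd a0 (fst p)"])
        show "inj_on (%p. sd a0 (fst p)) {p \<in> A \<times> B. ?f p = g}"
        proof (rule inj_onI)
          fix p p' assume h: "p \<in> {p \<in> A \<times> B. ?f p = g}" "p' \<in> {p \<in> A \<times> B. ?f p = g}" "sd a0 (fst p) = sd a0 (fst p')"
          obtain a b a' b' where e: "p = (a, b)" "p' = (a', b')" by (cases p, cases p')
          have "a = a'" using h(3) sd_eq_iff[of a0 a a'] by (simp add: e)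
          moreover have "sd a b = sd a' b'" using h by (simp add: e)
          ultimately show "p = p'" using e sd_eq_iff[of a b b'] by simp
        qed
        show "(%p. sd a0 (fst p)) ` {p \<in> A \<times> B. ?f p = g} \<subseteq> A \<inter> B"
        proof
          fix z assume "z \<in> (%p. sd a0 (fst p)) ` {p \<in> A \<times> B. ?f p = g}"
          then obtain a b where ab: "a \<in> A" "b \<in> B" "sd a b = g" "z = sd a0 a" by auto
          have "z = sd b0 b" using ab(3,4) 0(3) by blast
          then have "z \<in> B" using B[OF 0(2) ab(2)] by (simp only:)
          moreover have "z \<in> A" using A[OF 0(1) ab(1)] ab(4) by (simp only:)
          ultimately show "z \<in> A \<inter> B" by (rule IntI[rotated])
        qed
      qed (use finA in simp)
    qed (simp only: card.empty)
  qed
  also have "... = card (A \<inter> B) * card G" by simp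
  finally show ?thesis .
qed

text \<open>
  Left symbols are indices \<open>c l < k\<close> of codewords, and so are the witnesses \<open>c' r\<close> on the right;
  the edge \<open>(l, w)\<close> carries the row \<open>w\<close> of both.
\<close>

definition tanner :: "nat => nat => (nat => nat => nat) => nat => (nat => nat => nat set) => (nat => nat) => (nat => nat) => bool" where
  "tanner n D nbf k psi c c' \<longleftrightarrow> (\<forall>l<n. c l < k) & (\<forall>r<n. c' r < k) &
     (\<forall>l<n. \<forall>w<D. psi (c l) w = psi (c' (nbf w l)) w)"

text \<open>The edge labellings whose left rows are codewords and those whose right rows are
  codewords are subgroups with at least \<open>k ^ n\<close> elements each, inside a group of order
  \<open>2 ^ (y * D * n)\<close>. This is the usual count of constraints of a Tanner code, with the
  code from \<open>gv_code\<close> on both sides.\<close>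

theorem tanner_code_exists:
  assumes d: "d > 0"
  shows "\<exists>k psi. 2 ^ (y * D) <= k * (2 ^ D * 2 ^ (y * (d - 1))) & k <= 2 ^ (y * D) &
    (\<forall>c<k. \<forall>c'<k. c ~= c' --> card {w. w < D & psi c w = psi c' w} + d <= D) &
    (\<forall>n nbf. (\<forall>w<D. bij_betw (nbf w) {..<n} {..<n}) -->
       k ^ (2 * n) <= card {c \<in> {..<n} \<rightarrow>\<^sub>E {..<k}. \<exists>c'. tanner n D nbf k psi c c'} * 2 ^ (y * D * n))"
proof -
  obtain C where C: "lin_code D y d C" "2 ^ (y * D) <= card C * (2 ^ D * 2 ^ (y * (d - 1)))"
    using gv_code[OF d] by blast
  have c0: "{} \<in> C" and cl: "\<And>a b. a \<in> C ==> b \<in> C ==> sd a b \<in> C" and cU: "\<And>a. a \<in> C ==> a \<subseteq> {..<D} \<times> {..<y}"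
      and cw: "\<And>a. a \<in> C ==> a ~= {} ==> d <= wt a" using C(1) unfolding lin_code_def by blast+
  have CP: "C \<subseteq> Pow ({..<D} \<times> {..<y})" using cU by blast
  then have finC: "finite C" by (rule finite_subset) simp
  obtain e where e: "bij_betw e {..<card C} C" using ex_bij_betw_nat_finite[OF finC] by (auto simp: atLeast0LessThan)
  define psi where "psi c w = {i. (w, i) \<in> e c}" for c w
  have eC: "e c \<in> C" if "c < card C" for c using e that by (auto simp: bij_betw_def)
  have inj: "e c = e c' \<longleftrightarrow> c = c'" if "c < card C" "c' < card C" for c c'
    using e that by (auto simp: bij_betw_def inj_on_def)
  have "card C <= card (Pow ({..<D} \<times> {..<y}))" using CP by (intro card_mono) auto
  then have k2: "card C <= 2 ^ (y * D)" by (simp add: card_Pow card_cartesian_product mult.commute)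
  have dist: "card {w. w < D & psi c w = psi c' w} + d <= D" if "c < card C" "c' < card C" "c ~= c'" for c c'
  proof -
    have "d <= wt (sd (e c) (e c'))" using that inj cl[OF eC eC] by (intro cw) auto
    also have "... <= card {w. w < D & psi c w ~= psi c' w}"
      unfolding wt_def using cU[OF eC[OF that(1)]] cU[OF eC[OF that(2)]]
      by (intro card_mono) (force simp: psi_def)+
    finally have "card {w. w < D & psi c w = psi c' w} + d <=
       card {w. w < D & psi c w = psi c' w} + card {w. w < D & psi c w ~= psi c' w}" by simp
    also have "... = card ({w. w < D & psi c w = psi c' w} \<union> {w. w < D & psi c w ~= psi c' w})"
      by (rule card_Un_disjoint[symmetric]) auto
    also have "... = card {..<D}" by (rule arg_cong[where f = card]) auto
    finally show ?thesis by simp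
  qed
  have big: "card C ^ (2 * n) <= card {c \<in> {..<n} \<rightarrow>\<^sub>E {..<card C}. \<exists>c'. tanner n D nbf (card C) psi c c'} * 2 ^ (y * D * n)"
    if nb: "\<forall>w<D. bij_betw (nbf w) {..<n} {..<n}" for n :: nat and nbf
  proof -
    let ?G = "Pow ({..<n} \<times> {..<D} \<times> {..<y})"
    define ls where "ls X l = {(w, i). (l, w, i) \<in> X}" for X :: "(nat \<times> nat \<times> nat) set" and l
    define rs where "rs X r = {(w, i). \<exists>l<n. nbf w l = r & w < D & (l, w, i) \<in> X}" for X :: "(nat \<times> nat \<times> nat) set" and r
    define LL where "LL = {X \<in> ?G. \<forall>l<n. ls X l \<in> C}"
    define RR where "RR = {X \<in> ?G. \<forall>r<n. rs X r \<in> C}"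
    have ninj: "l = l'" if "w < D" "l < n" "l' < n" "nbf w l = nbf w l'" for w l l'
      using nb that by (auto simp: bij_betw_def inj_on_def)
    have nsurj: "\<exists>l<n. nbf w l = r" if "w < D" "r < n" for w r
    proof -
      have "r \<in> nbf w ` {..<n}" using nb that by (simp add: bij_betw_def)
      then show ?thesis by auto
    qed
    have nless: "nbf w l < n" if "w < D" "l < n" for w l using nb that by (auto simp: bij_betw_def)
    have LLcl: "sd a b \<in> LL" if "a \<in> LL" "b \<in> LL" for a b
    proof -
      have "ls (sd a b) l = sd (ls a l) (ls b l)" for l by (auto simp: ls_def)
      then show ?thesis using that cl by (auto simp: LL_def)
    qed
    have RRcl: "sd a b \<in> RR" if "a \<in> RR" "b \<in> RR" for a b
    proof -
      have "rs (sd a b) r = sd (rs a r) (rs b r)" for r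
        unfolding rs_def using ninj by (auto; metis)
      then show ?thesis using that cl by (auto simp: RR_def)
    qed
    have "card C ^ n = card ({..<n} \<rightarrow>\<^sub>E C)" by (simp add: card_PiE)
    also have "... <= card LL"
    proof (rule card_inj_on_le[where f = "%f. {(l, w, i). l < n & (w, i) \<in> f l}"])
      show "inj_on (%f. {(l, w, i). l < n & (w, i) \<in> f l}) ({..<n} \<rightarrow>\<^sub>E C)"
      proof (rule inj_onI)
        fix f g assume fg: "f \<in> {..<n} \<rightarrow>\<^sub>E C" "g \<in> {..<n} \<rightarrow>\<^sub>E C"
          and eq: "{(l, w, i). l < n & (w, i) \<in> f l} = {(l, w, i). l < n & (w, i) \<in> g l}"
        show "f = g"
        proof (rule PiE_ext[OF fg])
          fix l assume "l \<in> {..<n}"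
          then have "p \<in> f l \<longleftrightarrow> p \<in> g l" for p using eq by (cases p) auto
          then show "f l = g l" by blast
        qed
      qed
      show "(%f. {(l, w, i). l < n & (w, i) \<in> f l}) ` ({..<n} \<rightarrow>\<^sub>E C) \<subseteq> LL"
      proof
        fix X assume "X \<in> (%f. {(l, w, i). l < n & (w, i) \<in> f l}) ` ({..<n} \<rightarrow>\<^sub>E C)"
        then obtain f where f: "f \<in> {..<n} \<rightarrow>\<^sub>E C" "X = {(l, w, i). l < n & (w, i) \<in> f l}" by auto
        have fl: "f l \<in> C" if "l < n" for l using f(1) that by auto
        have "X \<in> ?G" using f(2) fl cU by fastforce
        moreover have "ls X l = f l" if "l < n" for l using that by (auto simp: ls_def f(2))
        ultimately show "X \<in> LL" using fl by (simp add: LL_def)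
      qed
    qed (simp add: LL_def)
    finally have cL: "card C ^ n <= card LL" .
    have "card C ^ n = card ({..<n} \<rightarrow>\<^sub>E C)" by (simp add: card_PiE)
    also have "... <= card RR"
    proof (rule card_inj_on_le[where f = "%f. {(l, w, i). l < n & w < D & (w, i) \<in> f (nbf w l)}"])
      show "inj_on (%f. {(l, w, i). l < n & w < D & (w, i) \<in> f (nbf w l)}) ({..<n} \<rightarrow>\<^sub>E C)"
      proof (rule inj_onI)
        fix f g assume fg: "f \<in> {..<n} \<rightarrow>\<^sub>E C" "g \<in> {..<n} \<rightarrow>\<^sub>E C"
          and eq: "{(l, w, i). l < n & w < D & (w, i) \<in> f (nbf w l)} = {(l, w, i). l < n & w < D & (w, i) \<in> g (nbf w l)}"
        show "f = g"
        proof (rule PiE_ext[OF fg])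
          fix r assume r: "r \<in> {..<n}"
          have "(w, i) \<in> f r \<longleftrightarrow> (w, i) \<in> g r" for w i
          proof (cases "w < D")
            case True
            then obtain l where l: "l < n" "nbf w l = r" using nsurj r by auto
            have "(l, w, i) \<in> {(l, w, i). l < n & w < D & (w, i) \<in> f (nbf w l)} \<longleftrightarrow>
               (l, w, i) \<in> {(l, w, i). l < n & w < D & (w, i) \<in> g (nbf w l)}" by (simp only: eq)
            then show ?thesis using l True by simp
          next
            case False
            have "f r \<subseteq> {..<D} \<times> {..<y}" "g r \<subseteq> {..<D} \<times> {..<y}" using fg r cU by auto
            then show ?thesis using False by auto
          qed
          then show "f r = g r" by auto
        qed
      qed
      show "(%f. {(l, w, i). l < n & w < D & (w, i) \<in> f (nbf w l)}) ` ({..<n} \<rightarrow>\<^sub>E C) \<subseteq> RR"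
      proof
        fix X assume "X \<in> (%f. {(l, w, i). l < n & w < D & (w, i) \<in> f (nbf w l)}) ` ({..<n} \<rightarrow>\<^sub>E C)"
        then obtain f where f: "f \<in> {..<n} \<rightarrow>\<^sub>E C" "X = {(l, w, i). l < n & w < D & (w, i) \<in> f (nbf w l)}" by auto
        have fl: "f l \<in> C" if "l < n" for l using f(1) that by auto
        have "X \<in> ?G" using f(2) fl[OF nless] cU by fastforce
        moreover have "rs X r = f r" if rn: "r < n" for r
        proof
          show "rs X r \<subseteq> f r" by (auto simp: rs_def f(2))
          show "f r \<subseteq> rs X r"
          proof
            fix p assume p: "p \<in> f r"
            then obtain w i where wi: "p = (w, i)" "w < D" using cU[OF fl[OF rn]] by auto
            then obtain l where "l < n" "nbf w l = r" using nsurj rn by blast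
            then show "p \<in> rs X r" using p wi by (auto simp: rs_def f(2))
          qed
        qed
        ultimately show "X \<in> RR" using fl by (simp add: RR_def)
      qed
    qed (simp add: RR_def)
    finally have cR: "card C ^ n <= card RR" .
    have "card C ^ (2 * n) = card C ^ n * card C ^ n" by (simp add: power_add mult_2)
    also have "... <= card LL * card RR" using cL cR by (rule mult_le_mono)
    also have "... <= card (LL \<inter> RR) * card ?G"
      by (rule card_inter_subgroups[OF _ _ _ _ LLcl RRcl]) (auto simp: LL_def RR_def)
    also have "card ?G = 2 ^ (y * D * n)" by (simp add: card_Pow card_cartesian_product mult_ac)
    also have "card (LL \<inter> RR) <= card {c \<in> {..<n} \<rightarrow>\<^sub>E {..<card C}. \<exists>c'. tanner n D nbf (card C) psi c c'}"
    proof (rule card_inj_on_le[where f = "%X. \<lambda>l\<in>{..<n}. inv_into {..<card C} e (ls X l)"])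
      have einv: "e (inv_into {..<card C} e a) = a & inv_into {..<card C} e a < card C" if "a \<in> C" for a
        using e that by (metis bij_betw_def f_inv_into_f inv_into_into lessThan_iff)
      show "inj_on (%X. \<lambda>l\<in>{..<n}. inv_into {..<card C} e (ls X l)) (LL \<inter> RR)"
      proof (rule inj_onI)
        fix X Y assume X: "X \<in> LL \<inter> RR" and Y: "Y \<in> LL \<inter> RR"
          and eq: "(\<lambda>l\<in>{..<n}. inv_into {..<card C} e (ls X l)) = (\<lambda>l\<in>{..<n}. inv_into {..<card C} e (ls Y l))"
        have "ls X l = ls Y l" if "l < n" for l
        proof -
          have "inv_into {..<card C} e (ls X l) = inv_into {..<card C} e (ls Y l)"
            using fun_cong[OF eq, of l] that by simp
          moreover have "ls X l \<in> C" "ls Y l \<in> C" using X Y that by (auto simp: LL_def)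
          ultimately show ?thesis using einv by metis
        qed
        then have "(l, w, i) \<in> X \<longleftrightarrow> (l, w, i) \<in> Y" if "l < n" for l w i using that by (auto simp: ls_def)
        moreover have "X \<subseteq> {..<n} \<times> UNIV" "Y \<subseteq> {..<n} \<times> UNIV" using X Y by (auto simp: LL_def)
        ultimately show "X = Y" by auto
      qed
      show "(%X. \<lambda>l\<in>{..<n}. inv_into {..<card C} e (ls X l)) ` (LL \<inter> RR) \<subseteq>
         {c \<in> {..<n} \<rightarrow>\<^sub>E {..<card C}. \<exists>c'. tanner n D nbf (card C) psi c c'}"
      proof
        fix c assume "c \<in> (%X. \<lambda>l\<in>{..<n}. inv_into {..<card C} e (ls X l)) ` (LL \<inter> RR)"
        then obtain X where X: "X \<in> LL" "X \<in> RR" "c = (\<lambda>l\<in>{..<n}. inv_into {..<card C} e (ls X l))" by auto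
        have lC: "ls X l \<in> C" if "l < n" for l using X that by (auto simp: LL_def)
        have rC: "rs X r \<in> C" if "r < n" for r using X that by (auto simp: RR_def)
        let ?c' = "%r. inv_into {..<card C} e (rs X r)"
        have "tanner n D nbf (card C) psi c ?c'"
          unfolding tanner_def
        proof (intro conjI allI impI)
          fix l w assume l: "l < n" "w < D"
          have "psi (c l) w = {i. (w, i) \<in> ls X l}" using einv[OF lC[OF l(1)]] X(3) l by (simp add: psi_def)
          also have "... = {i. (w, i) \<in> rs X (nbf w l)}" using l ninj by (auto simp: ls_def rs_def)
          also have "... = psi (?c' (nbf w l)) w" using einv[OF rC[OF nless[OF l(2,1)]]] by (simp add: psi_def)
          finally show "psi (c l) w = psi (?c' (nbf w l)) w" .
        qed (use einv lC rC X(3) in auto)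
        moreover have "c \<in> {..<n} \<rightarrow>\<^sub>E {..<card C}" using einv lC X(3) by auto
        ultimately show "c \<in> {c \<in> {..<n} \<rightarrow>\<^sub>E {..<card C}. \<exists>c'. tanner n D nbf (card C) psi c c'}" by blast
      qed
      show "finite {c \<in> {..<n} \<rightarrow>\<^sub>E {..<card C}. \<exists>c'. tanner n D nbf (card C) psi c c'}"
        by (rule finite_subset[of _ "{..<n} \<rightarrow>\<^sub>E {..<card C}"]) (auto intro: finite_PiE)
    qed
    finally show ?thesis by (simp add: mult_le_mono1)
  qed
  show ?thesis using C(2) k2 dist big by (intro exI[of _ "card C"] exI[of _ psi]) auto
qed

section \<open>Inner codes with small lists\<close>

definition dig :: "nat => nat => nat => nat" where
  "dig Q u w = u div Q ^ w mod Q"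

definition agr :: "nat => nat => nat => nat => nat" where
  "agr D Q u v = card {w. w < D & dig Q u w = dig Q v w}"

lemma dig_0: "dig Q u 0 = u mod Q" by (simp add: dig_def)
lemma dig_Suc: "dig Q u (Suc w) = dig Q (u div Q) w" by (simp add: dig_def div_mult2_eq)

lemma dig_inj: "u < Q ^ D ==> v < Q ^ D ==> (\<And>w. w < D ==> dig Q u w = dig Q v w) ==> u = v"
proof (induction D arbitrary: u v)
  case (Suc D)
  have "u div Q = v div Q"
    by (rule Suc.IH) (use Suc.prems in \<open>auto simp: dig_Suc[symmetric] less_mult_imp_div_less mult.commute\<close>)
  moreover have "u mod Q = v mod Q" using Suc.prems(3)[of 0] by (simp add: dig_0)
  ultimately show ?case by (metis div_mult_mod_eq)
qed simp

lemma dig_less: "Q > 0 ==> dig Q u w < Q" by (simp add: dig_def)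

lemma dig_surj:
  assumes "\<And>w. w < D ==> a w < Q" shows "\<exists>u<Q ^ D. \<forall>w<D. dig Q u w = a w"
  using assms
proof (induction D arbitrary: a)
  case (Suc D)
  from Suc.IH[of "%w. a (Suc w)"] Suc.prems obtain u where u: "u < Q ^ D" "\<forall>w<D. dig Q u w = a (Suc w)" by auto
  have a0: "a 0 < Q" using Suc.prems by simp
  let ?u = "u * Q + a 0"
  have "?u < Suc u * Q" using a0 by simp
  also have "... <= Q ^ D * Q" using u(1) by (intro mult_le_mono1) simp
  finally have "?u < Q ^ Suc D" by (simp add: mult.commute)
  moreover have "dig Q ?u w = a w" if "w < Suc D" for w
    using that u(2) a0 by (cases w) (auto simp: dig_0 dig_Suc)
  ultimately show ?case by blast
qed simp

lemma agr_self: "agr D Q u u = D" by (simp add: agr_def)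

text \<open>Union bound over the agreement sets: there are at most \<open>2 ^ D\<close>, and fixing
  \<open>t\<close> digits leaves \<open>D - t\<close> free ones.\<close>

lemma card_agr:
  assumes Q: "Q > 0"
  shows "card {u. u < Q ^ D & t <= agr D Q u v} <= 2 ^ D * Q ^ (D - t)"
proof -
  let ?W = "{W. W \<subseteq> {..<D} & t <= card W}"
  let ?F = "%W. {u. u < Q ^ D & (\<forall>w\<in>W. dig Q u w = dig Q v w)}"
  have finW: "finite ?W" by (rule finite_subset[of _ "Pow {..<D}"]) auto
  have "{u. u < Q ^ D & t <= agr D Q u v} \<subseteq> (\<Union>W\<in>?W. ?F W)"
  proof
    fix u assume u: "u \<in> {u. u < Q ^ D & t <= agr D Q u v}"
    then have "{w. w < D & dig Q u w = dig Q v w} \<in> ?W" by (auto simp: agr_def)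
    moreover have "u \<in> ?F {w. w < D & dig Q u w = dig Q v w}" using u by simp
    ultimately show "u \<in> (\<Union>W\<in>?W. ?F W)" by blast
  qed
  then have "card {u. u < Q ^ D & t <= agr D Q u v} <= card (\<Union>W\<in>?W. ?F W)"
    by (intro card_mono) (use finW in auto)
  also have "... <= (\<Sum>W\<in>?W. card (?F W))" by (rule card_UN_le[OF finW])
  also have "... <= (\<Sum>W\<in>?W. Q ^ (D - t))"
  proof (rule sum_mono)
    fix W assume W: "W \<in> ?W"
    have "card (?F W) <= card (({..<D} - W) \<rightarrow>\<^sub>E {..<Q})"
    proof (rule card_inj_on_le[where f = "%u. \<lambda>w\<in>{..<D} - W. dig Q u w"])
      show "inj_on (%u. \<lambda>w\<in>{..<D} - W. dig Q u w) (?F W)"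
      proof (rule inj_onI)
        fix u u' assume h: "u \<in> ?F W" "u' \<in> ?F W" "(\<lambda>w\<in>{..<D} - W. dig Q u w) = (\<lambda>w\<in>{..<D} - W. dig Q u' w)"
        show "u = u'"
        proof (rule dig_inj[of _ Q D])
          fix w assume "w < D"
          then show "dig Q u w = dig Q u' w" using h(1,2) fun_cong[OF h(3), of w] by (cases "w \<in> W") simp_all
        qed (use h in auto)
      qed
    qed (auto simp: dig_less[OF Q] PiE_iff extensional_def intro: finite_PiE split: if_splits)
    also have "... = Q ^ (D - card W)"
    proof -
      have "finite W" using W by (auto intro: finite_subset)
      then have "card ({..<D} - W) = D - card W" using W by (subst card_Diff_subset) auto
      then show ?thesis by (simp add: card_PiE)
    qed
    also have "... <= Q ^ (D - t)" using W Q by (intro power_increasing) auto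
    finally show "card (?F W) <= Q ^ (D - t)" .
  qed
  also have "... = card ?W * Q ^ (D - t)" by simp
  also have "card ?W <= card (Pow {..<D})" by (intro card_mono) auto
  also have "card (Pow {..<D}) = 2 ^ D" by (simp add: card_Pow)
  finally show ?thesis by simp
qed

lemma card_PiE_constrained:
  assumes S: "S \<subseteq> {..<M}" and B: "finite B"
  shows "card {f \<in> {..<M} \<rightarrow>\<^sub>E A. \<forall>c\<in>S. f c \<in> B} <= card B ^ card S * card A ^ (M - card S)"
proof -
  have "{f \<in> {..<M} \<rightarrow>\<^sub>E A. \<forall>c\<in>S. f c \<in> B} = Pi\<^sub>E {..<M} (%c. if c \<in> S then A \<inter> B else A)"
    using S by (auto simp: PiE_iff extensional_def split: if_splits)
  then have "card {f \<in> {..<M} \<rightarrow>\<^sub>E A. \<forall>c\<in>S. f c \<in> B} = (\<Prod>c<M. if c \<in> S then card (A \<inter> B) else card A)"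
    by (simp add: card_PiE if_distrib[of card] cong: if_cong)
  also have "... = card (A \<inter> B) ^ card S * card A ^ (M - card S)"
  proof -
    have "{..<M} \<inter> {c. c \<in> S} = S" "{..<M} \<inter> - {c. c \<in> S} = {..<M} - S" using S by auto
    then show ?thesis using S by (simp add: prod.If_cases card_Diff_subset finite_subset)
  qed
  also have "... <= card B ^ card S * card A ^ (M - card S)"
    using B by (intro mult_le_mono1 power_mono card_mono) auto
  finally show ?thesis .
qed

text \<open>Random coding with expurgation, by counting maps from \<open>M\<close> indices to words:
  at most a quarter of them put \<open>Suc K\<close> indices into one ball, at most a quarter have
  many close pairs. In a map outside both sets fewer than half of the indices have a close partner,
  and deleting those leaves \<open>k\<close> of them.\<close>

theorem inner_code_exists:
  assumes Q: "Q > 0" and M: "M > 0"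
    and c1: "8 * (M * (2 ^ D * Q ^ (D - t))) <= Q ^ D"
    and c2: "4 * (Q ^ D * (M * (2 ^ D * Q ^ (D - t))) ^ Suc K) <= (Q ^ D) ^ Suc K"
    and k: "2 * k <= M"
  shows "\<exists>phx. (\<forall>c<k. phx c < Q ^ D) & (\<forall>c<k. \<forall>c'<k. c ~= c' --> agr D Q (phx c) (phx c') < t) &
     (\<forall>u. card {c. c < k & t <= agr D Q (phx c) u} <= K)"
proof -
  define q where "q = Q ^ D"
  define B where "B = 2 ^ D * Q ^ (D - t)"
  have q0: "q > 0" using Q by (simp add: q_def)
  let ?A = "{..<q}"
  let ?F = "{..<M} \<rightarrow>\<^sub>E ?A"
  let ?ball = "%v. {u. u < q & t <= agr D Q u v}"
  have ball: "card (?ball v) <= B" for v using card_agr[OF Q] by (simp add: q_def B_def)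
  have finF: "finite ?F" by (intro finite_PiE) auto
  have cF: "card ?F = q ^ M" by (simp add: card_PiE)
  define SS where "SS = {S. S \<subseteq> {..<M} & card S = Suc K}"
  define Bad1 where "Bad1 = (\<Union>u<q. \<Union>S\<in>SS. {f \<in> ?F. \<forall>c\<in>S. f c \<in> ?ball u})"
  have finSS: "finite SS" unfolding SS_def by (rule finite_subset[of _ "Pow {..<M}"]) auto
  have cSS: "card SS <= M ^ Suc K"
  proof -
    have "card SS = M choose Suc K" unfolding SS_def using n_subsets[of "{..<M}" "Suc K"] by simp
    also have "... <= M ^ Suc K" by (cases "Suc K <= M") (auto intro: binomial_le_pow simp: binomial_eq_0 simp del: power_Suc)
    finally show ?thesis .
  qed
  have "card Bad1 <= (\<Sum>u<q. \<Sum>S\<in>SS. card {f \<in> ?F. \<forall>c\<in>S. f c \<in> ?ball u})"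
    unfolding Bad1_def by (rule order_trans[OF card_UN_le]) (auto intro!: sum_mono card_UN_le finSS)
  also have "... <= (\<Sum>u<q. \<Sum>S\<in>SS. B ^ Suc K * q ^ (M - Suc K))"
  proof (intro sum_mono)
    fix u S assume S: "S \<in> SS"
    have "card {f \<in> ?F. \<forall>c\<in>S. f c \<in> ?ball u} <= card (?ball u) ^ card S * card ?A ^ (M - card S)"
      by (rule card_PiE_constrained) (use S in \<open>auto simp: SS_def\<close>)
    also have "... <= B ^ Suc K * q ^ (M - Suc K)" using S ball by (auto simp: SS_def simp del: power_Suc intro!: mult_le_mono1 power_mono)
    finally show "card {f \<in> ?F. \<forall>c\<in>S. f c \<in> ?ball u} <= B ^ Suc K * q ^ (M - Suc K)" .
  qed
  also have "... = q * (card SS * (B ^ Suc K * q ^ (M - Suc K)))" by simp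
  finally have b1: "card Bad1 <= q * (card SS * (B ^ Suc K * q ^ (M - Suc K)))" .
  have bad1: "4 * card Bad1 <= q ^ M"
  proof (cases "Suc K <= M")
    case True
    have "4 * card Bad1 <= 4 * (q * (M ^ Suc K * (B ^ Suc K * q ^ (M - Suc K))))"
      by (rule mult_le_mono2, rule order_trans[OF b1], intro mult_le_mono2 mult_le_mono1 cSS)
    also have "... = 4 * (q * (M * B) ^ Suc K) * q ^ (M - Suc K)" by (simp add: power_mult_distrib mult_ac)
    also have "... <= q ^ Suc K * q ^ (M - Suc K)" using c2 by (intro mult_le_mono1) (simp add: q_def B_def)
    also have "... = q ^ M" using True by (metis le_add_diff_inverse power_add)
    finally show ?thesis .
  next
    case False
    have "card S <= M" if "S \<subseteq> {..<M}" for S using card_mono[OF _ that] by simp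
    then have "SS = {}" using False unfolding SS_def by (metis (mono_tags, lifting) Collect_empty_eq)
    then show ?thesis by (simp add: Bad1_def)
  qed
  define P where "P = {(c, c'). c < M & c' < M & c ~= c'}"
  have finP: "finite P" unfolding P_def by (rule finite_subset[of _ "{..<M} \<times> {..<M}"]) auto
  have cP: "card P <= M * M"
    using card_mono[of "{..<M} \<times> {..<M}" P] by (auto simp: P_def card_cartesian_product)
  define X where "X f = card {p \<in> P. t <= agr D Q (f (fst p)) (f (snd p))}" for f
  have pair: "card {f \<in> ?F. t <= agr D Q (f c) (f c')} <= B * q ^ (M - 1)" if c: "(c, c') \<in> P" for c c'
  proof -
    let ?F' = "({..<M} - {c}) \<rightarrow>\<^sub>E ?A"
    have "card {f \<in> ?F. t <= agr D Q (f c) (f c')} <= card (SIGMA g:?F'. ?ball (g c'))"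
    proof (rule card_inj_on_le[where f = "%f. (restrict f ({..<M} - {c}), f c)"])
      show "inj_on (%f. (restrict f ({..<M} - {c}), f c)) {f \<in> ?F. t <= agr D Q (f c) (f c')}"
      proof (rule inj_onI)
        fix f g assume h: "f \<in> {f \<in> ?F. t <= agr D Q (f c) (f c')}" "g \<in> {f \<in> ?F. t <= agr D Q (f c) (f c')}"
          "(restrict f ({..<M} - {c}), f c) = (restrict g ({..<M} - {c}), g c)"
        show "f = g"
        proof (rule PiE_ext[of f "{..<M}" "%_. ?A" g])
          fix x assume x: "x \<in> {..<M}"
          have e: "restrict f ({..<M} - {c}) = restrict g ({..<M} - {c})" "f c = g c" using h(3) by simp_all
          show "f x = g x" using e(2) fun_cong[OF e(1), of x] x by (cases "x = c") simp_all
        qed (use h(1,2) in simp_all)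
      qed
      show "(%f. (restrict f ({..<M} - {c}), f c)) ` {f \<in> ?F. t <= agr D Q (f c) (f c')} \<subseteq> (SIGMA g:?F'. ?ball (g c'))"
      proof (rule image_subsetI)
        fix f assume f: "f \<in> {f \<in> ?F. t <= agr D Q (f c) (f c')}"
        then have "restrict f ({..<M} - {c}) \<in> ?F'" by (simp add: restrict_PiE_iff PiE_iff)
        moreover have "restrict f ({..<M} - {c}) c' = f c'" using c by (simp add: P_def)
        moreover have "f c < q" using f c by (auto simp: P_def PiE_iff)
        ultimately show "(restrict f ({..<M} - {c}), f c) \<in> (SIGMA g:?F'. ?ball (g c'))" using f by simp
      qed
      show "finite (SIGMA g:?F'. ?ball (g c'))" by (intro finite_SigmaI finite_PiE) auto
    qed
    also have "... = (\<Sum>g\<in>?F'. card (?ball (g c')))" by (intro card_SigmaI finite_PiE) auto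
    also have "... <= (\<Sum>g\<in>?F'. B)" by (intro sum_mono ball)
    also have "... = B * q ^ (M - 1)" using c by (simp add: card_PiE P_def)
    finally show ?thesis .
  qed
  have "(\<Sum>f\<in>?F. X f) = (\<Sum>f\<in>?F. \<Sum>p\<in>P. if t <= agr D Q (f (fst p)) (f (snd p)) then 1 else 0)"
    unfolding X_def by (intro sum.cong refl) (simp only: card_eq_sum sum.inter_filter[OF finP])
  also have "... = (\<Sum>p\<in>P. card {f \<in> ?F. t <= agr D Q (f (fst p)) (f (snd p))})"
    by (subst sum.swap) (intro sum.cong refl, simp only: card_eq_sum sum.inter_filter[OF finF])
  also have "... <= (\<Sum>p\<in>P. B * q ^ (M - 1))" using pair by (intro sum_mono) auto
  also have "... <= M * M * (B * q ^ (M - 1))" using cP by simp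
  finally have sX: "(\<Sum>f\<in>?F. X f) <= M * M * (B * q ^ (M - 1))" .
  \<comment> \<open>Markov's inequality for the number of close pairs.\<close>
  define Bad2 where "Bad2 = {f \<in> ?F. M <= 2 * X f}"
  have "M * card Bad2 = (\<Sum>f\<in>Bad2. M)" by simp
  also have "... <= (\<Sum>f\<in>Bad2. 2 * X f)" by (intro sum_mono) (auto simp: Bad2_def)
  also have "... <= (\<Sum>f\<in>?F. 2 * X f)" using finF by (intro sum_mono2) (auto simp: Bad2_def)
  also have "... <= 2 * (M * M * (B * q ^ (M - 1)))" using sX by (simp add: sum_distrib_left[symmetric])
  finally have "M * (4 * card Bad2) <= M * (8 * (M * B) * q ^ (M - 1))" by (simp add: mult_ac)
  then have "4 * card Bad2 <= 8 * (M * B) * q ^ (M - 1)" using M by simp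
  also have "... <= q * q ^ (M - 1)" using c1 by (intro mult_le_mono1) (simp add: q_def B_def)
  also have "... = q ^ M" using M by (cases M) auto
  finally have bad2: "4 * card Bad2 <= q ^ M" .
  have "card (Bad1 \<union> Bad2) <= card Bad1 + card Bad2" by (rule card_Un_le)
  moreover have "q ^ M > 0" using q0 by simp
  ultimately have "card (Bad1 \<union> Bad2) < card ?F" using bad1 bad2 cF by linarith
  moreover have "Bad1 \<union> Bad2 \<subseteq> ?F" by (auto simp: Bad1_def Bad2_def)
  ultimately have "\<not> ?F \<subseteq> Bad1 \<union> Bad2"
    using card_mono[OF finite_subset[OF _ finF], of "Bad1 \<union> Bad2" ?F] by auto
  then obtain f where f: "f \<in> ?F" "f \<notin> Bad1" "f \<notin> Bad2" by blast
  have fq: "f c < q" if "c < M" for c using f(1) that by auto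
  define bad where "bad = {c. c < M & (\<exists>c'<M. c ~= c' & t <= agr D Q (f c) (f c'))}"
  have "card bad <= X f"
    unfolding X_def
  proof (rule surj_card_le[where f = fst])
    show "bad \<subseteq> fst ` {p \<in> P. t <= agr D Q (f (fst p)) (f (snd p))}"
      by (force simp: bad_def P_def)
  qed (use finP in simp)
  then have "2 * card bad < M" using f by (auto simp: Bad2_def)
  moreover have "card ({..<M} - bad) = M - card bad" by (subst card_Diff_subset) (auto simp: bad_def)
  ultimately have "k <= card ({..<M} - bad)" using k by linarith
  then obtain g where g: "bij_betw g {..<card ({..<M} - bad)} ({..<M} - bad)"
    using ex_bij_betw_nat_finite[of "{..<M} - bad"] by (auto simp: atLeast0LessThan)
  have gM: "g c < M & g c \<notin> bad" if "c < k" for c using g that \<open>k <= card ({..<M} - bad)\<close> by (auto simp: bij_betw_def)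
  have ginj: "inj_on g {..<k}" using g \<open>k <= card ({..<M} - bad)\<close> by (auto simp: bij_betw_def intro: inj_on_subset)
  show ?thesis
  proof (intro exI[of _ "%c. f (g c)"] conjI allI impI)
    fix c assume "c < k"
    then show "f (g c) < Q ^ D" using fq gM by (simp add: q_def)
  next
    fix c c' assume c: "c < k" "c' < k" "c ~= c'"
    then have "g c ~= g c'" using ginj by (auto simp: inj_on_def)
    then show "agr D Q (f (g c)) (f (g c')) < t" using gM[OF c(1)] gM[OF c(2)] by (auto simp: bad_def not_le)
  next
    fix u
    show "card {c. c < k & t <= agr D Q (f (g c)) u} <= K"
    proof (rule ccontr)
      assume "\<not> ?thesis"
      then have "Suc K <= card {c. c < k & t <= agr D Q (f (g c)) u}" by simp
      then obtain T where T: "T \<subseteq> {c. c < k & t <= agr D Q (f (g c)) u}" "card T = Suc K"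
        by (meson obtain_subset_with_card_n)
      have "g ` T \<in> SS" using T gM card_image[OF inj_on_subset[OF ginj, of T]] by (auto simp: SS_def)
      \<comment> \<open>An arbitrary \<open>u\<close> has the same digits as some
        \<open>v < Q ^ D\<close>, and agreement depends on these digits only.\<close>
      moreover obtain v where v: "v < Q ^ D" "\<forall>w<D. dig Q v w = dig Q u w"
        using dig_surj[of D "dig Q u" Q] dig_less[OF Q] by blast
      have "agr D Q x v = agr D Q x u" for x unfolding agr_def using v(2) by (intro arg_cong[where f = card]) auto
      then have "\<forall>c\<in>g ` T. f c \<in> ?ball v" using T gM fq by auto
      ultimately have "f \<in> Bad1" unfolding Bad1_def using f(1) v(1)
        by (intro UN_I[of v] UN_I[of "g ` T"]) (auto simp: q_def)
      then show False using f(2) by simp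
    qed
  qed
qed

section \<open>A language with bounded sums and its compilation\<close>

type_synonym store = "nat => nat => nat"

text \<open>The bounded sum is the only iteration inside expressions; products, quotients and table
  lookups are derived from it, as the machine merely adds and subtracts. Variables are read-only
  outside loops, arrays form the store.\<close>

datatype ex =
    Num nat
  | Var nat
  | Inp ex
  | Rd nat ex
  | Plus ex ex
  | Minus ex ex
  | Summ nat ex ex

datatype cm =
    Wr nat ex ex
  | Sq cm cm
  | Fr nat ex cm

text \<open>
  All loops are clamped to \<open>X\<close> rounds, so that running time is bounded by the nesting depth alone,
  independently of what a program computes.
\<close>

primrec ev :: "nat => (nat => nat) => ex => (nat => nat) => store => nat" where
  "ev X y (Num c) et sg = c"
| "ev X y (Var v) et sg = et v"
| "ev X y (Inp e) et sg = (if ev X y e et sg < X then y (ev X y e et sg) else 0)"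
| "ev X y (Rd a e) et sg = sg a (ev X y e et sg)"
| "ev X y (Plus e f) et sg = ev X y e et sg + ev X y f et sg"
| "ev X y (Minus e f) et sg = ev X y e et sg - ev X y f et sg"
| "ev X y (Summ v e f) et sg = (\<Sum>i<min X (ev X y e et sg). ev X y f (et(v := i)) sg)"

primrec run :: "nat => (nat => nat) => cm => (nat => nat) => store => store" where
  "run X y (Wr a e f) et sg = sg(a := (sg a)(ev X y e et sg := ev X y f et sg))"
| "run X y (Sq c d) et sg = run X y d et (run X y c et sg)"
| "run X y (Fr v e c) et sg = fold (%i. run X y c (et(v := i))) [0..<min X (ev X y e et sg)] sg"

primrec rds :: "ex => nat set" where
  "rds (Num c) = {}"
| "rds (Var v) = {}"
| "rds (Inp e) = rds e"
| "rds (Rd a e) = insert a (rds e)"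
| "rds (Plus e f) = rds e \<union> rds f"
| "rds (Minus e f) = rds e \<union> rds f"
| "rds (Summ v e f) = rds e \<union> rds f"

primrec wrs :: "cm => nat set" where
  "wrs (Wr a e f) = {a}"
| "wrs (Sq c d) = wrs c \<union> wrs d"
| "wrs (Fr v e c) = wrs c"

primrec arrs :: "cm => nat set" where
  "arrs (Wr a e f) = insert a (rds e \<union> rds f)"
| "arrs (Sq c d) = arrs c \<union> arrs d"
| "arrs (Fr v e c) = rds e \<union> arrs c"

primrec dpe :: "ex => nat" where
  "dpe (Num c) = 0"
| "dpe (Var v) = 0"
| "dpe (Inp e) = dpe e"
| "dpe (Rd a e) = dpe e"
| "dpe (Plus e f) = max (dpe e) (dpe f)"
| "dpe (Minus e f) = max (dpe e) (dpe f)"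
| "dpe (Summ v e f) = max (dpe e) (Suc (dpe f))"

primrec dpc :: "cm => nat" where
  "dpc (Wr a e f) = max (dpe e) (dpe f)"
| "dpc (Sq c d) = max (dpc c) (dpc d)"
| "dpc (Fr v e c) = max (dpe e) (Suc (dpc c))"

text \<open>Odd registers from 3 on hold variables, even ones from 4 on temporaries. Registers 0 to
  2 are left for the output length, the block length and the constant 1.\<close>

definition vr :: "nat => nat" where "vr v = 2 * v + 3"
definition tm :: "nat => nat" where "tm k = 2 * k + 4"

lemma vr_tm_simps [simp]:
  "vr v ~= tm k" "tm k ~= vr v" "vr v = vr w \<longleftrightarrow> v = w" "tm k = tm l \<longleftrightarrow> k = l"
  "vr v ~= Suc 0" "vr v ~= 2" "tm v ~= Suc 0" "tm v ~= 2" "vr v ~= 0" "tm v ~= 0"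
  "Suc 0 ~= vr v" "2 ~= vr v" "Suc 0 ~= tm v" "2 ~= tm v"
  by (auto simp: vr_def tm_def; presburger)+

text \<open>The factor \<open>w\<close> is known at compile time, so the product
  \<open>w * r j\<close> is unrolled.\<close>

primrec adds :: "nat => nat => nat => prog" where
  "adds 0 i j = Skip"
| "adds (Suc w) i j = Seq (Add i i j) (adds w i j)"

text \<open>Cell \<open>i\<close> of array \<open>a\<close> is stored at address \<open>N + i * W + a\<close>, behind the input.\<close>

definition addr :: "nat => nat => nat => nat => prog" where
  "addr W a i j = Seq (Const i a) (Seq (Add i i (Suc 0)) (adds W i j))"

text \<open>The value ends up in \<open>tm k\<close>; temporaries below \<open>k\<close> hold
  pending values of the enclosing evaluation. In \<open>Summ\<close> the bound is clamped by
  \<open>a - (a - X) = min X a\<close>, and the old value of the variable is saved in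
  \<open>tm (k + 2)\<close>.\<close>

primrec ce :: "nat => ex => nat => prog" where
  "ce W (Num c) k = Const (tm k) c"
| "ce W (Var v) k = Copy (tm k) (vr v)"
| "ce W (Inp e) k = Seq (ce W e k) (Seq (Sub (tm (Suc k)) (Suc 0) (tm k))
     (If_Pos (tm (Suc k)) (Load (tm k) (tm k)) (Const (tm k) 0)))"
| "ce W (Rd a e) k = Seq (ce W e k) (Seq (addr W a (tm (Suc k)) (tm k)) (Load (tm k) (tm (Suc k))))"
| "ce W (Plus e f) k = Seq (ce W e k) (Seq (ce W f (Suc k)) (Add (tm k) (tm k) (tm (Suc k))))"
| "ce W (Minus e f) k = Seq (ce W e k) (Seq (ce W f (Suc k)) (Sub (tm k) (tm k) (tm (Suc k))))"
| "ce W (Summ v e f) k = Seq (ce W e k) (Seq (Sub (tm (Suc k)) (tm k) (Suc 0))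
     (Seq (Sub (tm k) (tm k) (tm (Suc k))) (Seq (Const (tm (Suc k)) 0)
     (Seq (Copy (tm (k + 2)) (vr v)) (Seq (Const (vr v) 0)
     (Seq (While_Pos (tm k) (Seq (ce W f (k + 3)) (Seq (Add (tm (Suc k)) (tm (Suc k)) (tm (k + 3)))
        (Seq (Add (vr v) (vr v) 2) (Sub (tm k) (tm k) 2)))))
     (Seq (Copy (vr v) (tm (k + 2))) (Copy (tm k) (tm (Suc k))))))))))"

primrec cc :: "nat => cm => nat => prog" where
  "cc W (Wr a e f) k = Seq (ce W e k) (Seq (ce W f (Suc k)) (Seq (addr W a (tm (k + 2)) (tm k))
     (Store (tm (k + 2)) (tm (Suc k)))))"
| "cc W (Sq c d) k = Seq (cc W c k) (cc W d k)"
| "cc W (Fr v e c) k = Seq (ce W e k) (Seq (Sub (tm (Suc k)) (tm k) (Suc 0))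
     (Seq (Sub (tm k) (tm k) (tm (Suc k))) (Seq (Copy (tm (Suc k)) (vr v)) (Seq (Const (vr v) 0)
     (Seq (While_Pos (tm k) (Seq (cc W c (k + 2)) (Seq (Add (vr v) (vr v) 2) (Sub (tm k) (tm k) 2))))
       (Copy (vr v) (tm (Suc k))))))))"

primrec te :: "nat => nat => ex => nat" where
  "te W X (Num c) = 1"
| "te W X (Var v) = 1"
| "te W X (Inp e) = te W X e + 3"
| "te W X (Rd a e) = te W X e + W + 4"
| "te W X (Plus e f) = te W X e + te W X f + 1"
| "te W X (Minus e f) = te W X e + te W X f + 1"
| "te W X (Summ v e f) = te W X e + X * (te W X f + 4) + 8"

primrec tc :: "nat => nat => cm => nat" where
  "tc W X (Wr a e f) = te W X e + te W X f + W + 4"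
| "tc W X (Sq c d) = tc W X c + tc W X d"
| "tc W X (Fr v e c) = te W X e + X * (tc W X c + 3) + 6"

definition conf :: "nat => (nat => nat) => nat => (nat => nat) => store => state => bool" where
  "conf X y W et sg s \<longleftrightarrow> fst s (Suc 0) = X & fst s 2 = 1 & (\<forall>v. fst s (vr v) = et v) &
     (\<forall>i<X. snd s i = y i) & (\<forall>a<W. \<forall>i. snd s (X + i * W + a) = sg a i)"

lemma exec_cong: "exec p s t s' ==> t = u ==> s' = s'' ==> exec p s u s''"
  by simp

section \<open>Correctness of the compiler\<close>

lemma while_loop:
  assumes step: "\<And>i s. i < B ==> I i s ==> fst s c = B - i ==>
      \<exists>t s'. exec p s t s' & t <= ta & I (Suc i) s' & fst s' c = B - Suc i"
    and "I 0 s" "fst s c = B"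
  shows "\<exists>t s'. exec (While_Pos c p) s t s' & t <= B * Suc ta + 1 & I B s' & fst s' c = 0"
proof -
  have "I (B - k) s ==> fst s c = k ==> k <= B ==>
     \<exists>t s'. exec (While_Pos c p) s t s' & t <= k * Suc ta + 1 & I B s' & fst s' c = 0" for k s
  proof (induction k arbitrary: s)
    case 0
    then show ?case by (intro exI[of _ 1] exI[of _ s] conjI exec.While_False) auto
  next
    case (Suc k)
    obtain t s' where 1: "exec p s t s'" "t <= ta" "I (Suc (B - Suc k)) s'"
      "fst s' c = B - Suc (B - Suc k)"
      using step[of "B - Suc k" s] Suc.prems by auto
    have e: "Suc (B - Suc k) = B - k" "B - Suc (B - Suc k) = k" using Suc.prems by auto
    obtain t' s'' where 2: "exec (While_Pos c p) s' t' s''" "t' <= k * Suc ta + 1" "I B s''" "fst s'' c = 0"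
      using Suc.IH[of s'] 1 e Suc.prems by auto
    have "exec (While_Pos c p) s (Suc (t + t')) s''"
      using exec.While_True[OF _ 1(1) 2(1)] Suc.prems by auto
    then show ?case using 1 2 by (intro exI conjI) auto
  qed
  from this[where s=s and k=B] show ?thesis using assms by auto
qed

lemma exec_adds:
  assumes "i ~= j"
  shows "exec (adds w i j) (r, m) (Suc w) (r(i := r i + w * r j), m)"
proof (induction w arbitrary: r)
  case 0
  then show ?case using exec.Skip[of "(r, m)"] by simp
next
  case (Suc w)
  have "exec (Seq (Add i i j) (adds w i j)) (r, m) (1 + Suc w)
     ((r(i := r i + r j))(i := (r(i := r i + r j)) i + w * (r(i := r i + r j)) j), m)"
    by (intro exec.Seq[OF exec.Add Suc])
  then show ?case unfolding adds.simps
    by (rule exec_cong) (use assms in \<open>auto simp: algebra_simps fun_eq_iff\<close>)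
qed

lemma exec_addr:
  assumes "i ~= j" "i ~= Suc 0"
  shows "exec (addr W a i j) (r, m) (W + 3) (r(i := r (Suc 0) + r j * W + a), m)"
proof -
  let ?r = "r(i := a)" let ?r' = "?r(i := ?r i + ?r (Suc 0))"
  have "exec (addr W a i j) (r, m) (1 + (1 + Suc W)) (?r'(i := ?r' i + W * ?r' j), m)"
    unfolding addr_def
    by (rule exec.Seq[OF exec.Const exec.Seq[OF exec.Add exec_adds[OF assms(1)]]])
  then show ?thesis
    by (rule exec_cong) (use assms in \<open>auto simp: algebra_simps fun_eq_iff\<close>)
qed

definition keeps :: "nat => (nat => nat) => (nat => nat) => bool" where
  "keeps k r r' \<longleftrightarrow> (\<forall>j. (\<forall>i\<ge>k. j ~= tm i) --> r' j = r j)"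

lemma keeps_conf: "keeps k r r' ==> conf X y W et sg (r, m) ==> conf X y W et sg (r', m)"
  by (auto simp: keeps_def conf_def)

lemma keeps_refl: "keeps k r r" by (simp add: keeps_def)

lemma keeps_trans: "keeps k r r' ==> keeps l r' r'' ==> k <= l ==> keeps k r r''"
  unfolding keeps_def by (metis order_trans)

lemma keeps_upd: "keeps k r r' ==> k <= i ==> keeps k r (r'(tm i := x))"
  by (auto simp: keeps_def)

lemma keeps_tm: "keeps k r r' ==> i < k ==> r' (tm i) = r (tm i)"
  by (auto simp: keeps_def)

lemma keeps_vr: "keeps k r r' ==> r' (vr v) = r (vr v)"
  by (auto simp: keeps_def)

lemma keeps_12: "keeps k r r' ==> r' (Suc 0) = r (Suc 0) & r' 2 = r 2"
  by (auto simp: keeps_def)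

lemma out_step:
  "exec p s t s' ==> t <= T ==> P s' & fst s' c = z ==>
     \<exists>t s'. exec p s t s' & t <= T & P s' & fst s' c = z"
  by blast

lemma out_ce:
  "exec p (r, m) t (r', m) ==> t <= T ==> r' i = v ==> keeps k r r' ==>
     \<exists>t r'. exec p (r, m) t (r', m) & t <= T & r' i = v & keeps k r r'"
  by blast

lemma out_cc:
  "exec p (r, m) t (r', m') ==> t <= T ==> conf X y W et sg (r', m') ==> keeps k r r' ==>
     \<exists>t r' m'. exec p (r, m) t (r', m') & t <= T & conf X y W et sg (r', m') & keeps k r r'"
  by blast

lemma exec_ce:
  assumes "\<forall>a\<in>rds e. a < W" "conf X y W et sg (r, m)"
  shows "\<exists>t r'. exec (ce W e k) (r, m) t (r', m) & t <= te W X e & r' (tm k) = ev X y e et sg &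
     keeps k r r'"
  using assms
proof (induction e arbitrary: k r et)
  case (Num c)
  show ?case
    unfolding ce.simps
    by (intro exI[of _ 1] exI[of _ "r(tm k := c)"] conjI exec.Const keeps_upd keeps_refl) auto
next
  case (Var v)
  then show ?case unfolding ce.simps
    by (intro exI[of _ 1] exI[of _ "r(tm k := r (vr v))"] conjI exec.Copy keeps_upd keeps_refl)
      (auto simp: conf_def)
next
  case (Inp e)
  obtain t r1 where 1: "exec (ce W e k) (r, m) t (r1, m)" "t <= te W X e" "r1 (tm k) = ev X y e et sg"
    "keeps k r r1" using Inp.IH[of et r k] Inp.prems by auto
  note cf = keeps_conf[OF 1(4) Inp.prems(2)]
  define v where "v = ev X y e et sg"
  let ?r2 = "r1(tm (Suc k) := r1 (Suc 0) - r1 (tm k))"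
  have 2: "exec (Sub (tm (Suc k)) (Suc 0) (tm k)) (r1, m) 1 (?r2, m)" by (rule exec.Sub)
  have r10: "r1 (Suc 0) = X" using cf by (simp add: conf_def)
  have "\<exists>r3. exec (If_Pos (tm (Suc k)) (Load (tm k) (tm k)) (Const (tm k) 0)) (?r2, m) 2 (r3, m) &
      r3 = ?r2(tm k := if v < X then y v else 0)"
  proof (cases "v < X")
    case True
    have "exec (If_Pos (tm (Suc k)) (Load (tm k) (tm k)) (Const (tm k) 0)) (?r2, m) (Suc 1)
       (?r2(tm k := m (?r2 (tm k))), m)"
      using True r10 1(3) by (intro exec.If_True exec.Load) (simp add: v_def)
    moreover have "m (?r2 (tm k)) = y v" using cf True 1(3) by (simp add: conf_def v_def)
    ultimately show ?thesis using True by (simp add: numeral_2_eq_2)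
  next
    case False
    have "exec (If_Pos (tm (Suc k)) (Load (tm k) (tm k)) (Const (tm k) 0)) (?r2, m) (Suc 1)
       (?r2(tm k := 0), m)"
      using False r10 1(3) by (intro exec.If_False exec.Const) (simp add: v_def)
    then show ?thesis using False by (simp add: numeral_2_eq_2)
  qed
  then obtain r3 where 3: "exec (If_Pos (tm (Suc k)) (Load (tm k) (tm k)) (Const (tm k) 0)) (?r2, m) 2 (r3, m)"
     "r3 = ?r2(tm k := if v < X then y v else 0)" by blast
  have "keeps k r r3" unfolding 3(2) by (intro keeps_upd 1) auto
  moreover have "exec (ce W (Inp e) k) (r, m) (t + (1 + 2)) (r3, m)"
    unfolding ce.simps by (rule exec.Seq[OF 1(1) exec.Seq[OF 2 3(1)]])
  moreover have "r3 (tm k) = ev X y (Inp e) et sg" using 3(2) by (simp add: v_def)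
  ultimately show ?case using 1(2) by (intro out_ce) auto
next
  case (Rd a e)
  obtain t r1 where 1: "exec (ce W e k) (r, m) t (r1, m)" "t <= te W X e" "r1 (tm k) = ev X y e et sg"
    "keeps k r r1" using Rd.IH[of et r k] Rd.prems by auto
  note cf = keeps_conf[OF 1(4) Rd.prems(2)]
  define r2 where "r2 = r1(tm (Suc k) := r1 (Suc 0) + r1 (tm k) * W + a)"
  have 2: "exec (addr W a (tm (Suc k)) (tm k)) (r1, m) (W + 3) (r2, m)"
    unfolding r2_def by (rule exec_addr) auto
  have ex: "exec (ce W (Rd a e) k) (r, m) (t + ((W + 3) + 1)) (r2(tm k := m (r2 (tm (Suc k)))), m)"
    unfolding ce.simps by (rule exec.Seq[OF 1(1) exec.Seq[OF 2 exec.Load]])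
  have mv: "m (r2 (tm (Suc k))) = sg a (ev X y e et sg)"
    using cf 1(3) Rd.prems(1) by (simp add: conf_def r2_def)
  have kp: "keeps k r (r2(tm k := x))" for x unfolding r2_def by (intro keeps_upd 1) auto
  show ?case by (rule out_ce[OF ex _ _ kp]) (use 1(2) mv in simp_all)
next
  case (Plus e f)
  obtain t r1 where 1: "exec (ce W e k) (r, m) t (r1, m)" "t <= te W X e" "r1 (tm k) = ev X y e et sg"
    "keeps k r r1" using Plus.IH(1)[of et r k] Plus.prems by auto
  obtain u r2 where 2: "exec (ce W f (Suc k)) (r1, m) u (r2, m)" "u <= te W X f"
    "r2 (tm (Suc k)) = ev X y f et sg" "keeps (Suc k) r1 r2"
    using Plus.IH(2)[of et r1 "Suc k"] Plus.prems keeps_conf[OF 1(4)] by auto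
  have ex: "exec (ce W (Plus e f) k) (r, m) (t + (u + 1)) (r2(tm k := r2 (tm k) + r2 (tm (Suc k))), m)"
    unfolding ce.simps by (rule exec.Seq[OF 1(1) exec.Seq[OF 2(1) exec.Add]])
  have kp: "keeps k r (r2(tm k := x))" for x
    by (intro keeps_upd keeps_trans[OF 1(4) 2(4)]) auto
  show ?case by (rule out_ce[OF ex _ _ kp]) (use 1 2 keeps_tm[OF 2(4), of k] in simp_all)
next
  case (Minus e f)
  obtain t r1 where 1: "exec (ce W e k) (r, m) t (r1, m)" "t <= te W X e" "r1 (tm k) = ev X y e et sg"
    "keeps k r r1" using Minus.IH(1)[of et r k] Minus.prems by auto
  obtain u r2 where 2: "exec (ce W f (Suc k)) (r1, m) u (r2, m)" "u <= te W X f"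
    "r2 (tm (Suc k)) = ev X y f et sg" "keeps (Suc k) r1 r2"
    using Minus.IH(2)[of et r1 "Suc k"] Minus.prems keeps_conf[OF 1(4)] by auto
  have ex: "exec (ce W (Minus e f) k) (r, m) (t + (u + 1)) (r2(tm k := r2 (tm k) - r2 (tm (Suc k))), m)"
    unfolding ce.simps by (rule exec.Seq[OF 1(1) exec.Seq[OF 2(1) exec.Sub]])
  have kp: "keeps k r (r2(tm k := x))" for x
    by (intro keeps_upd keeps_trans[OF 1(4) 2(4)]) auto
  show ?case by (rule out_ce[OF ex _ _ kp]) (use 1 2 keeps_tm[OF 2(4), of k] in simp_all)
next
  case (Summ v e f)
  obtain t r1 where 1: "exec (ce W e k) (r, m) t (r1, m)" "t <= te W X e" "r1 (tm k) = ev X y e et sg"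
    "keeps k r r1" using Summ.IH(1)[of et r k] Summ.prems by auto
  note cf = keeps_conf[OF 1(4) Summ.prems(2)]
  define B where "B = min X (ev X y e et sg)"
  define r2 where "r2 = r1(tm (Suc k) := r1 (tm k) - r1 (Suc 0))"
  define r3 where "r3 = r2(tm k := r2 (tm k) - r2 (tm (Suc k)))"
  define r4 where "r4 = r3(tm (Suc k) := 0)"
  define r5 where "r5 = r4(tm (k + 2) := r4 (vr v))"
  define r6 where "r6 = r5(vr v := 0)"
  define S where "S i = (\<Sum>j<i. ev X y f (et(v := j)) sg)" for i
  \<comment> \<open>The register of the summation variable changes during the loop, so preservation
    of the other registers is stated for the state with that variable put back.\<close>
  define I where "I i s \<longleftrightarrow> snd s = m & conf X y W (et(v := i)) sg s & fst s (tm (Suc k)) = S i &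
     fst s (tm (k + 2)) = et v & keeps k r ((fst s)(vr v := et v))" for i and s :: state
  have B6: "r6 (tm k) = B"
    using cf 1(3) by (simp add: r6_def r5_def r4_def r3_def r2_def B_def conf_def)
  have k5: "keeps k r r5" unfolding r5_def r4_def r3_def r2_def by (intro keeps_upd 1) auto
  note cf5 = keeps_conf[OF k5 Summ.prems(2)]
  have e6: "r6(vr v := et v) = r5" using cf5 by (auto simp: r6_def conf_def)
  have I0: "I 0 (r6, m)"
    unfolding I_def using cf5 e6 k5
    by (auto simp: S_def conf_def r6_def) (auto simp: r5_def r4_def r3_def r2_def conf_def keeps_vr[OF 1(4)] cf[unfolded conf_def])
  have step: "\<exists>t s'. exec (Seq (ce W f (k + 3)) (Seq (Add (tm (Suc k)) (tm (Suc k)) (tm (k + 3)))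
        (Seq (Add (vr v) (vr v) 2) (Sub (tm k) (tm k) 2)))) s t s' & t <= te W X f + 3 & I (Suc i) s' &
        fst s' (tm k) = B - Suc i" if hyps: "i < B" "I i s" "fst s (tm k) = B - i" for i s
  proof -
    obtain a where s: "s = (a, m)" using hyps(2) unfolding I_def by (cases s) auto
    have ca: "conf X y W (et(v := i)) sg (a, m)" using hyps(2) s by (simp add: I_def)
    have ar: "\<forall>a\<in>rds f. a < W" using Summ.prems by simp
    obtain u b where u: "exec (ce W f (k + 3)) (a, m) u (b, m)" "u <= te W X f"
       "b (tm (k + 3)) = ev X y f (et(v := i)) sg" "keeps (k + 3) a b"
      using Summ.IH(2)[OF ar ca, of "k + 3"] by blast
    define b1 where "b1 = b(tm (Suc k) := b (tm (Suc k)) + b (tm (k + 3)))"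
    define b2 where "b2 = b1(vr v := b1 (vr v) + b1 2)"
    define b3 where "b3 = b2(tm k := b2 (tm k) - b2 2)"
    have ex: "exec (Seq (ce W f (k + 3)) (Seq (Add (tm (Suc k)) (tm (Suc k)) (tm (k + 3)))
        (Seq (Add (vr v) (vr v) 2) (Sub (tm k) (tm k) 2)))) s (u + (1 + (1 + 1))) (b3, m)"
      unfolding s b3_def b2_def b1_def
      by (rule exec.Seq[OF u(1) exec.Seq[OF exec.Add exec.Seq[OF exec.Add exec.Sub]]])
    note cb = keeps_conf[OF u(4) ca]
    have b2: "b 2 = 1" "b (vr v) = i" using cb by (auto simp: conf_def)
    have "keeps k r (a(vr v := et v))" using hyps(2) s by (simp add: I_def)
    moreover have "keeps k (a(vr v := et v)) (b(vr v := et v))"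
      using u(4) by (auto simp: keeps_def)
    ultimately have "keeps k r (b(vr v := et v))" by (rule keeps_trans) simp
    moreover have "b3(vr v := et v) = (b(vr v := et v))(tm (Suc k) := b (tm (Suc k)) + b (tm (k + 3)), tm k := b (tm k) - 1)"
      using b2 by (auto simp: b3_def b2_def b1_def fun_eq_iff)
    ultimately have kk: "keeps k r (b3(vr v := et v))" by (simp add: keeps_upd)
    have "b (tm (Suc k)) = S i" "b (tm (k + 2)) = et v" "b (tm k) = B - i"
      using hyps s keeps_tm[OF u(4)] by (auto simp: I_def)
    then have "I (Suc i) (b3, m) & b3 (tm k) = B - Suc i"
      unfolding I_def using kk cb b2 u(3)
      by (auto simp: b3_def b2_def b1_def conf_def S_def)
    then show ?thesis by (intro out_step[OF ex]) (use u(2) in simp_all)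
  qed
  have "fst (r6, m) (tm k) = B" using B6 by simp
  from while_loop[of B I "tm k", OF step I0 this]
  obtain t' s' where w: "exec (While_Pos (tm k) (Seq (ce W f (k + 3)) (Seq (Add (tm (Suc k)) (tm (Suc k)) (tm (k + 3)))
        (Seq (Add (vr v) (vr v) 2) (Sub (tm k) (tm k) 2))))) (r6, m) t' s'"
       "t' <= B * Suc (te W X f + 3) + 1" "I B s'" by blast
  obtain a where s': "s' = (a, m)" using w(3) unfolding I_def by (cases s') auto
  define a1 where "a1 = a(vr v := a (tm (k + 2)))"
  have ex: "exec (ce W (Summ v e f) k) (r, m) (t + (1 + (1 + (1 + (1 + (1 + (t' + (1 + 1))))))))
     (a1(tm k := a1 (tm (Suc k))), m)"
    using w(1) unfolding s' a1_def
    unfolding ce.simps r6_def r5_def r4_def r3_def r2_def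
    by (intro exec.Seq[OF 1(1)] exec.Seq[OF exec.Sub] exec.Seq[OF exec.Const] exec.Seq[OF exec.Copy])
      (rule exec.Seq[OF _ exec.Seq[OF exec.Copy exec.Copy]])
  have a1: "a1 = a(vr v := et v)" using w(3) by (simp add: a1_def s' I_def)
  have kp: "keeps k r (a(vr v := et v))" using w(3) by (simp add: s' I_def)
  have val: "a (tm (Suc k)) = ev X y (Summ v e f) et sg" using w(3) by (simp add: s' I_def S_def B_def)
  have tb: "B * Suc (te W X f + 3) <= X * (te W X f + 4)"
    by (rule mult_le_mono) (auto simp: B_def)
  have kp': "keeps k r (a1(tm k := a1 (tm (Suc k))))" unfolding a1 by (rule keeps_upd[OF kp]) simp
  show ?case by (rule out_ce[OF ex _ _ kp']) (use 1(2) w(2) tb val a1 in simp_all)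
qed

lemma exec_cc:
  assumes "\<forall>a\<in>arrs c. a < W" "conf X y W et sg (r, m)"
  shows "\<exists>t r' m'. exec (cc W c k) (r, m) t (r', m') & t <= tc W X c &
     conf X y W et (run X y c et sg) (r', m') & keeps k r r'"
  using assms
proof (induction c arbitrary: k r m et sg)
  case (Wr a e f)
  obtain t r1 where 1: "exec (ce W e k) (r, m) t (r1, m)" "t <= te W X e" "r1 (tm k) = ev X y e et sg"
    "keeps k r r1" using exec_ce[of e W X y et sg r m k] Wr.prems by auto
  obtain u r2 where 2: "exec (ce W f (Suc k)) (r1, m) u (r2, m)" "u <= te W X f"
    "r2 (tm (Suc k)) = ev X y f et sg" "keeps (Suc k) r1 r2"
    using exec_ce[of f W X y et sg r1 m "Suc k"] Wr.prems keeps_conf[OF 1(4)] by auto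
  define r3 where "r3 = r2(tm (k + 2) := r2 (Suc 0) + r2 (tm k) * W + a)"
  have 3: "exec (addr W a (tm (k + 2)) (tm k)) (r2, m) (W + 3) (r3, m)"
    unfolding r3_def by (rule exec_addr) auto
  define m' where "m' = m(r3 (tm (k + 2)) := r3 (tm (Suc k)))"
  have ex: "exec (cc W (Wr a e f) k) (r, m) (t + (u + (W + 3 + 1))) (r3, m')"
    unfolding m'_def cc.simps by (rule exec.Seq[OF 1(1) exec.Seq[OF 2(1) exec.Seq[OF 3 exec.Store]]])
  have kp: "keeps k r r3" unfolding r3_def by (intro keeps_upd keeps_trans[OF 1(4) 2(4)]) auto
  note cf = keeps_conf[OF kp Wr.prems(2)]
  have ad: "r3 (tm (k + 2)) = X + ev X y e et sg * W + a"
    using cf 1 keeps_tm[OF 2(4), of k] keeps_12[OF 2(4)] keeps_12[OF 1(4)] Wr.prems(2) by (simp add: r3_def conf_def)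
  \<comment> \<open>Array numbers are below \<open>W\<close>, so quotient and remainder by
    \<open>W\<close> recover cell and array from an address.\<close>
  have inj: "i * W + b = j * W + a \<longleftrightarrow> i = j & b = a" if "b < W" "a < W" for i j b
  proof
    assume "i * W + b = j * W + a"
    then have "(i * W + b) div W = (j * W + a) div W" "(i * W + b) mod W = (j * W + a) mod W" by auto
    then show "i = j & b = a" using that by simp
  qed simp
  have "conf X y W et (run X y (Wr a e f) et sg) (r3, m')"
    using cf Wr.prems(1) 2(3) inj unfolding conf_def m'_def ad by (auto simp: r3_def add.assoc)
  show ?case by (rule out_cc[OF ex _ \<open>conf X y W et (run X y (Wr a e f) et sg) (r3, m')\<close> kp]) (use 1(2) 2(2) in simp)
next
  case (Sq c d)
  obtain t r1 m1 where 1: "exec (cc W c k) (r, m) t (r1, m1)" "t <= tc W X c"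
     "conf X y W et (run X y c et sg) (r1, m1)" "keeps k r r1"
    using Sq.IH(1)[of et sg r m k] Sq.prems by auto
  obtain u r2 m2 where 2: "exec (cc W d k) (r1, m1) u (r2, m2)" "u <= tc W X d"
     "conf X y W et (run X y d et (run X y c et sg)) (r2, m2)" "keeps k r1 r2"
    using Sq.IH(2)[of et "run X y c et sg" r1 m1 k] Sq.prems 1 by auto
  show ?case unfolding cc.simps run.simps
    by (rule out_cc[OF exec.Seq[OF 1(1) 2(1)] _ 2(3) keeps_trans[OF 1(4) 2(4)]]) (use 1(2) 2(2) in simp_all)
next
  case (Fr v e c)
  obtain t r1 where 1: "exec (ce W e k) (r, m) t (r1, m)" "t <= te W X e" "r1 (tm k) = ev X y e et sg"
    "keeps k r r1" using exec_ce[of e W X y et sg r m k] Fr.prems by auto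
  note cf = keeps_conf[OF 1(4) Fr.prems(2)]
  define B where "B = min X (ev X y e et sg)"
  define r2 where "r2 = r1(tm (Suc k) := r1 (tm k) - r1 (Suc 0))"
  define r3 where "r3 = r2(tm k := r2 (tm k) - r2 (tm (Suc k)))"
  define r5 where "r5 = r3(tm (Suc k) := r3 (vr v))"
  define r6 where "r6 = r5(vr v := 0)"
  define S where "S i = fold (%i. run X y c (et(v := i))) [0..<i] sg" for i
  define I where "I i s \<longleftrightarrow> conf X y W (et(v := i)) (S i) s &
     fst s (tm (Suc k)) = et v & keeps k r ((fst s)(vr v := et v))" for i and s :: state
  have B6: "r6 (tm k) = B"
    using cf 1(3) by (simp add: r6_def r5_def r3_def r2_def B_def conf_def)
  have k5: "keeps k r r5" unfolding r5_def r3_def r2_def by (intro keeps_upd 1) auto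
  note cf5 = keeps_conf[OF k5 Fr.prems(2)]
  have e6: "r6(vr v := et v) = r5" using cf5 by (auto simp: r6_def conf_def)
  have I0: "I 0 (r6, m)"
    unfolding I_def using cf5 e6 k5
    by (auto simp: S_def conf_def r6_def) (auto simp: r5_def r3_def r2_def conf_def keeps_vr[OF 1(4)] cf[unfolded conf_def])
  have step: "\<exists>t s'. exec (Seq (cc W c (k + 2)) (Seq (Add (vr v) (vr v) 2) (Sub (tm k) (tm k) 2))) s t s' &
       t <= tc W X c + 2 & I (Suc i) s' &
        fst s' (tm k) = B - Suc i" if hyps: "i < B" "I i s" "fst s (tm k) = B - i" for i s
  proof -
    obtain a m0 where s: "s = (a, m0)" by (cases s) auto
    have ca: "conf X y W (et(v := i)) (S i) (a, m0)" using hyps(2) s by (simp add: I_def)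
    have ar: "\<forall>a\<in>arrs c. a < W" using Fr.prems by simp
    obtain u b m1 where u: "exec (cc W c (k + 2)) (a, m0) u (b, m1)" "u <= tc W X c"
       "conf X y W (et(v := i)) (run X y c (et(v := i)) (S i)) (b, m1)" "keeps (k + 2) a b"
      using Fr.IH[OF ar ca, of "k + 2"] by blast
    define b2 where "b2 = b(vr v := b (vr v) + b 2)"
    define b3 where "b3 = b2(tm k := b2 (tm k) - b2 2)"
    have ex: "exec (Seq (cc W c (k + 2)) (Seq (Add (vr v) (vr v) 2) (Sub (tm k) (tm k) 2))) s (u + (1 + 1)) (b3, m1)"
      unfolding s b3_def b2_def
      by (rule exec.Seq[OF u(1) exec.Seq[OF exec.Add exec.Sub]])
    note cb = u(3)
    have b2: "b 2 = 1" "b (vr v) = i" using cb by (auto simp: conf_def)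
    have "keeps k r (a(vr v := et v))" using hyps(2) s by (simp add: I_def)
    moreover have "keeps k (a(vr v := et v)) (b(vr v := et v))"
      using u(4) by (auto simp: keeps_def)
    ultimately have "keeps k r (b(vr v := et v))" by (rule keeps_trans) simp
    moreover have "b3(vr v := et v) = (b(vr v := et v))(tm k := b (tm k) - 1)"
      using b2 by (auto simp: b3_def b2_def fun_eq_iff)
    ultimately have kk: "keeps k r (b3(vr v := et v))" by (simp add: keeps_upd)
    have "b (tm (Suc k)) = et v" "b (tm k) = B - i"
      using hyps s keeps_tm[OF u(4)] by (auto simp: I_def)
    then have "I (Suc i) (b3, m1) & b3 (tm k) = B - Suc i"
      unfolding I_def using kk cb b2 u(3)
      by (auto simp: b3_def b2_def conf_def S_def)
    then show ?thesis by (intro out_step[OF ex]) (use u(2) in simp_all)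
  qed
  have "fst (r6, m) (tm k) = B" using B6 by simp
  from while_loop[of B I "tm k", OF step I0 this]
  obtain t' s' where w: "exec (While_Pos (tm k) (Seq (cc W c (k + 2)) (Seq (Add (vr v) (vr v) 2) (Sub (tm k) (tm k) 2)))) (r6, m) t' s'"
       "t' <= B * Suc (tc W X c + 2) + 1" "I B s'" by blast
  obtain a m' where s': "s' = (a, m')" by (cases s') auto
  have ex: "exec (cc W (Fr v e c) k) (r, m) (t + (1 + (1 + (1 + (1 + (t' + 1)))))) (a(vr v := a (tm (Suc k))), m')"
    using w(1) unfolding s'
    unfolding cc.simps r6_def r5_def r3_def r2_def
    by (intro exec.Seq[OF 1(1)] exec.Seq[OF exec.Sub] exec.Seq[OF exec.Const] exec.Seq[OF exec.Copy])
      (rule exec.Seq[OF _ exec.Copy])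
  have a1: "a(vr v := a (tm (Suc k))) = a(vr v := et v)" using w(3) by (simp add: s' I_def)
  have kp: "keeps k r (a(vr v := et v))" using w(3) by (simp add: s' I_def)
  have cf': "conf X y W et (run X y (Fr v e c) et sg) (a(vr v := et v), m')"
    using w(3) by (auto simp: s' I_def S_def B_def conf_def)
  have tb: "B * Suc (tc W X c + 2) <= X * (tc W X c + 3)"
    by (rule mult_le_mono) (auto simp: B_def)
  show ?case by (rule out_cc[OF ex[unfolded a1] _ cf' kp]) (use 1(2) w(2) tb in simp_all)
qed

section \<open>Running time\<close>

lemma poly_le: "a <= b ==> k * (X + 1) ^ a <= k * (X + 1 :: nat) ^ b"
  by (intro mult_le_mono2 power_increasing) auto

lemma const_le_poly: "(k :: nat) <= k * (X + 1) ^ a"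
  by simp

lemma poly_max:
  "k * (X + 1) ^ a <= k * (X + 1 :: nat) ^ max a b"
  "k * (X + 1) ^ b <= k * (X + 1 :: nat) ^ max a b"
  by (intro poly_le; simp)+

lemma te_poly: "\<exists>k. \<forall>X. te W X e <= k * (X + 1) ^ dpe e"
proof (induction e)
  case (Num x)
  show ?case by (intro exI[of _ 1]) simp
next
  case (Var x)
  show ?case by (intro exI[of _ 1]) simp
next
  case (Inp e)
  then obtain k where k: "\<And>X. te W X e <= k * (X + 1) ^ dpe e" by auto
  have "te W X (Inp e) <= (k + 3) * (X + 1) ^ dpe (Inp e)" for X
    using k[of X] const_le_poly[of 3 X "dpe e"] unfolding te.simps tc.simps dpe.simps add_mult_distrib by linarith
  then show ?case by blast
next
  case (Rd a e)
  then obtain k where k: "\<And>X. te W X e <= k * (X + 1) ^ dpe e" by auto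
  have "te W X (Rd a e) <= (k + (W + 4)) * (X + 1) ^ dpe (Rd a e)" for X
    using k[of X] const_le_poly[of "W + 4" X "dpe e"] unfolding te.simps tc.simps dpe.simps add_mult_distrib by linarith
  then show ?case by blast
next
  case (Plus e f)
  then obtain k l where k: "\<And>X. te W X e <= k * (X + 1) ^ dpe e" "\<And>X. te W X f <= l * (X + 1) ^ dpe f" by auto
  have "te W X (Plus e f) <= (k + l + 1) * (X + 1) ^ dpe (Plus e f)" for X
    using k(1)[of X] k(2)[of X] poly_max(1)[of k X "dpe e" "dpe f"] poly_max(2)[of l X "dpe f" "dpe e"]
      const_le_poly[of 1 X "dpe (Plus e f)"] unfolding te.simps tc.simps dpe.simps dpc.simps add_mult_distrib by linarith
  then show ?case by blast
next
  case (Minus e f)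
  then obtain k l where k: "\<And>X. te W X e <= k * (X + 1) ^ dpe e" "\<And>X. te W X f <= l * (X + 1) ^ dpe f" by auto
  have "te W X (Minus e f) <= (k + l + 1) * (X + 1) ^ dpe (Minus e f)" for X
    using k(1)[of X] k(2)[of X] poly_max(1)[of k X "dpe e" "dpe f"] poly_max(2)[of l X "dpe f" "dpe e"]
      const_le_poly[of 1 X "dpe (Minus e f)"] unfolding te.simps tc.simps dpe.simps dpc.simps add_mult_distrib by linarith
  then show ?case by blast
next
  case (Summ v e f)
  then obtain k l where k: "\<And>X. te W X e <= k * (X + 1) ^ dpe e" "\<And>X. te W X f <= l * (X + 1) ^ dpe f" by auto
  let ?d = "dpe (Summ v e f)"
  have "te W X (Summ v e f) <= (k + (l + 4) + 8) * (X + 1) ^ ?d" for X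
  proof -
    have "X * (te W X f + 4) <= (X + 1) * ((l + 4) * (X + 1) ^ dpe f)"
      using k(2)[of X] const_le_poly[of 4 X "dpe f"] unfolding add_mult_distrib[of l] by (intro mult_le_mono; linarith)
    also have "... = (l + 4) * (X + 1) ^ Suc (dpe f)" by (simp only: power_Suc mult.left_commute)
    also have "... <= (l + 4) * (X + 1) ^ ?d" by (intro poly_le) simp
    finally show ?thesis using k(1)[of X] poly_max(1)[of k X "dpe e" "Suc (dpe f)"] const_le_poly[of 8 X ?d]
      unfolding te.simps tc.simps dpe.simps dpc.simps add_mult_distrib by linarith
  qed
  then show ?case by blast
qed

text \<open>The degree is the nesting depth, and the coefficient depends on the program alone.
  Constant tables written into the program text therefore cost only a constant factor.\<close>

lemma tc_poly: "\<exists>k. \<forall>X. tc W X c <= k * (X + 1) ^ dpc c"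
proof (induction c)
  case (Wr a e f)
  obtain k l where k: "\<And>X. te W X e <= k * (X + 1) ^ dpe e" "\<And>X. te W X f <= l * (X + 1) ^ dpe f"
    using te_poly[of W e] te_poly[of W f] by auto
  have "tc W X (Wr a e f) <= (k + l + (W + 4)) * (X + 1) ^ dpc (Wr a e f)" for X
    using k(1)[of X] k(2)[of X] poly_max(1)[of k X "dpe e" "dpe f"] poly_max(2)[of l X "dpe f" "dpe e"]
      const_le_poly[of "W + 4" X "dpc (Wr a e f)"]
    unfolding te.simps tc.simps dpe.simps dpc.simps add_mult_distrib by linarith
  then show ?case by blast
next
  case (Sq c d)
  then obtain k l where k: "\<And>X. tc W X c <= k * (X + 1) ^ dpc c" "\<And>X. tc W X d <= l * (X + 1) ^ dpc d" by auto
  have "tc W X (Sq c d) <= (k + l) * (X + 1) ^ dpc (Sq c d)" for X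
    using k(1)[of X] k(2)[of X] poly_max(1)[of k X "dpc c" "dpc d"] poly_max(2)[of l X "dpc d" "dpc c"]
    unfolding te.simps tc.simps dpe.simps dpc.simps add_mult_distrib by linarith
  then show ?case by blast
next
  case (Fr v e c)
  obtain k where k: "\<And>X. te W X e <= k * (X + 1) ^ dpe e" using te_poly[of W e] by auto
  obtain l where l: "\<And>X. tc W X c <= l * (X + 1) ^ dpc c" using Fr by auto
  let ?d = "dpc (Fr v e c)"
  have "tc W X (Fr v e c) <= (k + (l + 3) + 6) * (X + 1) ^ ?d" for X
  proof -
    have "X * (tc W X c + 3) <= (X + 1) * ((l + 3) * (X + 1) ^ dpc c)"
      using l[of X] const_le_poly[of 3 X "dpc c"] unfolding add_mult_distrib[of l] by (intro mult_le_mono; linarith)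
    also have "... = (l + 3) * (X + 1) ^ Suc (dpc c)" by (simp only: power_Suc mult.left_commute)
    also have "... <= (l + 3) * (X + 1) ^ ?d" by (intro poly_le) simp
    finally show ?thesis using k[of X] poly_max(1)[of k X "dpe e" "Suc (dpc c)"] const_le_poly[of 6 X ?d]
      unfolding te.simps tc.simps dpe.simps dpc.simps add_mult_distrib by linarith
  qed
  then show ?case by blast
qed

definition epi_in :: prog where
  "epi_in = Seq (Load (tm 4) (tm 1)) (Seq (Store (tm 2) (tm 4)) (Seq (Add (tm 1) (tm 1) (tm 5))
     (Seq (Add (tm 2) (tm 2) 2) (Sub (tm 3) (tm 3) 2))))"

definition epi_out :: prog where
  "epi_out = Seq (Copy (tm 3) (Suc 0)) (Seq (While_Pos (tm 3) epi_in) (Sub (tm 0) (tm 0) 2))"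

definition epi :: "nat => nat => nat => prog" where
  "epi W ca oa = Seq (Const (tm 0) ca) (Seq (Add (tm 0) (tm 0) (Suc 0)) (Seq (Load (tm 0) (tm 0))
     (Seq (Copy 0 (tm 0)) (Seq (Const (tm 1) oa) (Seq (Add (tm 1) (tm 1) (Suc 0))
     (Seq (Const (tm 2) 0) (Seq (Const (tm 5) W) (While_Pos (tm 0) epi_out))))))))"

lemma tm_0 [simp]: "0 ~= tm k" "0 ~= vr k"
  by (auto simp: tm_def vr_def)

text \<open>The result array is interleaved with the other arrays and has to be moved to the start
  of the memory. Copying upwards destroys nothing that is still to be read, as the source address of
  cell \<open>k\<close> is at least \<open>k\<close>.\<close>

lemma exec_epi:
  assumes cf: "conf X y W et sg (r, m)" and W: "ca < W" "oa < W"
  shows "\<exists>t s. exec (epi W ca oa) (r, m) t s & t <= sg ca 0 * (6 * X + 4) + 9 & fst s 0 = sg ca 0 &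
     (\<forall>i < sg ca 0 * X. snd s i = sg oa i)"
proof -
  define L where "L = sg ca 0"
  define J where "J k s \<longleftrightarrow> fst s (Suc 0) = X & fst s 2 = 1 & fst s 0 = L & fst s (tm 1) = X + k * W + oa &
     fst s (tm 2) = k & fst s (tm 5) = W & (\<forall>j<k. snd s j = sg oa j) & (\<forall>j\<ge>k. snd s j = m j)"
     for k and s :: state
  have m: "m (X + i * W + oa) = sg oa i" for i using cf W by (simp add: conf_def)
  have inner: "\<exists>t s'. exec epi_in s t s' & t <= 5 & (J (k + Suc i) s' & fst s' (tm 0) = z) & fst s' (tm 3) = X - Suc i"
    if hyps: "i < X" "J (k + i) s & fst s (tm 0) = z" "fst s (tm 3) = X - i" for k i s z
  proof -
    obtain a b where s: "s = (a, b)" by (cases s)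
    note J = hyps(2)[unfolded J_def s fst_conv snd_conv]
    have ge: "X + (k + i) * W + oa \<ge> k + i" using W by (cases W) auto
    define a1 where "a1 = a(tm 4 := b (a (tm 1)))"
    define b1 where "b1 = b(a1 (tm 2) := a1 (tm 4))"
    define a2 where "a2 = a1(tm 1 := a1 (tm 1) + a1 (tm 5))"
    define a3 where "a3 = a2(tm 2 := a2 (tm 2) + a2 2)"
    define a4 where "a4 = a3(tm 3 := a3 (tm 3) - a3 2)"
    have ex: "exec epi_in s (1 + (1 + (1 + (1 + 1)))) (a4, b1)"
      unfolding epi_in_def s a4_def a3_def a2_def b1_def a1_def
      by (rule exec.Seq[OF exec.Load exec.Seq[OF exec.Store exec.Seq[OF exec.Add exec.Seq[OF exec.Add exec.Sub]]]])
    have "b (X + (k + i) * W + oa) = sg oa (k + i)" using J ge m by auto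
    then have "J (k + Suc i) (a4, b1) & a4 (tm 0) = z & a4 (tm 3) = X - Suc i"
      using J hyps(3) s unfolding J_def
      by (auto simp: a4_def a3_def a2_def b1_def a1_def algebra_simps less_Suc_eq)
    then show ?thesis by (intro out_step[OF ex]) simp_all
  qed
  have outer: "\<exists>t s'. exec epi_out s t s' & t <= 6 * X + 3 & J (Suc i * X) s' & fst s' (tm 0) = L - Suc i"
    if hyps: "i < L" "J (i * X) s" "fst s (tm 0) = L - i" for i s
  proof -
    obtain a b where s: "s = (a, b)" by (cases s)
    define a1 where "a1 = a(tm 3 := a (Suc 0))"
    have J1: "J (i * X + 0) (a1, b) & fst (a1, b) (tm 0) = L - i" "fst (a1, b) (tm 3) = X"
      using hyps s by (auto simp: J_def a1_def)
    from while_loop[of X "%j s. J (i * X + j) s & fst s (tm 0) = L - i" "tm 3" epi_in 5, OF inner J1]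
    obtain t s' where w: "exec (While_Pos (tm 3) epi_in) (a1, b) t s'" "t <= X * Suc 5 + 1"
       "J (i * X + X) s'" "fst s' (tm 0) = L - i" by blast
    obtain a2 b2 where s': "s' = (a2, b2)" by (cases s')
    have ex: "exec epi_out s (1 + (t + 1)) (a2(tm 0 := a2 (tm 0) - a2 2), b2)"
      unfolding epi_out_def s
      by (rule exec.Seq[OF exec.Copy exec.Seq[OF w(1)[unfolded a1_def s'] exec.Sub]])
    have J3: "J (Suc i * X) (a2(tm 0 := a2 (tm 0) - a2 2), b2)"
      using w(3,4) s' by (auto simp: J_def algebra_simps)
    have z: "fst (a2(tm 0 := a2 (tm 0) - a2 2), b2) (tm 0) = L - Suc i"
      using w(3,4) s' by (auto simp: J_def)
    show ?thesis by (rule out_step[where P = "J (Suc i * X)", OF ex _ conjI[OF J3 z]]) (use w(2) in simp)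
  qed
  define r1 where "r1 = r(tm 0 := ca)"
  define r2 where "r2 = r1(tm 0 := r1 (tm 0) + r1 (Suc 0))"
  define r3 where "r3 = r2(tm 0 := m (r2 (tm 0)))"
  define r4 where "r4 = r3(0 := r3 (tm 0))"
  define r5 where "r5 = r4(tm 1 := oa)"
  define r6 where "r6 = r5(tm 1 := r5 (tm 1) + r5 (Suc 0))"
  define r7 where "r7 = r6(tm 2 := 0)"
  define r8 where "r8 = r7(tm 5 := W)"
  have "\<forall>a<W. \<forall>i. m (X + i * W + a) = sg a i" using cf by (simp add: conf_def)
  then have "m (X + 0 * W + ca) = L" using W(1) unfolding L_def by blast
  then have "m (ca + X) = L" by (simp add: add.commute)
  then have J0: "J (0 * X) (r8, m)" "fst (r8, m) (tm 0) = L"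
    using cf unfolding J_def by (auto simp: r8_def r7_def r6_def r5_def r4_def r3_def r2_def r1_def conf_def)
  from while_loop[of L "%i. J (i * X)" "tm 0" epi_out "6 * X + 3" "(r8, m)", OF outer J0]
  obtain t s where w: "exec (While_Pos (tm 0) epi_out) (r8, m) t s" "t <= L * Suc (6 * X + 3) + 1" "J (L * X) s" by blast
  have ex: "exec (epi W ca oa) (r, m) (1 + (1 + (1 + (1 + (1 + (1 + (1 + (1 + t)))))))) s"
    unfolding epi_def
    by (rule exec.Seq[OF exec.Const exec.Seq[OF exec.Add exec.Seq[OF exec.Load exec.Seq[OF exec.Copy exec.Seq[OF exec.Const
          exec.Seq[OF exec.Add exec.Seq[OF exec.Const exec.Seq[OF exec.Const]]]]]]]])
      (rule w(1)[unfolded r8_def r7_def r6_def r5_def r4_def r3_def r2_def r1_def])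
  moreover have "1 + (1 + (1 + (1 + (1 + (1 + (1 + (1 + t))))))) <= sg ca 0 * (6 * X + 4) + 9"
    using w(2) by (simp add: L_def algebra_simps)
  ultimately show ?thesis using w(3) unfolding J_def L_def by blast
qed

lemma finite_rds: "finite (rds e)" by (induction e) auto
lemma finite_arrs: "finite (arrs c)" by (induction c) (auto simp: finite_rds)

definition env0 :: "nat => nat => nat => nat" where
  "env0 q N = (%_. 0)(0 := q, Suc 0 := N)"

theorem compile:
  fixes c :: cm and ca oa :: nat
  shows "\<exists>p k. \<forall>q ys. let N = length ys; sg = run N ((!) ys) c (env0 q N) (%_ _. 0) in
    sg ca 0 <= N --> (\<exists>t s. exec p (input_state q ys) t s & t <= k * (N + 1) ^ (dpc c + 2) &
       output_list N s = map (%j. map (%i. sg oa (j * N + i)) [0..<N]) [0..<sg ca 0])"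
proof -
  define W where "W = Suc (Max (insert ca (insert oa (arrs c))))"
  have W: "\<forall>a\<in>arrs c. a < W" "ca < W" "oa < W"
    unfolding W_def less_Suc_eq_le using finite_arrs[of c] by (auto intro!: Max_ge simp del: Max_insert)
  obtain k where k: "\<And>X. tc W X c <= k * (X + 1) ^ dpc c" using tc_poly[of W c] by auto
  define p where "p = Seq (Const 2 1) (Seq (Copy (vr 0) 0) (Seq (Copy (vr (Suc 0)) (Suc 0)) (Seq (cc W c 0) (epi W ca oa))))"
  have "\<exists>t s. exec p (input_state q ys) t s & t <= (k + 22) * (N + 1) ^ (dpc c + 2) &
       output_list N s = map (%j. map (%i. sg oa (j * N + i)) [0..<N]) [0..<sg ca 0]"
    if N: "N = length ys" and sg: "sg = run N ((!) ys) c (env0 q N) (%_ _. 0)" and le: "sg ca 0 <= N" for q ys N sg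
  proof -
    define r where "r = fst (input_state q ys)"
    define m where "m = snd (input_state q ys)"
    define r1 where "r1 = r(2 := 1)"
    define r2 where "r2 = r1(vr 0 := r1 0)"
    define r3 where "r3 = r2(vr (Suc 0) := r2 (Suc 0))"
    \<comment> \<open>The memory behind the input is zero, so all arrays start out as zero.\<close>
    have "conf N ((!) ys) W (env0 q N) (%_ _. 0) (r3, m)"
      unfolding conf_def r3_def r2_def r1_def r_def m_def input_state_def N env0_def by (auto simp: vr_def)
    from exec_cc[OF W(1) this, of 0] obtain t r4 m4 where
      t: "exec (cc W c 0) (r3, m) t (r4, m4)" "t <= tc W N c" "conf N ((!) ys) W (env0 q N) sg (r4, m4)"
      unfolding sg by auto
    from exec_epi[OF t(3) W(2,3)]
    obtain u s where u: "exec (epi W ca oa) (r4, m4) u s" "u <= sg ca 0 * (6 * N + 4) + 9" "fst s 0 = sg ca 0"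
      "\<forall>i<sg ca 0 * N. snd s i = sg oa i" by blast
    have "exec p (r, m) (1 + (1 + (1 + (t + u)))) s"
      unfolding p_def
      by (rule exec.Seq[OF exec.Const exec.Seq[OF exec.Copy exec.Seq[OF exec.Copy exec.Seq[OF _ u(1)]]]])
        (rule t(1)[unfolded r3_def r2_def r1_def])
    then have e: "exec p (input_state q ys) (1 + (1 + (1 + (t + u)))) s" by (simp add: r_def m_def)
    have "sg ca 0 * (6 * N + 4) <= (N + 1) * (10 * (N + 1))" using le by (intro mult_le_mono) auto
    also have "... = 10 * (N + 1) ^ 2" by (simp add: power2_eq_square algebra_simps)
    also have "... <= 10 * (N + 1) ^ (dpc c + 2)" by (rule poly_le) simp
    finally have "u <= 10 * (N + 1) ^ (dpc c + 2) + 9" using u(2) by simp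
    moreover have "k * (N + 1) ^ dpc c <= k * (N + 1) ^ (dpc c + 2)" by (rule poly_le) simp
    then have "t <= k * (N + 1) ^ (dpc c + 2)"
      by (rule order_trans[OF order_trans[OF t(2) k[of N]]])
    moreover have "12 <= 12 * (N + 1) ^ (dpc c + 2)" by (rule const_le_poly)
    ultimately have "1 + (1 + (1 + (t + u))) <= (k + 22) * (N + 1) ^ (dpc c + 2)"
      unfolding add_mult_distrib[of k] by simp
    moreover have "snd s (j * N + i) = sg oa (j * N + i)" if "j < sg ca 0" "i < N" for i j
    proof -
      have "j * N + i < Suc j * N" using that by simp
      also have "... <= sg ca 0 * N" using that by (intro mult_le_mono1) simp
      finally show ?thesis using u(4) by simp
    qed
    then have "output_list N s = map (%j. map (%i. sg oa (j * N + i)) [0..<N]) [0..<sg ca 0]"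
      unfolding output_list_def u(3) by auto
    ultimately show ?thesis using e by blast
  qed
  then show ?thesis unfolding Let_def by (intro exI[of _ p] exI[of _ "k + 22"]) auto
qed

section \<open>Reasoning about programs of the source language\<close>

text \<open>Variables 97 to 99 are reserved for derived forms. Because of the clamping, a product is
  exact only if its first factor is at most \<open>X\<close>.\<close>

definition Mul :: "ex => ex => ex" where "Mul a b = Summ 99 a b"
definition Leq :: "ex => ex => ex" where "Leq a b = Minus (Num 1) (Minus a b)"
definition Eq :: "ex => ex => ex" where "Eq a b = Minus (Num 1) (Plus (Minus a b) (Minus b a))"
definition Div :: "ex => ex => ex" where "Div a b = Summ 98 a (Leq (Mul (Plus (Var 98) (Num 1)) b) a)"

primrec fv :: "ex => nat set" where
  "fv (Num c) = {}"
| "fv (Var v) = {v}"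
| "fv (Inp e) = fv e"
| "fv (Rd a e) = fv e"
| "fv (Plus e f) = fv e \<union> fv f"
| "fv (Minus e f) = fv e \<union> fv f"
| "fv (Summ v e f) = fv e \<union> (fv f - {v})"

lemma ev_cong: "(\<And>v. v \<in> fv e ==> et v = et' v) ==> ev X y e et sg = ev X y e et' sg"
proof (induction e arbitrary: et et')
  case (Summ v e f)
  have "ev X y e et sg = ev X y e et' sg" by (rule Summ.IH(1)) (use Summ.prems in auto)
  moreover have "ev X y f (et(v := i)) sg = ev X y f (et'(v := i)) sg" for i
    using Summ.prems by (intro Summ.IH(2)) auto
  ultimately show ?case by (simp only: ev.simps)
next
  case (Plus e f)
  have "ev X y e et sg = ev X y e et' sg" "ev X y f et sg = ev X y f et' sg"
    using Plus.prems by (auto intro: Plus.IH)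
  then show ?case by simp
next
  case (Minus e f)
  have "ev X y e et sg = ev X y e et' sg" "ev X y f et sg = ev X y f et' sg"
    using Minus.prems by (auto intro: Minus.IH)
  then show ?case by simp
next
  case (Inp e)
  have "ev X y e et sg = ev X y e et' sg" using Inp.prems by (auto intro: Inp.IH)
  then show ?case by simp
next
  case (Rd a e)
  have "ev X y e et sg = ev X y e et' sg" using Rd.prems by (auto intro: Rd.IH)
  then show ?case by simp
qed auto

lemma ev_upd: "v \<notin> fv e ==> ev X y e (et(v := i)) sg = ev X y e et sg"
  by (rule ev_cong) auto

lemma fv_macros [simp]:
  "fv (Mul a b) = fv a \<union> (fv b - {99})" "fv (Leq a b) = fv a \<union> fv b"
  "fv (Eq a b) = fv a \<union> fv b" "fv (Div a b) = fv a \<union> (fv b - {98, 99}) \<union> (fv a - {98})"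
  by (auto simp: Mul_def Leq_def Eq_def Div_def)

lemma rds_macros [simp]:
  "rds (Mul a b) = rds a \<union> rds b" "rds (Leq a b) = rds a \<union> rds b"
  "rds (Eq a b) = rds a \<union> rds b" "rds (Div a b) = rds a \<union> rds b"
  by (auto simp: Mul_def Leq_def Eq_def Div_def)

lemma dpe_macros [simp]:
  "dpe (Mul a b) = max (dpe a) (Suc (dpe b))" "dpe (Leq a b) = max (dpe a) (dpe b)"
  "dpe (Eq a b) = max (dpe a) (dpe b)" "dpe (Div a b) = max (dpe a) (Suc (max (Suc (dpe b)) (dpe a)))"
  by (simp_all add: Mul_def Leq_def Eq_def Div_def)

lemma ev_Mul [simp]: "99 \<notin> fv b ==> ev X y (Mul a b) et sg = min X (ev X y a et sg) * ev X y b et sg"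
  by (simp add: Mul_def ev_upd)

lemma ev_Leq [simp]: "ev X y (Leq a b) et sg = (if ev X y a et sg <= ev X y b et sg then 1 else 0)"
  by (simp add: Leq_def)

lemma ev_Eq [simp]: "ev X y (Eq a b) et sg = (if ev X y a et sg = ev X y b et sg then 1 else 0)"
  by (simp add: Eq_def)

lemma div_count: "b > 0 ==> (\<Sum>j<a. if Suc j * b <= a then 1 else 0) = a div (b :: nat)"
proof -
  assume b: "b > 0"
  have "{..<a} \<inter> {j. Suc j * b <= a} = {..<a div b}"
  proof (intro set_eqI iffI)
    fix j assume "j \<in> {..<a} \<inter> {j. Suc j * b <= a}"
    then show "j \<in> {..<a div b}" using b by (simp add: less_eq_div_iff_mult_less_eq Suc_le_eq[symmetric])
  next
    fix j assume j: "j \<in> {..<a div b}"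
    then have "Suc j * b <= a" using b by (simp add: less_eq_div_iff_mult_less_eq Suc_le_eq[symmetric])
    moreover have "j < a" using j div_le_dividend[of a b] by (meson lessThan_iff order_less_le_trans)
    ultimately show "j \<in> {..<a} \<inter> {j. Suc j * b <= a}" by simp
  qed
  then show ?thesis by (simp add: sum.If_cases)
qed

lemma ev_Div:
  assumes "98 \<notin> fv a" "98 \<notin> fv b" "99 \<notin> fv b" "ev X y a et sg <= X" "ev X y b et sg > 0"
  shows "ev X y (Div a b) et sg = ev X y a et sg div ev X y b et sg"
proof -
  have "ev X y (Div a b) et sg = (\<Sum>j<ev X y a et sg. if Suc j * ev X y b et sg <= ev X y a et sg then 1 else 0)"
  proof -
    have "min X (ev X y a et sg) = ev X y a et sg" using assms(4) by simp
    moreover have "ev X y (Leq (Mul (Plus (Var 98) (Num 1)) b) a) (et(98 := j)) sg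
      = (if Suc j * ev X y b et sg <= ev X y a et sg then 1 else 0)" if j: "j < ev X y a et sg" for j
    proof -
      have "min X (Suc j) = Suc j" using j assms(4) by simp
      then show ?thesis using assms(1-3) by (simp add: ev_upd)
    qed
    ultimately show ?thesis unfolding Div_def by simp
  qed
  then show ?thesis using div_count[OF assms(5)] by simp
qed

section \<open>Rules for assignments, loops and tables\<close>

lemma ev_agree: "(\<And>a. a \<in> rds e ==> sg a = sg' a) ==> ev X y e et sg = ev X y e et sg'"
  by (induction e arbitrary: et) auto

lemma run_frame: "a \<notin> wrs c ==> run X y c et sg a = sg a"
proof (induction c arbitrary: et sg)
  case (Fr v e c)
  have "fold (%i. run X y c (et(v := i))) xs sg a = sg a" for xs
    using Fr by (induction xs arbitrary: sg) auto
  then show ?case by simp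
qed auto

lemma Fr_inv:
  assumes "B = min X (ev X y e et sg)" "I 0 sg"
    and "\<And>i sg'. i < B ==> I i sg' ==> I (Suc i) (run X y c (et(v := i)) sg')"
  shows "I B (run X y (Fr v e c) et sg)"
proof -
  have "k <= B ==> I k (fold (%i. run X y c (et(v := i))) [0..<k] sg)" for k
    by (induction k) (use assms in auto)
  then show ?thesis using assms(1) by simp
qed

text \<open>A conditional is a loop of at most one round; inside \<open>c\<close> variable 97 is
  0.\<close>

definition Cond :: "ex => cm => cm" where "Cond e c = Fr 97 e c"

lemma run_Cond:
  "X > 0 ==> ev X y e et sg = 1 ==> run X y (Cond e c) et sg = run X y c (et(97 := 0)) sg"
  "ev X y e et sg = 0 ==> run X y (Cond e c) et sg = sg"
proof -
  assume h: "X > 0" "ev X y e et sg = 1"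
  then have "min X (ev X y e et sg) = 1" by linarith
  then show "run X y (Cond e c) et sg = run X y c (et(97 := 0)) sg" by (simp add: Cond_def)
qed (simp add: Cond_def)

lemma Cond_simps [simp]: "wrs (Cond e c) = wrs c" "arrs (Cond e c) = rds e \<union> arrs c" "dpc (Cond e c) = max (dpe e) (Suc (dpc c))"
  by (simp_all add: Cond_def)

definition Tab :: "nat => ex => nat => ex => cm" where
  "Tab v b a e = Fr v b (Wr a (Var v) e)"

lemma Tab_simps [simp]: "wrs (Tab v b a e) = {a}" "arrs (Tab v b a e) = rds b \<union> insert a (rds e)"
  "dpc (Tab v b a e) = max (dpe b) (Suc (dpe e))"
  by (simp_all add: Tab_def)

text \<open>An entry may be computed from its own old value, which is still in place when its turn
  comes; hence the premise on \<open>sg' a i\<close> besides the one on the other arrays.\<close>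

lemma run_Tab:
  assumes B: "B = min X (ev X y b et sg)"
    and pw: "\<And>i sg'. i < B ==> (\<And>c. c ~= a ==> sg' c = sg c) ==> sg' a i = sg a i ==> ev X y e (et(v := i)) sg' = f i"
  shows "run X y (Tab v b a e) et sg = sg(a := %i. if i < B then f i else sg a i)"
proof -
  have "run X y (Tab v b a e) et sg = sg(a := %i. if i < B then f i else sg a i)"
    unfolding Tab_def
  proof (rule Fr_inv[OF B, where I = "%k sg'. sg' = sg(a := %i. if i < k then f i else sg a i)"])
    fix i sg' assume i: "i < B" and s: "sg' = sg(a := %j. if j < i then f j else sg a j)"
    have "ev X y e (et(v := i)) sg' = f i" by (rule pw[OF i]) (simp_all add: s)
    then show "run X y (Wr a (Var v) e) (et(v := i)) sg' = sg(a := %j. if j < Suc i then f j else sg a j)"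
      unfolding s by (auto simp: fun_eq_iff less_Suc_eq)
  qed simp
  then show ?thesis .
qed

lemma Tab_val:
  assumes "a \<notin> rds e"
  shows "run X y (Tab v b a e) et sg = sg(a := %i. if i < min X (ev X y b et sg) then ev X y e (et(v := i)) sg else sg a i)"
proof (rule run_Tab[OF refl])
  fix i sg' assume h: "\<And>c. c ~= a ==> sg' c = sg c"
  show "ev X y e (et(v := i)) sg' = ev X y e (et(v := i)) sg"
    by (rule ev_agree) (metis h assms)
qed

lemma pair_index: "(j :: nat) < m ==> j' < m ==> m * i + j = m * i' + j' ==> i = i' & j = j'"
proof -
  assume h: "j < m" "j' < m" "m * i + j = m * i' + j'"
  then have "(j + m * i) div m = (j' + m * i') div m" by (simp add: add.commute)
  then have "i = i'" using h(1,2) by simp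
  then show ?thesis using h by simp
qed

definition Tab2 :: "nat => ex => nat => nat => nat => ex => cm" where
  "Tab2 v b w m a e = Fr v b (Fr w (Num m) (Wr a (Plus (Mul (Num m) (Var v)) (Var w)) e))"

lemma Tab2_simps [simp]: "wrs (Tab2 v b w m a e) = {a}" "dpc (Tab2 v b w m a e) = max (dpe b) (Suc (Suc (max 1 (dpe e))))"
  by (simp_all add: Tab2_def)

lemma run_Tab2:
  assumes B: "B = min X (ev X y b et sg)" and m: "m <= X" and vw: "v ~= w" "v ~= 99"
    and e: "\<And>i j sg'. i < B ==> j < m ==> (\<And>c. c ~= a ==> sg' c = sg c) ==> sg' a (m * i + j) = sg a (m * i + j) ==>
      ev X y e (et(v := i, w := j)) sg' = f i j"
    and ij: "i < B" "j < m"
  shows "run X y (Tab2 v b w m a e) et sg a (m * i + j) = f i j"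
proof -
  define I where "I k sg' \<longleftrightarrow> (\<forall>c. c ~= a --> sg' c = sg c) & (\<forall>i j. j < m --> sg' a (m * i + j) = (if i < k then f i j else sg a (m * i + j)))" for k :: nat and sg' :: store
  have "I B (run X y (Tab2 v b w m a e) et sg)"
    unfolding Tab2_def
  proof (rule Fr_inv[OF B, where I = I])
    show "I 0 sg" by (simp add: I_def)
    fix i sg1 assume i: "i < B" and I1: "I i sg1"
    let ?et = "et(v := i)"
    define J where "J k sg' \<longleftrightarrow> (\<forall>c. c ~= a --> sg' c = sg c) & (\<forall>i' j. j < m --> sg' a (m * i' + j) = (if i' < i \<or> i' = i & j < k then f i' j else sg a (m * i' + j)))" for k :: nat and sg' :: store
    have "J m (run X y (Fr w (Num m) (Wr a (Plus (Mul (Num m) (Var v)) (Var w)) e)) ?et sg1)"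
    proof (rule Fr_inv[where I = J])
      show "m = min X (ev X y (Num m) ?et sg1)" using m by simp
      show "J 0 sg1" using I1 by (simp add: I_def J_def)
      fix j sg2 assume j: "j < m" and J2: "J j sg2"
      have ev: "ev X y e (?et(w := j)) sg2 = f i j"
        by (rule e[OF i j]) (use J2 j in \<open>simp_all add: J_def\<close>)
      have ix: "ev X y (Plus (Mul (Num m) (Var v)) (Var w)) (?et(w := j)) sg2 = m * i + j"
        using vw m by simp
      show "J (Suc j) (run X y (Wr a (Plus (Mul (Num m) (Var v)) (Var w)) e) (?et(w := j)) sg2)"
        unfolding J_def
      proof (intro conjI allI impI)
        fix c assume "c ~= a" then show "run X y (Wr a (Plus (Mul (Num m) (Var v)) (Var w)) e) (?et(w := j)) sg2 c = sg c"
          using J2 by (simp add: J_def)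
      next
        fix i' j' assume j': "j' < m"
        have eq: "m * i' + j' = m * i + j \<longleftrightarrow> i' = i & j' = j" using pair_index[OF j' j] by auto
        have old: "sg2 a (m * i' + j') = (if i' < i \<or> i' = i & j' < j then f i' j' else sg a (m * i' + j'))"
          using J2 j' by (simp add: J_def)
        have "run X y (Wr a (Plus (Mul (Num m) (Var v)) (Var w)) e) (?et(w := j)) sg2 a (m * i' + j')
          = (if i' = i & j' = j then f i j else sg2 a (m * i' + j'))"
          by (simp only: run.simps ix ev fun_upd_apply eq if_True simp_thms)
        then show "run X y (Wr a (Plus (Mul (Num m) (Var v)) (Var w)) e) (?et(w := j)) sg2 a (m * i' + j')
          = (if i' < i \<or> i' = i & j' < Suc j then f i' j' else sg a (m * i' + j'))"
          unfolding old by (auto simp: less_Suc_eq)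
      qed
    qed
    then show "I (Suc i) (run X y (Fr w (Num m) (Wr a (Plus (Mul (Num m) (Var v)) (Var w)) e)) ?et sg1)"
      unfolding I_def J_def by (auto simp: less_Suc_eq)
  qed
  then show ?thesis using ij by (simp add: I_def)
qed

text \<open>The language has no idle command; a loop of zero rounds stands for the empty
  sequence.\<close>

fun sqs :: "cm list => cm" where
  "sqs [] = Fr 0 (Num 0) (Wr 0 (Num 0) (Num 0))"
| "sqs [c] = c"
| "sqs (c # d # cs) = Sq c (sqs (d # cs))"

lemma run_sqs [simp]: "run X y (sqs cs) et sg = fold (%c. run X y c et) cs sg"
  by (induction cs arbitrary: sg rule: sqs.induct) simp_all

lemma wrs_sqs [simp]: "cs ~= [] ==> wrs (sqs cs) = (\<Union>c\<in>set cs. wrs c)"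
  by (induction cs rule: sqs.induct) auto

lemma dpc_sqs: "(\<And>c. c \<in> set cs ==> dpc c <= d) ==> 1 <= d ==> dpc (sqs cs) <= d"
  by (induction cs rule: sqs.induct) auto

lemma sqs_inv:
  assumes "I 0 sg" and "\<And>i sg'. i < k ==> I i sg' ==> I (Suc i) (run X y (f i) et sg')"
  shows "I k (run X y (sqs (map f [0..<k])) et sg)"
proof -
  have "j <= k ==> I j (fold (%i. run X y (f i) et) [0..<j] sg)" for j
    by (induction j) (use assms in auto)
  then show ?thesis by (simp add: fold_map comp_def)
qed

text \<open>Lookup in a table fixed at compile time. Its length enters the size of the program but
  not the nesting depth.\<close>

primrec sel :: "nat => ex => (nat => ex) => ex" where
  "sel 0 e g = Num 0"
| "sel (Suc n) e g = Plus (sel n e g) (Mul (Eq e (Num n)) (g n))"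

lemma ev_sel [simp]:
  assumes "\<And>i. i < n ==> 99 \<notin> fv (g i)" "X > 0"
  shows "ev X y (sel n e g) et sg = (if ev X y e et sg < n then ev X y (g (ev X y e et sg)) et sg else 0)"
  using assms(1)
proof (induction n)
  case (Suc n)
  have "min X (Suc 0) = Suc 0" using assms(2) by simp
  then show ?case using Suc by (auto simp: less_Suc_eq)
qed simp

lemma fv_sel [simp]: "x \<notin> fv e ==> (\<And>i. x \<notin> fv (g i)) ==> x \<notin> fv (sel n e g)"
  by (induction n) auto

lemma rds_sel [simp]: "x \<notin> rds e ==> (\<And>i. x \<notin> rds (g i)) ==> x \<notin> rds (sel n e g)"
  by (induction n) auto

lemma dpe_sel [simp]: "dpe e <= d ==> (\<And>i. Suc (dpe (g i)) <= d) ==> dpe (sel n e g) <= d"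
  by (induction n) auto

section \<open>The search for a distinguishing set\<close>

definition mtv :: "nat => nat => nat => (nat => nat => nat => bool) => nat => nat => nat => nat" where
  "mtv kap D q0 P c w u = (if c < kap & w < D & u < q0 & P c w u then 1 else 0)"

text \<open>The matrix \<open>mm\<close> of the regularity part: a symbol \<open>c\<close> counts at
  \<open>l\<close> only if it matches the received digits in at least \<open>tt\<close> positions,
  so the number of active symbols is at most the list size of the inner code.\<close>

definition mmv :: "nat => nat => nat => (nat => nat => nat => bool) => nat => (nat => nat => nat) => (nat => nat) => nat => nat => nat => nat" where
  "mmv kap D q0 P tt nbf Y l c w = (if tt <= (\<Sum>v<D. mtv kap D q0 P c v (Y (nbf v l))) then 1 else 0) * mtv kap D q0 P c w (Y (nbf w l))"

definition stv :: "nat => nat => (nat => nat => nat) => store => bool" where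
  "stv n D nbf sg \<longleftrightarrow> sg 0 (Suc 0) = n & sg 0 5 = fact n & (\<forall>l<n. \<forall>w<D. sg 4 (D * l + w) = nbf w l)"

lemma min_ind [simp]: "X > 0 ==> min X (if P then Suc 0 else 0) = (if P then Suc 0 else 0)"
  by simp

lemma run_Tab_mult:
  assumes "a \<notin> rds f" "v ~= 99"
  shows "run X y (Tab v b a (Mul f (Rd a (Var v)))) et sg
    = sg(a := %i. if i < min X (ev X y b et sg) then min X (ev X y f (et(v := i)) sg) * sg a i else sg a i)"
proof (rule run_Tab[OF refl])
  fix i sg' assume h: "\<And>c. c ~= a ==> sg' c = sg c" and i: "sg' a i = sg a i"
  have "ev X y f (et(v := i)) sg' = ev X y f (et(v := i)) sg" by (rule ev_agree) (metis h assms(1))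
  then show "ev X y (Mul f (Rd a (Var v))) (et(v := i)) sg' = min X (ev X y f (et(v := i)) sg) * sg a i"
    using i assms(2) by simp
qed

lemma run_Tab_plus:
  assumes "a \<notin> rds f"
  shows "run X y (Tab v b a (Plus f (Rd a (Var v)))) et sg
    = sg(a := %i. if i < min X (ev X y b et sg) then ev X y f (et(v := i)) sg + sg a i else sg a i)"
proof (rule run_Tab[OF refl])
  fix i sg' assume h: "\<And>c. c ~= a ==> sg' c = sg c" and i: "sg' a i = sg a i"
  have "ev X y f (et(v := i)) sg' = ev X y f (et(v := i)) sg" by (rule ev_agree) (metis h assms(1))
  then show "ev X y (Plus f (Rd a (Var v))) (et(v := i)) sg' = ev X y f (et(v := i)) sg + sg a i"
    using i by simp
qed

text \<open>
  Arrays of the program: 0 scalars (\<open>n0, n, 2 ^ L, Z, z, fact n\<close>), 1 and 2 powers of \<open>q0\<close> and of 2, 4 neighbours,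
  6 the received component, 9 the labels of the partition, 10 class sizes, 11 and 12 the iterated vector
  (positive and negative part), 13 and 14 its image, 15 and 16 class sums, 17 and 18 a projected level set,
  21 the level set, 22 the best level set, 25 and 26 left and right symbols, 27 decoded words,
  28 their validity, 29 the candidate word, 30 and 31 the output and its length.
  Vectors are kept integral: the orthogonal projection is scaled by \<open>fact n\<close>, which all class sizes divide.
\<close>

definition nE :: ex where "nE = Rd 0 (Num 1)"

lemma nE_simps [simp]: "ev X y nE et sg = sg 0 (Suc 0)" "fv nE = {}" "rds nE = {0}" "dpe nE = 0"
  by (simp_all add: nE_def)

definition vl :: "store => nat => nat => nat => real" where
  "vl sg p m r = real (sg p r) - real (sg m r)"

section \<open>The projection in integers\<close>

definition sumE :: "nat => ex" where
  "sumE p = Summ 65 nE (Mul (Eq (Rd 9 (Var 65)) (Rd 9 (Var 5))) (Rd p (Var 65)))"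
definition sizE :: ex where "sizE = Summ 65 nE (Eq (Rd 9 (Var 65)) (Rd 9 (Var 5)))"
definition facE :: ex where
  "facE = Minus (Plus (Var 6) (Num 1)) (Mul (Eq (Plus (Var 6) (Num 1)) (Rd 10 (Var 5))) (Var 6))"

text \<open>Subtracting a class average means adding it to the opposite part. Everything is scaled
  by \<open>fact n\<close>, one factor per round, since one factor of a product has to stay below
  the clamp; for class sums the factor equal to the class size is omitted, which divides them by
  it.\<close>

definition PROJ :: "nat => nat => cm" where
  "PROJ p m = sqs [Tab 5 nE 15 (sumE p), Tab 5 nE 16 (sumE m), Tab 5 nE 10 sizE,
     Fr 6 nE (sqs [Tab 5 nE p (Mul (Plus (Var 6) (Num 1)) (Rd p (Var 5))),
        Tab 5 nE m (Mul (Plus (Var 6) (Num 1)) (Rd m (Var 5))),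
        Tab 5 nE 15 (Mul facE (Rd 15 (Var 5))), Tab 5 nE 16 (Mul facE (Rd 16 (Var 5)))]),
     Tab 5 nE p (Plus (Rd 16 (Var 5)) (Rd p (Var 5))), Tab 5 nE m (Plus (Rd 15 (Var 5)) (Rd m (Var 5)))]"

lemma PROJ_simps [simp]: "wrs (PROJ p m) = {p, m, 10, 15, 16}"
  by (auto simp: PROJ_def)

text \<open>For \<open>0 < s <= n\<close> the value \<open>pf s n\<close> is the quotient of
  \<open>fact n\<close> by \<open>s\<close>, obtained without dividing a number beyond the
  clamp.\<close>

definition pf :: "nat => nat => nat" where "pf s j = (\<Prod>i<j. if Suc i = s then 1 else Suc i)"

lemma pf_fact: "0 < s ==> (if s <= j then s else 1) * pf s j = fact j"
proof (induction j)
  case (Suc j)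
  have "pf s (Suc j) = (if Suc j = s then 1 else Suc j) * pf s j" by (simp add: pf_def)
  moreover have "s * (Suc j * pf s j) = Suc j * fact j" if "s * pf s j = fact j"
    unfolding that[symmetric] by (simp add: mult.left_commute)
  ultimately show ?case using Suc by (cases "s <= j"; cases "s = Suc j") (auto simp del: mult_Suc)
qed (simp add: pf_def)

lemma run_PROJ_nat:
  fixes sg :: store
  defines "AT \<equiv> %p r. \<Sum>s<sg 0 (Suc 0). if sg 9 s = sg 9 r then sg p s else 0"
    and "sz \<equiv> %r. card {s. s < sg 0 (Suc 0) & sg 9 s = sg 9 r}"
  assumes n: "sg 0 (Suc 0) = n" "n <= X" and X: "X > 0" and pm: "p ~= m" "p \<notin> {0, 9, 10, 15, 16}" "m \<notin> {0, 9, 10, 15, 16}"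
    and r: "r < n"
  shows "run X y (PROJ p m) et sg p r = fact n * sg p r + pf (sz r) n * AT m r"
    "run X y (PROJ p m) et sg m r = fact n * sg m r + pf (sz r) n * AT p r"
proof -
  have X1: "min X (Suc 0) = Suc 0" using X by simp
  have sumE: "ev X y (sumE a) (et'(5 := r)) sg' = AT a r" if "sg' 0 = sg 0" "sg' 9 = sg 9" "sg' a = sg a" for sg' et' a r
    unfolding sumE_def AT_def using that n X by (auto intro!: sum.cong)
  have sizE: "ev X y sizE (et'(5 := r)) sg' = sz r" if "sg' 0 = sg 0" "sg' 9 = sg 9" for sg' et' r
  proof -
    have "{s. s < n & sg 9 s = sg 9 r} = {..<n} \<inter> {s. sg 9 s = sg 9 r}" by auto
    then show ?thesis unfolding sizE_def sz_def using that n by (simp add: sum.If_cases)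
  qed
  have facE: "min X (ev X y facE (et'(6 := i, 5 := r)) sg') = (if Suc i = sz r then 1 else Suc i)"
    if "i < n" "sg' 10 r = sz r" for sg' et' i r
    unfolding facE_def using that n X X1 by auto
  have rds: "15 \<notin> rds (sumE p)" "16 \<notin> rds (sumE m)" "10 \<notin> rds sizE" "15 \<notin> rds facE" "16 \<notin> rds facE"
    using pm by (auto simp: sumE_def sizE_def facE_def)
  define sg1 where "sg1 = run X y (Tab 5 nE 15 (sumE p)) et sg"
  define sg2 where "sg2 = run X y (Tab 5 nE 16 (sumE m)) et sg1"
  define sg3 where "sg3 = run X y (Tab 5 nE 10 sizE) et sg2"
  have s1: "sg1 a = sg a" if "a ~= 15" for a using that by (simp add: sg1_def run_frame)
  have s2: "sg2 a = sg1 a" if "a ~= 16" for a using that by (simp add: sg2_def run_frame)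
  have s3: "sg3 a = sg2 a" if "a ~= 10" for a using that by (simp add: sg3_def run_frame)
  have A1: "sg1 15 r = AT p r" if "r < n" for r
    unfolding sg1_def using that n by (simp add: Tab_val[OF rds(1)] sumE)
  have A2: "sg2 16 r = AT m r" if "r < n" for r
    unfolding sg2_def using that n pm by (simp add: Tab_val[OF rds(2)] sumE s1)
  have A3: "sg3 10 r = sz r" if "r < n" for r
    unfolding sg3_def using that n pm by (simp add: Tab_val[OF rds(3)] sizE s1 s2)
  define B where "B = sqs [Tab 5 nE p (Mul (Plus (Var 6) (Num 1)) (Rd p (Var 5))),
        Tab 5 nE m (Mul (Plus (Var 6) (Num 1)) (Rd m (Var 5))),
        Tab 5 nE 15 (Mul facE (Rd 15 (Var 5))), Tab 5 nE 16 (Mul facE (Rd 16 (Var 5)))]"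
  define I where "I j sg' \<longleftrightarrow> sg' 0 = sg 0 & sg' 10 = sg3 10 & (\<forall>r<n. sg' p r = fact j * sg p r & sg' m r = fact j * sg m r
     & sg' 15 r = pf (sz r) j * AT p r & sg' 16 r = pf (sz r) j * AT m r)" for j and sg' :: store
  define sg4 where "sg4 = run X y (Fr 6 nE B) et sg3"
  have "I n sg4" unfolding sg4_def
  proof (rule Fr_inv[where I = I])
    show "n = min X (ev X y nE et sg3)" using n by (simp add: s1 s2 s3)
    show "I 0 sg3" unfolding I_def using pm by (simp add: s1 s2 s3 A1 A2 pf_def)
    fix i sg' assume i: "i < n" and I: "I i sg'"
    have i0: "sg' 0 (Suc 0) = n" using I n by (simp add: I_def)
    have mi: "min X (Suc i) = Suc i" "min X n = n" using i n by auto
    define ta1 where "ta1 = run X y (Tab 5 nE p (Mul (Plus (Var 6) (Num 1)) (Rd p (Var 5)))) (et(6 := i)) sg'"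
    define ta2 where "ta2 = run X y (Tab 5 nE m (Mul (Plus (Var 6) (Num 1)) (Rd m (Var 5)))) (et(6 := i)) ta1"
    define ta3 where "ta3 = run X y (Tab 5 nE 15 (Mul facE (Rd 15 (Var 5)))) (et(6 := i)) ta2"
    define ta4 where "ta4 = run X y (Tab 5 nE 16 (Mul facE (Rd 16 (Var 5)))) (et(6 := i)) ta3"
    have f1: "ta1 a = sg' a" if "a ~= p" for a using that by (simp add: ta1_def run_frame)
    have f2: "ta2 a = ta1 a" if "a ~= m" for a using that by (simp add: ta2_def run_frame)
    have f3: "ta3 a = ta2 a" if "a ~= 15" for a using that by (simp add: ta3_def run_frame)
    have f4: "ta4 a = ta3 a" if "a ~= 16" for a using that by (simp add: ta4_def run_frame)
    have v1: "ta1 p r = Suc i * sg' p r" if "r < n" for r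
      unfolding ta1_def using that mi i0 by (subst run_Tab_mult) simp_all
    have v2: "ta2 m r = Suc i * ta1 m r" if "r < n" for r
      unfolding ta2_def using that mi i0 pm by (subst run_Tab_mult) (simp_all add: f1)
    have v3: "ta3 15 r = (if Suc i = sz r then 1 else Suc i) * ta2 15 r" if "r < n" for r
      unfolding ta3_def using that mi i0 pm A3[OF that] I rds
      by (subst run_Tab_mult) (simp_all add: f1 f2 facE i I_def)
    have v4: "ta4 16 r = (if Suc i = sz r then 1 else Suc i) * ta3 16 r" if "r < n" for r
      unfolding ta4_def using that mi i0 pm A3[OF that] I rds
      by (subst run_Tab_mult) (simp_all add: f1 f2 f3 facE i I_def)
    have "run X y B (et(6 := i)) sg' = ta4" by (simp add: B_def ta4_def ta3_def ta2_def ta1_def)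
    moreover have "I (Suc i) ta4"
      unfolding I_def using pm I by (auto simp: f1 f2 f3 f4 v1 v2 v3 v4 pf_def I_def algebra_simps)
    ultimately show "I (Suc i) (run X y B (et(6 := i)) sg')" by simp
  qed
  then have I: "sg4 0 = sg 0" "\<And>r. r < n ==> sg4 p r = fact n * sg p r" "\<And>r. r < n ==> sg4 m r = fact n * sg m r"
     "\<And>r. r < n ==> sg4 15 r = pf (sz r) n * AT p r" "\<And>r. r < n ==> sg4 16 r = pf (sz r) n * AT m r"
    unfolding I_def by auto
  define sg5 where "sg5 = run X y (Tab 5 nE p (Plus (Rd 16 (Var 5)) (Rd p (Var 5)))) et sg4"
  define sg6 where "sg6 = run X y (Tab 5 nE m (Plus (Rd 15 (Var 5)) (Rd m (Var 5)))) et sg5"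
  have s5: "sg5 a = sg4 a" if "a ~= p" for a using that by (simp add: sg5_def run_frame)
  have s6: "sg6 a = sg5 a" if "a ~= m" for a using that by (simp add: sg6_def run_frame)
  have mi: "min X n = n" using n by simp
  have "sg5 p r = pf (sz r) n * AT m r + fact n * sg p r"
    unfolding sg5_def using r n mi pm by (subst run_Tab_plus) (simp_all add: I)
  then have 6: "sg6 p r = fact n * sg p r + pf (sz r) n * AT m r" using s6[of p] pm by simp
  have 7: "sg6 m r = fact n * sg m r + pf (sz r) n * AT p r"
    unfolding sg6_def using r n mi pm by (subst run_Tab_plus) (simp_all add: I s5)
  have "run X y (PROJ p m) et sg = sg6" by (simp add: PROJ_def sg6_def sg5_def sg4_def sg3_def sg2_def sg1_def B_def)
  then show "run X y (PROJ p m) et sg p r = fact n * sg p r + pf (sz r) n * AT m r"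
    "run X y (PROJ p m) et sg m r = fact n * sg m r + pf (sz r) n * AT p r" using 6 7 by simp_all
qed

text \<open>All parameters are constants of the program text; alphabet size, block length and
  received word are the only data known at run time.\<close>

locale prg =
  fixes D kap q0 tt Gam :: nat and MTp :: "nat => nat => nat => bool"
begin

definition NBe :: "ex => ex => ex" where "NBe l w = Rd 4 (Plus (Mul (Num D) l) w)"
definition MTe :: "ex => ex => ex => ex" where
  "MTe c w u = sel kap c (%i. sel D w (%j. sel q0 u (%k. Num (if MTp i j k then 1 else 0))))"
definition MMe :: "ex => ex => ex => ex" where
  "MMe l c w = Mul (Leq (Num tt) (Summ 60 (Num D) (MTe c (Var 60) (Rd 6 (NBe l (Var 60)))))) (MTe c w (Rd 6 (NBe l w)))"
definition Me :: "nat => ex => ex => ex" where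
  "Me a l c = Summ 61 (Num D) (Mul (MMe l c (Var 61)) (Rd a (NBe l (Var 61))))"
definition TOPe :: "nat => ex" where
  "TOPe a = Summ 62 nE (Summ 63 (Num D) (Summ 64 (Num kap)
     (Mul (Eq (NBe (Var 62) (Var 63)) (Var 5)) (Mul (MMe (Var 62) (Var 64) (Var 63)) (Me a (Var 62) (Var 64))))))"
definition L1e :: ex where
  "L1e = Summ 66 nE (Summ 67 (Num kap) (Plus (Minus (Me 17 (Var 66) (Var 67)) (Me 18 (Var 66) (Var 67)))
     (Minus (Me 18 (Var 66) (Var 67)) (Me 17 (Var 66) (Var 67)))))"
definition STEP :: cm where
  "STEP = sqs [Tab 5 nE 13 (TOPe 11), Tab 5 nE 14 (TOPe 12), Tab 5 nE 11 (Rd 13 (Var 5)), Tab 5 nE 12 (Rd 14 (Var 5)), PROJ 11 12]"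
definition ITER :: cm where
  "ITER = sqs [Tab 5 nE 11 (Eq (Var 5) (Var 3)), Tab 5 nE 12 (Num 0), PROJ 11 12, Fr 7 nE STEP]"
text \<open>Signed entries are compared with the negative parts moved to the other side, and both
  sides of the norm test carry the factor \<open>fact n\<close> of the projection.\<close>

definition TEST :: cm where
  "TEST = sqs [Tab 5 nE 17 (Leq (Plus (Rd 11 (Var 4)) (Rd 12 (Var 5))) (Plus (Rd 11 (Var 5)) (Rd 12 (Var 4)))),
     Tab 5 nE 18 (Num 0), Tab 5 nE 21 (Rd 17 (Var 5)), PROJ 17 18,
     Cond (Leq (Mul (Num D) (Mul nE (Rd 0 (Num 5)))) (Mul (Num Gam) L1e)) (Tab 5 nE 22 (Rd 21 (Var 5)))]"
text \<open>The indicator of the set found becomes the last binary digit of the label, so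
  \<open>j\<close> rounds starting from 0 give labels below \<open>2 ^ j\<close>. If no set passes,
  the labels are just doubled.\<close>

definition SEARCH :: cm where
  "SEARCH = sqs [Tab 5 nE 22 (Num 0), Fr 3 nE (Sq ITER (Fr 4 nE TEST)),
     Tab 5 nE 9 (Plus (Rd 22 (Var 5)) (Mul (Num 2) (Rd 9 (Var 5))))]"

lemma fv_prg [simp]:
  "x \<notin> fv l ==> x \<notin> fv w ==> x \<notin> fv (NBe l w)"
  "x \<notin> fv c ==> x \<notin> fv w ==> x \<notin> fv u ==> x \<notin> fv (MTe c w u)"
  "x \<notin> fv l ==> x \<notin> fv c ==> x \<notin> fv w ==> x \<notin> fv (MMe l c w)"
  "x \<notin> fv l ==> x \<notin> fv c ==> x \<notin> fv (Me a l c)"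
  apply (auto simp: NBe_def)[1]
  apply (simp add: MTe_def)
  apply (cases "x = 60"; simp add: MMe_def NBe_def MTe_def)
  apply (cases "x = 61"; cases "x = 60"; simp add: Me_def MMe_def NBe_def MTe_def)
  done

lemma rds_prg [simp]:
  "x \<notin> rds l ==> x \<notin> rds w ==> x ~= 4 ==> x \<notin> rds (NBe l w)"
  "x \<notin> rds c ==> x \<notin> rds w ==> x \<notin> rds u ==> x \<notin> rds (MTe c w u)"
  "x \<notin> rds l ==> x \<notin> rds c ==> x \<notin> rds w ==> x ~= 4 ==> x ~= 6 ==> x \<notin> rds (MMe l c w)"
  "x \<notin> rds l ==> x \<notin> rds c ==> x ~= a ==> x ~= 4 ==> x ~= 6 ==> x \<notin> rds (Me a l c)"
  by (simp_all add: NBe_def MTe_def MMe_def Me_def)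

lemma rds_TOPe: "x \<notin> {0, 4, 6, a} ==> x \<notin> rds (TOPe a)"
  by (simp add: TOPe_def)

lemma prg_wrs [simp]: "wrs STEP = {10, 11, 12, 13, 14, 15, 16}" "wrs ITER = {10, 11, 12, 13, 14, 15, 16}"
  "wrs TEST = {10, 15, 16, 17, 18, 21, 22}" "wrs SEARCH = {9, 10, 11, 12, 13, 14, 15, 16, 17, 18, 21, 22}"
  by (auto simp: STEP_def ITER_def TEST_def SEARCH_def)

end

locale dec = prg D kap q0 tt Gam MTp + reg n D nbf lam kap K "%l c w. real (mmv kap D q0 MTp tt nbf Y l c w)"
  for D kap q0 tt Gam :: nat and MTp and n nbf and lam :: real and K and Y :: "nat => nat" +
  fixes X :: nat
  assumes X: "X > 0" "n <= X" "D <= X" "kap <= X" "q0 <= X" "Gam <= X" "n > 1"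
begin

section \<open>The search program performs power iteration\<close>

abbreviation "mt \<equiv> mtv kap D q0 MTp"
abbreviation "mf \<equiv> mmv kap D q0 MTp tt nbf Y"

definition st :: "store => bool" where
  "st sg \<longleftrightarrow> stv n D nbf sg & (\<forall>r<n. sg 6 r = Y r)"

lemma st_simps: "st sg ==> sg 0 (Suc 0) = n" "st sg ==> sg 0 5 = fact n"
  "st sg ==> l < n ==> w < D ==> sg 4 (D * l + w) = nbf w l"
  "st sg ==> r < n ==> sg 6 r = Y r"
  by (auto simp: st_def stv_def)

lemma st_cong: "sg' 0 = sg 0 ==> sg' 4 = sg 4 ==> sg' 6 = sg 6 ==> st sg' = st sg"
  by (simp add: st_def stv_def)

lemma Xs [simp]: "min X n = n" "min X D = D" "min X kap = kap" "min X q0 = q0" "min X Gam = Gam" "min X (Suc 0) = Suc 0"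
  using X by auto

lemma mt_le: "mt c w u <= 1" by (simp add: mtv_def)
lemma mf_le: "mf l c w <= 1" by (simp add: mmv_def mtv_def)
lemma min_mf [simp]: "min X (mf l c w) = mf l c w" "min X (mt c w u) = mt c w u"
  using X mf_le[of l c w] mt_le[of c w u] by auto

lemma ev_NBe [simp]: "st sg ==> ev X y l et sg < n ==> ev X y w et sg < D ==> 99 \<notin> fv l ==>
    ev X y (NBe l w) et sg = nbf (ev X y w et sg) (ev X y l et sg)"
  by (simp add: NBe_def st_simps)

lemma ev_MTe [simp]: "ev X y (MTe c w u) et sg = mt (ev X y c et sg) (ev X y w et sg) (ev X y u et sg)"
  if "99 \<notin> fv w" "99 \<notin> fv u"
  unfolding MTe_def using X that by (simp add: mtv_def)

lemma ev_MMe [simp]: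
  assumes s: "st sg" and l: "ev X y l et sg < n" and w: "ev X y w et sg < D"
    and fv: "60 \<notin> fv l" "60 \<notin> fv c" "99 \<notin> fv l" "99 \<notin> fv c" "99 \<notin> fv w"
  shows "ev X y (MMe l c w) et sg = mf (ev X y l et sg) (ev X y c et sg) (ev X y w et sg)"
proof -
  have "(\<Sum>v<D. ev X y (MTe c (Var 60) (Rd 6 (NBe l (Var 60)))) (et(60 := v)) sg)
    = (\<Sum>v<D. mt (ev X y c et sg) v (Y (nbf v (ev X y l et sg))))"
    by (rule sum.cong) (use assms in \<open>simp_all add: ev_upd st_simps nbf_less\<close>)
  then show ?thesis unfolding MMe_def using assms by (simp add: mmv_def st_simps nbf_less)
qed

definition Mn :: "(nat => nat) => nat => nat => nat" where
  "Mn x l c = (\<Sum>w<D. mf l c w * x (nbf w l))"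

lemma ev_Me [simp]:
  assumes "st sg" "ev X y l et sg < n" and fv: "60 \<notin> fv l" "60 \<notin> fv c" "61 \<notin> fv l" "61 \<notin> fv c" "99 \<notin> fv l" "99 \<notin> fv c"
  shows "ev X y (Me a l c) et sg = Mn (sg a) (ev X y l et sg) (ev X y c et sg)"
  unfolding Me_def Mn_def using assms by (auto simp: ev_upd intro!: sum.cong)

lemma ev_TOPe:
  assumes "st sg"
  shows "ev X y (TOPe a) et sg = (\<Sum>l<n. \<Sum>w<D. \<Sum>c<kap. (if nbf w l = et 5 then mf l c w * Mn (sg a) l c else 0))"
  unfolding TOPe_def using assms st_simps(1)[OF assms] by (auto intro!: sum.cong)

lemma M_vl: "M (vl sg p m) l c = real (Mn (sg p) l c) - real (Mn (sg m) l c)"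
  by (simp add: M_def vl_def Mn_def right_diff_distrib sum_subtractf)

lemma M_ext: "l < n ==> (\<And>r. r < n ==> x r = x' r) ==> M x l c = M x' l c"
  by (auto simp: M_def nbf_less intro!: sum.cong)

lemma MT_ext: "(\<And>l c. l < n ==> z l c = z' l c) ==> MT z r = MT z' r"
  unfolding MT_def by (intro sum.cong refl) auto

lemma Pr_ext: "r < n ==> (\<And>r. r < n ==> x r = x' r) ==> Pr lab x r = Pr lab x' r"
  unfolding Pr_def av_def by (auto simp: cl_def intro!: sum.cong arg_cong2[of _ _ _ _ "(/)"])

lemma Pr_scale: "Pr lab (%r. a * x r) r = a * Pr lab x r"
  by (simp add: Pr_def av_def sum_distrib_left[symmetric] right_diff_distrib)

lemma MT_scale: "MT (%l c. a * z l c) r = a * MT z r"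
  unfolding MT_def sum_distrib_left by (intro sum.cong refl) auto

lemma M_scale: "M (%r. a * x r) l c = a * M x l c"
  by (simp add: M_def sum_distrib_left mult_ac)

lemma Pr_Pr: "r < n ==> Pr lab (Pr lab x) r = Pr lab x r"
  using av_Pr[of r lab x] by (simp add: Pr_def[of lab "Pr lab x"])

lemma vl_PROJ:
  assumes s: "st sg" and pm: "p ~= m" "p \<notin> {0, 9, 10, 15, 16}" "m \<notin> {0, 9, 10, 15, 16}" and r: "r < n"
  shows "vl (run X y (PROJ p m) et sg) p m r = fact n * Pr (sg 9) (vl sg p m) r"
proof -
  let ?A = "%p. \<Sum>s<n. if sg 9 s = sg 9 r then sg p s else 0"
  let ?s = "card {s. s < n & sg 9 s = sg 9 r}"
  have n: "sg 0 (Suc 0) = n" using s by (simp add: st_simps)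
  note P = run_PROJ_nat[of sg n X p m r, OF n X(2) X(1) pm r, unfolded n]
  have s0: "?s > 0" using r by (auto simp: card_gt_0_iff)
  have sn: "?s <= n" using card_mono[of "{..<n}" "{s. s < n & sg 9 s = sg 9 r}"] by auto
  have "?s * pf ?s n = fact n" using pf_fact[OF s0, of n] sn by simp
  then have "real ?s * real (pf ?s n) = fact n" by (metis (no_types) of_nat_mult of_nat_fact)
  then have f: "real (pf ?s n) = fact n / real ?s" using s0 by (intro eq_divide_imp) (use r in \<open>auto simp: mult.commute\<close>)
  have A: "real (?A p) = (\<Sum>s\<in>cl (sg 9) r. real (sg p s))" for p
  proof -
    have "cl (sg 9) r = {..<n} \<inter> {s. sg 9 s = sg 9 r}" by (auto simp: cl_def)
    then have "(\<Sum>s\<in>cl (sg 9) r. real (sg p s)) = (\<Sum>s<n. if sg 9 s = sg 9 r then real (sg p s) else 0)"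
      by (simp add: sum.inter_restrict)
    then show ?thesis by (simp add: of_nat_sum if_distrib cong: if_cong)
  qed
  have av: "av (sg 9) (vl sg p m) r = (real (?A p) - real (?A m)) / real ?s"
    unfolding A by (simp add: av_def vl_def sum_subtractf cl_def)
  have "vl (run X y (PROJ p m) et sg) p m r
      = fact n * (real (sg p r) - real (sg m r)) - real (pf ?s n) * (real (?A p) - real (?A m))"
    unfolding vl_def P by (simp del: of_nat_sum add: algebra_simps)
  also have "... = fact n * Pr (sg 9) (vl sg p m) r"
    unfolding f Pr_def av by (simp del: of_nat_sum add: vl_def algebra_simps diff_divide_distrib)
  finally show ?thesis .
qed

lemma vl_STEP:
  assumes s: "st sg" and r: "r < n"
  shows "vl (run X y STEP et sg) 11 12 r = fact n * Pr (sg 9) (MT (M (vl sg 11 12))) r"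
proof -
  define sg1 where "sg1 = run X y (Tab 5 nE 13 (TOPe 11)) et sg"
  define sg2 where "sg2 = run X y (Tab 5 nE 14 (TOPe 12)) et sg1"
  define sg3 where "sg3 = run X y (Tab 5 nE 11 (Rd 13 (Var 5))) et sg2"
  define sg4 where "sg4 = run X y (Tab 5 nE 12 (Rd 14 (Var 5))) et sg3"
  have f1: "sg1 a = sg a" if "a ~= 13" for a using that by (simp add: sg1_def run_frame)
  have f2: "sg2 a = sg1 a" if "a ~= 14" for a using that by (simp add: sg2_def run_frame)
  have f3: "sg3 a = sg2 a" if "a ~= 11" for a using that by (simp add: sg3_def run_frame)
  have f4: "sg4 a = sg3 a" if "a ~= 12" for a using that by (simp add: sg4_def run_frame)
  have s1: "st sg1" and s4: "st sg4" using s by (simp_all add: st_cong[of sg1 sg] st_cong[of sg4 sg] f1 f2 f3 f4)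
  have rd: "13 \<notin> rds (TOPe 11)" "14 \<notin> rds (TOPe 12)" by (simp_all add: rds_TOPe)
  let ?T = "%a r. \<Sum>l<n. \<Sum>w<D. \<Sum>c<kap. (if nbf w l = r then mf l c w * Mn (sg a) l c else 0)"
  have v1: "sg1 13 r = ?T 11 r" if "r < n" for r
    unfolding sg1_def using that st_simps(1)[OF s] by (simp add: Tab_val[OF rd(1)] ev_TOPe[OF s])
  have v2: "sg2 14 r = ?T 12 r" if "r < n" for r
    unfolding sg2_def using that st_simps(1)[OF s1] by (simp add: Tab_val[OF rd(2)] ev_TOPe[OF s1] f1 cong: if_cong)
  have v3: "sg3 11 r = ?T 11 r" if "r < n" for r
    unfolding sg3_def using that st_simps(1)[OF s] by (simp add: Tab_val f1 f2 v1)
  have v4: "sg4 12 r = ?T 12 r" if "r < n" for r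
    unfolding sg4_def using that st_simps(1)[OF s] by (simp add: Tab_val f1 f2 f3 v2)
  have "vl sg4 11 12 r = MT (M (vl sg 11 12)) r" if r: "r < n" for r
  proof -
    have "vl sg4 11 12 r = real (?T 11 r) - real (?T 12 r)" unfolding vl_def using r by (simp add: f4 v3 v4 del: of_nat_sum)
    also have "... = MT (M (vl sg 11 12)) r"
      unfolding MT_def M_vl of_nat_sum sum_subtractf[symmetric] by (intro sum.cong refl) (auto simp: right_diff_distrib)
    finally show ?thesis .
  qed
  moreover have "sg4 9 = sg 9" by (simp add: f1 f2 f3 f4)
  ultimately have "vl (run X y (PROJ 11 12) et sg4) 11 12 r = fact n * Pr (sg 9) (MT (M (vl sg 11 12))) r"
    using vl_PROJ[OF s4, of 11 12 r] r by (simp, intro Pr_ext) auto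
  moreover have "run X y STEP et sg = run X y (PROJ 11 12) et sg4"
    by (simp add: STEP_def sg4_def sg3_def sg2_def sg1_def)
  ultimately show ?thesis by simp
qed

text \<open>The scaling factors of all projections accumulate in \<open>g\<close>; the level sets
  taken afterwards do not notice a positive factor.\<close>

lemma vl_ITER:
  assumes s: "st sg" and r0: "r0 = et 3"
  shows "\<exists>g>0. \<forall>r<n. vl (run X y ITER et sg) 11 12 r = g * (Bop (sg 9) ^^ n) (ind r0) r"
proof -
  define sg1 where "sg1 = run X y (Tab 5 nE 11 (Eq (Var 5) (Var 3))) et sg"
  define sg2 where "sg2 = run X y (Tab 5 nE 12 (Num 0)) et sg1"
  define sg3 where "sg3 = run X y (PROJ 11 12) et sg2"
  have f1: "sg1 a = sg a" if "a ~= 11" for a using that by (simp add: sg1_def run_frame)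
  have f2: "sg2 a = sg1 a" if "a ~= 12" for a using that by (simp add: sg2_def run_frame)
  have f3: "sg3 a = sg2 a" if "a \<notin> {11, 12, 10, 15, 16}" for a using that by (simp add: sg3_def run_frame)
  have s2: "st sg2" and s3: "st sg3" using s by (simp_all add: st_cong[of sg2 sg] st_cong[of sg3 sg] f1 f2 f3)
  define lab where "lab = sg 9"
  have l3: "sg3 9 = lab" "sg2 9 = lab" by (simp_all add: f1 f2 f3 lab_def)
  have v2: "vl sg2 11 12 r = ind r0 r" if r: "r < n" for r
  proof -
    have "sg2 12 r = 0" unfolding sg2_def using r st_simps(1)[OF s] by (simp add: Tab_val f1)
    moreover have "sg2 11 r = (if r = r0 then 1 else 0)" unfolding f2[of 11, simplified] sg1_def using r st_simps(1)[OF s] by (simp add: Tab_val r0)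
    ultimately show ?thesis by (simp add: vl_def ind_def)
  qed
  define I where "I j sg' \<longleftrightarrow> st sg' & sg' 9 = lab & (\<exists>g>0. \<forall>r<n. vl sg' 11 12 r = g * Pr lab ((Bop lab ^^ j) (ind r0)) r)" for j :: nat and sg'
  have "I n (run X y (Fr 7 nE STEP) et sg3)"
  proof (rule Fr_inv[where I = I])
    show "n = min X (ev X y nE et sg3)" using s3 by (simp add: st_simps)
    have "vl sg3 11 12 r = fact n * Pr lab (ind r0) r" if r: "r < n" for r
    proof -
      have "vl sg3 11 12 r = fact n * Pr lab (vl sg2 11 12) r" unfolding sg3_def using vl_PROJ[OF s2, of 11 12 r] r l3 by simp
      also have "Pr lab (vl sg2 11 12) r = Pr lab (ind r0) r" by (rule Pr_ext[OF r v2])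
      finally show ?thesis .
    qed
    then show "I 0 sg3" unfolding I_def using s3 l3 by (auto intro!: exI[of _ "fact n"])
    fix j sg' assume I: "I j sg'"
    then obtain g where g: "g > 0" "\<And>r. r < n ==> vl sg' 11 12 r = g * Pr lab ((Bop lab ^^ j) (ind r0)) r"
      and st': "st sg'" "sg' 9 = lab" by (auto simp: I_def)
    let ?s = "run X y STEP (et(7 := j)) sg'"
    let ?x = "(Bop lab ^^ j) (ind r0)"
    have fr: "?s a = sg' a" if "a \<notin> {10, 11, 12, 13, 14, 15, 16}" for a using that by (simp add: run_frame)
    have "vl ?s 11 12 r = (fact n * g) * Pr lab ((Bop lab ^^ Suc j) (ind r0)) r" if r: "r < n" for r
    proof -
      have "vl ?s 11 12 r = fact n * Pr lab (MT (M (vl sg' 11 12))) r" using vl_STEP[OF st'(1) r] st'(2) by simp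
      also have "Pr lab (MT (M (vl sg' 11 12))) r = Pr lab (%r. g * MT (M (Pr lab ?x)) r) r"
      proof (rule Pr_ext[OF r])
        fix r
        have "MT (M (vl sg' 11 12)) r = MT (%l c. g * M (Pr lab ?x) l c) r"
          by (rule MT_ext) (simp add: M_scale[symmetric] g(2) cong: M_ext)
        then show "MT (M (vl sg' 11 12)) r = g * MT (M (Pr lab ?x)) r" by (simp add: MT_scale)
      qed
      also have "... = g * Bop lab ?x r" by (simp add: Pr_scale Bop_def)
      also have "Bop lab ?x r = Pr lab (Bop lab ?x) r" unfolding Bop_def by (rule Pr_Pr[OF r, symmetric])
      finally show ?thesis by (simp only: funpow.simps o_apply mult.assoc)
    qed
    then show "I (Suc j) ?s" unfolding I_def using st' g(1) by (auto simp: fr st_cong[of ?s sg'] intro!: exI[of _ "fact n * g"])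
  qed
  moreover have "run X y ITER et sg = run X y (Fr 7 nE STEP) et sg3"
    by (simp add: ITER_def sg3_def sg2_def sg1_def)
  ultimately obtain g where g: "g > 0" "\<And>r. r < n ==> vl (run X y ITER et sg) 11 12 r = g * Pr lab ((Bop lab ^^ n) (ind r0)) r"
    by (auto simp: I_def)
  have "Pr lab ((Bop lab ^^ n) (ind r0)) r = (Bop lab ^^ n) (ind r0) r" if "r < n" for r
  proof -
    obtain k where "n = Suc k" using n0 by (cases n) auto
    then have "(Bop lab ^^ n) (ind r0) = Bop lab ((Bop lab ^^ k) (ind r0))" by (simp only: funpow.simps o_apply)
    then show ?thesis using Pr_Pr[OF that, of lab "MT (M (Pr lab ((Bop lab ^^ k) (ind r0))))"] by (simp only: Bop_def)
  qed
  then show ?thesis using g by (auto simp: lab_def)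
qed

definition heavy :: "(nat => nat) => (nat => real) => bool" where
  "heavy lab S \<longleftrightarrow> real D * n <= Gam * mone (Pr lab S)"

lemma ev_L1e:
  assumes s: "st sg" and v: "\<And>r. r < n ==> vl sg 17 18 r = fact n * x r"
  shows "real (ev X y L1e et sg) = fact n * mone x"
proof -
  have "ev X y L1e et sg = (\<Sum>l<n. \<Sum>c<kap. (Mn (sg 17) l c - Mn (sg 18) l c) + (Mn (sg 18) l c - Mn (sg 17) l c))"
    unfolding L1e_def using s st_simps(1)[OF s] by (auto intro!: sum.cong)
  then have "real (ev X y L1e et sg) = (\<Sum>l<n. \<Sum>c<kap. real ((Mn (sg 17) l c - Mn (sg 18) l c) + (Mn (sg 18) l c - Mn (sg 17) l c)))"
    by (simp only: of_nat_sum)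
  also have "... = (\<Sum>l<n. \<Sum>c<kap. fact n * \<bar>M x l c\<bar>)"
  proof (intro sum.cong refl)
    fix l c assume l: "l \<in> {..<n}"
    have "real ((a - b) + (b - a)) = \<bar>real a - real b\<bar>" for a b :: nat by linarith
    then have "real ((Mn (sg 17) l c - Mn (sg 18) l c) + (Mn (sg 18) l c - Mn (sg 17) l c)) = \<bar>M (vl sg 17 18) l c\<bar>"
      by (simp only: M_vl)
    also have "M (vl sg 17 18) l c = M (%r. fact n * x r) l c" using l v by (intro M_ext) auto
    finally show "real ((Mn (sg 17) l c - Mn (sg 18) l c) + (Mn (sg 18) l c - Mn (sg 17) l c)) = fact n * \<bar>M x l c\<bar>"
      by (simp add: M_scale abs_mult)
  qed
  finally show ?thesis by (simp add: mone_def sum_distrib_left)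
qed

lemma mone_ext: "(\<And>r. r < n ==> x r = x' r) ==> mone x = mone x'"
  unfolding mone_def by (intro sum.cong refl arg_cong[of _ _ abs] M_ext) auto

lemma heavy_ext: "(\<And>r. r < n ==> S r = S' r) ==> heavy lab S = heavy lab S'"
  unfolding heavy_def using mone_ext[of "Pr lab S" "Pr lab S'"] by (simp cong: Pr_ext)

lemma run_TEST:
  assumes s: "st sg" and g: "g > 0" "\<And>r. r < n ==> vl sg 11 12 r = g * x r" and r1: "et 4 < n"
  shows "if heavy (sg 9) (lev x (et 4)) then \<forall>r<n. real (run X y TEST et sg 22 r) = lev x (et 4) r
    else run X y TEST et sg 22 = sg 22"
proof -
  let ?L = "lev x (et 4)"
  define sg1 where "sg1 = run X y (Tab 5 nE 17 (Leq (Plus (Rd 11 (Var 4)) (Rd 12 (Var 5))) (Plus (Rd 11 (Var 5)) (Rd 12 (Var 4))))) et sg"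
  define sg2 where "sg2 = run X y (Tab 5 nE 18 (Num 0)) et sg1"
  define sg3 where "sg3 = run X y (Tab 5 nE 21 (Rd 17 (Var 5))) et sg2"
  define sg4 where "sg4 = run X y (PROJ 17 18) et sg3"
  define E where "E = Leq (Mul (Num D) (Mul nE (Rd 0 (Num 5)))) (Mul (Num Gam) L1e)"
  have run: "run X y TEST et sg = run X y (Cond E (Tab 5 nE 22 (Rd 21 (Var 5)))) et sg4"
    by (simp add: TEST_def sg4_def sg3_def sg2_def sg1_def E_def)
  have f1: "sg1 a = sg a" if "a ~= 17" for a using that by (simp add: sg1_def run_frame)
  have f2: "sg2 a = sg1 a" if "a ~= 18" for a using that by (simp add: sg2_def run_frame)
  have f3: "sg3 a = sg2 a" if "a ~= 21" for a using that by (simp add: sg3_def run_frame)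
  have f4: "sg4 a = sg3 a" if "a \<notin> {17, 18, 10, 15, 16}" for a using that by (simp add: sg4_def run_frame)
  have s3: "st sg3" and s4: "st sg4" using s by (simp_all add: st_cong[of sg3 sg] st_cong[of sg4 sg] f1 f2 f3 f4)
  have v1: "real (sg1 17 r) = ?L r" if r: "r < n" for r
  proof -
    have "(sg 11 (et 4) + sg 12 r <= sg 11 r + sg 12 (et 4)) \<longleftrightarrow> vl sg 11 12 (et 4) <= vl sg 11 12 r"
      unfolding vl_def by linarith
    also have "... \<longleftrightarrow> x (et 4) <= x r" using g r r1 by simp
    finally have "(sg 11 (et 4) + sg 12 r <= sg 11 r + sg 12 (et 4)) \<longleftrightarrow> x (et 4) <= x r" .
    then show ?thesis unfolding sg1_def using r st_simps(1)[OF s] by (simp add: Tab_val lev_def)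
  qed
  have v2: "sg2 18 r = 0" if r: "r < n" for r
    unfolding sg2_def using r st_simps(1)[OF s] by (simp add: Tab_val f1)
  have v3: "sg3 21 r = sg1 17 r" if r: "r < n" for r
    unfolding sg3_def using r st_simps(1)[OF s] by (simp add: Tab_val f1 f2)
  have v4: "vl sg4 17 18 r = fact n * Pr (sg 9) ?L r" if r: "r < n" for r
  proof -
    have "vl sg4 17 18 r = fact n * Pr (sg 9) (vl sg3 17 18) r"
      unfolding sg4_def using vl_PROJ[OF s3, of 17 18 r] r by (simp add: f1 f2 f3)
    also have "Pr (sg 9) (vl sg3 17 18) r = Pr (sg 9) ?L r"
      by (rule Pr_ext[OF r]) (simp add: vl_def f1 f2 f3 v1 v2)
    finally show ?thesis .
  qed
  have "ev X y E et sg4 = (if D * (n * fact n) <= Gam * ev X y L1e et sg4 then 1 else 0)"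
    unfolding E_def using st_simps(1,2)[OF s4] by (simp add: L1e_def)
  moreover have "D * (n * fact n) <= Gam * ev X y L1e et sg4 \<longleftrightarrow> heavy (sg 9) ?L"
  proof -
    have "D * (n * fact n) <= Gam * ev X y L1e et sg4 \<longleftrightarrow> real (D * (n * fact n)) <= real (Gam * ev X y L1e et sg4)"
      by (rule of_nat_le_iff[symmetric])
    also have "... \<longleftrightarrow> fact n * (real D * n) <= fact n * (Gam * mone (Pr (sg 9) ?L))"
      by (simp add: ev_L1e[OF s4 v4] mult_ac)
    also have "... \<longleftrightarrow> heavy (sg 9) ?L" unfolding heavy_def by (rule mult_le_cancel_left_pos) simp
    finally show ?thesis .
  qed
  ultimately have E: "ev X y E et sg4 = (if heavy (sg 9) ?L then 1 else 0)" by simp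
  show ?thesis
  proof (cases "heavy (sg 9) ?L")
    case True
    then have r: "run X y TEST et sg = run X y (Tab 5 nE 22 (Rd 21 (Var 5))) (et(97 := 0)) sg4"
      unfolding run using E X(1) by (simp add: run_Cond(1))
    have "real (run X y TEST et sg 22 r) = ?L r" if "r < n" for r
      unfolding r using that st_simps(1)[OF s4] by (simp add: Tab_val f4 v3 v1)
    then show ?thesis using True by simp
  next
    case False
    then have r: "run X y TEST et sg = sg4" unfolding run using E by (simp add: run_Cond(2))
    show ?thesis using False by (simp add: r f1 f2 f3 f4)
  qed
qed

lemma run_SEARCH:
  assumes s: "st sg" and sg'_def: "sg' = run X y SEARCH et sg"
  shows "\<exists>S. (\<forall>r<n. S r <= 1 & sg' 9 r = S r + 2 * sg 9 r) &
    ((\<exists>r<n. \<exists>s<n. heavy (sg 9) (lev ((Bop (sg 9) ^^ n) (ind r)) s)) --> heavy (sg 9) (%r. real (S r)))"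
proof -
  define lab where "lab = sg 9"
  define x where "x r0 = (Bop lab ^^ n) (ind r0)" for r0
  define sg1 where "sg1 = run X y (Tab 5 nE 22 (Num 0)) et sg"
  define sg2 where "sg2 = run X y (Fr 3 nE (Sq ITER (Fr 4 nE TEST))) et sg1"
  have f1: "sg1 a = sg a" if "a ~= 22" for a using that by (simp add: sg1_def run_frame)
  have f2: "sg2 a = sg1 a" if "a \<notin> {10, 11, 12, 13, 14, 15, 16, 17, 18, 21, 22}" for a unfolding sg2_def by (rule run_frame) (use that in simp)
  have v1: "sg1 22 r = 0" if r: "r < n" for r
    unfolding sg1_def using r st_simps(1)[OF s] by (simp add: Tab_val)
  define J where "J B sg' \<longleftrightarrow> st sg' & sg' 9 = lab & (\<forall>r<n. sg' 22 r <= 1) &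
     (B --> heavy lab (%r. real (sg' 22 r)))" for B sg'
  \<comment> \<open>Array 22 keeps the last set that passed, so success is monotone in both
    loops.\<close>
  define bad where "bad r0 k \<longleftrightarrow> (\<exists>r1<k. heavy lab (lev (x r0) r1))" for r0 k
  have "J (\<exists>r0<n. bad r0 n) sg2"
    unfolding sg2_def
  proof (rule Fr_inv[where I = "%k. J (\<exists>r0<k. bad r0 n)"])
    show "n = min X (ev X y nE et sg1)" using s by (simp add: f1 st_simps)
    show "J (\<exists>r0<0. bad r0 n) sg1" using s by (simp add: J_def v1 st_cong[of sg1 sg] f1 lab_def)
    fix r0 sg' assume r0: "r0 < n" and J0: "J (\<exists>r<r0. bad r n) sg'"
    define ta where "ta = run X y ITER (et(3 := r0)) sg'"
    have ft: "ta a = sg' a" if "a \<notin> {10, 11, 12, 13, 14, 15, 16}" for a using that by (simp add: ta_def run_frame)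
    have st': "st sg'" "sg' 9 = lab" using J0 by (auto simp: J_def)
    obtain g where g: "g > 0" "\<And>r. r < n ==> vl ta 11 12 r = g * x r0 r"
      using vl_ITER[OF st'(1), of r0 "et(3 := r0)" y] st'(2) by (auto simp: ta_def x_def)
    define J' where "J' k sg'' \<longleftrightarrow> J ((\<exists>r<r0. bad r n) \<or> bad r0 k) sg'' & sg'' 11 = ta 11 & sg'' 12 = ta 12" for k sg''
    have "J' n (run X y (Fr 4 nE TEST) (et(3 := r0)) ta)"
    proof (rule Fr_inv[where I = J'])
      show "n = min X (ev X y nE (et(3 := r0)) ta)" using st' by (simp add: ft st_simps)
      show "J' 0 ta" using J0 by (auto simp: J'_def J_def ft st_cong[of ta sg'] bad_def)
      fix r1 sg'' assume r1: "r1 < n" and J1: "J' r1 sg''"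
      let ?et = "et(3 := r0, 4 := r1)"
      let ?s = "run X y TEST ?et sg''"
      have st'': "st sg''" "sg'' 9 = lab" "sg'' 11 = ta 11" "sg'' 12 = ta 12" using J1 by (auto simp: J'_def J_def)
      have v: "vl sg'' 11 12 r = g * x r0 r" if "r < n" for r using g(2)[OF that] st'' by (simp add: vl_def)
      have fs: "?s a = sg'' a" if "a \<notin> {10, 15, 16, 17, 18, 21, 22}" for a using that by (simp add: run_frame)
      have T: "if heavy lab (lev (x r0) r1) then \<forall>r<n. real (?s 22 r) = lev (x r0) r1 r else ?s 22 = sg'' 22"
        using run_TEST[OF st''(1) g(1) v, of ?et y] r1 st''(2) by simp
      have "J ((\<exists>r<r0. bad r n) \<or> bad r0 (Suc r1)) ?s"
      proof (cases "heavy lab (lev (x r0) r1)")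
        case True
        then have T: "\<And>r. r < n ==> real (?s 22 r) = lev (x r0) r1 r" using T by simp
        have "heavy lab (%r. real (?s 22 r))" using heavy_ext[OF T] True by simp
        moreover have "?s 22 r <= 1" if "r < n" for r
        proof -
          have "real (?s 22 r) <= 1" using T[OF that] lev_01[of "x r0" r1 r] by simp
          then show ?thesis by linarith
        qed
        ultimately show ?thesis using st'' by (simp add: J_def fs st_cong[of ?s sg''])
      next
        case False
        then have "?s 22 = sg'' 22" "bad r0 (Suc r1) = bad r0 r1" using T by (auto simp: bad_def less_Suc_eq)
        then show ?thesis using J1 by (simp add: J'_def J_def fs st_cong[of ?s sg''])
      qed
      then show "J' (Suc r1) ?s" using st'' by (simp add: J'_def fs)
    qed
    then show "J (\<exists>r<Suc r0. bad r n) (run X y (Sq ITER (Fr 4 nE TEST)) (et(3 := r0)) sg')"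
      by (simp add: J'_def ta_def less_Suc_eq ex_disj_distrib conj_disj_distribR)
  qed
  moreover have "sg' = run X y (Tab 5 nE 9 (Plus (Rd 22 (Var 5)) (Mul (Num 2) (Rd 9 (Var 5))))) et sg2"
    by (simp add: sg'_def SEARCH_def sg2_def sg1_def)
  moreover have "min X 2 = 2" using X by simp
  then have "run X y (Tab 5 nE 9 (Plus (Rd 22 (Var 5)) (Mul (Num 2) (Rd 9 (Var 5))))) et sg2 9 r = sg2 22 r + 2 * sg 9 r" if "r < n" for r
    by (subst run_Tab[OF refl, where f = "%r. sg2 22 r + 2 * sg 9 r"]) (use that s in \<open>simp_all add: f1 f2 st_simps\<close>)
  ultimately show ?thesis
    by (intro exI[of _ "sg2 22"]) (auto simp: J_def bad_def x_def lab_def)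
qed

end

section \<open>Decoding from densities\<close>

locale prg2 = prg D kap q0 tt Gam MTp for D kap q0 tt Gam :: nat and MTp +
  fixes psi :: "nat => nat => nat set" and thr t0 LB :: nat
begin

definition EQe :: "ex => ex => ex => ex" where
  "EQe c c' w = sel kap c (%i. sel kap c' (%k. sel D w (%j. Num (if psi i j = psi k j then 1 else 0))))"
text \<open>A search for an index is a sum of all indices with the property. With several such
  indices the value is meaningless, but \<open>VALe\<close> later checks whatever has been
  decoded.\<close>

definition CIe :: "(nat => nat) => ex" where
  "CIe AL = Summ 68 (Num kap) (Mul (Var 68) (Leq (Num (Suc thr)) (Summ 61 (Num D)
     (Mul (MMe (Var 5) (Var 68) (Var 61)) (sel LB (Rd 9 (NBe (Var 5) (Var 61))) (%p. Num (AL p)))))))"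
definition CRe :: ex where
  "CRe = Summ 68 (Num kap) (Mul (Var 68) (Leq (Num t0) (Summ 62 nE (Summ 63 (Num D)
     (Mul (Eq (NBe (Var 62) (Var 63)) (Var 5)) (EQe (Rd 25 (Var 62)) (Var 68) (Var 63)))))))"
definition CLe :: ex where
  "CLe = Summ 68 (Num kap) (Mul (Var 68) (Leq (Num t0) (Summ 63 (Num D)
     (EQe (Var 68) (Rd 26 (NBe (Var 5) (Var 63))) (Var 63)))))"
definition VALe :: ex where
  "VALe = Leq (Mul (Num D) nE) (Summ 62 nE (Summ 63 (Num D)
     (EQe (Rd 25 (Var 62)) (Rd 26 (NBe (Var 62) (Var 63))) (Var 63))))"
definition CWe :: ex where
  "CWe = Summ 69 (Num q0) (Mul (Var 69) (Leq (Num D) (Summ 62 nE (Summ 63 (Num D)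
     (Mul (Eq (NBe (Var 62) (Var 63)) (Var 5)) (MTe (Rd 25 (Var 62)) (Var 63) (Var 69)))))))"
definition ZEM :: cm where "ZEM = Sq (Tab 5 nE 26 CRe) (Tab 5 nE 25 CLe)"
definition slotE :: "nat => ex" where "slotE sl = Plus (Mul (Num q0) (Var 2)) (Num sl)"
definition DEC :: "nat => (nat => nat) => cm" where
  "DEC sl AL = sqs [Tab 5 nE 25 (CIe AL), Fr 7 (Var 1) ZEM, Wr 28 (slotE sl) VALe,
     Fr 5 nE (Wr 27 (Plus (Mul (slotE sl) (Var 1)) (Var 5)) CWe)]"

lemma fv_EQe [simp]: "x \<notin> fv c ==> x \<notin> fv c' ==> x \<notin> fv w ==> x \<notin> fv (EQe c c' w)"
  by (simp add: EQe_def)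
lemma rds_EQe [simp]: "x \<notin> rds c ==> x \<notin> rds c' ==> x \<notin> rds w ==> x \<notin> rds (EQe c c' w)"
  by (simp add: EQe_def)
lemma wrs_DEC [simp]: "wrs ZEM = {25, 26}" "wrs (DEC sl AL) = {25, 26, 27, 28}"
  by (auto simp: DEC_def ZEM_def)

definition eqf :: "nat => nat => nat => nat" where
  "eqf a c w = (if a < kap & c < kap & w < D & psi a w = psi c w then 1 else 0)"

text \<open>Here \<open>h\<close> is a transmitted component, with the outer symbols
  \<open>c\<close> and \<open>c'\<close> as witnesses: digit \<open>w\<close> of the symbol at a
  right vertex comes from the left vertex of which it is the neighbour number
  \<open>w\<close>.\<close>

definition core :: "nat => (nat => nat => nat) => (nat => nat) => (nat => nat) => (nat => nat) => bool" where
  "core n nbf c c' h \<longleftrightarrow> tanner n D nbf kap psi c c' & (\<forall>r<n. h r < q0) & (\<forall>l<n. \<forall>w<D. MTp (c l) w (h (nbf w l)))"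

end

lemma sum_unique:
  fixes P :: "nat => bool"
  assumes "c0 < k" "\<And>c. c < k ==> P c \<longleftrightarrow> c = c0"
  shows "(\<Sum>c<k. if P c then c else 0) = c0"
proof -
  have "(\<Sum>c<k. if P c then c else 0) = (\<Sum>c<k. if c = c0 then c0 else 0)" by (intro sum.cong) (use assms(2) in auto)
  then show ?thesis using assms(1) by simp
qed

lemma sum_full:
  fixes f :: "nat => nat"
  assumes "\<And>w. w < m ==> f w <= b" "b * m <= (\<Sum>w<m. f w)" "w < m"
  shows "f w = b"
proof (rule ccontr)
  assume "f w ~= b"
  then have "(\<Sum>w<m. f w) < (\<Sum>w<m. b)" using assms by (intro sum_strict_mono_ex1) (auto intro!: bexI[of _ w] le_neq_implies_less)
  then show False using assms(2) by (simp add: mult.commute)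
qed

locale dec2 = prg2 D kap q0 tt Gam MTp psi thr t0 LB + dec D kap q0 tt Gam MTp n nbf lam K Y X
  for D kap q0 tt Gam :: nat and MTp and psi :: "nat => nat => nat set" and thr t0 LB n nbf and lam :: real and K Y X +
  fixes e0 :: nat
  assumes dist: "\<And>c c'. c < kap ==> c' < kap ==> c ~= c' ==> card {w. w < D & psi c w = psi c' w} + (2 * e0 + 1) <= D"
    and t0: "t0 + e0 = D" and lamE: "8 * lam^2 <= (real (e0 + 1))^2"
    and Minj: "\<And>a u u'. (\<And>w. w < D ==> a w < kap) ==> u < q0 ==> u' < q0 ==>
       (\<And>w. w < D ==> MTp (a w) w u) ==> (\<And>w. w < D ==> MTp (a w) w u') ==> u = u'"
    and Msurj: "\<And>a. (\<And>w. w < D ==> a w < kap) ==> \<exists>u<q0. \<forall>w<D. MTp (a w) w u"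
begin

lemma ev_EQe [simp]: "ev X y (EQe c c' w) et sg = eqf (ev X y c et sg) (ev X y c' et sg) (ev X y w et sg)"
  if "99 \<notin> fv c'" "99 \<notin> fv w"
  unfolding EQe_def using X that by (simp add: eqf_def)

definition crf :: "(nat => nat) => nat => nat" where
  "crf f r = (\<Sum>c<kap. if t0 <= (\<Sum>l<n. \<Sum>w<D. if nbf w l = r then eqf (f l) c w else 0) then c else 0)"
definition clf :: "(nat => nat) => nat => nat" where
  "clf g l = (\<Sum>c<kap. if t0 <= (\<Sum>w<D. eqf c (g (nbf w l)) w) then c else 0)"
definition score :: "(nat => nat) => (nat => nat) => nat => nat => nat" where
  "score AL lab l c = (\<Sum>w<D. mf l c w * (if lab (nbf w l) < LB then AL (lab (nbf w l)) else 0))"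
definition cif :: "(nat => nat) => (nat => nat) => nat => nat" where
  "cif AL lab l = (\<Sum>c<kap. if thr < score AL lab l c then c else 0)"

lemma min_kap: "c < kap ==> min X c = c" "u < q0 ==> min X u = u"
  using X by auto

lemma ev_CIe: "st sg ==> et 5 < n ==> ev X y (CIe AL) et sg = cif AL (sg 9) (et 5)"
  unfolding CIe_def cif_def score_def using X by (auto simp: min_kap Suc_le_eq intro!: sum.cong cong: if_cong)

lemma ev_CRe: "st sg ==> ev X y CRe et sg = crf (sg 25) (et 5)"
proof -
  assume s: "st sg"
  have "(\<Sum>l<n. \<Sum>w<D. ev X y (Mul (Eq (NBe (Var 62) (Var 63)) (Var 5)) (EQe (Rd 25 (Var 62)) (Var 68) (Var 63))) (et(68 := c, 62 := l, 63 := w)) sg)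
     = (\<Sum>l<n. \<Sum>w<D. if nbf w l = et 5 then eqf (sg 25 l) c w else 0)" for c
    by (intro sum.cong refl) (use s in simp)
  then show ?thesis unfolding CRe_def crf_def using st_simps(1)[OF s] by (auto simp: min_kap intro!: sum.cong)
qed

lemma ev_CLe: "st sg ==> et 5 < n ==> ev X y CLe et sg = clf (sg 26) (et 5)"
proof -
  assume s: "st sg" and l: "et 5 < n"
  have "(\<Sum>w<D. ev X y (EQe (Var 68) (Rd 26 (NBe (Var 5) (Var 63))) (Var 63)) (et(68 := c, 63 := w)) sg)
     = (\<Sum>w<D. eqf c (sg 26 (nbf w (et 5))) w)" for c
    by (intro sum.cong refl) (use s l in simp)
  then show ?thesis unfolding CLe_def clf_def by (auto simp: min_kap intro!: sum.cong)
qed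

section \<open>Bipartite unique decoding\<close>

definition pv :: "nat => nat => nat" where "pv w r = inv_into {..<n} (nbf w) r"

lemma pv: "w < D ==> r < n ==> pv w r < n & nbf w (pv w r) = r"
  using nbf_bij[of w] unfolding pv_def bij_betw_def
  by (metis f_inv_into_f inv_into_into lessThan_iff)

lemma pv_eq: "w < D ==> r < n ==> l < n ==> nbf w l = r \<longleftrightarrow> l = pv w r"
  using pv[of w r] nbf_inj[of w] by (auto simp: inj_on_def)

lemma sum_edges:
  fixes f :: "nat => nat => 'b :: comm_monoid_add"
  assumes "r < n" shows "(\<Sum>l<n. \<Sum>w<D. if nbf w l = r then f l w else 0) = (\<Sum>w<D. f (pv w r) w)"
proof -
  have "(\<Sum>l<n. \<Sum>w<D. if nbf w l = r then f l w else 0) = (\<Sum>w<D. \<Sum>l<n. if nbf w l = r then f l w else 0)"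
    by (rule sum.swap)
  also have "... = (\<Sum>w<D. \<Sum>l<n. if l = pv w r then f (pv w r) w else 0)"
    by (intro sum.cong refl) (use assms pv_eq in auto)
  also have "... = (\<Sum>w<D. f (pv w r) w)"
    by (intro sum.cong refl) (use assms pv in auto)
  finally show ?thesis .
qed

lemma eqf_comm: "eqf a c w = eqf c a w" by (auto simp: eqf_def)

text \<open>Two codewords that both agree with \<open>a\<close> in at least \<open>D - e0\<close>
  positions agree with each other in \<open>D - 2 * e0\<close> of them, more than
  \<open>dist\<close> allows.\<close>

lemma nearest:
  assumes c0: "c0 < kap" and close: "D <= (\<Sum>w<D. eqf c0 (a w) w) + e0"
  shows "(\<Sum>c<kap. if t0 <= (\<Sum>w<D. eqf c (a w) w) then c else 0) = c0"
proof (rule sum_unique[OF c0])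
  fix c assume c: "c < kap"
  define W where "W c = {w. w < D & a w < kap & psi c w = psi (a w) w}" for c
  have cW: "(\<Sum>w<D. eqf c (a w) w) = card (W c)" if "c < kap" for c
  proof -
    have "(\<Sum>w<D. eqf c (a w) w) = (\<Sum>w<D. if w \<in> W c then 1 else 0)"
      by (intro sum.cong) (use that in \<open>auto simp: eqf_def W_def\<close>)
    also have "... = card ({..<D} \<inter> W c)" by (simp add: sum.If_cases)
    also have "{..<D} \<inter> W c = W c" by (auto simp: W_def)
    finally show ?thesis .
  qed
  show "t0 <= (\<Sum>w<D. eqf c (a w) w) \<longleftrightarrow> c = c0"
  proof
    assume "c = c0" then show "t0 <= (\<Sum>w<D. eqf c (a w) w)" using close t0 by simp
  next
    assume h: "t0 <= (\<Sum>w<D. eqf c (a w) w)"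
    show "c = c0"
    proof (rule ccontr)
      assume ne: "c ~= c0"
      have fin: "finite (W c)" for c by (simp add: W_def)
      have "W c \<union> W c0 \<subseteq> {..<D}" by (auto simp: W_def)
      then have "card (W c \<union> W c0) <= D" using card_mono[of "{..<D}"] by force
      moreover have "card (W c) + card (W c0) = card (W c \<union> W c0) + card (W c \<inter> W c0)"
        by (rule card_Un_Int[OF fin fin])
      moreover have "card (W c \<inter> W c0) <= card {w. w < D & psi c w = psi c0 w}"
        by (rule card_mono) (auto simp: W_def)
      ultimately show False using dist[OF c c0 ne] h close t0 cW[OF c] cW[OF c0] by linarith
    qed
  qed
qed

definition wrL :: "(nat => nat) => (nat => nat) => nat set" where
  "wrL c f = {l. l < n & f l ~= c l}"

text \<open>A vertex with at most \<open>e0\<close> wrong neighbours decodes correctly by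
  \<open>nearest\<close>, so a wrong one sees at least \<open>e0 + 1\<close> of them;
  \<open>zemor_right\<close> and \<open>zemor_left\<close> do the counting.\<close>

lemma zemor_round:
  assumes tn: "tanner n D nbf kap psi c c'" and S: "2 * D^2 * real (card (wrL c f)) <= (real (e0 + 1))^2 * n"
    and g: "\<And>r. r < n ==> g r = crf f r" and f': "\<And>l. l < n ==> f' l = clf g l"
  shows "4 * card (wrL c' g) <= card (wrL c f)" "card (wrL c f') <= card (wrL c' g)"
proof -
  have cl: "c l < kap" if "l < n" for l using tn that by (simp add: tanner_def)
  have cr: "c' r < kap" if "r < n" for r using tn that by (simp add: tanner_def)
  have ce: "psi (c l) w = psi (c' (nbf w l)) w" if "l < n" "w < D" for l w using tn that by (simp add: tanner_def)
  let ?S = "wrL c f" and ?T = "wrL c' g"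
  show 1: "4 * card ?T <= card ?S"
  proof (rule zemor_right[where E = "e0 + 1"])
    fix r assume r: "r \<in> ?T"
    then have rn: "r < n" by (simp add: wrL_def)
    define ok where "ok = (\<Sum>w<D. eqf (c' r) (f (pv w r)) w)"
    define bad where "bad = (\<Sum>w<D. if pv w r \<in> ?S then 1 else 0 :: nat)"
    have "D <= ok + bad"
    proof -
      have "(\<Sum>w<D. 1) <= (\<Sum>w<D. eqf (c' r) (f (pv w r)) w + (if pv w r \<in> ?S then 1 else 0))"
      proof (intro sum_mono)
        fix w assume "w \<in> {..<D}"
        then have w: "w < D" by simp
        have p: "pv w r < n" "nbf w (pv w r) = r" using pv[OF w rn] by auto
        show "1 <= eqf (c' r) (f (pv w r)) w + (if pv w r \<in> ?S then 1 else 0)"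
          using ce[OF p(1) w] cl[OF p(1)] cr[OF rn] p w by (auto simp: wrL_def eqf_def)
      qed
      then show ?thesis by (simp add: ok_def bad_def sum.distrib)
    qed
    moreover have "\<not> D <= ok + e0"
    proof
      assume "D <= ok + e0"
      then have "(\<Sum>c<kap. if t0 <= (\<Sum>w<D. eqf c (f (pv w r)) w) then c else 0) = c' r"
        unfolding ok_def by (rule nearest[OF cr[OF rn]])
      moreover have "g r = (\<Sum>c<kap. if t0 <= (\<Sum>w<D. eqf c (f (pv w r)) w) then c else 0)"
        unfolding g[OF rn] crf_def sum_edges[OF rn] by (simp only: eqf_comm)
      ultimately show False using r by (simp add: wrL_def)
    qed
    ultimately have "e0 + 1 <= bad" by linarith
    moreover have "real bad = (\<Sum>l\<in>?S. \<Sum>w<D. if nbf w l = r then 1 else 0)"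
    proof -
      have Sn: "?S = {..<n} \<inter> ?S" by (auto simp: wrL_def)
      have "(\<Sum>l\<in>?S. \<Sum>w<D. if nbf w l = r then 1 else 0) = (\<Sum>l<n. if l \<in> ?S then \<Sum>w<D. if nbf w l = r then 1 else 0 else (0::real))"
        by (subst Sn) (simp only: sum.inter_restrict[OF finite_lessThan])
      also have "... = (\<Sum>l<n. \<Sum>w<D. if nbf w l = r then (if l \<in> ?S then 1 else 0) else 0)"
        by (intro sum.cong refl) (auto intro!: sum.cong)
      also have "... = (\<Sum>w<D. if pv w r \<in> ?S then 1 else 0)" by (rule sum_edges[OF rn])
      finally show ?thesis by (simp add: bad_def of_nat_sum if_distrib cong: if_cong)
    qed
    ultimately show "real (e0 + 1) <= (\<Sum>l\<in>?S. \<Sum>w<D. if nbf w l = r then 1 else 0)" by (metis of_nat_le_iff)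
  qed (use S lamE in \<open>auto simp: wrL_def\<close>)
  show "card (wrL c f') <= card ?T"
  proof (rule zemor_left[where E = "e0 + 1"])
    fix l assume l: "l \<in> wrL c f'"
    then have ln: "l < n" by (simp add: wrL_def)
    define ok where "ok = (\<Sum>w<D. eqf (c l) (g (nbf w l)) w)"
    define bad where "bad = (\<Sum>w<D. if nbf w l \<in> ?T then 1 else 0 :: nat)"
    have "D <= ok + bad"
    proof -
      have "(\<Sum>w<D. 1) <= (\<Sum>w<D. eqf (c l) (g (nbf w l)) w + (if nbf w l \<in> ?T then 1 else 0))"
      proof (intro sum_mono)
        fix w assume "w \<in> {..<D}"
        then have w: "w < D" by simp
        show "1 <= eqf (c l) (g (nbf w l)) w + (if nbf w l \<in> ?T then 1 else 0)"
          using ce[OF ln w] cl[OF ln] cr[OF nbf_less[OF ln w]] nbf_less[OF ln w] w by (auto simp: wrL_def eqf_def)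
      qed
      then show ?thesis by (simp add: ok_def bad_def sum.distrib)
    qed
    moreover have "\<not> D <= ok + e0"
    proof
      assume "D <= ok + e0"
      then have "clf g l = c l" unfolding ok_def clf_def by (rule nearest[OF cl[OF ln]])
      then show False using l f'[OF ln] by (simp add: wrL_def)
    qed
    ultimately have "e0 + 1 <= bad" by linarith
    moreover have "(\<Sum>w<D. indicator ?T (nbf w l)) = real bad"
      unfolding bad_def of_nat_sum by (intro sum.cong) (auto simp: indicator_def)
    ultimately show "real (e0 + 1) <= (\<Sum>w<D. indicator ?T (nbf w l))" by simp
  next
    have "real (card ?T) <= real (card ?S)" using 1 by linarith
    then have "2 * D^2 * real (card ?T) <= 2 * D^2 * real (card ?S)" by (intro mult_left_mono) auto
    then have sm: "2 * D^2 * real (card ?T) <= (real (e0 + 1))^2 * n" using S by simp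
    then show "2 * D^2 * real (card ?T) <= (e0 + 1)^2 * n" by (simp only: of_nat_power of_nat_mult)
  qed (use lamE in \<open>auto simp: wrL_def\<close>)
qed

lemma run_ZEM:
  assumes s: "st sg"
  shows "\<And>r. r < n ==> run X y ZEM et sg 26 r = crf (sg 25) r"
    "\<And>l. l < n ==> run X y ZEM et sg 25 l = clf (run X y ZEM et sg 26) l"
proof -
  define sg1 where "sg1 = run X y (Tab 5 nE 26 CRe) et sg"
  have f1: "sg1 a = sg a" if "a ~= 26" for a using that by (simp add: sg1_def run_frame)
  have s1: "st sg1" using s by (simp add: st_cong[of sg1 sg] f1)
  have rd: "26 \<notin> rds CRe" "25 \<notin> rds CLe" by (simp_all add: CRe_def CLe_def)
  have r: "run X y ZEM et sg = run X y (Tab 5 nE 25 CLe) et sg1" by (simp add: ZEM_def sg1_def)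
  have r26: "run X y ZEM et sg 26 = sg1 26" unfolding r by (rule run_frame) simp
  show "run X y ZEM et sg 26 r = crf (sg 25) r" if "r < n" for r
    unfolding r26 sg1_def using that st_simps(1)[OF s] by (simp add: Tab_val[OF rd(1)] ev_CRe[OF s])
  show "run X y ZEM et sg 25 l = clf (run X y ZEM et sg 26) l" if "l < n" for l
    unfolding r26 unfolding r using that st_simps(1)[OF s1] by (simp add: Tab_val[OF rd(2)] ev_CLe[OF s1])
qed

text \<open>Each round leaves at most a quarter of the errors, and \<open>n <= X < 4 ^ X\<close>
  means that none survives \<open>X\<close> rounds.\<close>

lemma run_ZEMs:
  assumes s: "st sg" and tn: "tanner n D nbf kap psi c c'" and e1: "et 1 = X"
    and S: "2 * D^2 * real (card (wrL c (sg 25))) <= (real (e0 + 1))^2 * n"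
  shows "\<forall>l<n. run X y (Fr 7 (Var 1) ZEM) et sg 25 l = c l" "\<forall>r<n. run X y (Fr 7 (Var 1) ZEM) et sg 26 r = c' r"
proof -
  define I where "I k sg' \<longleftrightarrow> st sg' & card (wrL c (sg' 25)) <= card (wrL c (sg 25)) & 4 ^ k * card (wrL c (sg' 25)) <= n
     & (k > 0 --> 4 ^ k * card (wrL c' (sg' 26)) <= n)" for k sg'
  have "I X (run X y (Fr 7 (Var 1) ZEM) et sg)"
  proof (rule Fr_inv[where I = I])
    show "X = min X (ev X y (Var 1) et sg)" using e1 by simp
    have "card (wrL c (sg 25)) <= card {..<n}" by (rule card_mono) (auto simp: wrL_def)
    then show "I 0 sg" using s by (simp add: I_def)
    fix k sg' assume I: "I k sg'"
    let ?s = "run X y ZEM (et(7 := k)) sg'"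
    have s': "st sg'" using I by (simp add: I_def)
    have "real (card (wrL c (sg' 25))) <= real (card (wrL c (sg 25)))" using I by (simp add: I_def)
    then have "2 * D^2 * real (card (wrL c (sg' 25))) <= 2 * D^2 * real (card (wrL c (sg 25)))" by (intro mult_left_mono) auto
    then have S': "2 * D^2 * real (card (wrL c (sg' 25))) <= (real (e0 + 1))^2 * n" using S by simp
    note z = zemor_round[OF tn S' run_ZEM(1)[OF s', where y = y and et = "et(7 := k)"] run_ZEM(2)[OF s', where y = y and et = "et(7 := k)"]]
    have st2: "st ?s" using s' st_cong[of ?s sg'] by (simp add: run_frame)
    have k4: "4 ^ k * card (wrL c (sg' 25)) <= n" "card (wrL c (sg' 25)) <= card (wrL c (sg 25))" using I by (simp_all add: I_def)
    have "4 ^ Suc k * card (wrL c' (?s 26)) = 4 ^ k * (4 * card (wrL c' (?s 26)))" by simp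
    also have "... <= 4 ^ k * card (wrL c (sg' 25))" by (rule mult_le_mono2[OF z(1)])
    finally have a: "4 ^ Suc k * card (wrL c' (?s 26)) <= n" using k4 by linarith
    have "4 ^ Suc k * card (wrL c (?s 25)) <= 4 ^ Suc k * card (wrL c' (?s 26))" by (rule mult_le_mono2[OF z(2)])
    then have b: "4 ^ Suc k * card (wrL c (?s 25)) <= n" using a by linarith
    have d: "card (wrL c (?s 25)) <= card (wrL c (sg 25))" using z k4 by linarith
    show "I (Suc k) ?s" unfolding I_def using st2 a b d by blast
  qed
  moreover have "n < 4 ^ X"
  proof -
    have "n < 2 ^ n" by (rule less_exp)
    also have "(2::nat) ^ n <= 2 ^ X" using X by (intro power_increasing) auto
    also have "(2::nat) ^ X <= 4 ^ X" by (intro power_mono) auto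
    finally show ?thesis .
  qed
  moreover have z0: "k = 0" if "4 ^ X * k <= n" for k
    using that \<open>n < 4 ^ X\<close> by (cases k) simp_all
  ultimately have "card (wrL c (run X y (Fr 7 (Var 1) ZEM) et sg 25)) = 0" "card (wrL c' (run X y (Fr 7 (Var 1) ZEM) et sg 26)) = 0"
    unfolding I_def using X(1) z0 by blast+
  then show "\<forall>l<n. run X y (Fr 7 (Var 1) ZEM) et sg 25 l = c l" "\<forall>r<n. run X y (Fr 7 (Var 1) ZEM) et sg 26 r = c' r"
    by (auto simp: wrL_def)
qed

definition cwf :: "(nat => nat) => nat => nat" where
  "cwf f r = (\<Sum>u<q0. if D <= (\<Sum>l<n. \<Sum>w<D. if nbf w l = r then mt (f l) w u else 0) then u else 0)"

lemma ev_CWe: "st sg ==> ev X y CWe et sg = cwf (sg 25) (et 5)"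
proof -
  assume s: "st sg"
  have "(\<Sum>l<n. \<Sum>w<D. ev X y (Mul (Eq (NBe (Var 62) (Var 63)) (Var 5)) (MTe (Rd 25 (Var 62)) (Var 63) (Var 69))) (et(69 := u, 62 := l, 63 := w)) sg)
     = (\<Sum>l<n. \<Sum>w<D. if nbf w l = et 5 then mt (sg 25 l) w u else 0)" for u
    by (intro sum.cong refl) (use s in simp)
  then show ?thesis unfolding CWe_def cwf_def using st_simps(1)[OF s] by (auto simp: min_kap intro!: sum.cong)
qed

definition allok :: "(nat => nat) => (nat => nat) => bool" where
  "allok f g \<longleftrightarrow> D * n <= (\<Sum>l<n. \<Sum>w<D. eqf (f l) (g (nbf w l)) w)"

lemma ev_VALe: "st sg ==> ev X y VALe et sg = (if allok (sg 25) (sg 26) then 1 else 0)"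
proof -
  assume s: "st sg"
  have "(\<Sum>l<n. \<Sum>w<D. ev X y (EQe (Rd 25 (Var 62)) (Rd 26 (NBe (Var 62) (Var 63))) (Var 63)) (et(62 := l, 63 := w)) sg)
     = (\<Sum>l<n. \<Sum>w<D. eqf (sg 25 l) (sg 26 (nbf w l)) w)"
    by (intro sum.cong refl) (use s in simp)
  then show ?thesis unfolding VALe_def allok_def using st_simps(1)[OF s] by simp
qed

lemma eqf_le: "eqf a c w <= 1" by (simp add: eqf_def)

text \<open>Each edge contributes at most 1, so the full count \<open>D * n\<close> forces every
  single edge constraint.\<close>

lemma allok_iff: "allok f g \<longleftrightarrow> tanner n D nbf kap psi f g"
proof
  assume a: "allok f g"
  have le: "(\<Sum>w<D. eqf (f l) (g (nbf w l)) w) <= D" for l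
    using sum_mono[of "{..<D}" "%w. eqf (f l) (g (nbf w l)) w" "%_. 1"] eqf_le by simp
  have row: "(\<Sum>w<D. eqf (f l) (g (nbf w l)) w) = D" if "l < n" for l
    by (rule sum_full[OF le _ that]) (use a in \<open>simp add: allok_def\<close>)
  have cell: "eqf (f l) (g (nbf w l)) w = 1" if "l < n" "w < D" for l w
    using sum_full[of D "%w. eqf (f l) (g (nbf w l)) w" 1 w] eqf_le row[OF that(1)] that(2) by simp
  have cell': "f l < kap & g (nbf w l) < kap & psi (f l) w = psi (g (nbf w l)) w" if "l < n" "w < D" for l w
    using cell[OF that] by (simp add: eqf_def split: if_splits)
  have "g r < kap" if "r < n" for r using cell'[of "pv 0 r" 0] pv[OF D0 that] D0 by auto
  then show "tanner n D nbf kap psi f g" unfolding tanner_def using cell' D0 by blast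
next
  assume "tanner n D nbf kap psi f g"
  then have "eqf (f l) (g (nbf w l)) w = 1" if "l < n" "w < D" for l w
    using that nbf_less[OF that] unfolding tanner_def eqf_def by auto
  then have "(\<Sum>l<n. \<Sum>w<D. eqf (f l) (g (nbf w l)) w) = D * n" by (simp add: mult.commute)
  then show "allok f g" by (simp add: allok_def)
qed

lemma cwf_core:
  assumes tn: "tanner n D nbf kap psi f g" and r: "r < n"
  shows "cwf f r < q0 & (\<forall>w<D. MTp (f (pv w r)) w (cwf f r))"
    "u < q0 ==> (\<And>w. w < D ==> MTp (f (pv w r)) w u) ==> cwf f r = u"
proof -
  have fk: "f (pv w r) < kap" if "w < D" for w using tn pv[OF that r] by (simp add: tanner_def)
  have iff: "D <= (\<Sum>l<n. \<Sum>w<D. if nbf w l = r then mt (f l) w u else 0) \<longleftrightarrow> (\<forall>w<D. MTp (f (pv w r)) w u)"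
    if u: "u < q0" for u
    unfolding sum_edges[OF r]
  proof
    assume h: "D <= (\<Sum>w<D. mt (f (pv w r)) w u)"
    have "mt (f (pv w r)) w u = 1" if "w < D" for w
      using sum_full[of D "%w. mt (f (pv w r)) w u" 1 w] mt_le h that by simp
    then show "\<forall>w<D. MTp (f (pv w r)) w u" unfolding mtv_def by (metis zero_neq_one)
  next
    assume "\<forall>w<D. MTp (f (pv w r)) w u"
    then have "mt (f (pv w r)) w u = 1" if "w < D" for w using that fk u by (simp add: mtv_def)
    then show "D <= (\<Sum>w<D. mt (f (pv w r)) w u)" by simp
  qed
  show eq: "cwf f r = u" if u: "u < q0" "\<And>w. w < D ==> MTp (f (pv w r)) w u" for u
    unfolding cwf_def
  proof (rule sum_unique[OF u(1)])
    fix v assume v: "v < q0"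
    show "D <= (\<Sum>l<n. \<Sum>w<D. if nbf w l = r then mt (f l) w v else 0) \<longleftrightarrow> v = u"
      unfolding iff[OF v] using Minj[of "%w. f (pv w r)" v u] fk u v by blast
  qed
  obtain u where "u < q0" "\<forall>w<D. MTp (f (pv w r)) w u" using Msurj[of "%w. f (pv w r)"] fk by blast
  then show "cwf f r < q0 & (\<forall>w<D. MTp (f (pv w r)) w (cwf f r))" using eq[of u] by simp
qed

lemma core_cwf: "tanner n D nbf kap psi f g ==> core n nbf f g (cwf f)"
proof -
  assume tn: "tanner n D nbf kap psi f g"
  have "MTp (f l) w (cwf f (nbf w l))" if l: "l < n" "w < D" for l w
  proof -
    have "pv w (nbf w l) = l" using pv_eq[OF l(2) nbf_less[OF l] l(1)] by simp
    then show ?thesis using cwf_core(1)[OF tn nbf_less[OF l]] l(2) by metis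
  qed
  then show ?thesis unfolding core_def using tn cwf_core(1)[OF tn] by blast
qed

lemma cwf_eq: "core n nbf c c' h ==> (\<And>l. l < n ==> f l = c l) ==> r < n ==> cwf f r = h r"
proof -
  assume co: "core n nbf c c' h" and f: "\<And>l. l < n ==> f l = c l" and r: "r < n"
  have tn: "tanner n D nbf kap psi f c'" using co f by (simp add: core_def tanner_def)
  show ?thesis
  proof (rule cwf_core(2)[OF tn r])
    show "h r < q0" using co r by (simp add: core_def)
    fix w assume w: "w < D"
    then show "MTp (f (pv w r)) w (h r)" using co f pv[OF w r] by (metis core_def)
  qed
qed

text \<open>The first two claims protect the other slots. The third is soundness for any guess: flag
  1 certifies a codeword, because \<open>VALe\<close> characterises Tanner words. The fourth is
  completeness for a starting word with few errors.\<close>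

lemma run_DEC:
  assumes s: "st sg" and e1: "et 1 = X" and sl: "k0 = q0 * et 2 + sl" "k0 <= X" and sg': "sg' = run X y (DEC sl AL) et sg"
  shows "\<And>k. k ~= k0 ==> sg' 28 k = sg 28 k"
    "\<And>k r. k ~= k0 ==> r < X ==> sg' 27 (X * k + r) = sg 27 (X * k + r)"
    "sg' 28 k0 = 0 \<or> sg' 28 k0 = 1 & (\<exists>c c'. core n nbf c c' (%r. sg' 27 (X * k0 + r)))"
    "\<And>c c' h. core n nbf c c' h ==> 2 * D^2 * real (card (wrL c (cif AL (sg 9)))) <= (real (e0 + 1))^2 * n ==>
       sg' 28 k0 = 1 & (\<forall>r<n. sg' 27 (X * k0 + r) = h r)"
proof -
  define sg1 where "sg1 = run X y (Tab 5 nE 25 (CIe AL)) et sg"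
  define sg2 where "sg2 = run X y (Fr 7 (Var 1) ZEM) et sg1"
  define sg3 where "sg3 = run X y (Wr 28 (slotE sl) VALe) et sg2"
  have r: "sg' = run X y (Fr 5 nE (Wr 27 (Plus (Mul (slotE sl) (Var 1)) (Var 5)) CWe)) et sg3"
    by (simp add: sg' DEC_def sg3_def sg2_def sg1_def del: run.simps(1,3))
  have f1: "sg1 a = sg a" if "a ~= 25" for a using that by (simp add: sg1_def run_frame)
  have f2: "sg2 a = sg1 a" if "a \<notin> {25, 26}" for a unfolding sg2_def by (rule run_frame) (use that in simp)
  have f3: "sg3 a = sg2 a" if "a ~= 28" for a unfolding sg3_def by (rule run_frame) (use that in simp)
  have s1: "st sg1" and s2: "st sg2" and s3: "st sg3" using s by (simp_all add: st_cong[of sg1 sg] st_cong[of sg2 sg] st_cong[of sg3 sg] f1 f2 f3)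
  have rd: "25 \<notin> rds (CIe AL)" by (simp add: CIe_def)
  have v1: "sg1 25 l = cif AL (sg 9) l" if "l < n" for l
    unfolding sg1_def using that st_simps(1)[OF s] by (simp add: Tab_val[OF rd] ev_CIe[OF s])
  have ix: "ev X y (slotE sl) (et(5 := r)) ta = k0" "ev X y (slotE sl) et ta = k0" for r ta using sl by (simp_all add: slotE_def)
  have fvs: "99 \<notin> fv (slotE sl)" by (simp add: slotE_def)
  have v3: "sg3 28 = (sg2 28)(k0 := if allok (sg2 25) (sg2 26) then 1 else 0)"
    unfolding sg3_def by (simp add: ix ev_VALe[OF s2])
  define I where "I m ta \<longleftrightarrow> st ta & ta 28 = sg3 28 & ta 25 = sg2 25 & (\<forall>k r. r < X --> ta 27 (X * k + r) = (if k = k0 & r < m then cwf (sg2 25) r else sg 27 (X * k + r)))" for m ta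
  have "I n sg'" unfolding r
  proof (rule Fr_inv[where I = I])
    show "n = min X (ev X y nE et sg3)" using s3 by (simp add: st_simps)
    show "I 0 sg3" using s3 by (simp add: I_def f1 f2 f3)
    fix m ta assume m: "m < n" and I: "I m ta"
    let ?s = "run X y (Wr 27 (Plus (Mul (slotE sl) (Var 1)) (Var 5)) CWe) (et(5 := m)) ta"
    have stta: "st ta" using I by (simp add: I_def)
    have "min X k0 * X = X * k0" using sl(2) by (simp add: mult.commute)
    then have e: "ev X y (Plus (Mul (slotE sl) (Var 1)) (Var 5)) (et(5 := m)) ta = X * k0 + m" using e1 by (simp add: ix)
    have w: "ev X y CWe (et(5 := m)) ta = cwf (sg2 25) m" using I by (simp add: ev_CWe[OF stta] I_def)
    have mX: "m < X" using m X by linarith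
    have s27: "?s 27 = (ta 27)(X * k0 + m := cwf (sg2 25) m)" by (simp only: run.simps e w fun_upd_same)
    have so: "?s a = ta a" if "a ~= 27" for a by (rule run_frame) (use that in simp)
    have "?s 27 (X * k + r) = (if k = k0 & r < Suc m then cwf (sg2 25) r else sg 27 (X * k + r))" if rX: "r < X" for k r
    proof -
      have "X * k + r = X * k0 + m \<longleftrightarrow> k = k0 & r = m" using pair_index[OF rX mX, of k k0] by auto
      moreover have "ta 27 (X * k + r) = (if k = k0 & r < m then cwf (sg2 25) r else sg 27 (X * k + r))"
        using I rX by (simp add: I_def)
      ultimately show ?thesis unfolding s27 by (auto simp: less_Suc_eq)
    qed
    then show "I (Suc m) ?s" unfolding I_def using stta I st_cong[of ?s ta] so by (simp only: I_def) simp
  qed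
  then have 28: "sg' 28 = sg3 28" and 27: "\<And>k r. r < X ==> sg' 27 (X * k + r) = (if k = k0 & r < n then cwf (sg2 25) r else sg 27 (X * k + r))"
    by (auto simp: I_def)
  show "sg' 28 k = sg 28 k" if "k ~= k0" for k using that by (simp add: 28 v3 f1 f2)
  show "sg' 27 (X * k + r) = sg 27 (X * k + r)" if "k ~= k0" "r < X" for k r using that by (simp add: 27)
  have w27: "sg' 27 (X * k0 + r) = cwf (sg2 25) r" if "r < n" for r using that X by (simp add: 27)
  have k28: "sg' 28 k0 = (if allok (sg2 25) (sg2 26) then 1 else 0)" by (simp add: 28 v3)
  show "sg' 28 k0 = 0 \<or> sg' 28 k0 = 1 & (\<exists>c c'. core n nbf c c' (%r. sg' 27 (X * k0 + r)))"
  proof (cases "allok (sg2 25) (sg2 26)")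
    case True
    then have "core n nbf (sg2 25) (sg2 26) (cwf (sg2 25))" by (intro core_cwf) (simp add: allok_iff)
    then have "core n nbf (sg2 25) (sg2 26) (%r. sg' 27 (X * k0 + r))"
      unfolding core_def using w27 nbf_less by simp
    then show ?thesis using True k28 by auto
  qed (simp add: k28)
  fix c c' h assume co: "core n nbf c c' h" and S: "2 * D^2 * real (card (wrL c (cif AL (sg 9)))) <= (real (e0 + 1))^2 * n"
  have tn: "tanner n D nbf kap psi c c'" using co by (simp add: core_def)
  have "wrL c (sg1 25) = wrL c (cif AL (sg 9))" using v1 by (auto simp: wrL_def)
  then have S1: "2 * D^2 * real (card (wrL c (sg1 25))) <= (real (e0 + 1))^2 * n" using S by simp
  have z: "\<forall>l<n. sg2 25 l = c l" "\<forall>r<n. sg2 26 r = c' r"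
    using run_ZEMs[where sg = sg1 and et = et and y = y, OF s1 tn e1 S1] unfolding sg2_def by auto
  then have "allok (sg2 25) (sg2 26)" unfolding allok_iff using tn nbf_less by (simp add: tanner_def)
  moreover have "cwf (sg2 25) r = h r" if "r < n" for r by (rule cwf_eq[OF co _ that]) (use z in auto)
  ultimately show "sg' 28 k0 = 1 & (\<forall>r<n. sg' 27 (X * k0 + r) = h r)" using k28 w27 by simp
qed

end

section \<open>Decoding one component\<close>

locale prg3 = prg2 D kap q0 tt Gam MTp psi thr t0 LB
  for D kap q0 tt Gam :: nat and MTp and psi and thr t0 LB :: nat +
  fixes TT mg EC :: nat
begin

text \<open>The digits of \<open>e\<close> in base \<open>Suc mg\<close> are a guess of all the
  rounded densities.\<close>

definition CANDS :: "nat => cm" where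
  "CANDS j = sqs (map (%e. DEC (j * EC + e) (dig (Suc mg) e)) [0..<EC])"
definition ROUNDS :: cm where
  "ROUNDS = sqs (map (%j. Sq (CANDS j) SEARCH) [0..<TT])"

end

text \<open>\<open>Gam\<close> lets a level set from \<open>irregular_found\<close> pass the test;
  \<open>TT\<close> rounds of the resulting gain exceed the maximal energy; \<open>thr\<close>
  separates the score of the true symbol from the scores of the others, which match in at most
  \<open>tin\<close> places; \<open>bad\<close> brings the remaining errors within the radius of
  unique decoding; \<open>slots\<close> fits all candidates of a component into \<open>q0\<close>
  slots.\<close>

locale dec3 = prg3 D kap q0 tt Gam MTp psi thr t0 LB TT mg EC +
  dec2 D kap q0 tt Gam MTp psi thr t0 LB n nbf lam K Y X e0
  for D kap q0 tt Gam :: nat and MTp psi thr t0 LB TT mg EC n nbf and lam :: real and K Y X e0 +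
  fixes dl ta alx :: real and tin :: nat
  assumes dl: "0 < dl" "dl <= 1" and K0: "0 < K" and lamd: "lam^2 <= dl * D^2 / (128 * K)"
    and Gam: "8192 * K <= Gam * dl^2" and LB: "LB = 2 ^ TT" and mg: "mg > 0" and EC: "EC = Suc mg ^ LB"
    and slots: "TT * EC <= q0"
    and TT: "K * (D^2 + lam^2 * 2 ^ TT) < TT * (D^2 / (Gam^2 * K))"
    and inner: "\<And>c c' u. c < kap ==> c' < kap ==> c ~= c' ==> card {w. w < D & MTp c w (u w) & MTp c' w (u w)} <= tin"
    and ta: "0 < ta" and act: "tt <= alx * D - ta" and thr1: "mg * (tin + ta) <= thr" and thr2: "thr < mg * (alx * D - 2 * ta)"
    and bad: "2 * (real D)^2 * (2 * dl * (real D)^2 + 4 * K * (real D)^2 / (real mg)^2 + lam^2) <= (real (e0 + 1))^2 * ta^2"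
begin

definition target :: "(nat => nat) => bool" where
  "target h \<longleftrightarrow> (\<exists>c c'. core n nbf c c' h) & alx * n <= card {r. r < n & h r = Y r}"

lemma M_indicator:
  assumes l: "l < n"
  shows "M (indicator A) l c = card {w. w < D & mf l c w = 1 & nbf w l \<in> A}"
proof -
  have "real (mf l c w) * indicator A (nbf w l) = (if mf l c w = 1 & nbf w l \<in> A then 1 else 0)" for w
    using mf_le[of l c w] by (cases "mf l c w") (auto simp: indicator_def)
  then have "M (indicator A) l c = (\<Sum>w<D. if mf l c w = 1 & nbf w l \<in> A then 1 else 0)"
    unfolding M_def by simp
  also have "... = card ({..<D} \<inter> {w. mf l c w = 1 & nbf w l \<in> A})" by (simp add: sum.If_cases)
  also have "{..<D} \<inter> {w. mf l c w = 1 & nbf w l \<in> A} = {w. w < D & mf l c w = 1 & nbf w l \<in> A}" by auto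
  finally show ?thesis .
qed

lemma score_M:
  assumes l: "l < n" and AL: "\<And>r. r < n ==> lab r < LB & AL (lab r) = dens mg lab A (lab r)"
  shows "real (score AL lab l c) = mg * M (%r. dens mg lab A (lab r) / mg) l c"
proof -
  have "real (score AL lab l c) = (\<Sum>w<D. real (mf l c w) * real (dens mg lab A (lab (nbf w l))))"
    unfolding score_def of_nat_sum by (intro sum.cong refl) (use AL nbf_less[OF l] in simp)
  then show ?thesis using mg unfolding M_def by (simp add: sum_distrib_left)
qed

text \<open>The true symbol matches on all its edges into the agreement set, nearly
  \<open>alx * D\<close> of them or more. There the received digits are those of the true symbol, so
  another symbol matches on at most \<open>tin\<close> of these edges. The threshold lies between
  the two, even after the error \<open>ta\<close> of the estimate.\<close>

lemma decode_good:
  assumes co: "core n nbf c c' h" and A: "A = {r. r < n & h r = Y r}" and l: "l < n"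
    and alxA: "alx * n <= card A"
    and dev: "\<bar>(\<Sum>w<D. indicator A (nbf w l)) - D * card A / n\<bar> < ta"
    and reg: "\<And>c. c < kap ==> \<bar>M (indicator A) l c - M (%r. dens mg lab A (lab r) / mg) l c\<bar> < ta"
    and AL: "\<And>r. r < n ==> lab r < LB & AL (lab r) = dens mg lab A (lab r)"
  shows "cif AL lab l = c l"
  unfolding cif_def
proof (rule sum_unique)
  show ck: "c l < kap" using co l by (simp add: core_def tanner_def)
  define W where "W = {w. w < D & nbf w l \<in> A}"
  have WY: "mt (c l) w (Y (nbf w l)) = 1" if "w \<in> W" for w
  proof -
    have w: "w < D" "nbf w l < n" "h (nbf w l) = Y (nbf w l)" using that by (auto simp: W_def A)
    then have "MTp (c l) w (h (nbf w l))" "h (nbf w l) < q0" using co l unfolding core_def by blast+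
    then show ?thesis using w(1) ck by (simp add: mtv_def w(3)[symmetric])
  qed
  have cW: "(\<Sum>w<D. indicator A (nbf w l)) = real (card W)"
  proof -
    have "W = {..<D} \<inter> {w. nbf w l \<in> A}" by (auto simp: W_def)
    then show ?thesis by (simp add: indicator_def sum.If_cases)
  qed
  have "alx * D <= D * card A / n"
    using mult_left_mono[OF alxA, of "real D"] n0 by (simp add: field_simps)
  then have Walx: "alx * D - ta < card W" using dev unfolding cW by linarith
  have "card W = (\<Sum>w\<in>W. mt (c l) w (Y (nbf w l)))" using WY by simp
  also have "... <= (\<Sum>w<D. mt (c l) w (Y (nbf w l)))" by (rule sum_mono2) (auto simp: W_def)
  finally have "tt <= (\<Sum>w<D. mt (c l) w (Y (nbf w l)))" using Walx act by linarith
  then have "mf l (c l) w = 1" if "w \<in> W" for w using WY[OF that] by (simp add: mmv_def)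
  then have "W \<subseteq> {w. w < D & mf l (c l) w = 1 & nbf w l \<in> A}" by (auto simp: W_def)
  then have "card W <= card {w. w < D & mf l (c l) w = 1 & nbf w l \<in> A}" by (intro card_mono) auto
  then have Mc: "alx * D - ta < M (indicator A) l (c l)" using Walx unfolding M_indicator[OF l] by linarith
  fix c2 assume c2: "c2 < kap"
  have sM: "real (score AL lab l c3) = mg * M (%r. dens mg lab A (lab r) / mg) l c3" for c3
    by (rule score_M[OF l AL])
  show "thr < score AL lab l c2 \<longleftrightarrow> c2 = c l"
  proof
    assume e: "c2 = c l"
    have "alx * D - 2 * ta < M (%r. dens mg lab A (lab r) / mg) l (c l)" using Mc reg[OF ck] by linarith
    then have "mg * (alx * D - 2 * ta) < mg * M (%r. dens mg lab A (lab r) / mg) l (c l)" using mg by (intro mult_strict_left_mono) auto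
    then have "mg * (alx * D - 2 * ta) < real (score AL lab l c2)" unfolding e sM[of "c l"] .

    then have "real thr < real (score AL lab l c2)" using thr2 by linarith
    then show "thr < score AL lab l c2" by simp
  next
    assume s: "thr < score AL lab l c2"
    show "c2 = c l"
    proof (rule ccontr)
      assume ne: "c2 ~= c l"
      have "{w. w < D & mf l c2 w = 1 & nbf w l \<in> A} \<subseteq> {w. w < D & MTp c2 w (h (nbf w l)) & MTp (c l) w (h (nbf w l))}"
      proof
        fix w assume w: "w \<in> {w. w < D & mf l c2 w = 1 & nbf w l \<in> A}"
        then have "mt c2 w (Y (nbf w l)) = 1" "w < D" by (auto simp: mmv_def split: if_splits)
        then have "MTp c2 w (Y (nbf w l))" by (simp add: mtv_def split: if_splits)
        moreover have "Y (nbf w l) = h (nbf w l)" using w by (auto simp: A)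
        moreover have "MTp (c l) w (h (nbf w l))" using co l w by (auto simp: core_def)
        ultimately show "w \<in> {w. w < D & MTp c2 w (h (nbf w l)) & MTp (c l) w (h (nbf w l))}" using w by auto
      qed
      then have "card {w. w < D & mf l c2 w = 1 & nbf w l \<in> A} <= card {w. w < D & MTp c2 w (h (nbf w l)) & MTp (c l) w (h (nbf w l))}"
        by (intro card_mono) auto
      also have "... <= tin" by (rule inner[OF c2 ck ne])
      finally have "M (indicator A) l c2 <= tin" unfolding M_indicator[OF l] by simp
      then have "M (%r. dens mg lab A (lab r) / mg) l c2 <= tin + ta" using reg[OF c2] by linarith
      then have "real (score AL lab l c2) <= mg * (tin + ta)" unfolding sM by (intro mult_left_mono) auto
      then show False using thr1 s by linarith
    qed
  qed
qed

lemma lamD: "lam^2 <= D^2"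
proof -
  have "dl * (real D)^2 <= 1 * (real D)^2" using dl by (intro mult_right_mono) auto
  then have "dl * (real D)^2 / (128 * K) <= (real D)^2 / 1" using K0 dl by (intro frac_le) auto
  then show ?thesis using lamd by simp
qed

text \<open>\<open>decode_good\<close> fails only at vertices where the densities mislead or where
  the share of neighbours in the agreement set deviates. Both kinds are counted by Chebyshev bounds,
  and \<open>bad\<close> compares the total with the decoding radius.\<close>

lemma decode_small:
  assumes co: "core n nbf c c' h" and A: "A = {r. r < n & h r = Y r}"
    and alxA: "alx * n <= card A" and small: "msq (Pr lab (indicator A)) <= (dl * D^2) * n"
    and AL: "\<And>r. r < n ==> lab r < LB & AL (lab r) = dens mg lab A (lab r)"
  shows "2 * D^2 * real (card (wrL c (cif AL lab))) <= (real (e0 + 1))^2 * n"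
proof -
  let ?B1 = "{l. l < n & (\<exists>c<kap. ta <= \<bar>M (indicator A) l c - M (%r. dens mg lab A (lab r) / mg) l c\<bar>)}"
  let ?B2 = "{l. l < n & ta <= \<bar>(\<Sum>w<D. indicator A (nbf w l)) - D * card A / n\<bar>}"
  have An: "A \<subseteq> {..<n}" by (auto simp: A)
  have "wrL c (cif AL lab) \<subseteq> ?B1 \<union> ?B2"
  proof
    fix l assume l: "l \<in> wrL c (cif AL lab)"
    then have ln: "l < n" "cif AL lab l ~= c l" by (auto simp: wrL_def)
    show "l \<in> ?B1 \<union> ?B2"
    proof (rule ccontr)
      assume "l \<notin> ?B1 \<union> ?B2"
      then have "cif AL lab l = c l" using ln(1) by (intro decode_good[OF co A ln(1) alxA _ _ AL]) (auto simp: not_le)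
      then show False using ln by simp
    qed
  qed
  then have "card (wrL c (cif AL lab)) <= card (?B1 \<union> ?B2)" by (intro card_mono) auto
  also have "... <= card ?B1 + card ?B2" by (rule card_Un_le)
  finally have "real (card (wrL c (cif AL lab))) <= real (card ?B1) + real (card ?B2)" by linarith
  then have "real (card (wrL c (cif AL lab))) * ta^2 <= (real (card ?B1) + real (card ?B2)) * ta^2" by (intro mult_right_mono) auto
  also have "... = card ?B1 * ta^2 + card ?B2 * ta^2" by (rule distrib_right)
  also have "... <= (2 * (dl * D^2) + 4 * K * D^2 / mg^2) * n + lam^2 * n"
    by (intro add_mono) (use decode_regular[OF small mg lamD ta] degree_deviation[OF An ta] in simp_all)
  also have "... = (2 * dl * D^2 + 4 * K * D^2 / mg^2 + lam^2) * n" by (simp add: algebra_simps)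
  finally have 1: "real (card (wrL c (cif AL lab))) * ta^2 <= (2 * dl * D^2 + 4 * K * D^2 / mg^2 + lam^2) * n" .
  have "(2 * D^2 * real (card (wrL c (cif AL lab)))) * ta^2 = 2 * D^2 * (real (card (wrL c (cif AL lab))) * ta^2)" by simp
  also have "... <= 2 * D^2 * ((2 * dl * D^2 + 4 * K * D^2 / mg^2 + lam^2) * n)" by (rule mult_left_mono[OF 1]) simp
  also have "... = (2 * D^2 * (2 * dl * D^2 + 4 * K * D^2 / mg^2 + lam^2)) * n" by simp
  also have "... <= ((e0 + 1)^2 * ta^2) * n" using mult_right_mono[OF bad, of "real n"] by simp
  also have "... = ((real (e0 + 1))^2 * n) * ta^2" by simp
  finally show ?thesis using ta by (simp add: mult_le_cancel_right)
qed

definition has :: "store => nat => (nat => nat) => bool" where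
  "has sg k h \<longleftrightarrow> sg 28 k = 1 & (\<forall>r<n. sg 27 (X * k + r) = h r)"
definition sound :: "store => bool" where
  "sound sg \<longleftrightarrow> (\<forall>k. sg 28 k = 0 \<or> sg 28 k = 1 & (\<exists>c c'. core n nbf c c' (%r. sg 27 (X * k + r))))"

lemma core_cong: "(\<And>r. r < n ==> h r = h' r) ==> core n nbf c c' h = core n nbf c c' h'"
  unfolding core_def using nbf_less by auto

lemma run_CANDS:
  assumes s: "st sg" and e1: "et 1 = X" and i: "q0 * et 2 + q0 <= X" and j: "j < TT" and so: "sound sg"
    and sg': "sg' = run X y (CANDS j) et sg" and k0: "k0 = q0 * et 2 + j * EC"
  shows "st sg'" "sg' 9 = sg 9" "sound sg'"
    "\<And>k h. k \<notin> {k0..<k0 + EC} ==> has sg' k h = has sg k h"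
    "\<And>c c' h e. core n nbf c c' h ==> e < EC ==>
        2 * D^2 * real (card (wrL c (cif (dig (Suc mg) e) (sg 9)))) <= (real (e0 + 1))^2 * n ==> has sg' (k0 + e) h"
proof -
  define I where "I m ta \<longleftrightarrow> st ta & ta 9 = sg 9 & sound ta & (\<forall>k h. k \<notin> {k0..<k0 + m} --> has ta k h = has sg k h) &
     (\<forall>c c' h e. core n nbf c c' h --> e < m -->
        2 * D^2 * real (card (wrL c (cif (dig (Suc mg) e) (sg 9)))) <= (real (e0 + 1))^2 * n --> has ta (k0 + e) h)" for m ta
  have "I EC sg'"
    unfolding sg' CANDS_def
  proof (rule sqs_inv[where I = I])
    show "I 0 sg" using s so by (simp add: I_def)
    fix m ta assume m: "m < EC" and I: "I m ta"
    let ?s = "run X y (DEC (j * EC + m) (dig (Suc mg) m)) et ta"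
    have kk: "k0 + m = q0 * et 2 + (j * EC + m)" by (simp add: k0)
    have "j * EC + m < Suc j * EC" using m by simp
    also have "... <= TT * EC" using j by (intro mult_le_mono1) simp
    finally have kX: "k0 + m <= X" using slots i unfolding kk by linarith
    have stta: "st ta" "ta 9 = sg 9" using I by (auto simp: I_def)
    note R = run_DEC[OF stta(1) e1 kk kX refl, where y = y and AL = "dig (Suc mg) m"]
    have fr: "?s a = ta a" if "a \<notin> {25, 26, 27, 28}" for a by (rule run_frame) (use that in simp)
    have nX: "r < X" if "r < n" for r using that X by linarith
    have has: "has ?s k h = has ta k h" if "k ~= k0 + m" for k h
      unfolding has_def using R(1)[OF that] R(2)[OF that nX] by simp
    have sd: "sound ?s" unfolding sound_def
    proof
      fix k
      show "?s 28 k = 0 \<or> ?s 28 k = 1 & (\<exists>c c'. core n nbf c c' (%r. ?s 27 (X * k + r)))"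
      proof (cases "k = k0 + m")
        case True
        show ?thesis unfolding True by (rule R(3))
      next
        case False
        have "ta 28 k = 0 \<or> ta 28 k = 1 & (\<exists>c c'. core n nbf c c' (%r. ta 27 (X * k + r)))" using I by (simp add: I_def sound_def)
        moreover have "core n nbf c c' (%r. ?s 27 (X * k + r)) = core n nbf c c' (%r. ta 27 (X * k + r))" for c c'
          by (rule core_cong) (rule R(2)[OF False nX])
        ultimately show ?thesis using R(1)[OF False] by simp
      qed
    qed
    have "has ?s (k0 + e) h" if co: "core n nbf c c' h" and e: "e < Suc m"
       and sm: "2 * D^2 * real (card (wrL c (cif (dig (Suc mg) e) (sg 9)))) <= (real (e0 + 1))^2 * n" for c c' h e
    proof (cases "e = m")
      case True
      then show ?thesis using R(4)[OF co] sm stta(2) by (simp add: has_def)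
    next
      case False
      then have "has ta (k0 + e) h" using I co e sm unfolding I_def by (metis less_Suc_eq)
      then show ?thesis using has[of "k0 + e"] False by simp
    qed
    moreover have "has ?s k h = has sg k h" if "k \<notin> {k0..<k0 + Suc m}" for k h
    proof -
      have "k ~= k0 + m" "k \<notin> {k0..<k0 + m}" using that by auto
      then show ?thesis using has I by (simp add: I_def)
    qed
    moreover have "st ?s" using stta(1) st_cong[of ?s ta] fr by simp
    moreover have "?s 9 = sg 9" using stta(2) fr[of 9] by simp
    ultimately show "I (Suc m) ?s" unfolding I_def using sd by blast
  qed
  then show "st sg'" "sg' 9 = sg 9" "sound sg'"
    "\<And>k h. k \<notin> {k0..<k0 + EC} ==> has sg' k h = has sg k h"
    "\<And>c c' h e. core n nbf c c' h ==> e < EC ==>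
        2 * D^2 * real (card (wrL c (cif (dig (Suc mg) e) (sg 9)))) <= (real (e0 + 1))^2 * n ==> has sg' (k0 + e) h"
    unfolding I_def by blast+
qed

lemma Gam0: "0 < Gam"
proof (rule ccontr)
  assume "\<not> 0 < Gam" then show False using Gam K0 by simp
qed

text \<open>The parity of a new label is the bit of the set found and the rest is the old label, so
  the new partition refines the old one and separates the set, as \<open>energy_gain\<close>
  requires.\<close>

lemma irregular_step:
  assumes irr: "(dl * D^2) * n <= msq (Pr lab (indicator A))"
    and S: "\<And>r. r < n ==> S r <= 1 & lab' r = S r + 2 * lab r"
    and he: "(\<exists>r<n. \<exists>s<n. heavy lab (lev ((Bop lab ^^ n) (ind r)) s)) --> heavy lab (%r. real (S r))"
  shows "Phi lab + D^2 / (Gam^2 * K) <= Phi lab'"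
proof -
  have lamd': "lam^2 <= dl * real (D^2) / real (128 * K)" using lamd by simp
  obtain r s where rs: "r < n" "s < n" "dl^2 * real D * real n / real (8192 * K) <= mone (Pr lab (lev ((Bop lab ^^ n) (ind r)) s))"
    using irregular_found[OF dl K0 lamd' irr] by blast
  have "real D * n * (8192 * K) <= real D * n * (Gam * dl^2)" using Gam by (intro mult_left_mono) auto
  then have "real D * n <= Gam * (dl^2 * real D * real n / real (8192 * K))" using K0 by (simp add: field_simps)
  also have "... <= Gam * mone (Pr lab (lev ((Bop lab ^^ n) (ind r)) s))" using rs by (intro mult_left_mono) auto
  finally have hv: "heavy lab (%r. real (S r))" using he rs by (auto simp: heavy_def)
  \<comment> \<open>\<open>S\<close> is controlled below \<open>n\<close> only, while
    \<open>energy_gain\<close> asks for bounds everywhere.\<close>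
  define S' where "S' r = (if r < n then real (S r) else 0)" for r
  have "heavy lab S'" using hv heavy_ext[of S' "%r. real (S r)" lab] by (simp add: S'_def)
  then have big: "D * n <= real Gam * mone (Pr lab S')" by (simp add: heavy_def)
  have ref: "lab r = lab s & S' r = S' s" if h: "r < n" "s < n" "lab' r = lab' s" for r s
  proof -
    have "S r + 2 * lab r = S s + 2 * lab s" "S r <= 1" "S s <= 1" using S[OF h(1)] S[OF h(2)] h(3) by auto
    then have "lab r = lab s & S r = S s" by presburger
    then show ?thesis using h by (simp add: S'_def)
  qed
  have S01: "0 <= S' r & S' r <= 1" for r using S[of r] by (auto simp: S'_def)
  from energy_gain[where G = Gam and S = S' and lab = lab and lab' = lab', OF ref S01 Gam0 K0 big]
  show ?thesis by (simp only: of_nat_mult of_nat_power)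
qed

text \<open>For each target the invariant is an alternative: it sits in a slot filled so far, or all
  \<open>j\<close> partitions were irregular for it and the energy is at least \<open>j * g\<close>.
  After \<open>TT\<close> rounds the second is impossible by \<open>Phi_bound\<close>. The
  refinement does not depend on the target, so one run serves all of them.\<close>

theorem run_ROUNDS:
  assumes s: "st sg" and e1: "et 1 = X" and i: "q0 * et 2 + q0 <= X" and so: "sound sg"
    and lab0: "\<And>r. r < n ==> sg 9 r = 0" and sg': "sg' = run X y ROUNDS et sg"
  shows "sound sg'" "\<And>k h. k \<notin> {q0 * et 2..<q0 * et 2 + q0} ==> has sg' k h = has sg k h"
    "\<And>h. target h ==> \<exists>sl<q0. has sg' (q0 * et 2 + sl) h" "\<And>a. a \<notin> {0, 4} ==> a \<notin> wrs SEARCH \<union> {25, 26, 27, 28} ==> sg' a = sg a"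
    "sg' 4 = sg 4" "sg' 0 = sg 0"
proof -
  define g where "g = D^2 / (Gam^2 * K)"
  define I where "I j ta \<longleftrightarrow> st ta & sound ta & (\<forall>k h. k \<notin> {q0 * et 2..<q0 * et 2 + q0} --> has ta k h = has sg k h)
    & (\<forall>r<n. ta 9 r < 2 ^ j) & (\<forall>h. target h --> (\<exists>sl<j * EC. has ta (q0 * et 2 + sl) h) \<or> j * g <= Phi (ta 9))
    & (\<forall>a. a \<notin> wrs SEARCH \<union> {25, 26, 27, 28} --> ta a = sg a)" for j ta
  have I: "I TT sg'" unfolding sg' ROUNDS_def
  proof (rule sqs_inv[where I = I])
    show "I 0 sg" using s so lab0 Phi_nonneg by (simp add: I_def)
    fix j ta assume j: "j < TT" and I: "I j ta"
    have stta: "st ta" "sound ta" using I by (auto simp: I_def)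
    define ta1 where "ta1 = run X y (CANDS j) et ta"
    define k0 where "k0 = q0 * et 2 + j * EC"
    note C = run_CANDS[OF stta(1) e1 i j stta(2) ta1_def k0_def]
    define ta2 where "ta2 = run X y SEARCH et ta1"
    have f2: "ta2 a = ta1 a" if "a \<notin> wrs SEARCH" for a unfolding ta2_def by (rule run_frame[OF that])
    have "ta1 a = ta a" if "a \<notin> {25, 26, 27, 28}" for a
    proof -
      have "fold (%e. run X y (DEC (j * EC + e) (dig (Suc mg) e)) et) xs rh a = rh a" for xs rh
        by (induction xs arbitrary: rh) (use that in \<open>simp_all add: run_frame\<close>)
      then show ?thesis unfolding ta1_def CANDS_def by (simp add: fold_map comp_def)
    qed
    note f1 = this
    obtain S where S: "\<And>r. r < n ==> S r <= 1 & ta2 9 r = S r + 2 * ta1 9 r"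
      and he: "(\<exists>r<n. \<exists>s<n. heavy (ta1 9) (lev ((Bop (ta1 9) ^^ n) (ind r)) s)) --> heavy (ta1 9) (%r. real (S r))"
      using run_SEARCH[OF C(1) ta2_def] by blast
    have st2: "st ta2" using C(1) st_cong[of ta2 ta1] f2 by simp
    have h2: "has ta2 k h = has ta1 k h" for k h by (simp add: has_def f2)
    have so2: "sound ta2" using C(3) by (simp add: sound_def f2)
    have "j * EC + EC = Suc j * EC" by simp
    also have "... <= TT * EC" using j by (intro mult_le_mono1) simp
    finally have jE: "j * EC + EC <= q0" using slots by linarith
    have labj: "ta2 9 r < 2 ^ Suc j" if "r < n" for r
    proof -
      have "ta 9 r < 2 ^ j" using I that by (simp add: I_def)
      then show ?thesis using S[OF that] C(2) by simp
    qed
    have outside: "has ta2 k h = has sg k h" if "k \<notin> {q0 * et 2..<q0 * et 2 + q0}" for k h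
    proof -
      have "k \<notin> {k0..<k0 + EC}" using that jE by (auto simp: k0_def)
      then show ?thesis using h2 C(4) I that by (simp add: I_def)
    qed
    have main: "(\<exists>sl<Suc j * EC. has ta2 (q0 * et 2 + sl) h) \<or> Suc j * g <= Phi (ta2 9)" if t: "target h" for h
    proof -
      have "(\<exists>sl<j * EC. has ta (q0 * et 2 + sl) h) \<or> j * g <= Phi (ta 9)" using I t by (simp add: I_def)
      then show ?thesis
      proof
        assume "\<exists>sl<j * EC. has ta (q0 * et 2 + sl) h"
        then obtain sl where sl: "sl < j * EC" "has ta (q0 * et 2 + sl) h" by blast
        then have "has ta2 (q0 * et 2 + sl) h" using h2 C(4) by (simp add: k0_def)
        moreover have "sl < Suc j * EC" using sl(1) by simp
        ultimately show ?thesis by blast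
      next
        assume ph: "j * g <= Phi (ta 9)"
        obtain c c' where co: "core n nbf c c' h" and al: "alx * n <= card {r. r < n & h r = Y r}" using t by (auto simp: target_def)
        define A where "A = {r. r < n & h r = Y r}"
        show ?thesis
        proof (cases "(dl * D^2) * n <= msq (Pr (ta1 9) (indicator A))")
          case True
          have "Phi (ta1 9) + g <= Phi (ta2 9)" unfolding g_def by (rule irregular_step[OF True S he])
          then have "Suc j * g <= Phi (ta2 9)" using ph C(2) by (simp add: distrib_right)
          then show ?thesis by blast
        next
          case False
          \<comment> \<open>A rounded density may equal \<open>mg\<close>, hence base
            \<open>Suc mg\<close>.\<close>
          obtain e where e: "e < Suc mg ^ LB" "\<forall>p<LB. dig (Suc mg) e p = dens mg (ta 9) A p"
            using dig_surj[of LB "%p. dens mg (ta 9) A p" "Suc mg"] dens_le by (auto simp: less_Suc_eq_le)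
          have "(2::nat) ^ j <= LB" unfolding LB using j by (intro power_increasing) auto
          then have ll: "ta 9 r < LB & dig (Suc mg) e (ta 9 r) = dens mg (ta 9) A (ta 9 r)" if "r < n" for r
            using I that e by (auto simp: I_def intro: order_less_le_trans)
          have eE: "e < EC" using e EC by simp
          have "has ta1 (k0 + e) h"
            by (rule C(5)[OF co eE decode_small[OF co A_def]]) (use al ll False C(2) in \<open>simp_all add: A_def\<close>)
          then have "has ta2 (q0 * et 2 + (j * EC + e)) h" by (simp add: h2 k0_def add.assoc)
          moreover have "j * EC + e < Suc j * EC" using eE by simp
          ultimately show ?thesis by blast
        qed
      qed
    qed
    have "run X y (Sq (CANDS j) SEARCH) et ta = ta2" by (simp add: ta1_def ta2_def)
    moreover have "ta2 a = sg a" if "a \<notin> wrs SEARCH \<union> {25, 26, 27, 28}" for a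
    proof -
      have "ta2 a = ta1 a" by (rule f2) (use that in blast)
      also have "... = ta a" by (rule f1) (use that in blast)
      finally show ?thesis using I that unfolding I_def by metis
    qed
    then have "I (Suc j) ta2" unfolding I_def using st2 so2 labj outside main by blast
    ultimately show "I (Suc j) (run X y (Sq (CANDS j) SEARCH) et ta)" by simp
  qed
  then show "sound sg'" "\<And>k h. k \<notin> {q0 * et 2..<q0 * et 2 + q0} ==> has sg' k h = has sg k h"
    "\<And>a. a \<notin> {0, 4} ==> a \<notin> wrs SEARCH \<union> {25, 26, 27, 28} ==> sg' a = sg a"
    unfolding I_def by blast+
  show "sg' 4 = sg 4" "sg' 0 = sg 0" using I unfolding I_def by simp_all
  fix h assume t: "target h"
  have "\<not> TT * g <= Phi (sg' 9)"
  proof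
    assume "TT * g <= Phi (sg' 9)"
    moreover have "Phi (sg' 9) <= K * (D^2 + lam^2 * (2 ^ TT))"
      using Phi_bound[of "sg' 9" "2 ^ TT"] I by (simp add: I_def)
    ultimately show False using TT unfolding g_def by linarith
  qed
  then obtain sl where "sl < TT * EC" "has sg' (q0 * et 2 + sl) h" using I t unfolding I_def by blast
  then show "\<exists>sl<q0. has sg' (q0 * et 2 + sl) h" using slots by (intro exI[of _ sl]) auto
qed

end

section \<open>The Gabber--Galil expander\<close>

definition ch :: "int => int => complex" where
  "ch m t = cis (2 * pi * of_int t / of_int m)"

lemma ch_add: "ch m (s + t) = ch m s * ch m t"
  by (simp add: ch_def cis_mult add_divide_distrib distrib_left)

lemma ch_0 [simp]: "ch m 0 = 1" by (simp add: ch_def)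

lemma norm_ch [simp]: "norm (ch m t) = 1" by (simp add: ch_def)

lemma cnj_ch: "cnj (ch m t) = ch m (- t)" by (simp add: ch_def cis_cnj)

lemma ch_period: "m > 0 ==> ch m (m * k) = 1"
proof -
  assume "m > 0"
  then have "2 * pi * of_int (m * k) / of_int m = 2 * pi * of_int k" by simp
  then show ?thesis unfolding ch_def by (metis cis_multiple_2pi Ints_of_int)
qed

lemma ch_mod: "m > 0 ==> ch m (t mod m) = ch m t"
  by (metis ch_add ch_period mult_div_mod_eq mult_1)

lemma ch_eq_1:
  assumes "m > 0" shows "ch m t = 1 \<longleftrightarrow> m dvd t"
proof
  assume "ch m t = 1"
  then have "cos (2 * pi * of_int t / of_int m) = 1" by (simp add: ch_def complex_eq_iff)
  then obtain k :: int where "2 * pi * of_int t / of_int m = of_int k * 2 * pi"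
    by (auto simp: cos_one_2pi_int)
  then have "of_int t = (of_int (k * m) :: real)" using assms by (simp add: field_simps)
  then have "t = k * m" by linarith
  then show "m dvd t" by simp
next
  assume "m dvd t"
  then show "ch m t = 1" using ch_period[OF assms] by auto
qed

lemma sum_shift:
  fixes phx :: "int => 'a :: comm_monoid_add"
  assumes "m > 0" "\<And>a. phx (a mod m) = phx a"
  shows "(\<Sum>a\<in>{0..<m}. phx (a + s)) = (\<Sum>a\<in>{0..<m}. phx a)"
proof -
  have "(\<Sum>a\<in>{0..<m}. phx (a + s)) = (\<Sum>a\<in>{0..<m}. phx ((a + s) mod m))" using assms by simp
  also have "... = (\<Sum>a\<in>{0..<m}. phx a)"
    by (rule sum.reindex_bij_witness[where i = "%a. (a - s) mod m" and j = "%a. (a + s) mod m"])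
      (use assms in \<open>auto simp: mod_simps\<close>)
  finally show ?thesis .
qed

lemma ch_sum:
  assumes "m > 0"
  shows "(\<Sum>a\<in>{0..<m}. ch m (a * t)) = (if m dvd t then of_int m else 0)"
proof (cases "m dvd t")
  case True
  then have "ch m (a * t) = 1" for a using ch_eq_1[OF assms] by simp
  then show ?thesis using True assms by simp
next
  case False
  have p: "ch m (a mod m * t) = ch m (a * t)" for a
    using ch_mod[OF assms, of "a mod m * t"] ch_mod[OF assms, of "a * t"] by (simp add: mod_mult_left_eq)
  have "(\<Sum>a\<in>{0..<m}. ch m (a * t)) = (\<Sum>a\<in>{0..<m}. ch m ((a + 1) * t))"
    using sum_shift[of m "%a. ch m (a * t)" 1] assms p by simp
  also have "... = ch m t * (\<Sum>a\<in>{0..<m}. ch m (a * t))"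
    by (simp add: sum_distrib_left distrib_right ch_add mult.commute[of "ch m t"])
  finally have "(1 - ch m t) * (\<Sum>a\<in>{0..<m}. ch m (a * t)) = 0" by (simp add: algebra_simps)
  then show ?thesis using False ch_eq_1[OF assms] by auto
qed

definition dft :: "int => (int => complex) => int => complex" where
  "dft m u a = (\<Sum>x\<in>{0..<m}. u x * ch m (- (a * x)))"

lemma plancherel:
  assumes "m > 0"
  shows "(\<Sum>a\<in>{0..<m}. dft m u a * cnj (dft m v a)) = of_int m * (\<Sum>x\<in>{0..<m}. u x * cnj (v x))"
proof -
  have "(\<Sum>a\<in>{0..<m}. dft m u a * cnj (dft m v a)) =
    (\<Sum>a\<in>{0..<m}. \<Sum>x\<in>{0..<m}. \<Sum>z\<in>{0..<m}. u x * cnj (v z) * ch m (a * (z - x)))"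
  proof (rule sum.cong[OF refl])
    fix a
    have e: "u x * ch m (- (a * x)) * (cnj (v z) * ch m (a * z)) = u x * cnj (v z) * ch m (a * (z - x))" for x z
    proof -
      have "ch m (a * (z - x)) = ch m (- (a * x) + a * z)" by (simp add: algebra_simps)
      then show ?thesis by (simp only: ch_add mult_ac)
    qed
    show "dft m u a * cnj (dft m v a) =
      (\<Sum>x\<in>{0..<m}. \<Sum>z\<in>{0..<m}. u x * cnj (v z) * ch m (a * (z - x)))"
      unfolding dft_def cnj_sum sum_product complex_cnj_mult cnj_ch minus_minus e ..
  qed
  also have "... = (\<Sum>x\<in>{0..<m}. \<Sum>z\<in>{0..<m}. u x * cnj (v z) * (\<Sum>a\<in>{0..<m}. ch m (a * (z - x))))"
    unfolding sum_distrib_left by (rule trans[OF sum.swap]) (intro sum.cong refl sum.swap)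
  also have "... = (\<Sum>x\<in>{0..<m}. \<Sum>z\<in>{0..<m}. if z = x then u x * cnj (v z) * of_int m else 0)"
  proof (intro sum.cong refl)
    fix x z assume "x \<in> {0..<m}" "z \<in> {0..<m}"
    then have "m dvd z - x \<longleftrightarrow> z = x" using zdvd_not_zless[of "z - x" m] zdvd_not_zless[of "x - z" m]
      by (smt (verit) atLeastLessThan_iff dvd_0_right dvd_diff_commute)
    then show "u x * cnj (v z) * (\<Sum>a\<in>{0..<m}. ch m (a * (z - x))) =
      (if z = x then u x * cnj (v z) * of_int m else 0)" by (simp add: ch_sum[OF assms])
  qed
  also have "... = of_int m * (\<Sum>x\<in>{0..<m}. u x * cnj (v x))"
    by (simp add: sum_distrib_left mult.commute)
  finally show ?thesis .
qed

definition dft2 :: "int => (int => int => real) => int => int => complex" where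
  "dft2 m h a b = dft m (%x. dft m (%y. of_real (h x y)) b) a"

lemma plancherel2:
  assumes "m > 0"
  shows "(\<Sum>a\<in>{0..<m}. \<Sum>b\<in>{0..<m}. dft2 m h a b * cnj (dft2 m g a b)) =
     of_int (m * m) * of_real (\<Sum>x\<in>{0..<m}. \<Sum>y\<in>{0..<m}. h x y * g x y)"
proof -
  have "(\<Sum>a\<in>{0..<m}. \<Sum>b\<in>{0..<m}. dft2 m h a b * cnj (dft2 m g a b)) =
      (\<Sum>b\<in>{0..<m}. \<Sum>a\<in>{0..<m}. dft2 m h a b * cnj (dft2 m g a b))" by (rule sum.swap)
  also have "... = of_int m * (\<Sum>b\<in>{0..<m}. \<Sum>x\<in>{0..<m}. dft m (%y. of_real (h x y)) b * cnj (dft m (%y. of_real (g x y)) b))"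
    unfolding dft2_def plancherel[OF assms] by (simp add: sum_distrib_left)
  also have "... = of_int m * (\<Sum>x\<in>{0..<m}. \<Sum>b\<in>{0..<m}. dft m (%y. of_real (h x y)) b * cnj (dft m (%y. of_real (g x y)) b))"
    by (subst sum.swap) simp
  also have "... = of_int (m * m) * of_real (\<Sum>x\<in>{0..<m}. \<Sum>y\<in>{0..<m}. h x y * g x y)"
    unfolding plancherel[OF assms] by (simp add: sum_distrib_left[symmetric])
  finally show ?thesis .
qed

lemma dft2_sum: "dft2 m h a b = (\<Sum>x\<in>{0..<m}. \<Sum>y\<in>{0..<m}. of_real (h x y) * ch m (- (a * x + b * y)))"
  unfolding dft2_def dft_def
  by (simp only: sum_distrib_right minus_add_distrib ch_add mult.assoc) (simp only: mult.commute[of "ch m (- (b * _))"])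

lemma ch_cong: "m > 0 ==> s mod m = t mod m ==> ch m s = ch m t"
  by (metis ch_mod)

lemma ch_dvd: "m > 0 ==> m dvd s - t ==> ch m s = ch m t"
  by (intro ch_cong) (auto simp: mod_eq_dvd_iff)

lemma dvd_mod_diff: "(m :: int) dvd a mod m - a" "m dvd a - a mod m"
  by (simp_all add: mod_eq_dvd_iff[symmetric])

lemma dft2_period:
  assumes m: "m > 0"
  shows "dft2 m h (a mod m) b = dft2 m h a b" "dft2 m h a (b mod m) = dft2 m h a b"
proof -
  have "ch m (- (a mod m * x + b * y)) = ch m (- (a * x + b * y))"
    "ch m (- (a * x + b mod m * y)) = ch m (- (a * x + b * y))" for x y
  proof -
    have "- (a mod m * x + b * y) - - (a * x + b * y) = (a - a mod m) * x"
      "- (a * x + b mod m * y) - - (a * x + b * y) = (b - b mod m) * y" by (simp_all add: algebra_simps)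
    then show "ch m (- (a mod m * x + b * y)) = ch m (- (a * x + b * y))"
      "ch m (- (a * x + b mod m * y)) = ch m (- (a * x + b * y))"
      using dvd_mult2[OF dvd_mod_diff(2)] by (intro ch_dvd[OF m]; metis)+
  qed
  then show "dft2 m h (a mod m) b = dft2 m h a b" "dft2 m h a (b mod m) = dft2 m h a b"
    unfolding dft2_sum by simp_all
qed

text \<open>A shear of the torus acts on frequencies by the inverse transposed shear, and the
  translation by \<open>c\<close> becomes a phase.\<close>

lemma dft2_shear1:
  assumes m: "m > 0" and per: "\<And>x y. h (x mod m) y = h x y"
  shows "dft2 m (%x y. h (x + 2 * y + c) y) a b = ch m (a * c) * dft2 m h a (b - 2 * a)"
proof -
  have "(\<Sum>x\<in>{0..<m}. of_real (h (x + 2 * y + c) y) * ch m (- (a * x + b * y))) =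
     (\<Sum>x\<in>{0..<m}. ch m (a * c) * (of_real (h x y) * ch m (- (a * x + (b - 2 * a) * y))))" for y
  proof -
    let ?phx = "%x. of_real (h x y) * ch m (- (a * (x - 2 * y - c) + b * y))"
    have "ch m (- (a * (x mod m - 2 * y - c) + b * y)) = ch m (- (a * (x - 2 * y - c) + b * y))" for x
    proof (rule ch_dvd[OF m])
      have "- (a * (x mod m - 2 * y - c) + b * y) - - (a * (x - 2 * y - c) + b * y) = a * (x - x mod m)" by (simp add: algebra_simps)
      then show "m dvd - (a * (x mod m - 2 * y - c) + b * y) - - (a * (x - 2 * y - c) + b * y)" using dvd_mult[OF dvd_mod_diff(2)] by metis
    qed
    then have sh: "(\<Sum>x\<in>{0..<m}. ?phx (x + (2 * y + c))) = (\<Sum>x\<in>{0..<m}. ?phx x)"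
      using per by (intro sum_shift[OF m]) simp
    have pe: "?phx x = ch m (a * c) * (of_real (h x y) * ch m (- (a * x + (b - 2 * a) * y)))" for x
    proof -
      have "- (a * (x - 2 * y - c) + b * y) = a * c + - (a * x + (b - 2 * a) * y)" by (simp add: algebra_simps)
      then show ?thesis by (simp only: ch_add mult_ac)
    qed
    have "(\<Sum>x\<in>{0..<m}. of_real (h (x + 2 * y + c) y) * ch m (- (a * x + b * y))) = (\<Sum>x\<in>{0..<m}. ?phx (x + (2 * y + c)))"
      by (intro sum.cong refl) (simp add: add.assoc)
    also have "... = (\<Sum>x\<in>{0..<m}. ch m (a * c) * (of_real (h x y) * ch m (- (a * x + (b - 2 * a) * y))))"
      unfolding sh by (intro sum.cong refl pe)
    finally show ?thesis .
  qed
  then show ?thesis unfolding dft2_sum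
    by (subst sum.swap, simp, subst sum.swap) (simp add: sum_distrib_left)
qed

lemma dft2_shear2:
  assumes m: "m > 0" and per: "\<And>x y. h x (y mod m) = h x y"
  shows "dft2 m (%x y. h x (y + 2 * x + c)) a b = ch m (b * c) * dft2 m h (a - 2 * b) b"
proof -
  have "(\<Sum>y\<in>{0..<m}. of_real (h x (y + 2 * x + c)) * ch m (- (a * x + b * y))) =
     (\<Sum>y\<in>{0..<m}. ch m (b * c) * (of_real (h x y) * ch m (- ((a - 2 * b) * x + b * y))))" for x
  proof -
    let ?phx = "%y. of_real (h x y) * ch m (- (a * x + b * (y - 2 * x - c)))"
    have "ch m (- (a * x + b * (y mod m - 2 * x - c))) = ch m (- (a * x + b * (y - 2 * x - c)))" for y
    proof (rule ch_dvd[OF m])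
      have "- (a * x + b * (y mod m - 2 * x - c)) - - (a * x + b * (y - 2 * x - c)) = b * (y - y mod m)" by (simp add: algebra_simps)
      then show "m dvd - (a * x + b * (y mod m - 2 * x - c)) - - (a * x + b * (y - 2 * x - c))" using dvd_mult[OF dvd_mod_diff(2)] by metis
    qed
    then have sh: "(\<Sum>y\<in>{0..<m}. ?phx (y + (2 * x + c))) = (\<Sum>y\<in>{0..<m}. ?phx y)"
      using per by (intro sum_shift[OF m]) simp
    have pe: "?phx y = ch m (b * c) * (of_real (h x y) * ch m (- ((a - 2 * b) * x + b * y)))" for y
    proof -
      have "- (a * x + b * (y - 2 * x - c)) = b * c + - ((a - 2 * b) * x + b * y)" by (simp add: algebra_simps)
      then show ?thesis by (simp only: ch_add mult_ac)
    qed
    have "(\<Sum>y\<in>{0..<m}. of_real (h x (y + 2 * x + c)) * ch m (- (a * x + b * y))) = (\<Sum>y\<in>{0..<m}. ?phx (y + (2 * x + c)))"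
      by (intro sum.cong refl) (simp add: add.assoc)
    also have "... = (\<Sum>y\<in>{0..<m}. ch m (b * c) * (of_real (h x y) * ch m (- ((a - 2 * b) * x + b * y))))"
      unfolding sh by (intro sum.cong refl pe)
    finally show ?thesis .
  qed
  then show ?thesis unfolding dft2_sum by (simp add: sum_distrib_left)
qed

section \<open>Weights on the frequencies\<close>

definition ab :: "int => int => int" where
  "ab m a = min (a mod m) (m - a mod m)"

definition cs :: "int => int => real" where
  "cs m a = \<bar>cos (pi * of_int a / of_int m)\<bar>"

text \<open>A weight for the inequality between arithmetic and geometric mean, reciprocal under
  exchange of the arguments. The frequency farther from 0 gets the larger weight; 5/4 is tuned to
  the bound 73/20 below.\<close>

definition gam :: "int => int => real" where
  "gam p q = (if p > q then 5 / 4 else if p < q then 4 / 5 else 1)"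

lemma norm_1_ch: "norm (1 + ch m a) = 2 * cs m a"
proof -
  define t where "t = pi * of_int a / of_int m"
  have "ch m a = cis (2 * t)" by (simp add: ch_def t_def mult.assoc)
  then have "1 + ch m a = cis t * of_real (2 * cos t)"
    by (simp add: complex_eq_iff cos_double_cos sin_double power2_eq_square)
  then have "norm (1 + ch m a) = \<bar>2 * cos t\<bar>" by (simp only: norm_mult norm_cis norm_of_real mult_1)
  then show ?thesis by (simp add: cs_def t_def abs_mult)
qed

lemma ab_small: "m > 0 ==> 0 <= x ==> x <= m ==> ab m x = min x (m - x)"
  by (cases "x = m") (auto simp: ab_def)

lemma ab_uminus: "m > 0 ==> ab m (- x) = ab m x"
  by (cases "x mod m = 0") (auto simp: ab_def zmod_zminus1_eq_if)

lemma ab_cong: "x mod m = y mod m ==> ab m x = ab m y"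
  by (simp add: ab_def)

lemma cs_uminus: "cs m (- a) = cs m a"
  by (simp add: cs_def)

lemma cs_period: "m > 0 ==> cs m (a + m * k) = cs m a"
proof -
  assume m: "m > 0"
  have "ch m (a + m * k) = ch m a" by (simp add: ch_add ch_period[OF m])
  then show ?thesis using norm_1_ch[of m a] norm_1_ch[of m "a + m * k"] by simp
qed

lemma cs_small:
  assumes "m > 0" "0 <= p" "2 * p <= m"
  shows "cs m p = cos (pi * of_int p / of_int m)" "0 <= cs m p" "cs m p <= 1"
proof -
  have "0 <= pi * of_int p / of_int m" using assms by simp
  moreover have "pi * of_int p / of_int m <= pi / 2"
    using assms mult_left_mono[of "of_int (2 * p)" "of_int m" pi] by (simp add: field_simps)
  ultimately show "cs m p = cos (pi * of_int p / of_int m)" unfolding cs_def by (intro abs_of_nonneg cos_ge_zero) auto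
qed (auto simp: cs_def)

definition coef :: "int => int => int => real" where
  "coef m a b = cs m a * (gam (ab m b) (ab m (b - 2 * a)) + gam (ab m b) (ab m (b + 2 * a)))
              + cs m b * (gam (ab m a) (ab m (a - 2 * b)) + gam (ab m a) (ab m (a + 2 * b)))"

lemma coef_swap: "coef m a b = coef m b a"
  by (simp add: coef_def)

lemma coef_neg: "m > 0 ==> coef m (- a) b = coef m a b"
proof -
  assume m: "m > 0"
  have "ab m (- a - 2 * b) = ab m (a + 2 * b)" "ab m (- a + 2 * b) = ab m (a - 2 * b)"
    using ab_uminus[OF m, of "a + 2 * b"] ab_uminus[OF m, of "a - 2 * b"] by (simp_all add: algebra_simps)
  moreover have "b - 2 * - a = b + 2 * a" "b + 2 * - a = b - 2 * a" by simp_all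
  ultimately show ?thesis by (simp only: coef_def cs_uminus ab_uminus[OF m] add.commute)
qed

lemma coef_mod:
  assumes m: "m > 0" shows "coef m (a + m * k) b = coef m a b"
proof -
  have e: "b - 2 * (a + m * k) = (b - 2 * a) + m * (- 2 * k)" "b + 2 * (a + m * k) = (b + 2 * a) + m * (2 * k)"
    "a + m * k - 2 * b = (a - 2 * b) + m * k" "a + m * k + 2 * b = (a + 2 * b) + m * k"
    by (simp_all add: algebra_simps)
  have ab: "ab m (x + m * k) = ab m x" for x k by (simp add: ab_def)
  show ?thesis unfolding coef_def e ab cs_period[OF m] ..
qed

lemma gam_le: "gam p q <= 5 / 4" by (simp add: gam_def)

text \<open>If \<open>2 * (p + q) < m\<close> and \<open>q < p\<close>, both
  \<open>q + 2 * p\<close> and \<open>q - 2 * p\<close> lie farther from 0 than \<open>q\<close>,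
  with weight 4/5 each, and at most one of \<open>p + 2 * q\<close> and \<open>p - 2 * q\<close>
  lies closer than \<open>p\<close>: 8/5 + 5/4 + 4/5 = 73/20. For \<open>q = p\<close> the sum is at
  most 18/5. Otherwise the two cosines add up to at most the square root of 2, which is below 1.46,
  and 1.46 times 5/2 is again 73/20.\<close>

lemma coef_small:
  assumes m: "m > 0" and q: "0 <= q" "q <= p" "2 * p <= m" "p > 0"
  shows "coef m p q <= 73 / 20"
proof (cases "2 * (p + q) < m")
  case True
  have 1: "ab m q = q" "ab m p = p" using q by (auto simp: ab_small[OF m])
  have 2: "gam (ab m q) (ab m (q - 2 * p)) + gam (ab m q) (ab m (q + 2 * p)) = 8 / 5"
    if "q < p"
  proof -
    have "ab m (q - 2 * p) = ab m (2 * p - q)" using ab_uminus[OF m, of "2 * p - q"] by simp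
    then show ?thesis using 1 True q that m by (auto simp: ab_small[OF m] gam_def min_def)
  qed
  have 3: "gam (ab m q) (ab m (q - 2 * p)) + gam (ab m q) (ab m (q + 2 * p)) = 9 / 5"
     "gam (ab m p) (ab m (p - 2 * q)) + gam (ab m p) (ab m (p + 2 * q)) = 9 / 5"
    if "q = p"
    using 1 True q that m ab_uminus[OF m, of p] by (auto simp: ab_small[OF m] gam_def min_def)
  have 4: "gam (ab m p) (ab m (p - 2 * q)) + gam (ab m p) (ab m (p + 2 * q)) <= 41 / 20"
    if "q < p"
  proof (cases "p \<ge> 2 * q")
    case True
    then show ?thesis using 1 \<open>2 * (p + q) < m\<close> q that m
      by (cases "q = 0") (auto simp: ab_small[OF m] gam_def min_def)
  next
    case False
    have "ab m (p - 2 * q) = ab m (2 * q - p)" using ab_uminus[OF m, of "2 * q - p"] by simp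
    then show ?thesis using 1 True q that m False by (auto simp: ab_small[OF m] gam_def min_def)
  qed
  have cp: "0 <= cs m p" "cs m p <= 1" "0 <= cs m q" "cs m q <= 1"
    using cs_small[OF m, of p] cs_small[OF m, of q] q by auto
  show ?thesis
  proof (cases "q = p")
    case True
    show ?thesis using cp unfolding coef_def 3[OF True] by simp
  next
    case False
    then have l: "q < p" using q by simp
    have "cs m q * (gam (ab m p) (ab m (p - 2 * q)) + gam (ab m p) (ab m (p + 2 * q))) <= 1 * (41 / 20)"
      using cp 4[OF l] by (intro mult_mono) (auto simp: gam_def)
    then show ?thesis using cp unfolding coef_def 2[OF l] by simp
  qed
next
  case False
  have cp: "0 <= cs m p" "0 <= cs m q" using cs_small[OF m, of p] cs_small[OF m, of q] q by auto
  define t where "t = pi * of_int p / of_int m"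
  have t: "cs m p = cos t" using cs_small[OF m, of p] q by (simp add: t_def)
  have "pi / 2 - t <= pi * of_int q / of_int m"
  proof -
    have "m <= 2 * (p + q)" using False by simp
    then have "real_of_int m <= real_of_int (2 * (p + q))" by (simp only: of_int_le_iff)
    then have "of_int m <= (2 * (of_int p + of_int q) :: real)" by simp
    then have "pi * of_int m <= pi * (2 * (of_int p + of_int q))" by (intro mult_left_mono) auto
    then have "pi / 2 <= (pi * of_int p + pi * of_int q) / of_int m" using m
      by (simp add: pos_le_divide_eq algebra_simps)
    then show ?thesis unfolding t_def add_divide_distrib by linarith
  qed
  moreover have "0 <= t" using m q by (simp add: t_def)
  moreover have "t <= pi / 2"
    using q m mult_left_mono[of "of_int (2 * p)" "of_int m" pi] by (simp add: t_def field_simps)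
  moreover have "pi * of_int q / of_int m <= pi"
    using q m mult_left_mono[of "of_int q" "of_int m" pi] by (simp add: field_simps)
  ultimately have "cos (pi * of_int q / of_int m) <= cos (pi / 2 - t)"
    by (intro cos_monotone_0_pi_le) auto
  then have u: "cs m q <= sin t" using cs_small[OF m, of q] q by (simp add: cos_diff)
  have "(cos t + sin t)^2 = 1 + 2 * (cos t * sin t)"
    using sin_cos_squared_add[of t] by (simp add: power2_sum algebra_simps)
  also have "2 * (cos t * sin t) = sin (2 * t)" by (simp add: sin_double)
  also have "1 + sin (2 * t) <= (1.46)^2" unfolding power2_eq_square using sin_le_one[of "2 * t"] by linarith
  finally have "cos t + sin t <= 1.46" by (rule power2_le_imp_le) simp
  then have s: "cs m p + cs m q <= 1.46" using t u by simp
  have "coef m p q <= cs m p * (5 / 4 + 5 / 4) + cs m q * (5 / 4 + 5 / 4)"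
    unfolding coef_def using cp by (intro add_mono mult_left_mono gam_le) auto
  then show ?thesis using s by simp
qed

text \<open>Periodicity and change of sign move both frequencies into the interval from 0 to
  \<open>m / 2\<close>, and symmetry orders them.\<close>

lemma coef_le:
  assumes m: "m > 0" and nz: "\<not> (m dvd a & m dvd b)"
  shows "coef m a b <= 73 / 20"
proof -
  have ex: "\<exists>p k. 0 <= p & 2 * p <= m & (a = p + m * k \<or> a = - p + m * k)" for a
  proof (cases "2 * (a mod m) <= m")
    case True
    then show ?thesis using m by (intro exI[of _ "a mod m"] exI[of _ "a div m"]) auto
  next
    case False
    have "a = - (m - a mod m) + m * (a div m + 1)" by (simp add: algebra_simps)
    then show ?thesis using m False
      by (intro exI[of _ "m - a mod m"] exI[of _ "a div m + 1"]) (auto simp: order.order_iff_strict)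
  qed
  have red: "\<exists>p. 0 <= p & 2 * p <= m & (p = 0 --> m dvd a) & (\<forall>b. coef m a b = coef m p b)" for a
    using ex[of a] coef_mod[OF m] coef_neg[OF m] by (metis add_0 add.inverse_neutral dvd_triv_left)
  obtain p where p: "0 <= p" "2 * p <= m" "p = 0 --> m dvd a" "\<forall>b. coef m a b = coef m p b" using red[of a] by blast
  obtain q where q: "0 <= q" "2 * q <= m" "q = 0 --> m dvd b" "\<forall>a. coef m b a = coef m q a" using red[of b] by blast
  have e: "coef m a b = coef m p q" using p q by (metis coef_swap)
  show ?thesis
  proof (cases "q <= p")
    case True
    then show ?thesis using e coef_small[OF m, of q p] p q nz by force
  next
    case False
    then show ?thesis using e coef_small[OF m, of p q] p q nz coef_swap[of m p q] by force
  qed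
qed

lemma two_gam: "2 * (x * y) <= gam p q * x^2 + gam q p * (y :: real)^2"
proof -
  have "0 <= (5 * x - 4 * y)^2" "0 <= (4 * x - 5 * y)^2" "0 <= (x - y)^2" by simp_all
  then show ?thesis by (auto simp: gam_def power2_eq_square algebra_simps)
qed

text \<open>Each product is replaced by weighted squares, and the second square is shifted back to
  the frequency of the first; every square then collects the factor \<open>coef\<close>.\<close>

lemma fourier_bound:
  fixes G :: "int => int => real"
  assumes m: "m > 0" and per: "\<And>a b. G (a mod m) b = G a b" "\<And>a b. G a (b mod m) = G a b"
    and z: "G 0 0 = 0"
  shows "(\<Sum>a\<in>{0..<m}. \<Sum>b\<in>{0..<m}. 2 * (G a b * G a (b - 2 * a)) * cs m a + 2 * (G a b * G (a - 2 * b) b) * cs m b)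
     <= 73 / 20 * (\<Sum>a\<in>{0..<m}. \<Sum>b\<in>{0..<m}. (G a b)^2)"
proof -
  have cs0: "cs m a \<ge> 0" for a by (simp add: cs_def)
  let ?S = "%f. \<Sum>a\<in>{0..<m}. \<Sum>b\<in>{0..<m}. (f a b :: real)"
  let ?g1 = "%a b. gam (ab m b) (ab m (b - 2 * a))" and ?g2 = "%a b. gam (ab m (b - 2 * a)) (ab m b)"
  let ?g3 = "%a b. gam (ab m b) (ab m (b + 2 * a))"
  have key: "(\<Sum>b\<in>{0..<m}. 2 * (H b * H (b - 2 * a)) * cs m a) <=
      (\<Sum>b\<in>{0..<m}. cs m a * (?g1 a b + ?g3 a b) * (H b)^2)" if H: "\<And>b. H (b mod m) = H b" for H :: "int => real" and a
  proof -
    have "(\<Sum>b\<in>{0..<m}. 2 * (H b * H (b - 2 * a)) * cs m a) <=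
      (\<Sum>b\<in>{0..<m}. (?g1 a b * (H b)^2 + ?g2 a b * (H (b - 2 * a))^2) * cs m a)"
      by (intro sum_mono mult_right_mono two_gam cs0)
    also have "... = (\<Sum>b\<in>{0..<m}. cs m a * ?g1 a b * (H b)^2) + (\<Sum>b\<in>{0..<m}. cs m a * ?g2 a b * (H (b - 2 * a))^2)"
      by (simp add: sum.distrib[symmetric] algebra_simps)
    also have "(\<Sum>b\<in>{0..<m}. cs m a * ?g2 a b * (H (b - 2 * a))^2) = (\<Sum>b\<in>{0..<m}. cs m a * ?g3 a b * (H b)^2)"
    proof -
      let ?phx = "%b. cs m a * ?g3 a b * (H b)^2"
      have "ab m (b mod m) = ab m b" "ab m (b mod m + 2 * a) = ab m (b + 2 * a)" for b
        by (intro ab_cong; simp add: mod_simps)+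
      then have "(\<Sum>b\<in>{0..<m}. ?phx (b + - (2 * a))) = (\<Sum>b\<in>{0..<m}. ?phx b)"
        using H by (intro sum_shift[OF m]) simp
      then show ?thesis by simp
    qed
    finally show ?thesis by (simp add: sum.distrib[symmetric] algebra_simps)
  qed
  have "?S (%a b. 2 * (G a b * G a (b - 2 * a)) * cs m a + 2 * (G a b * G (a - 2 * b) b) * cs m b) =
    ?S (%a b. 2 * (G a b * G a (b - 2 * a)) * cs m a) + (\<Sum>b\<in>{0..<m}. \<Sum>a\<in>{0..<m}. 2 * (G a b * G (a - 2 * b) b) * cs m b)"
    by (simp add: sum.distrib) (rule sum.swap)
  also have "... <= ?S (%a b. cs m a * (?g1 a b + ?g3 a b) * (G a b)^2) +
     (\<Sum>b\<in>{0..<m}. \<Sum>a\<in>{0..<m}. cs m b * (?g1 b a + ?g3 b a) * (G a b)^2)"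
    by (intro add_mono sum_mono key[of "%b. G _ b"] key[of "%a. G a _"] per)
  also have "(\<Sum>b\<in>{0..<m}. \<Sum>a\<in>{0..<m}. cs m b * (?g1 b a + ?g3 b a) * (G a b)^2) =
     ?S (%a b. cs m b * (?g1 b a + ?g3 b a) * (G a b)^2)" by (rule sum.swap)
  also have "?S (%a b. cs m a * (?g1 a b + ?g3 a b) * (G a b)^2) + ?S (%a b. cs m b * (?g1 b a + ?g3 b a) * (G a b)^2) =
     ?S (%a b. coef m a b * (G a b)^2)"
    by (simp add: sum.distrib[symmetric] coef_def algebra_simps)
  also have "... <= ?S (%a b. 73 / 20 * (G a b)^2)"
  proof (intro sum_mono)
    fix a b assume "a \<in> {0..<m}" "b \<in> {0..<m}"
    show "coef m a b * (G a b)^2 <= 73 / 20 * (G a b)^2"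
    proof (cases "m dvd a & m dvd b")
      case True
      then have "G a b = G 0 0" using per(1)[of a b] per(2)[of 0 b] by auto
      then show ?thesis using z by simp
    next
      case False
      then show ?thesis by (intro mult_right_mono coef_le[OF m]) auto
    qed
  qed
  also have "... = 73 / 20 * ?S (%a b. (G a b)^2)" by (simp add: sum_distrib_left)
  finally show ?thesis .
qed

text \<open>On the Fourier side the maps without and with the translation by 1 combine to a factor
  \<open>1 + ch m a\<close> of modulus \<open>2 * cs m a\<close>. Sum zero makes the transform
  vanish at frequency 0, the one place that \<open>coef_le\<close> excludes.\<close>

theorem gabber_galil_form:
  fixes h :: "int => int => real"
  assumes m: "m > 0" and per: "\<And>x y. h (x mod m) y = h x y" "\<And>x y. h x (y mod m) = h x y"
    and z: "(\<Sum>x\<in>{0..<m}. \<Sum>y\<in>{0..<m}. h x y) = 0"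
  shows "\<bar>\<Sum>x\<in>{0..<m}. \<Sum>y\<in>{0..<m}. h x y * (h (x + 2 * y) y + h (x + 2 * y + 1) y + h x (y + 2 * x) + h x (y + 2 * x + 1))\<bar>
     <= 73 / 20 * (\<Sum>x\<in>{0..<m}. \<Sum>y\<in>{0..<m}. (h x y)^2)"
proof -
  let ?S = "%f. \<Sum>x\<in>{0..<m}. \<Sum>y\<in>{0..<m}. f x y"
  define F where "F = dft2 m h"
  let ?g = "%x y. h (x + 2 * y) y + h (x + 2 * y + 1) y + h x (y + 2 * x) + h x (y + 2 * x + 1)"
  have dg: "dft2 m ?g a b = (1 + ch m a) * F a (b - 2 * a) + (1 + ch m b) * F (a - 2 * b) b" for a b
  proof -
    have "dft2 m ?g a b = dft2 m (%x y. h (x + 2 * y + 0) y) a b + dft2 m (%x y. h (x + 2 * y + 1) y) a b +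
       dft2 m (%x y. h x (y + 2 * x + 0)) a b + dft2 m (%x y. h x (y + 2 * x + 1)) a b"
      unfolding dft2_sum by (simp add: sum.distrib algebra_simps)
    also have "... = (1 + ch m a) * F a (b - 2 * a) + (1 + ch m b) * F (a - 2 * b) b"
      unfolding dft2_shear1[of m h, OF m per(1)] dft2_shear2[of m h, OF m per(2)] F_def by (simp add: algebra_simps)
    finally show ?thesis .
  qed
  have "real_of_int (m * m) * \<bar>?S (%x y. h x y * ?g x y)\<bar> = norm (?S (%a b. F a b * cnj (dft2 m ?g a b)))"
    unfolding F_def plancherel2[OF m] using m by (simp add: norm_mult del: of_real_sum of_real_mult)
  also have "... <= ?S (%a b. norm (F a b * cnj (dft2 m ?g a b)))"
    by (rule order_trans[OF norm_sum]) (intro sum_mono norm_sum)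
  also have "... <= ?S (%a b. 2 * (norm (F a b) * norm (F a (b - 2 * a))) * cs m a + 2 * (norm (F a b) * norm (F (a - 2 * b) b)) * cs m b)"
  proof (intro sum_mono)
    fix a b
    have "norm (dft2 m ?g a b) <= norm ((1 + ch m a) * F a (b - 2 * a)) + norm ((1 + ch m b) * F (a - 2 * b) b)"
      unfolding dg by (rule norm_triangle_ineq)
    then have "norm (F a b) * norm (dft2 m ?g a b) <= norm (F a b) * (2 * cs m a * norm (F a (b - 2 * a)) + 2 * cs m b * norm (F (a - 2 * b) b))"
      by (intro mult_left_mono) (simp_all add: norm_mult norm_1_ch)
    then show "norm (F a b * cnj (dft2 m ?g a b)) <= 2 * (norm (F a b) * norm (F a (b - 2 * a))) * cs m a + 2 * (norm (F a b) * norm (F (a - 2 * b) b)) * cs m b"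
      by (simp add: norm_mult algebra_simps)
  qed
  also have "... <= 73 / 20 * ?S (%a b. (norm (F a b))^2)"
  proof (rule fourier_bound[OF m])
    have "F 0 0 = of_real (?S h)" unfolding F_def dft2_sum by simp
    then show "norm (F 0 0) = 0" using z by simp
  qed (simp_all add: F_def dft2_period[OF m])
  also have "?S (%a b. (norm (F a b))^2) = real_of_int (m * m) * ?S (%x y. (h x y)^2)"
  proof -
    have "complex_of_real (?S (%a b. (norm (F a b))^2)) = ?S (%a b. F a b * cnj (F a b))"
      unfolding of_real_sum complex_norm_square ..
    also have "... = of_int (m * m) * of_real (?S (%x y. h x y * h x y))" unfolding F_def by (rule plancherel2[OF m])
    also have "... = complex_of_real (real_of_int (m * m) * ?S (%x y. (h x y)^2))"
      by (simp add: power2_eq_square)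
    finally show ?thesis by (simp only: of_real_eq_iff)
  qed
  finally have "real_of_int (m * m) * \<bar>?S (%x y. h x y * ?g x y)\<bar> <= real_of_int (m * m) * (73 / 20 * ?S (%x y. (h x y)^2))"
    by (simp add: algebra_simps)
  then show ?thesis using m by (simp only: mult_le_cancel_left_pos of_int_0_less_iff mult_pos_pos)
qed

text \<open>
  Vertex \<open>v < m * m\<close> stands for \<open>(v div m, v mod m)\<close>; generator \<open>g + 4\<close> is the inverse of \<open>g\<close>.
\<close>

definition gg :: "nat => nat => nat => nat" where
  "gg m g v = (let x = v div m; y = v mod m; u = (if g mod 4 < 2 then y else x);
      t = (if g < 4 then 2 * u + g mod 2 else 2 * (m - u) + (m - 1) * (g mod 2)) in
      if g mod 4 < 2 then (x + t) mod m * m + y else x * m + (y + t) mod m)"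

text \<open>Walks of length \<open>k\<close>: the power of the graph has degree
  \<open>8 ^ k\<close>, and its spectral ratio, at most \<open>(73 / 80) ^ k\<close>, becomes as
  small as desired.\<close>

fun nb :: "nat => nat => nat => nat => nat" where
  "nb m 0 w v = v"
| "nb m (Suc k) w v = nb m k (w div 8) (gg m (w mod 8) v)"

lemma gg_less: "v < m * m ==> gg m g v < m * m"
proof -
  assume v: "v < m * m"
  then have m: "m > 0" by (cases m) auto
  have "a * m + b < m * m" if "a < m" "b < m" for a b
  proof -
    have "a * m + b < Suc a * m" using that by simp
    also have "... <= m * m" using that by (intro mult_le_mono1) simp
    finally show ?thesis .
  qed
  moreover have "v div m < m" using v by (simp add: less_mult_imp_div_less)
  ultimately show ?thesis using m by (simp add: gg_def Let_def)
qed

lemma nb_less: "v < m * m ==> nb m k w v < m * m"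
  by (induction k arbitrary: w v) (simp_all add: gg_less)

section \<open>From the torus to vertex numbers\<close>

definition per :: "nat => (nat => real) => int => int => real" where
  "per m f x y = f (nat (x mod int m) * m + nat (y mod int m))"

lemma sum_int_nat: "(\<Sum>x\<in>{0..<int m}. phx x) = (\<Sum>x<m. phx (int x))"
  by (rule sum.reindex_bij_witness[where i = int and j = nat]) auto

lemma sum_square: "(\<Sum>v<m * m. phx (v div m) (v mod m)) = (\<Sum>x<m. \<Sum>y<m. phx x (y :: nat))" for m :: nat
proof (cases "m = 0")
  case False
  show ?thesis unfolding sum.cartesian_product
    by (rule sum.reindex_bij_witness[where i = "%(x, y). x * m + y" and j = "%v. (v div m, v mod m)"])
      (use False in \<open>auto simp: less_mult_imp_div_less\<close>, metis add_mult_distrib2 add.commute mult_Suc mult_Suc_right Suc_le_eq mult_le_mono1 nat_add_left_cancel_less order_less_le_trans)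
qed simp

lemma sum_per: "(\<Sum>x\<in>{0..<int m}. \<Sum>y\<in>{0..<int m}. \<Phi> (per m f x y)) = (\<Sum>v<m * m. \<Phi> (f v))"
proof -
  have "(\<Sum>v<m * m. \<Phi> (f v)) = (\<Sum>v<m * m. \<Phi> (f (v div m * m + v mod m)))" by simp
  also have "... = (\<Sum>x<m. \<Sum>y<m. \<Phi> (f (x * m + y)))"
    by (rule sum_square[of "%x y. \<Phi> (f (x * m + y))"])
  also have "... = (\<Sum>x\<in>{0..<int m}. \<Sum>y\<in>{0..<int m}. \<Phi> (per m f x y))"
    by (simp add: sum_int_nat per_def nat_mod_distrib)
  finally show ?thesis by simp
qed

lemma gg_per:
  assumes v: "v < m * m"
  defines "x \<equiv> int (v div m)" and "y \<equiv> int (v mod m)"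
  shows "f (gg m 0 v) = per m f (x + 2 * y) y" "f (gg m 1 v) = per m f (x + 2 * y + 1) y"
    "f (gg m 2 v) = per m f x (y + 2 * x)" "f (gg m 3 v) = per m f x (y + 2 * x + 1)"
    "f (gg m 4 v) = per m f (x - 2 * y) y" "f (gg m 5 v) = per m f (x - 2 * y - 1) y"
    "f (gg m 6 v) = per m f x (y - 2 * x)" "f (gg m 7 v) = per m f x (y - 2 * x - 1)"
proof -
  have m: "m > 0" using v by (cases m) auto
  define a where "a = v div m"
  define b where "b = v mod m"
  have a: "a < m" using v by (simp add: a_def less_mult_imp_div_less)
  have b: "b < m" using m by (simp add: b_def)
  have xy: "x = int a" "y = int b" by (simp_all add: x_def y_def a_def b_def)
  have n1: "nat (int a mod int m) = a" "nat (int b mod int m) = b" using a b by auto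
  have n2: "nat ((int c + 2 * int d) mod int m) = (c + 2 * d) mod m"
    "nat ((int c + 2 * int d + 1) mod int m) = (c + (2 * d + 1)) mod m" for c d
    by (simp_all add: nat_mod_distrib nat_add_distrib nat_mult_distrib)
  have n3: "nat ((int c - 2 * int d) mod int m) = (c + 2 * (m - d)) mod m"
    "nat ((int c - 2 * int d - 1) mod int m) = (c + (2 * (m - d) + (m - 1))) mod m" if "d < m" for c d
  proof -
    \<comment> \<open>A multiple of \<open>m\<close> is added to match the nonnegative
      representatives used by \<open>gg\<close>.\<close>
    have "(int c - 2 * int d) mod int m = (int c - 2 * int d + 2 * int m) mod int m" by (simp add: mod_add_right_eq[symmetric])
    also have "int c - 2 * int d + 2 * int m = int (c + 2 * (m - d))" using that by simp
    finally show "nat ((int c - 2 * int d) mod int m) = (c + 2 * (m - d)) mod m" by (simp only: zmod_int[symmetric] nat_int)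
    have "(int c - 2 * int d - 1) mod int m = (int c - 2 * int d - 1 + 3 * int m) mod int m" by (simp add: mod_add_right_eq[symmetric])
    also have "int c - 2 * int d - 1 + 3 * int m = int (c + (2 * (m - d) + (m - 1)))" using that by (simp add: of_nat_diff)
    finally show "nat ((int c - 2 * int d - 1) mod int m) = (c + (2 * (m - d) + (m - 1))) mod m" by (simp only: zmod_int[symmetric] nat_int)
  qed
  show "f (gg m 0 v) = per m f (x + 2 * y) y" "f (gg m 1 v) = per m f (x + 2 * y + 1) y"
    "f (gg m 2 v) = per m f x (y + 2 * x)" "f (gg m 3 v) = per m f x (y + 2 * x + 1)"
    "f (gg m 4 v) = per m f (x - 2 * y) y" "f (gg m 5 v) = per m f (x - 2 * y - 1) y"
    "f (gg m 6 v) = per m f x (y - 2 * x)" "f (gg m 7 v) = per m f x (y - 2 * x - 1)"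
    unfolding per_def xy n1 n2 n3[OF a] n3[OF b] by (simp_all add: gg_def Let_def a_def b_def)
qed

lemma per_per [simp]: "per m f (x mod int m) y = per m f x y" "per m f x (y mod int m) = per m f x y"
  by (simp_all add: per_def)

definition adj :: "nat => (nat => real) => nat => real" where
  "adj m f v = (\<Sum>g<8. f (gg m g v))"

lemma sum_prod_per:
  "(\<Sum>v<m * m. \<Phi> (int (v div m)) (int (v mod m))) = (\<Sum>x\<in>{0..<int m}. \<Sum>y\<in>{0..<int m}. \<Phi> x y)"
  by (subst sum_square[of "%x y. \<Phi> (int x) (int y)"]) (simp add: sum_int_nat)

lemma per_div_mod: "v < m * m ==> per m f (int (v div m)) (int (v mod m)) = f v"
  by (simp add: per_def nat_mod_distrib less_mult_imp_div_less flip: of_nat_mod)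

lemma gg_swap:
  fixes f h :: "nat => real"
  assumes m: "m > 0" and g: "g < 4"
  shows "(\<Sum>v<m * m. f v * h (gg m g v)) = (\<Sum>v<m * m. h v * f (gg m (g + 4) v))"
proof -
  let ?S = "%\<Phi>. \<Sum>x\<in>{0..<int m}. \<Sum>y\<in>{0..<int m}. (\<Phi> x y :: real)"
  have tr: "(\<Sum>v<m * m. f v * h (gg m g v)) = ?S (%x y. per m f x y * H x y)"
    if "\<And>v. v < m * m ==> h (gg m g v) = H (int (v div m)) (int (v mod m))" for f h g H
    by (subst sum_prod_per[symmetric]) (use that in \<open>simp add: per_div_mod\<close>)
  have s1: "?S (%x y. per m f x y * per m h (x + 2 * y + c) y) = ?S (%x y. per m h x y * per m f (x - 2 * y - c) y)" for c
  proof (subst (1 2) sum.swap, rule sum.cong[OF refl])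
    fix y
    let ?phx = "%x. per m h x y * per m f (x - 2 * y - c) y"
    have "per m f (x mod int m - 2 * y - c) y = per m f (x - 2 * y - c) y" for x
      by (simp add: per_def mod_simps diff_diff_eq)
    then have "(\<Sum>x\<in>{0..<int m}. ?phx (x + (2 * y + c))) = (\<Sum>x\<in>{0..<int m}. ?phx x)"
      using m by (intro sum_shift) auto
    then show "(\<Sum>x\<in>{0..<int m}. per m f x y * per m h (x + 2 * y + c) y) = (\<Sum>x\<in>{0..<int m}. ?phx x)"
      by (simp add: algebra_simps)
  qed
  have s2: "?S (%x y. per m f x y * per m h x (y + 2 * x + c)) = ?S (%x y. per m h x y * per m f x (y - 2 * x - c))" for c
  proof (rule sum.cong[OF refl])
    fix x
    let ?phx = "%y. per m h x y * per m f x (y - 2 * x - c)"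
    have "per m f x (y mod int m - 2 * x - c) = per m f x (y - 2 * x - c)" for y
      by (simp add: per_def mod_simps diff_diff_eq)
    then have "(\<Sum>y\<in>{0..<int m}. ?phx (y + (2 * x + c))) = (\<Sum>y\<in>{0..<int m}. ?phx y)"
      using m by (intro sum_shift) auto
    then show "(\<Sum>y\<in>{0..<int m}. per m f x y * per m h x (y + 2 * x + c)) = (\<Sum>y\<in>{0..<int m}. ?phx y)"
      by (simp add: algebra_simps)
  qed
  consider "g = 0" | "g = 1" | "g = 2" | "g = 3" using g by linarith
  then show ?thesis
  proof cases
    case 1
    then show ?thesis using tr[where f = f and h = h and g = 0 and H = "%x y. per m h (x + 2 * y) y", OF gg_per(1)]
        tr[where f = h and h = f and g = 4 and H = "%x y. per m f (x - 2 * y) y", OF gg_per(5)] s1[of 0] by simp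
  next
    case 2
    then show ?thesis using tr[where f = f and h = h and g = 1 and H = "%x y. per m h (x + 2 * y + 1) y", OF gg_per(2)]
        tr[where f = h and h = f and g = 5 and H = "%x y. per m f (x - 2 * y - 1) y", OF gg_per(6)] s1[of 1] by simp
  next
    case 3
    then show ?thesis using tr[where f = f and h = h and g = 2 and H = "%x y. per m h x (y + 2 * x)", OF gg_per(3)]
        tr[where f = h and h = f and g = 6 and H = "%x y. per m f x (y - 2 * x)", OF gg_per(7)] s2[of 0] by simp
  next
    case 4
    then show ?thesis using tr[where f = f and h = h and g = 3 and H = "%x y. per m h x (y + 2 * x + 1)", OF gg_per(4)]
        tr[where f = h and h = f and g = 7 and H = "%x y. per m f x (y - 2 * x - 1)", OF gg_per(8)] s2[of 1] by simp
  qed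
qed

lemma sum4: "(\<Sum>g<4. phx g) = phx 0 + phx 1 + phx 2 + phx (3::nat)" for phx :: "nat => 'a :: comm_monoid_add"
  by (simp add: numeral_eq_Suc add.assoc)

lemma sum8_split: "(\<Sum>g<8. phx g) = (\<Sum>g<4. phx g) + (\<Sum>g<4. phx (g + 4 :: nat))" for phx :: "nat => 'a :: comm_monoid_add"
  by (simp add: numeral_eq_Suc add.assoc)

lemma adj_split: "(\<Sum>v<m * m. f v * adj m h v) = (\<Sum>g<4. \<Sum>v<m * m. f v * h (gg m g v)) + (\<Sum>g<4. \<Sum>v<m * m. f v * h (gg m (g + 4) v))"
  unfolding adj_def sum8_split distrib_left sum_distrib_left sum.distrib
  by (rule arg_cong2[where f = "(+)"]) (rule sum.swap)+

lemma adj_sym: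
  assumes m: "m > 0"
  shows "(\<Sum>v<m * m. f v * adj m h v) = (\<Sum>v<m * m. adj m f v * h v)"
proof -
  have "(\<Sum>v<m * m. f v * adj m h v) = (\<Sum>v<m * m. h v * adj m f v)"
    unfolding adj_split using gg_swap[OF m, of _ f h] gg_swap[OF m, of _ h f] by (simp add: add.commute)
  then show ?thesis by (simp add: mult.commute)
qed

text \<open>The four inverse generators contribute the same form as the generators themselves, hence
  twice 73/20.\<close>

lemma adj_form:
  assumes m: "m > 0" and z: "(\<Sum>v<m * m. f v) = 0"
  shows "\<bar>\<Sum>v<m * m. f v * adj m f v\<bar> <= 73 / 10 * (\<Sum>v<m * m. (f v)^2)"
proof -
  let ?S = "%\<Phi>. \<Sum>x\<in>{0..<int m}. \<Sum>y\<in>{0..<int m}. (\<Phi> x y :: real)"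
  let ?h = "per m f"
  have "(\<Sum>v<m * m. f v * adj m f v) = 2 * (\<Sum>g<4. \<Sum>v<m * m. f v * f (gg m g v))"
    unfolding adj_split using gg_swap[OF m, of _ f f] by simp
  also have "(\<Sum>g<4. \<Sum>v<m * m. f v * f (gg m g v)) =
      ?S (%x y. ?h x y * (?h (x + 2 * y) y + ?h (x + 2 * y + 1) y + ?h x (y + 2 * x) + ?h x (y + 2 * x + 1)))"
    by (subst sum_prod_per[symmetric])
      (simp add: sum4 gg_per[simplified] per_div_mod distrib_left sum.distrib)
  finally show ?thesis
    using gabber_galil_form[of "int m" ?h] m z sum_per[of "%x. x" m f] sum_per[of "%x. x^2" m f]
    by simp
qed

lemma adj_sum:
  assumes m: "m > 0" shows "(\<Sum>v<m * m. adj m f v) = 8 * (\<Sum>v<m * m. f v)"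
  using adj_sym[OF m, of "%_. 1" f] by (simp add: adj_def sum_distrib_left)

text \<open>Polarisation passes from the quadratic form to the operator norm: apply
  \<open>adj_form\<close> to the image of \<open>f\<close> plus and minus \<open>73 / 10\<close>
  times \<open>f\<close>. The two forms differ by a multiple of the squared norm of the
  image.\<close>

lemma adj_norm:
  assumes m: "m > 0" and z: "(\<Sum>v<m * m. f v) = 0"
  shows "(\<Sum>v<m * m. (adj m f v)^2) <= (73 / 10)^2 * (\<Sum>v<m * m. (f v)^2)"
proof -
  let ?l = "73 / 10 :: real"
  let ?g = "adj m f"
  let ?p = "%v. ?g v + ?l * f v" and ?q = "%v. ?g v - ?l * f v"
  have zg: "(\<Sum>v<m * m. ?g v) = 0" using adj_sum[OF m, of f] z by simp
  have lin: "adj m (%v. a v + c * b v) v = adj m a v + c * adj m b v" for a b c v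
    by (simp add: adj_def sum.distrib sum_distrib_left)
  have "\<bar>\<Sum>v<m * m. ?p v * adj m ?p v\<bar> <= ?l * (\<Sum>v<m * m. (?p v)^2)"
    by (rule adj_form[OF m]) (simp only: sum.distrib zg z sum_distrib_left[symmetric] mult_zero_right add_0)
  moreover have "\<bar>\<Sum>v<m * m. ?q v * adj m ?q v\<bar> <= ?l * (\<Sum>v<m * m. (?q v)^2)"
    by (rule adj_form[OF m]) (simp only: sum_subtractf zg z sum_distrib_left[symmetric] mult_zero_right diff_zero)
  moreover have "(\<Sum>v<m * m. ?p v * adj m ?p v) - (\<Sum>v<m * m. ?q v * adj m ?q v) = 4 * ?l * (\<Sum>v<m * m. (?g v)^2)"
  proof -
    have "adj m ?q v = adj m ?g v - ?l * adj m f v" for v using lin[of ?g "- ?l" f v] by simp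
    then have "(\<Sum>v<m * m. ?p v * adj m ?p v) - (\<Sum>v<m * m. ?q v * adj m ?q v) =
       (\<Sum>v<m * m. 2 * ?l * (?g v * ?g v) + 2 * ?l * (f v * adj m ?g v))"
      unfolding sum_subtractf[symmetric] by (intro sum.cong refl) (simp only: lin, simp add: algebra_simps)
    also have "... = 2 * ?l * (\<Sum>v<m * m. ?g v * ?g v) + 2 * ?l * (\<Sum>v<m * m. f v * adj m ?g v)"
      by (simp only: sum.distrib sum_distrib_left)
    also have "(\<Sum>v<m * m. f v * adj m ?g v) = (\<Sum>v<m * m. ?g v * ?g v)" by (rule adj_sym[OF m])
    finally show ?thesis by (simp add: power2_eq_square)
  qed
  moreover have "(\<Sum>v<m * m. (?p v)^2) + (\<Sum>v<m * m. (?q v)^2) = 2 * (\<Sum>v<m * m. (?g v)^2) + 2 * ?l^2 * (\<Sum>v<m * m. (f v)^2)"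
    unfolding sum.distrib[symmetric] sum_distrib_left by (intro sum.cong refl) (simp add: power2_eq_square algebra_simps)
  ultimately show ?thesis by (simp add: power2_eq_square)
qed

lemma sum_digit: "(\<Sum>w<8 ^ Suc k. phx (w mod 8) (w div 8)) = (\<Sum>g<8. \<Sum>w<8 ^ k. phx g (w :: nat))" for phx :: "nat => nat => real"
  unfolding sum.cartesian_product
  by (rule sum.reindex_bij_witness[where i = "%(g, w). 8 * w + g" and j = "%w. (w mod 8, w div 8)"]) auto

lemma nb_adj: "(\<Sum>w<8 ^ Suc k. f (nb m (Suc k) w v)) = adj m (%v. \<Sum>w<8 ^ k. f (nb m k w v)) v"
  using sum_digit[of "%g w. f (nb m k w (gg m g v))" k] by (simp add: adj_def)

text \<open>Each step of the walk preserves sum zero, so \<open>adj_norm\<close> applies again and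
  the factors multiply.\<close>

theorem nb_expander:
  fixes f :: "nat => real"
  assumes m: "m > 0" and z: "(\<Sum>v<m * m. f v) = 0"
  shows "(\<Sum>v<m * m. (\<Sum>w<8 ^ k. f (nb m k w v))^2) <= ((73 / 10)^2) ^ k * (\<Sum>v<m * m. (f v)^2)"
proof -
  have "(\<Sum>v<m * m. \<Sum>w<8 ^ k. f (nb m k w v)) = 0 &
    (\<Sum>v<m * m. (\<Sum>w<8 ^ k. f (nb m k w v))^2) <= ((73 / 10)^2) ^ k * (\<Sum>v<m * m. (f v)^2)"
  proof (induction k)
    case 0
    have "(\<Sum>v<m * m. (\<Sum>w<8 ^ 0. f (nb m 0 w v))^2) = (\<Sum>v<m * m. (f v)^2)" by simp
    also have "... = ((73 / 10)^2) ^ 0 * (\<Sum>v<m * m. (f v)^2)" by (subst power_0, rule mult_1[symmetric])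
    finally have "(\<Sum>v<m * m. (\<Sum>w<8 ^ 0. f (nb m 0 w v))^2) <= ((73 / 10)^2) ^ 0 * (\<Sum>v<m * m. (f v)^2)"
      by (rule eq_refl)
    moreover have "(\<Sum>v<m * m. \<Sum>w<8 ^ 0. f (nb m 0 w v)) = 0" using z by simp
    ultimately show ?case by blast
  next
    case (Suc k)
    let ?F = "%v. \<Sum>w<8 ^ k. f (nb m k w v)"
    have "(\<Sum>v<m * m. (adj m ?F v)^2) <= (73 / 10)^2 * (\<Sum>v<m * m. (?F v)^2)"
      using Suc by (intro adj_norm[OF m]) simp
    also have "... <= (73 / 10)^2 * (((73 / 10)^2) ^ k * (\<Sum>v<m * m. (f v)^2))"
      using Suc by (intro mult_left_mono) auto
    finally show ?case using Suc adj_sum[OF m, of ?F] unfolding nb_adj unfolding power_Suc by (simp only: mult.assoc mult_zero_right simp_thms)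
  qed
  then show ?thesis by simp
qed

section \<open>The neighbour maps are permutations\<close>

lemma gg_inverse:
  assumes v: "v < m * m" and g: "g < 4"
  shows "gg m (g + 4) (gg m g v) = v"
proof -
  have m: "m > 0" using v by (cases m) auto
  have vm: "v div m < m" using v by (simp add: less_mult_imp_div_less)
  have key: "((a + (2 * u + c)) mod m + (2 * (m - u) + (m - 1) * c)) mod m = a" if "a < m" "u < m" "c < 2" for a u c
  proof -
    have "(m - 1) * c + c = m * c" using m by (cases m) auto
    then have e: "a + (2 * u + c) + (2 * (m - u) + (m - 1) * c) = a + m * (2 + c)"
      using that by (simp add: algebra_simps)
    have "((a + (2 * u + c)) mod m + (2 * (m - u) + (m - 1) * c)) mod m = (a + (2 * u + c) + (2 * (m - u) + (m - 1) * c)) mod m"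
      by (simp add: mod_add_left_eq)
    then show ?thesis unfolding e by (simp only: mod_mult_self2 mod_less that)
  qed
  have d: "(a * m + b) div m = a" "(a * m + b) mod m = b" if "b < m" for a b using that by auto
  have ym: "v mod m < m" using m by simp
  have c2: "g mod 2 < 2" by simp
  have xm: "((a + c) mod m) < m" for a c using m by simp
  consider "g = 0" | "g = 1" | "g = 2" | "g = 3" using g by linarith
  then show ?thesis
  proof cases
    case 1
    then show ?thesis using key[OF vm ym, of 0] by (simp add: gg_def Let_def d[OF ym] d[OF xm])
  next
    case 2
    then show ?thesis using key[OF vm ym, of 1] by (simp add: gg_def Let_def d m)
  next
    case 3
    then show ?thesis using key[OF ym vm, of 0] by (simp add: gg_def Let_def d[OF ym] d[OF xm])
  next
    case 4
    then show ?thesis using key[OF ym vm, of 1] by (simp add: gg_def Let_def d m)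
  qed
qed

lemma gg_inj: "inj_on (gg m g) {..<m * m}" if "g < 8"
proof (cases "g < 4")
  case True
  then show ?thesis by (intro inj_on_inverseI[of _ "gg m (g + 4)"]) (auto simp: gg_inverse)
next
  case False
  have g: "g - 4 < 4" "g - 4 + 4 = g" using that False by auto
  \<comment> \<open>For an inverse generator this is a right inverse: the map is onto, hence
    injective on a finite set.\<close>
  have inv: "gg m g (gg m (g - 4) v) = v" if "v < m * m" for v
    using gg_inverse[OF that g(1)] g(2) by simp
  show ?thesis
  proof (rule eq_card_imp_inj_on)
    have "{..<m * m} \<subseteq> gg m g ` {..<m * m}"
    proof
      fix v assume "v \<in> {..<m * m}"
      then show "v \<in> gg m g ` {..<m * m}" using inv[of v] gg_less[of v m "g - 4"] by (intro image_eqI[of _ _ "gg m (g - 4) v"]) auto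
    qed
    moreover have "gg m g ` {..<m * m} \<subseteq> {..<m * m}" by (auto simp: gg_less)
    ultimately have "gg m g ` {..<m * m} = {..<m * m}" by blast
    then show "card (gg m g ` {..<m * m}) = card {..<m * m}" by simp
  qed simp
qed

lemma nb_inj: "w < 8 ^ k ==> inj_on (nb m k w) {..<m * m}"
proof (induction k arbitrary: w)
  case (Suc k)
  have "w div 8 < 8 ^ k" using Suc.prems by (simp add: less_mult_imp_div_less mult.commute)
  note ih = Suc.IH[OF this]
  have "inj_on (nb m k (w div 8) \<circ> gg m (w mod 8)) {..<m * m}"
    by (rule comp_inj_on[OF gg_inj inj_on_subset[OF ih]]) (auto simp: gg_less)
  then have "inj_on (%v. nb m k (w div 8) (gg m (w mod 8) v)) {..<m * m}" by (simp add: comp_def)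
  then show ?case by simp
qed (simp add: inj_on_def)

section \<open>The list decoding program\<close>

definition MODe :: "ex => ex => ex" where "MODe a b = Minus a (Mul (Div a b) b)"

lemma ev_MODe:
  assumes "98 \<notin> fv a" "98 \<notin> fv b" "99 \<notin> fv b" "ev X y a et sg <= X" "ev X y b et sg > 0"
  shows "ev X y (MODe a b) et sg = ev X y a et sg mod ev X y b et sg"
proof -
  have "ev X y a et sg div ev X y b et sg <= X" using div_le_dividend assms(4) by (rule order_trans)
  then show ?thesis unfolding MODe_def using ev_Div[OF assms] assms(3) by (simp add: minus_div_mult_eq_mod)
qed

lemma fv_MODe [simp]: "x \<notin> fv a ==> x \<notin> fv b ==> x \<notin> fv (MODe a b)"
  by (simp add: MODe_def)

definition rootE :: ex where "rootE = Rd 0 (Num 0)"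

definition gge :: "nat => ex => ex" where
  "gge g v = (let x = Div v rootE; y = MODe v rootE; u = (if g mod 4 < 2 then y else x);
     t = (if g < 4 then Plus (Plus u u) (Num (g mod 2)) else Plus (Plus (Minus rootE u) (Minus rootE u)) (if g mod 2 = 0 then Num 0 else Minus rootE (Num 1)))
   in if g mod 4 < 2 then Plus (Mul (MODe (Plus x t) rootE) rootE) y else Plus (Mul x rootE) (MODe (Plus y t) rootE))"

lemma ev_gge:
  assumes r: "sg 0 0 = m" and m: "4 <= m" "m * m <= X" and v: "ev X y e et sg < m * m" and fv: "98 \<notin> fv e" "99 \<notin> fv e"
  shows "ev X y (gge g e) et sg = gg m g (ev X y e et sg)"
proof -
  define v where "v = ev X y e et sg"
  have rt: "ev X y rootE et sg = m" "fv rootE = {}" for et using r by (simp_all add: rootE_def)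
  have m0: "0 < m" using m by simp
  have vX: "ev X y e et sg <= X" using assms by linarith
  define x where "x = Div e rootE"
  define yy where "yy = MODe e rootE"
  have x: "ev X y x et sg = v div m" unfolding x_def v_def using ev_Div[of e rootE X y et sg] fv vX m0 by (simp add: rt)
  have yy: "ev X y yy et sg = v mod m" unfolding yy_def v_def using ev_MODe[of e rootE X y et sg] fv vX m0 by (simp add: rt)
  have fx: "98 \<notin> fv x" "99 \<notin> fv x" "98 \<notin> fv yy" "99 \<notin> fv yy" using fv by (simp_all add: x_def yy_def rt)
  have xm: "v div m < m" using v by (simp add: v_def less_mult_imp_div_less)
  have ym: "v mod m < m" using m0 by simp
  define u where "u = (if g mod 4 < 2 then yy else x)"
  define un where "un = (if g mod 4 < 2 then v mod m else v div m)"
  define t where "t = (if g < 4 then Plus (Plus u u) (Num (g mod 2)) else Plus (Plus (Minus rootE u) (Minus rootE u)) (if g mod 2 = 0 then Num 0 else Minus rootE (Num 1)))"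
  define tn where "tn = (if g < 4 then 2 * un + g mod 2 else 2 * (m - un) + (m - 1) * (g mod 2))"
  have u: "ev X y u et sg = un" "98 \<notin> fv u" "99 \<notin> fv u" using fx by (simp_all add: u_def un_def x yy)
  have um: "un < m" using xm ym by (simp add: un_def)
  have t: "ev X y t et sg = tn" "98 \<notin> fv t" "99 \<notin> fv t"
    using u by (auto simp: t_def tn_def rt mod2_eq_if)
  have g2: "(m - 1) * (g mod 2) <= m - 1" by (simp add: mod2_eq_if)
  have tm: "tn + m <= 4 * m"
  proof (cases "g < 4")
    case True
    have "g mod 2 <= 1" by simp
    then show ?thesis using True um m by (simp add: tn_def)
  next
    case False
    then have "tn = 2 * (m - un) + (m - 1) * (g mod 2)" by (simp only: tn_def if_False)
    then show ?thesis using um g2 m0 by linarith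
  qed
  have "4 * m <= m * m" using m by (intro mult_le_mono1) simp
  then have tX: "tn + m <= X" using tm m by linarith
  have a: "ev X y (MODe (Plus x t) rootE) et sg = (v div m + tn) mod m"
    using ev_MODe[of "Plus x t" rootE X y et sg] fx t x xm tX m0 by (simp add: rt)
  have b: "ev X y (MODe (Plus yy t) rootE) et sg = (v mod m + tn) mod m"
    using ev_MODe[of "Plus yy t" rootE X y et sg] fx t yy ym tX m0 by (simp add: rt)
  have mX: "m <= X" using m(1) m(2) le_square[of m] by linarith
  have "(v div m + tn) mod m < m" using m0 by simp
  then have am: "min X ((v div m + tn) mod m) = (v div m + tn) mod m" "min X (v div m) = v div m" using mX xm by linarith+
  have "gge g e = (if g mod 4 < 2 then Plus (Mul (MODe (Plus x t) rootE) rootE) yy else Plus (Mul x rootE) (MODe (Plus yy t) rootE))"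
    unfolding gge_def Let_def t_def u_def x_def yy_def ..
  moreover have "gg m g v = (if g mod 4 < 2 then (v div m + tn) mod m * m + v mod m else v div m * m + (v mod m + tn) mod m)"
    unfolding gg_def Let_def tn_def un_def ..
  ultimately show ?thesis unfolding v_def[symmetric] using am by (simp add: a b x yy rt)
qed

lemma fv_gge [simp]: "x \<notin> fv e ==> x \<notin> fv (gge g e)"
  by (simp add: gge_def Let_def rootE_def)

definition POW :: "nat => nat => cm" where
  "POW a b = Sq (Wr a (Num 0) (Num 1)) (Fr 6 (Var 1) (Wr a (Plus (Var 6) (Num 1)) (Mul (Num b) (Rd a (Var 6)))))"

lemma run_POW:
  assumes "et 1 = X" "b <= X" "i <= X" shows "run X y (POW a b) et sg a i = b ^ i"
proof -
  define I where "I k ta \<longleftrightarrow> (\<forall>i\<le>k. ta a i = b ^ i)" for k and ta :: store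
  have "I X (run X y (Fr 6 (Var 1) (Wr a (Plus (Var 6) (Num 1)) (Mul (Num b) (Rd a (Var 6))))) et (run X y (Wr a (Num 0) (Num 1)) et sg))"
    by (rule Fr_inv[where I = I]) (use assms in \<open>auto simp: I_def le_Suc_eq\<close>)
  then show ?thesis using assms by (simp add: POW_def I_def del: run.simps(3))
qed

lemma wrs_POW [simp]: "wrs (POW a b) = {a}" by (simp add: POW_def)

definition FACT :: cm where
  "FACT = Sq (Wr 0 (Num 5) (Num 1)) (Fr 6 nE (Wr 0 (Num 5) (Mul (Plus (Var 6) (Num 1)) (Rd 0 (Num 5)))))"

lemma run_FACT:
  assumes n: "sg 0 (Suc 0) <= X"
  shows "run X y FACT et sg 0 = (sg 0)(5 := fact (sg 0 (Suc 0)))"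
proof -
  define I where "I k ta \<longleftrightarrow> ta 0 = (sg 0)(5 := fact k)" for k and ta :: store
  have "I (sg 0 (Suc 0)) (run X y (Fr 6 nE (Wr 0 (Num 5) (Mul (Plus (Var 6) (Num 1)) (Rd 0 (Num 5))))) et (run X y (Wr 0 (Num 5) (Num 1)) et sg))"
  proof (rule Fr_inv[where I = I])
    fix k ta assume k: "k < sg 0 (Suc 0)" and I: "I k ta"
    have "min X (Suc k) = Suc k" using k n by simp
    then show "I (Suc k) (run X y (Wr 0 (Num 5) (Mul (Plus (Var 6) (Num 1)) (Rd 0 (Num 5)))) (et(6 := k)) ta)"
      using I by (simp add: I_def)
  qed (use n in \<open>simp_all add: I_def\<close>)
  then show ?thesis by (simp add: FACT_def I_def del: run.simps(3))
qed

lemma wrs_FACT [simp]: "wrs FACT = {0}" by (simp add: FACT_def)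

locale prg4 = prg3 D kap q0 tt Gam MTp psi thr t0 LB TT mg EC
  for D kap q0 tt Gam :: nat and MTp and psi and thr t0 LB TT mg EC :: nat +
  fixes kk oo :: nat
begin

definition NBS :: cm where
  "NBS = Sq (Tab2 6 nE 7 D 4 (Var 6)) (sqs (map (%s. Tab2 6 nE 7 D 4
     (sel D (Var 7) (%w. gge (w div 8 ^ s mod 8) (NBe (Var 6) (Var 7))))) [0..<kk]))"
text \<open>The graph needs a square number of vertices: \<open>n0 * n0\<close> is the largest
  square up to the block length, and the remaining positions of a codeword are 0.\<close>

definition n0x :: ex where "n0x = Summ 50 (Var 1) (Leq (Mul (Plus (Var 50) (Num 1)) (Plus (Var 50) (Num 1))) (Var 1))"
definition Px :: ex where
  "Px = Summ 50 (Var 1) (Mul (Leq (Rd 2 (Var 50)) (Var 1)) (Mul (Leq (Plus (Var 1) (Num 1)) (Rd 2 (Plus (Var 50) (Num 1)))) (Rd 2 (Var 50))))"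
text \<open>With \<open>P\<close> the largest power of two up to \<open>N\<close>, the quotient of
  \<open>N - P\<close> by \<open>P\<close> approximates the fraction of errors encoded in the
  length. \<open>SCAL\<close> adds the rounding correction \<open>oo\<close> and obtains the exact
  number of errors.\<close>

definition Zx :: ex where
  "Zx = Summ 50 (Var 1) (Leq (Mul (Plus (Var 50) (Num 1)) (Rd 0 (Num 2))) (Mul (Minus (Var 1) (Rd 0 (Num 2))) (Var 1)))"
definition zx :: ex where "zx = Summ 50 (Var 1) (Leq (Rd 1 (Plus (Var 50) (Num 1))) (Var 0))"
definition SCAL :: cm where
  "SCAL = sqs [Wr 0 (Num 0) n0x, Wr 0 (Num 1) (Mul (Rd 0 (Num 0)) (Rd 0 (Num 0))), Wr 0 (Num 2) Px,
     Wr 0 (Num 3) (Plus (Num oo) Zx), Wr 0 (Num 4) zx]"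
definition SETUP :: cm where "SETUP = sqs [POW 1 q0, POW 2 2, SCAL, FACT, NBS]"
definition dige :: "ex => ex => ex" where
  "dige e i = Minus (Div e (Rd 1 i)) (Mul (Num q0) (Div e (Rd 1 (Plus i (Num 1)))))"
definition COMP :: cm where
  "COMP = Sq (Tab 5 nE 6 (dige (Inp (Var 5)) (Var 2))) (Sq (Tab 5 nE 9 (Num 0)) ROUNDS)"
definition COMPS :: cm where "COMPS = Fr 2 (Rd 0 (Num 4)) COMP"
text \<open>The digits in base \<open>q0\<close> of the loop index in variable 3 pick one slot for
  each component, so \<open>q\<close> rounds run through all combinations.\<close>

definition slE :: ex where "slE = Plus (Mul (Num q0) (Var 50)) (dige (Var 3) (Var 50))"
definition WE :: ex where
  "WE = Mul (Leq (Plus (Var 5) (Num 1)) nE) (Summ 50 (Rd 0 (Num 4)) (Mul (Rd 27 (Plus (Mul slE (Var 1)) (Var 5))) (Rd 1 (Var 50))))"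
definition C1 :: ex where "C1 = Leq (Rd 0 (Num 4)) (Summ 50 (Rd 0 (Num 4)) (Rd 28 slE))"
definition C2 :: ex where "C2 = Leq (Summ 51 (Var 1) (Minus (Num 1) (Eq (Rd 29 (Var 51)) (Inp (Var 51))))) (Rd 0 (Num 3))"
definition C3 :: ex where
  "C3 = Eq (Num 0) (Summ 52 (Rd 31 (Num 0)) (Leq (Var 1) (Summ 51 (Var 1)
     (Eq (Rd 30 (Plus (Mul (Var 52) (Var 1)) (Var 51))) (Rd 29 (Var 51))))))"
definition ADD :: cm where
  "ADD = Sq (Fr 5 (Var 1) (Wr 30 (Plus (Mul (Rd 31 (Num 0)) (Var 1)) (Var 5)) (Rd 29 (Var 5))))
     (Wr 31 (Num 0) (Plus (Rd 31 (Num 0)) (Num 1)))"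
definition ITEM :: cm where
  "ITEM = Sq (Tab 5 (Var 1) 29 WE) (Cond (Mul C1 (Mul C2 C3)) ADD)"
definition MAIN :: cm where "MAIN = sqs [SETUP, COMPS, Fr 3 (Var 0) ITEM]"

end

section \<open>The stages of the program\<close>

lemma count_less: "k <= N ==> (\<And>i. i < N ==> P i \<longleftrightarrow> i < k) ==> (\<Sum>i<N. if P i then 1 else 0) = (k :: nat)"
proof -
  assume k: "k <= N" and P: "\<And>i. i < N ==> P i \<longleftrightarrow> i < k"
  have "{..<N} \<inter> {i. P i} = {..<k}" using k P by auto
  then show ?thesis by (simp add: sum.If_cases)
qed

locale full = prg4 D kap q0 tt Gam MTp psi thr t0 LB TT mg EC kk oo
  for D kap q0 tt Gam :: nat and MTp and psi and thr t0 LB TT mg EC kk oo :: nat +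
  fixes n0 n N z q Z L K e0 tin :: nat and lam dl ta alx :: real and y :: "nat => nat"
  assumes d3: "\<And>Y. dec3 D kap q0 tt Gam MTp psi thr t0 LB TT mg EC n (nb n0 kk) lam K Y N e0 dl ta alx tin"
    and n: "n = n0 * n0" "4 <= n0" "n <= N" "N < (n0 + 1) * (n0 + 1)"
    and D: "D = 8 ^ kk" and q0: "2 <= q0" and q: "q = q0 ^ z" "q <= N" "q0 * z <= N" "q0 <= N" "D <= N"
    and L: "2 ^ L <= N" "N < 2 * 2 ^ L" and Z: "Z = oo + (N - 2 ^ L) * N div 2 ^ L"
    and alx: "alx * n + Z <= n" and y: "\<And>r. r < N ==> y r < q"
begin

lemma N0: "0 < N" using n by (metis gr0I le_zero_eq mult_eq_0_iff not_numeral_le_zero)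

definition stat :: "store => bool" where
  "stat sg \<longleftrightarrow> stv n D (nb n0 kk) sg & sg 0 3 = Z & sg 0 4 = z & (\<forall>i\<le>N. sg 1 i = q0 ^ i)"

lemma z_le: "z <= N"
proof -
  have "z < 2 ^ z" by (rule less_exp)
  also have "2 ^ z <= q0 ^ z" using q0 by (rule power_mono) simp
  finally show ?thesis using q by linarith
qed

lemma run_SCAL:
  assumes e: "et 1 = N" "et 0 = q" and s: "\<And>i. i <= N ==> sg 1 i = q0 ^ i" "\<And>i. i <= N ==> sg 2 i = 2 ^ i"
  shows "run N y SCAL et sg 0 0 = n0" "run N y SCAL et sg 0 (Suc 0) = n" "run N y SCAL et sg 0 3 = Z" "run N y SCAL et sg 0 4 = z"
proof -
  have m: "min N (Suc i) = Suc i" if "i < N" for i using that by simp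
  have nn: "n0 <= N" using n le_square[of n0] by linarith
  have n0E: "ev N y n0x et ta = n0" for ta
  proof -
    have "(\<Sum>i<N. ev N y (Leq (Mul (Plus (Var 50) (Num 1)) (Plus (Var 50) (Num 1))) (Var 1)) (et(50 := i)) ta)
      = (\<Sum>i<N. if Suc i * Suc i <= N then 1 else 0)"
      by (intro sum.cong refl) (use e m in simp)
    also have "... = n0"
    proof (rule count_less[OF nn])
      fix i assume "i < N"
      show "Suc i * Suc i <= N \<longleftrightarrow> i < n0"
      proof
        assume h: "Suc i * Suc i <= N"
        show "i < n0"
        proof (rule ccontr)
          assume "\<not> i < n0"
          then have "(n0 + 1) * (n0 + 1) <= Suc i * Suc i" by (intro mult_le_mono) auto
          then show False using h n by linarith
        qed
      next
        assume "i < n0"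
        then have "Suc i * Suc i <= n0 * n0" by (intro mult_le_mono) auto
        then show "Suc i * Suc i <= N" using n by linarith
      qed
    qed
    finally show ?thesis using e by (simp add: n0x_def)
  qed
  have PE: "ev N y Px et ta = 2 ^ L"
    if t: "\<And>i. i <= N ==> ta 2 i = 2 ^ i" for ta
  proof -
    have LN: "L < N" using less_exp[of L] L by linarith
    have "(\<Sum>i<N. ev N y (Mul (Leq (Rd 2 (Var 50)) (Var 1)) (Mul (Leq (Plus (Var 1) (Num 1)) (Rd 2 (Plus (Var 50) (Num 1)))) (Rd 2 (Var 50)))) (et(50 := i)) ta)
      = (\<Sum>i<N. if i = L then 2 ^ L else 0)"
    proof (intro sum.cong refl)
      fix i assume "i \<in> {..<N}"
      then have i: "i < N" by simp
      have "(2 ^ i <= N & N < 2 ^ Suc i) \<longleftrightarrow> i = L"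
      proof
        assume h: "2 ^ i <= N & N < 2 ^ Suc i"
        have "(2::nat) ^ i < 2 ^ Suc L" "(2::nat) ^ L < 2 ^ Suc i" using h L by auto
        then have "i < Suc L" "L < Suc i" by (simp_all add: power_strict_increasing_iff del: power_Suc)
        then show "i = L" by simp
      qed (use L in simp)
      then show "ev N y (Mul (Leq (Rd 2 (Var 50)) (Var 1)) (Mul (Leq (Plus (Var 1) (Num 1)) (Rd 2 (Plus (Var 50) (Num 1)))) (Rd 2 (Var 50)))) (et(50 := i)) ta
        = (if i = L then 2 ^ L else 0)"
        using t[of i] t[of "Suc i"] i e N0 by (simp add: Suc_le_eq) (metis (no_types, lifting) power_Suc)
    qed
    then show ?thesis using e LN by (simp add: Px_def)
  qed
  have ZE: "ev N y Zx et ta = (N - 2 ^ L) * N div 2 ^ L"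
    if t: "ta 0 2 = 2 ^ L" for ta
  proof -
    have "(\<Sum>i<N. ev N y (Leq (Mul (Plus (Var 50) (Num 1)) (Rd 0 (Num 2))) (Mul (Minus (Var 1) (Rd 0 (Num 2))) (Var 1))) (et(50 := i)) ta)
      = (\<Sum>i<N. if Suc i * 2 ^ L <= (N - 2 ^ L) * N then 1 else 0)"
      by (intro sum.cong refl) (use e m t in simp)
    also have "... = (N - 2 ^ L) * N div 2 ^ L"
    proof (rule count_less)
      have "(N - 2 ^ L) * N <= 2 ^ L * N" using L by (intro mult_le_mono1) linarith
      then have "(N - 2 ^ L) * N div 2 ^ L <= 2 ^ L * N div 2 ^ L" by (rule div_le_mono)
      then show "(N - 2 ^ L) * N div 2 ^ L <= N" by simp
      fix i show "Suc i * 2 ^ L <= (N - 2 ^ L) * N \<longleftrightarrow> i < (N - 2 ^ L) * N div 2 ^ L"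
        by (simp add: less_eq_div_iff_mult_less_eq Suc_le_eq[symmetric])
    qed
    finally show ?thesis using e by (simp add: Zx_def)
  qed
  have zE: "ev N y zx et ta = z"
    if t: "\<And>i. i <= N ==> ta 1 i = q0 ^ i" for ta
  proof -
    have "(\<Sum>i<N. ev N y (Leq (Rd 1 (Plus (Var 50) (Num 1))) (Var 0)) (et(50 := i)) ta)
      = (\<Sum>i<N. if q0 ^ Suc i <= q0 ^ z then 1 else 0)"
      by (intro sum.cong refl) (use e t q in simp)
    also have "... = z"
      by (rule count_less[OF z_le]) (use q0 in \<open>simp add: Suc_le_eq power_increasing_iff del: power_Suc\<close>)
    finally show ?thesis using e by (simp add: zx_def)
  qed
  let ?f0 = "(sg 0)(0 := n0)" let ?f1 = "?f0(1 := n)" let ?f2 = "?f1(2 := 2 ^ L)" let ?f3 = "?f2(3 := Z)" let ?f4 = "?f3(4 := z)"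
  have mn: "min N n0 = n0" using nn by simp
  have "run N y SCAL et sg = sg(0 := ?f4)"
    unfolding SCAL_def by (simp add: n0E mn n(1)[symmetric] PE ZE zE s s[simplified] Z[symmetric])
  then show "run N y SCAL et sg 0 0 = n0" "run N y SCAL et sg 0 (Suc 0) = n" "run N y SCAL et sg 0 3 = Z" "run N y SCAL et sg 0 4 = z"
    by simp_all
qed

lemma wrs_SCAL [simp]: "wrs SCAL = {0}" by (simp add: SCAL_def)

lemma run_NBS:
  assumes s: "sg 0 0 = n0" "sg 0 (Suc 0) = n"
  shows "run N y NBS et sg 0 = sg 0" "\<And>l w. l < n ==> w < D ==> run N y NBS et sg 4 (D * l + w) = nb n0 kk w l"
    "\<And>a. a \<notin> {0, 4} ==> run N y NBS et sg a = sg a"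
proof -
  have mn: "min N n = n" using n by simp
  define sg1 where "sg1 = run N y (Tab2 6 nE 7 D 4 (Var 6)) et sg"
  have f1: "sg1 a = sg a" if "a ~= 4" for a unfolding sg1_def by (rule run_frame) (use that in simp)
  have v1: "sg1 4 (D * l + w) = l" if "l < n" "w < D" for l w
    unfolding sg1_def by (rule run_Tab2[where B = n]) (use that s mn q in simp_all)
  \<comment> \<open>The first \<open>k\<close> steps of the walk have been taken; the rest of it
    starts at the stored vertex.\<close>
  define I where "I k ta \<longleftrightarrow> (\<forall>a. a ~= 4 --> ta a = sg a) & (\<forall>l<n. \<forall>w<D. ta 4 (D * l + w) < n &
     nb n0 (kk - k) (w div 8 ^ k) (ta 4 (D * l + w)) = nb n0 kk w l)" for k ta
  let ?e = "%s. sel D (Var 7) (%w. gge (w div 8 ^ s mod 8) (NBe (Var 6) (Var 7)))"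
  have "I kk (run N y (sqs (map (%s. Tab2 6 nE 7 D 4 (?e s)) [0..<kk])) et sg1)"
  proof (rule sqs_inv[where I = I])
    show "I 0 sg1" by (simp add: I_def f1 v1)
    fix k ta assume k: "k < kk" and I: "I k ta"
    let ?s = "run N y (Tab2 6 nE 7 D 4 (?e k)) et ta"
    have fs: "?s a = ta a" if "a ~= 4" for a by (rule run_frame) (use that in simp)
    have t0: "ta 0 = sg 0" using I by (simp add: I_def)
    have v: "?s 4 (D * l + w) = gg n0 (w div 8 ^ k mod 8) (ta 4 (D * l + w))" if lw: "l < n" "w < D" for l w
    proof (rule run_Tab2[where B = n and f = "%l w. gg n0 (w div 8 ^ k mod 8) (ta 4 (D * l + w))"])
      fix i j ta' assume ij: "i < n" "j < D" and t': "\<And>c. c ~= 4 ==> ta' c = ta c" "ta' 4 (D * i + j) = ta 4 (D * i + j)"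
      have nbv: "ev N y (NBe (Var 6) (Var 7)) (et(6 := i, 7 := j)) ta' = ta 4 (D * i + j)"
        using q t'(2) by (simp add: NBe_def min_def)
      have "ta 4 (D * i + j) < n" using I ij by (simp add: I_def)
      then have "ev N y (gge g (NBe (Var 6) (Var 7))) (et(6 := i, 7 := j)) ta' = gg n0 g (ta 4 (D * i + j))" for g
        using ev_gge[of ta' n0 N y "NBe (Var 6) (Var 7)" "et(6 := i, 7 := j)" g] t' t0 s n by (simp add: nbv)
      then show "ev N y (?e k) (et(6 := i, 7 := j)) ta' = gg n0 (j div 8 ^ k mod 8) (ta 4 (D * i + j))"
        using ij N0 by simp
    qed (use lw s mn q t0 in simp_all)
    have "?s 4 (D * l + w) < n & nb n0 (kk - Suc k) (w div 8 ^ Suc k) (?s 4 (D * l + w)) = nb n0 kk w l" if lw: "l < n" "w < D" for l w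
    proof -
      have old: "ta 4 (D * l + w) < n" "nb n0 (kk - k) (w div 8 ^ k) (ta 4 (D * l + w)) = nb n0 kk w l" using I lw by (auto simp: I_def)
      have "kk - k = Suc (kk - Suc k)" using k by simp
      then have "nb n0 (kk - Suc k) (w div 8 ^ k div 8) (gg n0 (w div 8 ^ k mod 8) (ta 4 (D * l + w))) = nb n0 kk w l"
        using old(2) by simp
      moreover have "w div 8 ^ k div 8 = w div 8 ^ Suc k" by (simp only: div_mult2_eq[symmetric] power_Suc2)
      ultimately show ?thesis unfolding v[OF lw] using gg_less old(1) n by simp
    qed
    then show "I (Suc k) ?s" using I by (auto simp: I_def fs)
  qed
  moreover have "run N y NBS et sg = run N y (sqs (map (%s. Tab2 6 nE 7 D 4 (?e s)) [0..<kk])) et sg1"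
    by (simp add: NBS_def sg1_def)
  ultimately have "I kk (run N y NBS et sg)" by simp
  moreover have "w div 8 ^ kk = 0" if "w < D" for w using that D by simp
  ultimately show "run N y NBS et sg 0 = sg 0" "\<And>l w. l < n ==> w < D ==> run N y NBS et sg 4 (D * l + w) = nb n0 kk w l"
    "\<And>a. a \<notin> {0, 4} ==> run N y NBS et sg a = sg a"
    by (auto simp: I_def)
qed

lemma run_SETUP:
  assumes e: "et 1 = N" "et 0 = q" and sg: "sg = run N y SETUP et (%_ _. 0)"
  shows "stat sg" "\<And>a. a \<notin> {0, 1, 2, 4} ==> sg a = (%_. 0)"
proof -
  define sg1 where "sg1 = run N y (POW 1 q0) et (%_ _. 0)"
  define sg2 where "sg2 = run N y (POW 2 2) et sg1"
  define sg3 where "sg3 = run N y SCAL et sg2"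
  define sg4 where "sg4 = run N y FACT et sg3"
  have r: "sg = run N y NBS et sg4" by (simp add: sg SETUP_def sg4_def sg3_def sg2_def sg1_def)
  have f1: "sg1 a = (%_. 0)" if "a ~= 1" for a using run_frame[of a "POW 1 q0"] that by (simp add: sg1_def)
  have f2: "sg2 a = sg1 a" if "a ~= 2" for a using that by (simp add: sg2_def run_frame)
  have f3: "sg3 a = sg2 a" if "a ~= 0" for a using that by (simp add: sg3_def run_frame)
  have f4: "sg4 a = sg3 a" if "a ~= 0" for a using that by (simp add: sg4_def run_frame)
  have v1: "sg1 1 i = q0 ^ i" if "i <= N" for i unfolding sg1_def by (rule run_POW) (use e q that in auto)
  have v2: "sg2 2 i = 2 ^ i" if "i <= N" for i unfolding sg2_def by (rule run_POW) (use e q q0 that in auto)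
  have v12: "sg2 1 i = q0 ^ i" if "i <= N" for i using v1[OF that] f2[of 1] by simp
  note S = run_SCAL[OF e v12 v2, folded sg3_def]
  have v4: "sg4 0 = (sg3 0)(5 := fact n)" unfolding sg4_def using run_FACT[of sg3 N y et] S(2) n by simp
  have "sg4 0 0 = n0" "sg4 0 (Suc 0) = n" using S v4 by simp_all
  note B = run_NBS[where sg = sg4 and et = et, OF this, folded r]
  show "stat sg" unfolding stat_def stv_def using B S v4 v12 f3 f4 by simp
  show "sg a = (%_. 0)" if "a \<notin> {0, 1, 2, 4}" for a using that B(3) f1 f2 f3 f4 by simp
qed

lemma ev_dige:
  assumes st: "stat sg" and e: "ev N y e et sg <= N" and i: "ev N y i et sg < N" and fv: "98 \<notin> fv e" "98 \<notin> fv i" "99 \<notin> fv i" "99 \<notin> fv e"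
  shows "ev N y (dige e i) et sg = dig q0 (ev N y e et sg) (ev N y i et sg)"
proof -
  define u where "u = ev N y e et sg"
  define k where "k = ev N y i et sg"
  have p: "sg 1 k = q0 ^ k" "sg 1 (Suc k) = q0 ^ Suc k" using st i by (simp_all add: stat_def k_def)
  have pos: "0 < q0 ^ k" "0 < q0 ^ Suc k" using q0 by simp_all
  have a: "ev N y (Div e (Rd 1 i)) et sg = u div q0 ^ k"
    using ev_Div[of e "Rd 1 i" N y et sg] fv e pos p by (simp add: u_def k_def)
  have b: "ev N y (Div e (Rd 1 (Plus i (Num 1)))) et sg = u div q0 ^ Suc k"
    using ev_Div[of e "Rd 1 (Plus i (Num 1))" N y et sg] fv e pos p by (simp add: u_def k_def)
  have "u div q0 ^ Suc k = u div q0 ^ k div q0" by (simp only: div_mult2_eq[symmetric] power_Suc2)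
  then have "u div q0 ^ k - q0 * (u div q0 ^ Suc k) = u div q0 ^ k mod q0"
    by (simp only: minus_mult_div_eq_mod)
  moreover have "ev N y (Mul (Num q0) (Div e (Rd 1 (Plus i (Num 1))))) et sg = q0 * (u div q0 ^ Suc k)"
    using fv q b by (simp add: min_def)
  ultimately show ?thesis using a unfolding dige_def dig_def u_def[symmetric] k_def[symmetric] by simp
qed

definition cr :: "(nat => nat) => bool" where "cr h \<longleftrightarrow> (\<exists>c c'. core n (nb n0 kk) c c' h)"
definition hs :: "store => nat => (nat => nat) => bool" where
  "hs sg k h \<longleftrightarrow> sg 28 k = 1 & (\<forall>r<n. sg 27 (N * k + r) = h r)"
definition snd28 :: "store => bool" where
  "snd28 sg \<longleftrightarrow> (\<forall>k. sg 28 k = 0 \<or> sg 28 k = 1 & cr (%r. sg 27 (N * k + r)))"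
definition tg :: "nat => (nat => nat) => bool" where
  "tg i h \<longleftrightarrow> cr h & alx * n <= card {r. r < n & h r = dig q0 (y r) i}"

text \<open>Component \<open>i\<close> owns the \<open>q0\<close> slots from \<open>q0 * i\<close>
  on, so later components leave the results of earlier ones intact.\<close>

lemma run_COMPS:
  assumes e: "et 1 = N" and s: "stat sg" "snd28 sg" and sg': "sg' = run N y COMPS et sg"
  shows "stat sg'" "snd28 sg'" "\<And>i h. i < z ==> tg i h ==> \<exists>sl<q0. hs sg' (q0 * i + sl) h"
    "sg' 30 = sg 30" "sg' 31 = sg 31"
proof -
  define I where "I k mux \<longleftrightarrow> stat mux & snd28 mux & (\<forall>i<k. \<forall>h. tg i h --> (\<exists>sl<q0. hs mux (q0 * i + sl) h)) & mux 30 = sg 30 & mux 31 = sg 31" for k mux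
  have "I z sg'" unfolding sg' COMPS_def
  proof (rule Fr_inv[where I = I])
    show "z = min N (ev N y (Rd 0 (Num 4)) et sg)" using s z_le by (simp add: stat_def)
    show "I 0 sg" using s by (simp add: I_def)
    fix i mux assume i: "i < z" and I: "I i mux"
    let ?et = "et(2 := i)"
    define Y where "Y r = dig q0 (y r) i" for r
    interpret d: dec3 D kap q0 tt Gam MTp psi thr t0 LB TT mg EC n "nb n0 kk" lam K Y N e0 dl ta alx tin by (rule d3)
    define mux1 where "mux1 = run N y (Tab 5 nE 6 (dige (Inp (Var 5)) (Var 2))) ?et mux"
    define mux2 where "mux2 = run N y (Tab 5 nE 9 (Num 0)) ?et mux1"
    define mux3 where "mux3 = run N y ROUNDS ?et mux2"
    have f1: "mux1 a = mux a" if "a ~= 6" for a using that by (simp add: mux1_def run_frame)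
    have f2: "mux2 a = mux1 a" if "a ~= 9" for a using that by (simp add: mux2_def run_frame)
    have st: "stat mux" using I by (simp add: I_def)
    then have n1: "mux 0 (Suc 0) = n" by (simp add: stat_def stv_def)
    have iN: "i < N" using i z_le by simp
    have v6: "mux1 6 r = Y r" if r: "r < n" for r
      unfolding mux1_def
    proof (subst run_Tab[OF refl, where f = Y])
      fix r mux' assume r: "r < min N (ev N y nE ?et mux)" and t': "\<And>c. c ~= 6 ==> mux' c = mux c"
      have "stat mux'" using st t' by (simp add: stat_def stv_def)
      moreover have "y r <= N" using y[of r] r q by simp
      ultimately show "ev N y (dige (Inp (Var 5)) (Var 2)) (?et(5 := r)) mux' = Y r"
        using ev_dige[of mux' "Inp (Var 5)" "?et(5 := r)" "Var 2"] r iN by (simp add: Y_def)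
    qed (use r n n1 in simp)
    have v9: "mux2 9 r = 0" if r: "r < n" for r
      unfolding mux2_def using r n n1 by (simp add: Tab_val f1)
    have dst: "d.st mux2" unfolding d.st_def using st v6 f1 f2 by (simp add: stat_def stv_def)
    have so: "d.sound mux2" using I unfolding d.sound_def I_def snd28_def cr_def by (simp add: f1 f2)
    have "q0 * i + q0 = q0 * Suc i" by simp
    also have "... <= q0 * z" using i by (intro mult_le_mono2) simp
    finally have qi: "q0 * ?et 2 + q0 <= N" using q by simp
    have e1: "?et 1 = N" using e by simp
    note R = d.run_ROUNDS[OF dst e1 qi so v9 mux3_def]
    have h: "hs mux' k h = d.has mux' k h" for mux' k h by (simp add: hs_def d.has_def)
    have h2: "d.has mux2 k h = hs mux k h" for k h by (simp add: hs_def d.has_def f1 f2)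
    have st3: "stat mux3" using st R(4)[of 1] R(5,6) by (simp add: stat_def stv_def f1 f2)
    have so3: "snd28 mux3" using R(1) unfolding d.sound_def snd28_def cr_def .
    have "\<exists>sl<q0. hs mux3 (q0 * i' + sl) h" if i': "i' < Suc i" and t: "tg i' h" for i' h
    proof (cases "i' = i")
      case True
      then have "d.target h" using t unfolding d.target_def tg_def cr_def Y_def by simp
      then show ?thesis using R(3)[of h] True by (simp add: h)
    next
      case False
      then have "i' < i" using i' by simp
      then obtain sl where sl: "sl < q0" "hs mux (q0 * i' + sl) h" using I t by (auto simp: I_def)
      have "q0 * i' + sl < q0 * Suc i'" using sl by simp
      also have "... <= q0 * i" using \<open>i' < i\<close> by (intro mult_le_mono2) simp
      finally have "q0 * i' + sl \<notin> {q0 * ?et 2..<q0 * ?et 2 + q0}" by simp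
      then have "hs mux3 (q0 * i' + sl) h" using R(2) sl by (simp add: h h2)
      then show ?thesis using sl by blast
    qed
    moreover have "mux3 30 = sg 30" "mux3 31 = sg 31" using R(4)[of 30] R(4)[of 31] I by (simp_all add: f1 f2 I_def)
    moreover have "run N y COMP ?et mux = mux3" by (simp add: COMP_def mux3_def mux2_def mux1_def)
    ultimately show "I (Suc i) (run N y COMP ?et mux)" unfolding I_def using st3 so3 by simp
  qed
  then show "stat sg'" "snd28 sg'" "\<And>i h. i < z ==> tg i h ==> \<exists>sl<q0. hs sg' (q0 * i + sl) h"
    "sg' 30 = sg 30" "sg' 31 = sg 31" by (auto simp: I_def)
qed

end

section \<open>Recombining the components\<close>

lemma dig_sum: "u < Q ^ z ==> u = (\<Sum>i<z. dig Q u i * Q ^ i)"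
proof (induction z arbitrary: u)
  case (Suc z)
  have "u div Q < Q ^ z" using Suc.prems by (simp add: less_mult_imp_div_less mult.commute)
  from Suc.IH[OF this] have "u div Q = (\<Sum>i<z. dig Q u (Suc i) * Q ^ i)" by (simp add: dig_Suc)
  then have "Q * (u div Q) = (\<Sum>i<z. dig Q u (Suc i) * Q ^ Suc i)" by (simp add: sum_distrib_left mult_ac)
  then show ?case using mult_div_mod_eq[of Q u] by (simp add: sum.lessThan_Suc_shift dig_0 del: sum.lessThan_Suc)
qed simp

lemma dig_of_sum:
  assumes a: "\<And>i. i < z ==> a i < Q" and i: "i < z"
  shows "dig Q (\<Sum>i<z. a i * Q ^ i) i = a i" "(\<Sum>i<z. a i * Q ^ i) < Q ^ z"
proof -
  obtain u where u: "u < Q ^ z" "\<forall>i<z. dig Q u i = a i" using dig_surj[of z a Q] a by auto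
  have "u = (\<Sum>i<z. a i * Q ^ i)" using dig_sum[OF u(1)] u(2) by simp
  then show "dig Q (\<Sum>i<z. a i * Q ^ i) i = a i" "(\<Sum>i<z. a i * Q ^ i) < Q ^ z" using u i by auto
qed

context full
begin

definition cwd :: "(nat => nat => nat) => nat => nat" where
  "cwd h r = (if r < n then \<Sum>i<z. h i r * q0 ^ i else 0)"
definition slot :: "nat => nat => nat" where "slot s i = q0 * i + dig q0 s i"
text \<open>The minimum is the clamping of a product; entries of a valid slot are below
  \<open>q0 <= N\<close> and pass unchanged.\<close>

definition hh :: "store => nat => nat => nat => nat" where
  "hh rh s i r = min N (rh 27 (N * slot s i + r))"
definition wd :: "store => nat => nat list" where "wd rh s = map (cwd (hh rh s)) [0..<N]"
definition errs :: "(nat => nat) => nat" where "errs w = card {r. r < N & w r ~= y r}"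
definition okk :: "store => nat => bool" where
  "okk rh s \<longleftrightarrow> (\<forall>i<z. rh 28 (slot s i) = 1) & errs (cwd (hh rh s)) <= Z"
definition outw :: "store => nat => nat list" where "outw rh j = map (%i. rh 30 (j * N + i)) [0..<N]"
definition outs :: "store => nat list list" where "outs rh = map (outw rh) [0..<rh 31 0]"

lemma slot_le: "i < z ==> slot s i < N"
proof -
  assume i: "i < z"
  have "dig q0 s i < q0" using dig_less q0 by simp
  then have "slot s i < q0 * Suc i" by (simp add: slot_def)
  also have "... <= q0 * z" using i by (intro mult_le_mono2) simp
  finally show ?thesis using q by simp
qed

lemma map_N_eq: "map f [0..<N] = map g [0..<N] \<longleftrightarrow> (\<forall>r<N. f r = g r)"
  by auto

lemma cond_and: "N > 0 ==> min N (if P then Suc 0 else 0) * (min N (if Q then Suc 0 else 0) * (if R then Suc 0 else 0)) = (if P & Q & R then Suc 0 else 0)"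
  by (simp add: min_def)

lemma run_ADD:
  assumes e: "et 1 = N" and c: "sg 31 0 <= N" and sg': "sg' = run N y ADD et sg"
  shows "sg' 31 0 = Suc (sg 31 0)" "\<And>j. j < sg 31 0 ==> outw sg' j = outw sg j"
    "outw sg' (sg 31 0) = map (sg 29) [0..<N]" "\<And>a. a \<notin> {30, 31} ==> sg' a = sg a"
proof -
  define c0 where "c0 = sg 31 0"
  define I where "I k mux \<longleftrightarrow> (\<forall>a. a ~= 30 --> mux a = sg a) & (\<forall>j r. r < N --> mux 30 (j * N + r) = (if j = c0 & r < k then sg 29 r else sg 30 (j * N + r)))" for k mux
  define sg1 where "sg1 = run N y (Fr 5 (Var 1) (Wr 30 (Plus (Mul (Rd 31 (Num 0)) (Var 1)) (Var 5)) (Rd 29 (Var 5)))) et sg"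
  have "I N sg1" unfolding sg1_def
  proof (rule Fr_inv[where I = I])
    show "N = min N (ev N y (Var 1) et sg)" using e by simp
    show "I 0 sg" by (simp add: I_def)
    fix k mux assume k: "k < N" and I: "I k mux"
    let ?c = "Wr 30 (Plus (Mul (Rd 31 (Num 0)) (Var 1)) (Var 5)) (Rd 29 (Var 5))"
    let ?s = "run N y ?c (et(5 := k)) mux"
    have m: "mux 31 0 = c0" "mux 29 = sg 29" using I by (simp_all add: I_def c0_def)
    have ix: "ev N y (Plus (Mul (Rd 31 (Num 0)) (Var 1)) (Var 5)) (et(5 := k)) mux = c0 * N + k"
      using e c m by (simp add: c0_def)
    have vv: "ev N y (Rd 29 (Var 5)) (et(5 := k)) mux = sg 29 k" using m by simp
    have s30: "?s 30 = (mux 30)(c0 * N + k := sg 29 k)" by (simp only: run.simps ix vv fun_upd_same)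
    have so: "?s a = mux a" if "a ~= 30" for a by (rule run_frame) (use that in simp)
    have "?s 30 (j * N + r) = (if j = c0 & r < Suc k then sg 29 r else sg 30 (j * N + r))" if r: "r < N" for j r
    proof -
      have "j * N + r = c0 * N + k \<longleftrightarrow> j = c0 & r = k" using pair_index[OF r k, of j c0] by (auto simp: mult.commute)
      moreover have "mux 30 (j * N + r) = (if j = c0 & r < k then sg 29 r else sg 30 (j * N + r))" using I r by (simp add: I_def)
      ultimately show ?thesis unfolding s30 by (auto simp: less_Suc_eq)
    qed
    then show "I (Suc k) ?s" using I so by (simp add: I_def del: run.simps)
  qed
  then have 1: "\<And>a. a ~= 30 ==> sg1 a = sg a" "\<And>j r. r < N ==> sg1 30 (j * N + r) = (if j = c0 then sg 29 r else sg 30 (j * N + r))"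
    by (auto simp: I_def)
  have r: "sg' = run N y (Wr 31 (Num 0) (Plus (Rd 31 (Num 0)) (Num 1))) et sg1"
    by (simp add: sg' ADD_def sg1_def)
  have 2: "sg' a = sg1 a" if "a ~= 31" for a unfolding r by (rule run_frame) (use that in simp)
  show "sg' 31 0 = Suc (sg 31 0)" unfolding r by (simp add: 1)
  show "outw sg' j = outw sg j" if "j < sg 31 0" for j
    unfolding outw_def map_N_eq using that by (simp add: 2 1 c0_def)
  show "outw sg' (sg 31 0) = map (sg 29) [0..<N]"
    unfolding outw_def map_N_eq by (simp add: 2 1 c0_def)
  show "sg' a = sg a" if "a \<notin> {30, 31}" for a using that by (simp add: 2 1)
qed

lemma run_ITEM:
  assumes e: "et 1 = N" "et 3 = s" and s: "s < q" and st: "stat sg" "snd28 sg" and c: "sg 31 0 <= s" and sg': "sg' = run N y ITEM et sg"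
  shows "\<And>a. a \<notin> {29, 30, 31} ==> sg' a = sg a"
    "outs sg' = (if okk sg s & wd sg s \<notin> set (outs sg) then outs sg @ [wd sg s] else outs sg)"
    "sg' 31 0 <= Suc s"
proof -
  have cN: "sg 31 0 <= N" using c s q by linarith
  have sN: "s <= N" using s q by linarith
  have z: "z <= N" by (rule z_le)
  define sg1 where "sg1 = run N y (Tab 5 (Var 1) 29 WE) et sg"
  have f1: "sg1 a = sg a" if "a ~= 29" for a using that by (simp add: sg1_def run_frame)
  have st1: "stat mux" if "\<And>a. a ~= 29 ==> mux a = sg a" for mux using st(1) that by (simp add: stat_def stv_def)
  have sl: "ev N y slE et' mux = slot s i" if "\<And>a. a ~= 29 ==> mux a = sg a" "et' 3 = s" "et' 50 = i" "i < z" for et' mux i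
    unfolding slE_def slot_def using ev_dige[OF st1, of mux "Var 3" et' "Var 50"] that sN z q by (simp add: min_def)
  have n1: "sg 0 (Suc 0) = n" "sg 0 4 = z" "sg 0 3 = Z" "\<And>i. i <= N ==> sg (Suc 0) i = q0 ^ i" using st(1) by (simp_all add: stat_def stv_def)
  have fs: "99 \<notin> fv slE" "98 \<notin> fv slE" by (simp_all add: slE_def dige_def)
  have WE: "ev N y WE (et(5 := r)) mux = cwd (hh sg s) r" if r: "r < N" and m: "\<And>a. a ~= 29 ==> mux a = sg a" for r mux
  proof -
    have "(\<Sum>i<z. ev N y (Mul (Rd 27 (Plus (Mul slE (Var 1)) (Var 5))) (Rd 1 (Var 50))) (et(5 := r, 50 := i)) mux)
      = (\<Sum>i<z. hh sg s i r * q0 ^ i)"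
    proof (intro sum.cong refl)
      fix i assume "i \<in> {..<z}"
      then have i: "i < z" by simp
      have "min N (slot s i) = slot s i" using slot_le[OF i, of s] by simp
      then show "ev N y (Mul (Rd 27 (Plus (Mul slE (Var 1)) (Var 5))) (Rd 1 (Var 50))) (et(5 := r, 50 := i)) mux = hh sg s i r * q0 ^ i"
        using sl[OF m, of "et(5 := r, 50 := i)" i] i e z fs n1(4)[of i] by (simp add: hh_def m mult.commute)
    qed
    moreover have "min N z = z" using z by simp
    ultimately have "ev N y (Summ 50 (Rd 0 (Num 4)) (Mul (Rd 27 (Plus (Mul slE (Var 1)) (Var 5))) (Rd 1 (Var 50)))) (et(5 := r)) mux
      = (\<Sum>i<z. hh sg s i r * q0 ^ i)" using n1 by (simp only: ev.simps m[of 0, simplified])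
    then show ?thesis unfolding WE_def using r N0 n1 m fs by (simp add: cwd_def Suc_le_eq del: ev.simps(7))
  qed
  have v1: "sg1 29 r = cwd (hh sg s) r" if r: "r < N" for r
    unfolding sg1_def
  proof (subst run_Tab[OF refl, where f = "cwd (hh sg s)"])
    fix r mux assume "r < min N (ev N y (Var 1) et sg)" "\<And>c. c ~= 29 ==> mux c = sg c"
    then show "ev N y WE (et(5 := r)) mux = cwd (hh sg s) r" by (intro WE) simp_all
  qed (use r e in simp)
  have m1: "map (sg1 29) [0..<N] = wd sg s" unfolding wd_def map_N_eq using v1 by simp
  have C1: "ev N y C1 et sg1 = (if (\<forall>i<z. sg 28 (slot s i) = 1) then 1 else 0)"
  proof -
    have "(\<Sum>i<z. ev N y (Rd 28 slE) (et(50 := i)) sg1) = (\<Sum>i<z. sg 28 (slot s i))"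
      by (intro sum.cong refl) (use sl[OF f1] e in \<open>simp add: f1\<close>)
    moreover have "min N z = z" using z by simp
    ultimately have "ev N y C1 et sg1 = (if z <= (\<Sum>i<z. sg 28 (slot s i)) then 1 else 0)"
      unfolding C1_def using n1 by (simp add: f1 del: fun_upd_apply)
    moreover have "z <= (\<Sum>i<z. sg 28 (slot s i)) \<longleftrightarrow> (\<forall>i<z. sg 28 (slot s i) = 1)"
    proof
      assume h: "z <= (\<Sum>i<z. sg 28 (slot s i))"
      have "sg 28 k <= 1" for k using st(2) unfolding snd28_def by (metis le_refl zero_le_one)
      then show "\<forall>i<z. sg 28 (slot s i) = 1" using sum_full[of z "%i. sg 28 (slot s i)" 1] h by simp
    qed simp
    ultimately show ?thesis by simp
  qed
  have C2: "ev N y C2 et sg1 = (if errs (cwd (hh sg s)) <= Z then 1 else 0)"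
  proof -
    have "(\<Sum>r<N. ev N y (Minus (Num 1) (Eq (Rd 29 (Var 51)) (Inp (Var 51)))) (et(51 := r)) sg1)
      = (\<Sum>r<N. if cwd (hh sg s) r ~= y r then 1 else 0)"
      by (intro sum.cong refl) (simp add: v1)
    also have "... = card ({..<N} \<inter> {r. cwd (hh sg s) r ~= y r})" by (simp add: sum.If_cases)
    also have "{..<N} \<inter> {r. cwd (hh sg s) r ~= y r} = {r. r < N & cwd (hh sg s) r ~= y r}" by auto
    finally show ?thesis unfolding C2_def errs_def using n1 e by (simp add: f1 del: ev.simps(3,6) ev_Eq fun_upd_apply)
  qed
  have C3: "ev N y C3 et sg1 = (if wd sg s \<notin> set (outs sg) then 1 else 0)"
  proof -
    have "(\<Sum>j<sg 31 0. ev N y (Leq (Var 1) (Summ 51 (Var 1) (Eq (Rd 30 (Plus (Mul (Var 52) (Var 1)) (Var 51))) (Rd 29 (Var 51))))) (et(52 := j)) sg1)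
      = (\<Sum>j<sg 31 0. if outw sg j = wd sg s then 1 else 0)"
    proof (intro sum.cong refl)
      fix j assume "j \<in> {..<sg 31 0}"
      then have j: "min N j = j" using cN by simp
      have "(\<Sum>r<N. ev N y (Eq (Rd 30 (Plus (Mul (Var 52) (Var 1)) (Var 51))) (Rd 29 (Var 51))) (et(52 := j, 51 := r)) sg1)
        = (\<Sum>r<N. if sg 30 (j * N + r) = cwd (hh sg s) r then 1 else 0)"
        by (intro sum.cong refl) (use e j in \<open>simp add: v1 f1\<close>)
      moreover have "N <= (\<Sum>r<N. if sg 30 (j * N + r) = cwd (hh sg s) r then 1 else 0) \<longleftrightarrow> outw sg j = wd sg s"
        unfolding outw_def wd_def map_N_eq
      proof
        assume h: "N <= (\<Sum>r<N. if sg 30 (j * N + r) = cwd (hh sg s) r then 1 else 0)"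
        have "(if sg 30 (j * N + r) = cwd (hh sg s) r then 1 else 0) = (1::nat)" if "r < N" for r
          using sum_full[of N "%r. if sg 30 (j * N + r) = cwd (hh sg s) r then 1 else 0" 1 r] h that by simp
        then show "\<forall>r<N. sg 30 (j * N + r) = cwd (hh sg s) r" by (metis zero_neq_one)
      qed simp
      ultimately show "ev N y (Leq (Var 1) (Summ 51 (Var 1) (Eq (Rd 30 (Plus (Mul (Var 52) (Var 1)) (Var 51))) (Rd 29 (Var 51))))) (et(52 := j)) sg1
        = (if outw sg j = wd sg s then 1 else 0)" using e by (simp del: ev_Eq)
    qed
    also have "... = card ({..<sg 31 0} \<inter> {j. outw sg j = wd sg s})" by (simp add: sum.If_cases)
    finally have sm: "(\<Sum>j<sg 31 0. ev N y (Leq (Var 1) (Summ 51 (Var 1) (Eq (Rd 30 (Plus (Mul (Var 52) (Var 1)) (Var 51))) (Rd 29 (Var 51))))) (et(52 := j)) sg1)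
      = card ({..<sg 31 0} \<inter> {j. outw sg j = wd sg s})" .
    have "card ({..<sg 31 0} \<inter> {j. outw sg j = wd sg s}) = 0 \<longleftrightarrow> wd sg s \<notin> set (outs sg)"
      by (auto simp: outs_def) (metis atLeastLessThan_iff image_eqI le0)
    moreover have "min N (sg 31 0) = sg 31 0" using cN by simp
    then have "ev N y C3 et sg1 = (if 0 = card ({..<sg 31 0} \<inter> {j. outw sg j = wd sg s}) then 1 else 0)"
      unfolding C3_def using sm by (simp add: f1 del: ev_Leq)
    ultimately show ?thesis by simp
  qed
  have fC: "99 \<notin> fv C2" "99 \<notin> fv C3" by (simp_all add: C2_def C3_def)
  let ?b = "okk sg s & wd sg s \<notin> set (outs sg)"
  have E: "ev N y (Mul C1 (Mul C2 C3)) et sg1 = (if ?b then 1 else 0)"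
    using fC N0 cond_and[OF N0] by (simp add: C1 C2 C3 okk_def del: min_ind)
  have r: "sg' = run N y (Cond (Mul C1 (Mul C2 C3)) ADD) et sg1" by (simp add: sg' ITEM_def sg1_def)
  have o1: "outs sg1 = outs sg" by (simp add: outs_def outw_def[abs_def] f1)
  have "(\<forall>a. a \<notin> {29, 30, 31} --> sg' a = sg a) & outs sg' = (if ?b then outs sg @ [wd sg s] else outs sg) & sg' 31 0 <= Suc s"
  proof (cases ?b)
    case True
    then have r2: "sg' = run N y ADD (et(97 := 0)) sg1" unfolding r using E N0 by (intro run_Cond(1)) simp_all
    have "(et(97 := 0)) 1 = N" "sg1 31 0 <= N" using e cN by (simp_all add: f1)
    note A = run_ADD[OF this r2]
    have "outs sg' = map (outw sg') [0..<sg 31 0] @ [outw sg' (sg 31 0)]" unfolding outs_def using A(1) by (simp add: f1)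
    also have "map (outw sg') [0..<sg 31 0] = map (outw sg1) [0..<sg 31 0]" using A(2) by (simp add: f1)
    also have "... = outs sg" unfolding o1[symmetric] by (simp add: outs_def f1)
    also have "outw sg' (sg 31 0) = wd sg s" using A(3) m1 by (simp add: f1)
    finally show ?thesis using True A(1,4) c f1 by simp
  next
    case False
    then have r2: "sg' = sg1" unfolding r using E by (intro run_Cond(2)) simp
    show ?thesis using False o1 f1 c unfolding r2 by simp
  qed
  then show "\<And>a. a \<notin> {29, 30, 31} ==> sg' a = sg a"
    "outs sg' = (if okk sg s & wd sg s \<notin> set (outs sg) then outs sg @ [wd sg s] else outs sg)" "sg' 31 0 <= Suc s" by auto
qed

text \<open>Sound, because every flagged slot is a codeword and the errors of the combination are
  counted. Complete, because a word with at most \<open>Z\<close> errors has components that agree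
  with those of the received word in at least \<open>n - Z\<close> positions; each is a target and
  occupies a slot, and the number with these slots as digits is below \<open>q\<close>.\<close>

theorem run_MAIN:
  assumes e: "et 1 = N" "et 0 = q" and sg: "sg = run N y MAIN et (%_ _. 0)"
  shows "sg 31 0 <= N" "distinct (outs sg)"
    "set (outs sg) = {w. \<exists>h. (\<forall>i<z. cr (h i)) & w = map (cwd h) [0..<N] & errs (cwd h) <= Z}"
proof -
  define rh0 where "rh0 = run N y SETUP et (%_ _. 0)"
  define rh where "rh = run N y COMPS et rh0"
  note S = run_SETUP[OF e rh0_def]
  have sn: "snd28 rh0" by (simp add: snd28_def S(2))
  note C = run_COMPS[OF e(1) S(1) sn rh_def]
  define I where "I k mux \<longleftrightarrow> (\<forall>a. a \<notin> {29, 30, 31} --> mux a = rh a) & mux 31 0 <= k & distinct (outs mux) &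
     set (outs mux) = {wd rh s | s. s < k & okk rh s}" for k mux
  have "I q (run N y (Fr 3 (Var 0) ITEM) et rh)"
  proof (rule Fr_inv[where I = I])
    show "q = min N (ev N y (Var 0) et rh)" using e q by simp
    show "I 0 rh" using C(5) by (simp add: I_def outs_def S(2))
    fix s mux assume s: "s < q" and I: "I s mux"
    obtain mux' where mu': "mux' = run N y ITEM (et(3 := s)) mux" by simp
    have m: "mux 0 = rh 0" "mux (Suc 0) = rh (Suc 0)" "mux 4 = rh 4" "mux 27 = rh 27" "mux 28 = rh 28" using I by (simp_all add: I_def)
    have st: "stat mux" "snd28 mux" using C(1,2) m by (simp_all add: stat_def stv_def snd28_def)
    have ww: "wd mux s = wd rh s" "okk mux s = okk rh s"
      by (simp_all add: wd_def okk_def hh_def[abs_def] m)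
    have e': "(et(3 := s)) 1 = N" "(et(3 := s)) 3 = s" "mux 31 0 <= s" using e I by (simp_all add: I_def)
    note T = run_ITEM[OF e'(1,2) s st e'(3) mu']
    have "{wd rh s' | s'. s' < Suc s & okk rh s'} = {wd rh s' | s'. s' < s & okk rh s'} \<union> (if okk rh s then {wd rh s} else {})"
      by (auto simp: less_Suc_eq)
    then have "I (Suc s) mux'" using T I unfolding I_def ww by auto
    then show "I (Suc s) (run N y ITEM (et(3 := s)) mux)" by (simp only: mu')
  qed
  moreover have "sg = run N y (Fr 3 (Var 0) ITEM) et rh" by (simp add: sg MAIN_def rh_def rh0_def)
  ultimately have I: "sg 31 0 <= q" "distinct (outs sg)" "set (outs sg) = {wd rh s | s. s < q & okk rh s}"
    by (simp_all add: I_def)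
  show "sg 31 0 <= N" using I(1) q by linarith
  show "distinct (outs sg)" by (rule I(2))
  have cr_less: "h r < q0" if "cr h" "r < n" for h r using that by (auto simp: cr_def core_def)
  show "set (outs sg) = {w. \<exists>h. (\<forall>i<z. cr (h i)) & w = map (cwd h) [0..<N] & errs (cwd h) <= Z}"
    unfolding I(3)
  proof (intro equalityI subsetI)
    fix w assume "w \<in> {wd rh s | s. s < q & okk rh s}"
    then obtain s where s: "w = wd rh s" "okk rh s" by blast
    define h where "h i r = rh 27 (N * slot s i + r)" for i r
    have crh: "cr (h i)" if "i < z" for i
      using C(2) s(2) that unfolding snd28_def okk_def h_def by (metis zero_neq_one)
    have "hh rh s i r = h i r" if "i < z" "r < n" for i r
      using cr_less[OF crh[OF that(1)] that(2)] q by (simp add: hh_def h_def)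
    then have "cwd (hh rh s) = cwd h" by (auto simp: cwd_def fun_eq_iff intro!: sum.cong)
    then show "w \<in> {w. \<exists>h. (\<forall>i<z. cr (h i)) & w = map (cwd h) [0..<N] & errs (cwd h) <= Z}"
      using s crh by (auto simp: wd_def okk_def)
  next
    fix w assume "w \<in> {w. \<exists>h. (\<forall>i<z. cr (h i)) & w = map (cwd h) [0..<N] & errs (cwd h) <= Z}"
    then obtain h where h: "\<And>i. i < z ==> cr (h i)" "w = map (cwd h) [0..<N]" "errs (cwd h) <= Z" by blast
    have "\<exists>sl<q0. hs rh (q0 * i + sl) (h i)" if i: "i < z" for i
    proof (rule C(3)[OF i])
      have "{r. r < n & cwd h r = y r} \<subseteq> {r. r < n & h i r = dig q0 (y r) i}"
      proof
        fix r assume r: "r \<in> {r. r < n & cwd h r = y r}"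
        then have "dig q0 (cwd h r) i = h i r" using dig_of_sum(1)[of z "%i. h i r" q0 i] cr_less[OF h(1)] i by (simp add: cwd_def)
        then show "r \<in> {r. r < n & h i r = dig q0 (y r) i}" using r by simp
      qed
      then have a: "card {r. r < n & cwd h r = y r} <= card {r. r < n & h i r = dig q0 (y r) i}" by (intro card_mono) auto
      have "{..<n} \<subseteq> {r. r < n & cwd h r = y r} \<union> {r. r < N & cwd h r ~= y r}" using n by auto
      then have "card {..<n} <= card ({r. r < n & cwd h r = y r} \<union> {r. r < N & cwd h r ~= y r})" by (intro card_mono) auto
      also have "... <= card {r. r < n & cwd h r = y r} + card {r. r < N & cwd h r ~= y r}" by (rule card_Un_le)
      finally have "n <= card {r. r < n & h i r = dig q0 (y r) i} + Z" using a h(3) by (simp add: errs_def)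
      then show "tg i (h i)" unfolding tg_def using h(1)[OF i] alx by linarith
    qed
    then obtain sl where sl: "\<And>i. i < z ==> sl i < q0 & hs rh (q0 * i + sl i) (h i)" by metis
    then obtain s where s: "s < q0 ^ z" "\<forall>i<z. dig q0 s i = sl i" using dig_surj[of z sl q0] by auto
    have hsl: "hs rh (slot s i) (h i)" if "i < z" for i using sl[OF that] s(2) that by (simp add: slot_def)
    have "hh rh s i r = h i r" if "i < z" "r < n" for i r
      using hsl[OF that(1)] cr_less[OF h(1)[OF that(1)] that(2)] that q by (simp add: hh_def hs_def)
    then have eq: "cwd (hh rh s) = cwd h" by (auto simp: cwd_def fun_eq_iff intro!: sum.cong)
    then have "okk rh s" unfolding okk_def using h(3) hsl by (simp add: hs_def)
    then show "w \<in> {wd rh s | s. s < q & okk rh s}" using h(2) eq s(1) q(1) unfolding wd_def by (metis (mono_tags, lifting) mem_Collect_eq)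
  qed
qed

end

section \<open>Nesting depth\<close>

context prg4
begin

lemma dpe_NBe [simp]: "dpe (NBe l w) = max (Suc (dpe l)) (dpe w)"
  by (simp add: NBe_def)

lemma dpe_MTe: "dpe c <= 3 ==> dpe w <= 2 ==> dpe u <= 1 ==> 3 <= d ==> dpe (MTe c w u) <= d"
  unfolding MTe_def by (rule order_trans[of _ 3]) (auto intro!: dpe_sel simp: numeral_eq_Suc)

lemma dpe_EQe: "dpe c <= 3 ==> dpe c' <= 2 ==> dpe w <= 1 ==> 3 <= d ==> dpe (EQe c c' w) <= d"
  unfolding EQe_def by (rule order_trans[of _ 3]) (auto intro!: dpe_sel simp: numeral_eq_Suc)

lemma dpe_MMe: "dpe l <= 0 ==> dpe c <= 3 ==> dpe w <= 1 ==> 4 <= d ==> dpe (MMe l c w) <= d"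
  unfolding MMe_def by (rule order_trans[of _ 4]) (auto simp: numeral_eq_Suc intro!: dpe_MTe)

lemma dpe_Me: "dpe l <= 0 ==> dpe c <= 3 ==> 5 <= d ==> dpe (Me a l c) <= d"
  unfolding Me_def by (rule order_trans[of _ 5]) (auto simp: numeral_eq_Suc intro!: dpe_MMe)

lemma dpe_gge: "dpe e <= 1 ==> 20 <= d ==> dpe (gge g e) <= d"
  by (rule order_trans[of _ 20]) (auto simp: gge_def Let_def rootE_def MODe_def)

lemma dpe_dige: "dpe e <= 0 ==> dpe i <= 0 ==> 5 <= d ==> dpe (dige e i) <= d"
  by (rule order_trans[of _ 5]) (auto simp: dige_def)

lemmas dpe_rules = dpe_MTe dpe_EQe dpe_MMe dpe_Me dpe_gge dpe_dige

lemma dpe_consts: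
  "20 <= d ==> dpe (TOPe a) <= d" "20 <= d ==> dpe L1e <= d" "20 <= d ==> dpe (CIe AL) <= d"
  "20 <= d ==> dpe CRe <= d" "20 <= d ==> dpe CLe <= d" "20 <= d ==> dpe VALe <= d" "20 <= d ==> dpe CWe <= d"
  "20 <= d ==> dpe WE <= d" "20 <= d ==> dpe C1 <= d" "20 <= d ==> dpe C2 <= d" "20 <= d ==> dpe C3 <= d"
  "20 <= d ==> dpe n0x <= d" "20 <= d ==> dpe Px <= d" "20 <= d ==> dpe Zx <= d" "20 <= d ==> dpe zx <= d"
  "20 <= d ==> dpe (slotE sl) <= d" "20 <= d ==> dpe slE <= d"
  "20 <= d ==> dpe (sumE a) <= d" "20 <= d ==> dpe sizE <= d" "20 <= d ==> dpe facE <= d"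
  by (rule order_trans[of _ 20]; simp add: dpe_rules TOPe_def L1e_def CIe_def CRe_def CLe_def VALe_def CWe_def WE_def C1_def C2_def C3_def
     n0x_def Px_def Zx_def zx_def slE_def slotE_def sumE_def sizE_def facE_def)+

lemma dpc_PROJ: "25 <= d ==> dpc (PROJ a b) <= d"
  by (rule order_trans[of _ 25]) (simp_all add: PROJ_def dpe_consts)

lemma dpc_PROJ': "25 <= d ==> dpc STEP <= d"
  by (rule order_trans[of _ 25]) (simp_all add: STEP_def dpe_consts dpc_PROJ)
lemma dpc_ITER: "28 <= d ==> dpc ITER <= d"
  by (rule order_trans[of _ 28]) (simp_all add: ITER_def dpe_consts dpc_PROJ dpc_PROJ')
lemma dpc_TEST: "28 <= d ==> dpc TEST <= d"
  by (rule order_trans[of _ 28]) (simp_all add: TEST_def dpe_consts dpc_PROJ)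
lemma dpc_SEARCH: "35 <= d ==> dpc SEARCH <= d"
  by (rule order_trans[of _ 35]) (simp_all add: SEARCH_def dpc_ITER dpc_TEST)
lemma dpc_DEC: "35 <= d ==> dpc (DEC sl AL) <= d"
  by (rule order_trans[of _ 35]) (simp_all add: DEC_def ZEM_def dpe_consts)
lemma dpc_NBS: "35 <= d ==> dpc NBS <= d"
  by (rule order_trans[of _ 35]) (auto simp: NBS_def dpe_rules intro!: dpc_sqs dpe_sel)
lemma dpc_FACT: "35 <= d ==> dpc FACT <= d" "35 <= d ==> dpc (POW a b) <= d" "35 <= d ==> dpc ADD <= d" "35 <= d ==> dpc SCAL <= d"
  by (rule order_trans[of _ 35]; simp add: FACT_def POW_def ADD_def SCAL_def dpe_consts)+

lemmas dpc_consts = dpc_SEARCH dpc_DEC dpc_NBS dpc_FACT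

lemma dpc_ROUNDS: "36 <= d ==> dpc ROUNDS <= d"
  by (rule order_trans[of _ 36]) (auto simp: ROUNDS_def CANDS_def dpc_consts intro!: dpc_sqs)

lemma dpc_le:
  "dpc c <= d ==> dpc c' <= d ==> dpc (Sq c c') <= d" "dpe e <= Suc d ==> dpc c <= d ==> dpc (Fr v e c) <= Suc d"
  "dpe e <= Suc d ==> dpe f <= d ==> dpc (Tab v e a f) <= Suc d" "dpe e <= Suc d ==> dpc c <= d ==> dpc (Cond e c) <= Suc d"
  by auto

text \<open>No parameter enters: table lookups have constant depth, and rounds and candidates are
  unrolled one after the other.\<close>

lemma dpc_MAIN: "dpc MAIN <= 40"
proof -
  have "dpc SETUP <= 36"
    unfolding SETUP_def by (rule dpc_sqs) (auto simp: dpc_consts)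
  moreover have "dpc COMP <= 37"
    unfolding COMP_def by (intro dpc_le dpc_le(3)[of _ 36, simplified] dpc_ROUNDS) (simp_all add: dpe_dige)
  moreover have "dpc ITEM <= 37"
  proof -
    have "dpe (Mul C1 (Mul C2 C3)) <= 37" using dpe_consts(9-11)[of 20] by simp
    then show ?thesis unfolding ITEM_def
      by (intro dpc_le dpc_le(3)[of _ 36, simplified] dpc_le(4)[of _ 36, simplified] dpc_consts) (simp_all add: dpe_consts dpc_consts)
  qed
  ultimately show ?thesis by (simp add: MAIN_def COMPS_def)
qed

end

section \<open>The choice of the constants\<close>

text \<open>\<open>bex\<close> is the square of \<open>ep / 128\<close> times
  \<open>ep / 16\<close>, the radius of unique decoding and the tolerance \<open>ta\<close> relative
  to \<open>D\<close>; irregularity, rounding and spectral gap may each use a part of it.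
  \<open>t\<close> lies far enough above \<open>R0 * D\<close> for the list size and far enough
  below the expected agreement for all tolerances. The spectral ratio \<open>x\<close> also has to
  be small against \<open>2 ^ TT\<close>, the number of classes.\<close>

locale params =
  fixes R0 ep :: real and K mg Gam TT kk D b y kap t e0 thr :: nat
    and psi :: "nat => nat => nat set" and phx :: "nat => nat" and bex dl x :: real
  assumes R: "0 < R0" "R0 < 1" "0 < ep" "ep <= 1 - R0"
    and bex: "bex = (ep^2 / 2048)^2" and dl: "dl = bex / 16"
    and K: "8 / ep <= K" and mg: "0 < mg" "4 * real K / (real mg)^2 <= bex / 16" and Gam: "8192 * real K <= Gam * dl^2"
    and TT: "TT = 2 * K^2 * Gam^2 + 1"
    and D: "D = 8 ^ kk" "16 / ep <= D" and x: "x = ((73 / 80)^2) ^ kk" "x <= bex / 16" "x <= dl / (128 * K)" "8 * x <= (ep / 128)^2" "x * 2 ^ TT <= 1"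
    and t: "t = nat \<lceil>(R0 + ep / 2) * D\<rceil>" and e0: "e0 = nat \<lfloor>ep * D / 128\<rfloor>" and thr: "thr = nat \<lceil>mg * (t + ep * D / 16)\<rceil>"
    and b: "64 / ep <= b" "TT * Suc mg ^ (2 ^ TT) <= 2 ^ (b * D)" and y: "y = nat \<lceil>(R0 + ep / 8) * b\<rceil>"
    and kap: "2 ^ (y * D) <= kap * (2 ^ D * 2 ^ (y * (2 * e0)))"
    and dist: "\<And>c c'. c < kap ==> c' < kap ==> c ~= c' ==> card {w. w < D & psi c w = psi c' w} + (2 * e0 + 1) <= D"
    and many: "\<And>n nbf. (\<And>w. w < D ==> bij_betw (nbf w) {..<n} {..<n}) ==>
       kap ^ (2 * n) <= card {c \<in> {..<n} \<rightarrow>\<^sub>E {..<kap}. \<exists>c'. tanner n D nbf kap psi c c'} * 2 ^ (y * D * n)"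
    and phx: "\<And>c. c < kap ==> phx c < (2 ^ b) ^ D"
      "\<And>c c'. c < kap ==> c' < kap ==> c ~= c' ==> agr D (2 ^ b) (phx c) (phx c') < t"
      "\<And>u. card {c. c < kap & t <= agr D (2 ^ b) (phx c) u} <= K"
begin

abbreviation "q0 \<equiv> 2 ^ (b * D) :: nat"
abbreviation "Q \<equiv> 2 ^ b :: nat"
abbreviation "MTp \<equiv> %c w u. dig Q u w = dig Q (phx c) w"
abbreviation "lam \<equiv> (73 / 10) ^ kk :: real"
abbreviation "ta \<equiv> ep * D / 16"
abbreviation "alx \<equiv> R0 + 15 * ep / 16"

lemma pos: "0 < K" "0 < D" "0 < b" "0 < bex" "0 < dl" "ep < 1" "0 < Gam"
proof -
  show "0 < K" using K R by (cases K) (auto simp: field_simps)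
  show "0 < D" using D by simp
  show "0 < b" using b R by (cases b) (auto simp: field_simps)
  show "0 < bex" using R by (simp add: bex)
  then show "0 < dl" by (simp add: dl)
  show "ep < 1" using R by simp
  show "0 < Gam" using Gam \<open>0 < K\<close> by (cases Gam) auto
qed

lemma q0_eq: "q0 = Q ^ D" by (simp add: power_mult)

lemma eD: "16 <= ep * D" using D(2) R by (simp add: field_simps)

lemma lam_x: "lam^2 = x * (real D)^2"
proof -
  have "lam^2 = ((73 / 10)^2) ^ kk" by (simp only: power_mult[symmetric] mult.commute)
  also have "(73 / 10 :: real)^2 = (73 / 80)^2 * 8^2" by (simp add: power2_eq_square)
  also have "((73 / 80 :: real)^2 * 8^2) ^ kk = x * (8^2) ^ kk" by (simp only: power_mult_distrib x(1))
  also have "((8 :: real)^2) ^ kk = (real D)^2" by (simp only: D(1) of_nat_power of_nat_numeral power_mult[symmetric] mult.commute)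
  finally show ?thesis .
qed

lemma t_bounds: "(R0 + ep / 2) * D <= t" "t <= (R0 + ep / 2) * D + 1" "t <= D"
proof -
  have p: "0 <= (R0 + ep / 2) * D" using R by simp
  have "real t = of_int \<lceil>(R0 + ep / 2) * D\<rceil>" using p unfolding t by (simp add: of_nat_nat)
  then show 1: "(R0 + ep / 2) * D <= t" "t <= (R0 + ep / 2) * D + 1" by linarith+
  have "(R0 + ep / 2) * D <= (1 - ep / 2) * D" using R by (intro mult_right_mono) auto
  also have "... = D - ep * D / 2" by (simp add: algebra_simps)
  finally have "real t <= D" using 1 eD by linarith
  then show "t <= D" by simp
qed

lemma e0_bounds: "ep * D / 128 <= real (e0 + 1)" "real e0 <= ep * D / 128" "e0 <= D"
proof -
  have p: "0 <= ep * D / 128" using R by simp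
  have "real e0 = of_int \<lfloor>ep * D / 128\<rfloor>" using p unfolding e0 by (simp add: of_nat_nat)
  then show 1: "ep * D / 128 <= real (e0 + 1)" "real e0 <= ep * D / 128" by linarith+
  have "ep * real D <= 1 * real D" using pos by (intro mult_right_mono) auto
  then have "real e0 <= D" using 1 by linarith
  then show "e0 <= D" by simp
qed

lemma kap_bound: "kap <= 2 ^ (b * D)"
proof -
  have "inj_on phx {..<kap}"
  proof (rule inj_onI, rule ccontr)
    fix c c' assume h: "c \<in> {..<kap}" "c' \<in> {..<kap}" "phx c = phx c'" "c ~= c'"
    then have "agr D Q (phx c) (phx c) < t" using phx(2)[of c c'] by simp
    then show False using t_bounds by (simp add: agr_self)
  qed
  then have "card {..<kap} = card (phx ` {..<kap})" by (simp add: card_image)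
  also have "... <= card {..<Q ^ D}" by (rule card_mono) (use phx(1) in auto)
  finally show ?thesis by (simp add: power_mult)
qed

lemma agr_mt: "(\<Sum>v<D. mtv kap D q0 MTp c v (a v)) <= card {v. v < D & dig Q (a v) v = dig Q (phx c) v}"
proof -
  have "(\<Sum>v<D. mtv kap D q0 MTp c v (a v)) <= (\<Sum>v<D. if dig Q (a v) v = dig Q (phx c) v then 1 else 0)"
    by (intro sum_mono) (simp add: mtv_def)
  also have "... = card ({..<D} \<inter> {v. dig Q (a v) v = dig Q (phx c) v})" by (simp add: sum.If_cases)
  also have "{..<D} \<inter> {v. dig Q (a v) v = dig Q (phx c) v} = {v. v < D & dig Q (a v) v = dig Q (phx c) v}" by auto
  finally show ?thesis .
qed

text \<open>The digits that the neighbours of \<open>l\<close> return to it form one word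
  \<open>u\<close>, and plausible symbols are codewords in a ball around it.\<close>

lemma few: "card {c. c < kap & (\<exists>w<D. real (mmv kap D q0 MTp t nbf Y l c w) ~= 0)} <= K"
proof -
  obtain u where u: "u < Q ^ D" "\<forall>w<D. dig Q u w = dig Q (Y (nbf w l)) w"
    using dig_surj[of D "%w. dig Q (Y (nbf w l)) w" Q] dig_less[of Q] by auto
  have "{c. c < kap & (\<exists>w<D. real (mmv kap D q0 MTp t nbf Y l c w) ~= 0)} \<subseteq> {c. c < kap & t <= agr D Q (phx c) u}"
  proof
    fix c assume "c \<in> {c. c < kap & (\<exists>w<D. real (mmv kap D q0 MTp t nbf Y l c w) ~= 0)}"
    then have c: "c < kap" "t <= (\<Sum>v<D. mtv kap D q0 MTp c v (Y (nbf v l)))" by (auto simp: mmv_def split: if_splits)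
    note c(2)
    also have "(\<Sum>v<D. mtv kap D q0 MTp c v (Y (nbf v l))) <= card {v. v < D & dig Q (Y (nbf v l)) v = dig Q (phx c) v}"
      by (rule agr_mt)
    also have "{v. v < D & dig Q (Y (nbf v l)) v = dig Q (phx c) v} = {w. w < D & dig Q (phx c) w = dig Q u w}" using u by auto
    finally show "c \<in> {c. c < kap & t <= agr D Q (phx c) u}" using c by (simp add: agr_def)
  qed
  then have "card {c. c < kap & (\<exists>w<D. real (mmv kap D q0 MTp t nbf Y l c w) ~= 0)} <= card {c. c < kap & t <= agr D Q (phx c) u}"
    by (intro card_mono) auto
  also have "... <= K" by (rule phx(3))
  finally show ?thesis .
qed

lemma bad_small: "2 * (real D)^2 * (2 * dl * (real D)^2 + 4 * real K * (real D)^2 / (real mg)^2 + lam^2) <= (real (e0 + 1))^2 * ta^2"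
proof -
  have "2 * (real D)^2 * (2 * dl * (real D)^2 + 4 * real K * (real D)^2 / (real mg)^2 + lam^2)
    = (real D)^2 * (real D)^2 * (2 * (2 * dl + 4 * real K / (real mg)^2 + x))"
    unfolding lam_x by (simp add: algebra_simps)
  also have "... <= (real D)^2 * (real D)^2 * bex"
    using mg(2) x(2) pos by (intro mult_left_mono) (auto simp: dl)
  also have "... = (ep * D / 128)^2 * ta^2" by (simp add: bex power2_eq_square)
  also have "... <= (real (e0 + 1))^2 * ta^2" using e0_bounds R by (intro mult_right_mono power_mono) auto
  finally show ?thesis .
qed

text \<open>\<open>x * 2 ^ TT <= 1\<close> keeps the energy below \<open>2 * K * D^2\<close> for as
  many as \<open>2 ^ TT\<close> classes; dividing by the gain per round leaves
  \<open>TT - 1\<close>.\<close>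

lemma rounds: "real K * ((real D)^2 + lam^2 * 2 ^ TT) < real TT * ((real D)^2 / ((real Gam)^2 * real K))"
proof -
  have D2: "0 < (real D)^2" using pos by simp
  have "x * 2 ^ TT * (real D)^2 <= 1 * (real D)^2" using x(5) by (intro mult_right_mono) auto
  then have "lam^2 * 2 ^ TT <= (real D)^2" unfolding lam_x by (simp add: mult_ac)
  then have "real K * ((real D)^2 + lam^2 * 2 ^ TT) <= real K * (2 * (real D)^2)" by (intro mult_left_mono) auto
  also have "... = 2 * real K * (real D)^2" by simp
  also have "2 * real K < real TT / ((real Gam)^2 * real K)"
  proof -
    have "2 * real K * ((real Gam)^2 * real K) < real TT" by (simp add: TT power2_eq_square)
    then show ?thesis using pos by (simp add: less_divide_eq)
  qed
  then have "2 * real K * (real D)^2 < real TT / ((real Gam)^2 * real K) * (real D)^2" using D2 by (intro mult_strict_right_mono)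
  finally show ?thesis by simp
qed

lemma thr_bounds: "real mg * (real t + ta) <= thr" "thr < real mg * (alx * D - 2 * ta)" "t <= alx * D - ta"
proof -
  have p: "0 <= real mg * (real t + ta)" using R by simp
  have "real thr = of_int \<lceil>real mg * (real t + ta)\<rceil>" using p unfolding thr by (simp add: of_nat_nat)
  then have 1: "real mg * (real t + ta) <= thr" "thr < real mg * (real t + ta) + 1" by linarith+
  show "real mg * (real t + ta) <= thr" by (rule 1)
  have e: "(R0 + ep / 2) * D = R0 * D + ep * D / 2" "alx * D = R0 * D + 15 * (ep * D) / 16" by (simp_all add: algebra_simps)
  show "t <= alx * D - ta" using t_bounds(2) eD unfolding e by linarith
  have "real t + ta + 1 <= alx * D - 2 * ta" using t_bounds(2) eD unfolding e by linarith
  then have "real mg * (real t + ta + 1) <= real mg * (alx * D - 2 * ta)" by (intro mult_left_mono) auto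
  moreover have "real mg * (real t + ta) + 1 <= real mg * (real t + ta + 1)" using mg by (simp add: distrib_left)
  ultimately show "thr < real mg * (alx * D - 2 * ta)" using 1 by linarith
qed

lemma nb_bij: "0 < n0 ==> w < D ==> bij_betw (nb n0 kk w) {..<n0 * n0} {..<n0 * n0}"
  using nb_inj[of w kk n0] nb_less[of _ n0 kk w] D(1) unfolding bij_betw_def
  by (metis (no_types, lifting) card_image card_subset_eq finite_lessThan image_subsetI lessThan_iff)

lemma decoder:
  assumes n0: "2 <= n0" and X: "n0 * n0 <= X" "D <= X" "q0 <= X" "Gam <= X"
  shows "dec3 D kap q0 t Gam MTp psi thr (D - e0) (2 ^ TT) TT mg (Suc mg ^ 2 ^ TT) (n0 * n0) (nb n0 kk) lam K Y X e0 dl ta alx t"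
proof unfold_locales
  let ?n = "n0 * n0"
  show n1: "1 < ?n" using n0 mult_le_mono[OF n0 n0] by linarith
  show "0 < ?n" using n1 by linarith
  show "0 < D" by (rule pos)
  show "nb n0 kk w v < ?n" if "v < ?n" "w < D" for v w using that by (simp add: nb_less)
  show "inj_on (nb n0 kk w) {..<?n}" if "w < D" for w using nb_inj that D by simp
  show "(\<Sum>v<?n. (\<Sum>w<D. f (nb n0 kk w v))^2) <= lam^2 * (\<Sum>v<?n. (f v)^2)" if "(\<Sum>v<?n. f v) = 0" for f :: "nat => real"
  proof -
    have "lam^2 = ((73 / 10)^2) ^ kk" by (simp only: power_mult[symmetric] mult.commute)
    then show ?thesis using nb_expander[of n0 f kk] that n0 D(1) by simp
  qed
  show "real (mmv kap D q0 MTp t (nb n0 kk) Y l c w) \<in> {0, 1}" for l c w by (simp add: mmv_def mtv_def)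
  show "card {c. c < kap & (\<exists>w<D. real (mmv kap D q0 MTp t (nb n0 kk) Y l c w) ~= 0)} <= K" for l by (rule few)
  show "0 < X" using X(2) pos(2) by linarith
  show "?n <= X" "D <= X" "q0 <= X" "Gam <= X" by (rule X)+
  show "kap <= X" using kap_bound X by linarith
  show "card {w. w < D & psi c w = psi c' w} + (2 * e0 + 1) <= D" if "c < kap" "c' < kap" "c ~= c'" for c c' by (rule dist[OF that])
  show "D - e0 + e0 = D" using e0_bounds by simp
  have "8 * lam^2 = 8 * x * (real D)^2" by (simp add: lam_x)
  also have "... <= (ep / 128)^2 * (real D)^2" using x(4) by (intro mult_right_mono) auto
  also have "... = (ep * D / 128)^2" by (simp add: power2_eq_square)
  also have "... <= (real (e0 + 1))^2" using e0_bounds R by (intro power_mono) auto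
  finally show "8 * lam^2 <= (real (e0 + 1))^2" .
  show "u = u'" if "\<And>w. w < D ==> a w < kap" "u < q0" "u' < q0" "\<And>w. w < D ==> dig Q u w = dig Q (phx (a w)) w"
     "\<And>w. w < D ==> dig Q u' w = dig Q (phx (a w)) w" for a u u'
    by (rule dig_inj[of u Q D u']) (use that in \<open>auto simp: q0_eq\<close>)
  show "\<exists>u<q0. \<forall>w<D. dig Q u w = dig Q (phx (a w)) w" if "\<And>w. w < D ==> a w < kap" for a
    unfolding q0_eq by (rule dig_surj) (simp add: dig_less)
  show "0 < dl" "0 < K" "0 < mg" by (rule pos mg)+
  have "ep^2 <= 1" using pos R by (simp add: power_le_one)
  then have "(ep^2 / 2048)^2 <= 1" by (intro power_le_one) auto
  then show "dl <= 1" by (simp add: dl bex)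
  show "lam^2 <= dl * real (D^2) / (128 * real K)"
    unfolding lam_x using mult_right_mono[OF x(3), of "(real D)^2"] by simp
  show "8192 * real K <= real Gam * dl^2" using Gam by simp
  show "2 ^ TT = (2 :: nat) ^ TT" "Suc mg ^ 2 ^ TT = Suc mg ^ 2 ^ TT" by simp_all
  show "TT * Suc mg ^ 2 ^ TT <= q0" by (rule b)
  show "real K * (real (D^2) + lam^2 * 2 ^ TT) < real TT * (real (D^2) / real (Gam^2 * K))" using rounds by simp
  show "card {w. w < D & dig Q (u w) w = dig Q (phx c) w & dig Q (u w) w = dig Q (phx c') w} <= t" if "c < kap" "c' < kap" "c ~= c'" for c c' and u :: "nat => nat"
  proof -
    have "card {w. w < D & dig Q (u w) w = dig Q (phx c) w & dig Q (u w) w = dig Q (phx c') w} <= agr D Q (phx c) (phx c')"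
      unfolding agr_def by (intro card_mono) auto
    then show ?thesis using phx(2)[OF that] by linarith
  qed
  show "0 < ta" using R pos by simp
  show "real t <= alx * real D - ta" "real mg * (real t + ta) <= real thr" "real thr < real mg * (alx * real D - 2 * ta)" by (rule thr_bounds)+
  show "2 * (real D)^2 * (2 * dl * (real D)^2 + 4 * real K * (real D)^2 / (real mg)^2 + lam^2) <= (real (e0 + 1))^2 * ta^2"
    using bad_small by simp
qed

end

text \<open>The quotient of \<open>f\<close> by \<open>P\<close> misses \<open>rh\<close> by less
  than \<open>1 / P\<close>. Multiplied by \<open>N < 2 * P\<close> this is an error below 2, so the
  integer parts differ by at most 2.\<close>

lemma floor_split:
  fixes rh :: real and P :: nat
  assumes rh: "0 <= rh" "rh < 1" and P: "0 < P" and f: "f = nat \<lfloor>rh * P\<rfloor>" and N: "N = P + f"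
  shows "N < 2 * P" "f * N div P <= nat \<lfloor>rh * N\<rfloor>" "nat \<lfloor>rh * N\<rfloor> <= f * N div P + 2"
proof -
  have "real f = of_int \<lfloor>rh * P\<rfloor>" using rh unfolding f by (simp add: of_nat_nat)
  then have f1: "real f <= rh * P" "rh * P < real f + 1" by linarith+
  have "rh * P < 1 * real P" using rh P by (intro mult_strict_right_mono) auto
  then have "real f < P" using f1 by linarith
  then show N2: "N < 2 * P" unfolding N by simp
  have a: "real f * N / P <= rh * N"
    using mult_right_mono[OF f1(1), of "real N"] P by (simp add: divide_le_eq mult_ac)
  have "rh * N <= (real f + 1) * N / P"
    using mult_right_mono[OF less_imp_le[OF f1(2)], of "real N"] P by (simp add: le_divide_eq mult_ac)
  also have "... = real f * N / P + real N / P" by (simp add: algebra_simps add_divide_distrib)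
  also have "real N / P <= 2" using N2 P by (simp add: divide_le_eq)
  finally have b: "rh * N <= real f * N / P + 2" by simp
  have "\<lfloor>real (f * N) / real P\<rfloor> = int (f * N div P)" by (rule floor_divide_of_nat_eq)
  then have fl: "\<lfloor>real f * N / P\<rfloor> = int (f * N div P)" by simp
  have "\<lfloor>real f * N / P\<rfloor> <= \<lfloor>rh * N\<rfloor>" by (rule floor_mono[OF a])
  moreover have "\<lfloor>rh * N\<rfloor> <= \<lfloor>real f * N / P\<rfloor> + 2" using floor_mono[OF b] by simp
  ultimately have "int (f * N div P) <= \<lfloor>rh * N\<rfloor>" "\<lfloor>rh * N\<rfloor> <= int (f * N div P) + 2" using fl by simp_all
  then show "f * N div P <= nat \<lfloor>rh * N\<rfloor>" "nat \<lfloor>rh * N\<rfloor> <= f * N div P + 2" by linarith+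
qed

text \<open>The exponent 42 is the depth 40 plus 2 for the output. For \<open>N >= 1 / g^2\<close>
  the base \<open>N * g\<close> is at least the square root of \<open>N\<close>, so half of the
  exponent \<open>e\<close>, at least 80, remains for \<open>N\<close>; 43 is enough, as one power
  of \<open>N\<close> absorbs the constant.\<close>

lemma time_bound:
  fixes N k :: nat and g e :: real
  assumes g: "0 < g" and e: "160 <= e" and N: "1 / g^2 <= N" "k * 2 ^ 42 <= N" "1 <= N"
  shows "real (k * (N + 1) ^ 42) <= (N * g) powr e"
proof -
  have "k * (N + 1) ^ 42 <= k * (2 * N) ^ 42" using N by (intro mult_le_mono2 power_mono) auto
  also have "... = k * 2 ^ 42 * N ^ 42" by (simp only: power_mult_distrib mult.assoc)
  also have "... <= N * N ^ 42" using N by (intro mult_le_mono1) auto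
  also have "... = N ^ (1 + 42)" by (simp only: power_add power_one_right)
  finally have "real (k * (N + 1) ^ 42) <= real (N ^ (1 + 42))" by (rule of_nat_mono)
  also have "... = N powr 43" using N powr_realpow[of "real N" 43] by simp
  also have "... <= N powr (e / 2)" using N e by (intro powr_mono) auto
  also have "... = (N powr (1 / 2)) powr e" by (simp add: powr_powr)
  also have "... <= (N * g) powr e"
  proof (rule powr_mono2)
    have "real N <= (N * g)^2"
    proof -
      have "1 <= real N * g^2" using N(1) g by (simp add: divide_le_eq)
      then have "real N * 1 <= real N * (real N * g^2)" by (intro mult_left_mono) auto
      then show ?thesis by (simp add: power2_eq_square mult_ac)
    qed
    then have "sqrt (real N) <= N * g" using g by (intro real_le_lsqrt) auto
    then show "N powr (1 / 2) <= N * g" by (simp add: powr_half_sqrt)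
  qed (use e in auto)
  finally show ?thesis .
qed

text \<open>Rounding the square root down loses at most \<open>2 * sqrt N\<close> positions, and
  this is at most \<open>c * N\<close> for large \<open>N\<close>.\<close>

lemma square_below:
  fixes N :: nat and c :: real
  assumes c: "0 < c" and N: "(2 / c)^2 <= N" "16 <= N"
  shows "\<exists>n0. 4 <= n0 & n0 * n0 <= N & N < (n0 + 1) * (n0 + 1) & (1 - c) * N <= real (n0 * n0)"
proof -
  define n0 where "n0 = nat \<lfloor>sqrt N\<rfloor>"
  have "real n0 = of_int \<lfloor>sqrt N\<rfloor>" by (simp add: n0_def of_nat_nat)
  then have n: "real n0 <= sqrt N" "sqrt N < real n0 + 1" by linarith+
  have s2: "sqrt N * sqrt N = N" by simp
  have "real n0 * real n0 <= sqrt N * sqrt N" using n by (intro mult_mono) auto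
  then have "real (n0 * n0) <= N" by simp
  then have 1: "n0 * n0 <= N" by (simp only: of_nat_le_iff)
  have "sqrt N * sqrt N < (real n0 + 1) * (real n0 + 1)" using n by (intro mult_strict_mono) auto
  then have "real N < real ((n0 + 1) * (n0 + 1))" by (simp add: algebra_simps)
  then have 2: "N < (n0 + 1) * (n0 + 1)" by (simp only: of_nat_less_iff)
  have "sqrt 16 <= sqrt N" using N(2) by (subst real_sqrt_le_iff) simp
  moreover have "sqrt 16 = (4 :: real)" by (rule real_sqrt_unique) auto
  ultimately have 3: "4 <= n0" unfolding n0_def by (intro le_nat_floor) simp
  have "2 / c <= sqrt N" using N(1) c by (intro real_le_rsqrt) auto
  then have "2 * sqrt N <= (c * sqrt N) * sqrt N" using c by (intro mult_right_mono) (auto simp: field_simps)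
  then have "2 * sqrt N <= c * N" by (simp only: mult.assoc s2)
  moreover have "(sqrt N - 1) * (sqrt N - 1) <= real n0 * real n0"
  proof -
    have "4 <= real n0" using 3 by simp
    then show ?thesis using n by (intro mult_mono; linarith)
  qed
  moreover have "(sqrt N - 1) * (sqrt N - 1) = N - 2 * sqrt N + 1" using s2 by (simp add: algebra_simps)
  ultimately have "(1 - c) * N <= real (n0 * n0)" by (simp add: algebra_simps)
  then show ?thesis using 1 2 3 by blast
qed

section \<open>The interleaved code and its rate\<close>

context params
begin

definition crr :: "nat => (nat => nat) => bool" where
  "crr n0 h \<longleftrightarrow> (\<exists>c c'. prg2.core D kap q0 MTp psi (n0 * n0) (nb n0 kk) c c' h)"
definition cw :: "nat => nat => (nat => nat => nat) => nat => nat" where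
  "cw n z h r = (if r < n then \<Sum>i<z. h i r * q0 ^ i else 0)"
definition code :: "nat => nat => nat => nat list set" where
  "code n0 N z = {w. \<exists>h. (\<forall>i<z. crr n0 (h i)) & w = map (cw (n0 * n0) z h) [0..<N]}"
definition CC :: "nat => (nat => nat) set" where
  "CC n0 = {h \<in> {..<n0 * n0} \<rightarrow>\<^sub>E {..<q0}. crr n0 h}"

lemma q0_pos: "2 <= q0"
proof -
  have "(2::nat) ^ 1 <= 2 ^ (b * D)" using pos by (intro power_increasing) auto
  then show ?thesis by simp
qed

lemma crr_less: "crr n0 h ==> r < n0 * n0 ==> h r < q0"
  unfolding crr_def prg2.core_def by blast

lemma cw_less: "(\<And>i. i < z ==> crr n0 (h i)) ==> cw (n0 * n0) z h r < q0 ^ z"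
proof (cases "r < n0 * n0")
  case True
  assume "\<And>i. i < z ==> crr n0 (h i)"
  then have "h i r < q0" if "i < z" for i by (rule crr_less[OF _ True]) (rule that)
  then have "(\<Sum>i<z. h i r * q0 ^ i) < q0 ^ z" if "0 < z" using dig_of_sum(2)[of z "%i. h i r" q0 0] that by simp
  then show ?thesis using True by (cases z) (simp_all add: cw_def)
qed (simp add: cw_def)

lemma code_is_code: "is_code {..<q0 ^ z} N (code n0 N z)"
  unfolding is_code_def words_def code_def using cw_less by auto

lemma finite_code: "finite (code n0 N z)"
proof (rule finite_subset)
  show "code n0 N z \<subseteq> {xs. set xs \<subseteq> {..<q0 ^ z} & length xs = N}" using code_is_code by (simp add: is_code_def words_def)
  show "finite {xs. set xs \<subseteq> {..<q0 ^ z} & length xs = N}" by (rule finite_lists_length_eq) simp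
qed

text \<open>A component word determines its outer word: the digits along the edges at
  \<open>l\<close> form the inner codeword of \<open>c l\<close>, and inner codewords are distinct.
  \<open>F\<close> reads the outer word off.\<close>

lemma card_CC:
  assumes n0: "2 <= n0"
  shows "card {c \<in> {..<n0 * n0} \<rightarrow>\<^sub>E {..<kap}. \<exists>c'. tanner (n0 * n0) D (nb n0 kk) kap psi c c'} <= card (CC n0)"
proof -
  let ?n = "n0 * n0" and ?nb = "nb n0 kk"
  let ?T = "{c \<in> {..<?n} \<rightarrow>\<^sub>E {..<kap}. \<exists>c'. tanner ?n D ?nb kap psi c c'}"
  interpret d: dec3 D kap q0 t Gam MTp psi thr "D - e0" "2 ^ TT" TT mg "Suc mg ^ 2 ^ TT" ?n ?nb lam K "%_. 0" "?n + D + q0 + Gam" e0 dl ta alx t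
    by (rule decoder[OF n0]) auto
  define F where "F h = (SOME c. c \<in> {..<?n} \<rightarrow>\<^sub>E {..<kap} & (\<exists>c'. d.core ?n ?nb c c' h))" for h
  have "?T \<subseteq> F ` CC n0"
  proof
    fix c assume "c \<in> ?T"
    then have cE: "c \<in> {..<?n} \<rightarrow>\<^sub>E {..<kap}" and ex: "\<exists>c'. tanner ?n D ?nb kap psi c c'" by simp_all
    from ex obtain c' where tn: "tanner ?n D ?nb kap psi c c'" by (rule exE)
    note c = cE tn
    define h where "h = restrict (d.cwf c) {..<?n}"
    have "d.core ?n ?nb c c' (d.cwf c)" by (rule d.core_cwf[OF c(2)])
    then have co: "d.core ?n ?nb c c' h" using d.core_cong[of h "d.cwf c" c c'] by (simp add: h_def)
    have "h \<in> {..<?n} \<rightarrow>\<^sub>E {..<q0}" using co unfolding d.core_def by (auto simp: h_def)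
    moreover have "crr n0 h" unfolding crr_def using co by (intro exI)
    ultimately have hC: "h \<in> CC n0" by (simp add: CC_def)
    have ex: "c \<in> {..<?n} \<rightarrow>\<^sub>E {..<kap} & (\<exists>c'. d.core ?n ?nb c c' h)" using c(1) co by (intro conjI exI)
    have uniq: "c2 = c" if h2: "c2 \<in> {..<?n} \<rightarrow>\<^sub>E {..<kap} & (\<exists>c'. d.core ?n ?nb c2 c' h)" for c2
    proof (rule ext)
      fix l
      show "c2 l = c l"
      proof (cases "l < ?n")
        case True
        have k: "c2 l < kap" "c l < kap" using h2 c True by auto
        have eq: "dig Q (phx (c l)) w = dig Q (phx (c2 l)) w" if w: "w < D" for w
        proof -
          obtain c2' where co2: "d.core ?n ?nb c2 c2' h" using conjunct2[OF h2] by (rule exE)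
          have "dig Q (h (?nb w l)) w = dig Q (phx (c l)) w" using co True w unfolding d.core_def by simp
          moreover have "dig Q (h (?nb w l)) w = dig Q (phx (c2 l)) w" using co2 True w unfolding d.core_def by simp
          ultimately show ?thesis by simp
        qed
        have "phx (c l) = phx (c2 l)" by (rule dig_inj[of _ Q D]) (use eq phx(1) k in auto)
        then have "agr D Q (phx (c l)) (phx (c2 l)) = D" by (simp add: agr_self)
        then show ?thesis using phx(2)[OF k(2) k(1)] t_bounds by (cases "c l = c2 l") auto
      next
        case False
        then show ?thesis using h2 c by (auto simp: PiE_def extensional_def)
      qed
    qed
    have "F h = c" unfolding F_def
    proof (rule some_equality)
      show "c \<in> {..<?n} \<rightarrow>\<^sub>E {..<kap} & (\<exists>c'. d.core ?n ?nb c c' h)" by (rule ex)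
    qed (rule uniq)
    then show "c \<in> F ` CC n0" using hC by (metis image_eqI)
  qed
  moreover have "finite (CC n0)" unfolding CC_def by (rule finite_subset[of _ "{..<?n} \<rightarrow>\<^sub>E {..<q0}"]) (auto intro!: finite_PiE)
  ultimately show ?thesis using surj_card_le[of "CC n0" ?T F] by simp
qed

lemma card_code:
  assumes N: "n0 * n0 <= N"
  shows "card (CC n0) ^ z <= card (code n0 N z)"
proof -
  let ?f = "%h. map (cw (n0 * n0) z h) [0..<N]"
  have "card ({..<z} \<rightarrow>\<^sub>E CC n0) = card (CC n0) ^ z" by (simp add: card_PiE)
  moreover have "inj_on ?f ({..<z} \<rightarrow>\<^sub>E CC n0)"
  proof (rule inj_onI)
    fix h h' assume h: "h \<in> {..<z} \<rightarrow>\<^sub>E CC n0" "h' \<in> {..<z} \<rightarrow>\<^sub>E CC n0" "?f h = ?f h'"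
    show "h = h'"
    proof (rule PiE_ext[OF h(1,2)])
      fix i assume i: "i \<in> {..<z}"
      have hi: "h i \<in> CC n0" "h' i \<in> CC n0" if "i < z" for i using h(1,2) that by auto
      show "h i = h' i"
      proof (rule PiE_ext[of _ "{..<n0 * n0}" "%_. {..<q0}"])
        fix r assume r: "r \<in> {..<n0 * n0}"
        then have "r < N" using N by simp
        then have "cw (n0 * n0) z h r = cw (n0 * n0) z h' r" using h(3) by auto
        then have eq: "(\<Sum>i<z. h i r * q0 ^ i) = (\<Sum>i<z. h' i r * q0 ^ i)" using r by (simp add: cw_def)
        have less: "h i r < q0" "h' i r < q0" if "i < z" for i using hi[OF that] r crr_less by (auto simp: CC_def)
        have "h i r = dig q0 (\<Sum>i<z. h i r * q0 ^ i) i" by (rule dig_of_sum(1)[symmetric]) (use less i in auto)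
        also have "... = h' i r" unfolding eq by (rule dig_of_sum(1)) (use less i in auto)
        finally show "h i r = h' i r" .
      qed (use hi i in \<open>auto simp: CC_def\<close>)
    qed
  qed
  moreover have "?f ` ({..<z} \<rightarrow>\<^sub>E CC n0) \<subseteq> code n0 N z"
  proof
    fix w assume "w \<in> ?f ` ({..<z} \<rightarrow>\<^sub>E CC n0)"
    then obtain h where "h \<in> {..<z} \<rightarrow>\<^sub>E CC n0" "w = ?f h" by blast
    moreover from this have "\<forall>i<z. crr n0 (h i)" by (auto simp: CC_def PiE_def Pi_def)
    ultimately show "w \<in> code n0 N z" unfolding code_def by blast
  qed
  ultimately show ?thesis by (metis card_image card_mono finite_code)
qed

lemma y_bounds: "(R0 + ep / 8) * b <= y" "y <= b"
proof -
  have p: "0 <= (R0 + ep / 8) * b" using R by simp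
  have "real y = of_int \<lceil>(R0 + ep / 8) * b\<rceil>" using p unfolding y by (simp add: of_nat_nat)
  then have 1: "(R0 + ep / 8) * b <= y" "y <= (R0 + ep / 8) * b + 1" by linarith+
  show "(R0 + ep / 8) * b <= y" by (rule 1)
  have "(R0 + ep / 8) * b <= (1 - 7 * ep / 8) * b" using R by (intro mult_right_mono) auto
  also have "... = b - 7 * (ep * b) / 8" by (simp add: algebra_simps)
  finally have 2: "(R0 + ep / 8) * b <= b - 7 * (ep * b) / 8" .
  have "64 <= ep * b" using b(1) R by (simp add: field_simps)
  then have "real y <= b" using 1 2 by linarith
  then show "y <= b" by simp
qed

text \<open>The Tanner count gives \<open>kap^2\<close> over \<open>2 ^ (y * D)\<close> per vertex.
  In the exponent the losses \<open>2 * D\<close> and \<open>4 * y * e0\<close> are at most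
  \<open>ep * b * D / 32\<close> each, and \<open>y\<close> exceeds \<open>R0 * b\<close> by at
  least \<open>ep * b / 8\<close>; a surplus of \<open>ep / 16\<close> in the rate remains.\<close>

lemma card_CC_bound:
  assumes n0: "2 <= n0"
  shows "2 powr ((R0 + ep / 16) * b * D * real (n0 * n0)) <= card (CC n0)"
proof -
  let ?n = "n0 * n0"
  let ?T = "{c \<in> {..<?n} \<rightarrow>\<^sub>E {..<kap}. \<exists>c'. tanner ?n D (nb n0 kk) kap psi c c'}"
  have "0 < n0" using n0 by simp
  then have "kap ^ (2 * ?n) <= card ?T * 2 ^ (y * D * ?n)" by (intro many nb_bij)
  also have "... <= card (CC n0) * 2 ^ (y * D * ?n)" by (rule mult_le_mono1[OF card_CC[OF n0]])
  finally have k: "kap ^ (2 * ?n) <= card (CC n0) * 2 ^ (y * D * ?n)" .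
  have "(2 ^ (y * D)) ^ (2 * ?n) <= (kap * (2 ^ D * 2 ^ (y * (2 * e0)))) ^ (2 * ?n)" using kap by (intro power_mono) auto
  also have "... = kap ^ (2 * ?n) * 2 ^ ((D + y * (2 * e0)) * (2 * ?n))"
    by (simp only: power_mult_distrib power_add[symmetric] power_mult[symmetric])
  also have "... <= (card (CC n0) * 2 ^ (y * D * ?n)) * 2 ^ ((D + y * (2 * e0)) * (2 * ?n))" using k by (rule mult_le_mono1)
  finally have "2 ^ (y * D * (2 * ?n)) <= card (CC n0) * 2 ^ (y * D * ?n + (D + y * (2 * e0)) * (2 * ?n))"
    by (simp only: power_mult[symmetric] power_add mult.assoc)
  then have "real (2 ^ (y * D * (2 * ?n))) <= real (card (CC n0) * 2 ^ (y * D * ?n + (D + y * (2 * e0)) * (2 * ?n)))" by (rule of_nat_mono)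
  moreover have p2: "2 powr real m = 2 ^ m" for m :: nat by (rule powr_realpow) simp
  ultimately have c: "2 powr real (y * D * (2 * ?n)) <= card (CC n0) * 2 powr real (y * D * ?n + (D + y * (2 * e0)) * (2 * ?n))"
    unfolding p2 by (simp only: of_nat_mult of_nat_power of_nat_numeral)
  have "(R0 + ep / 16) * b * D + (2 * D + 4 * (real y * e0)) <= real y * D"
  proof -
    have "real y * e0 <= b * (ep * D / 128)" using y_bounds e0_bounds R by (intro mult_mono) auto
    then have 1: "4 * (real y * e0) <= ep * b * D / 32" by (simp add: mult_ac)
    have "64 <= ep * b" using b(1) R by (simp add: field_simps)
    then have "64 * real D <= ep * b * D" by (intro mult_right_mono) auto
    then have 2: "2 * real D <= ep * b * D / 32" by simp
    have "(R0 + ep / 8) * b * D <= real y * D" using y_bounds by (intro mult_right_mono) auto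
    moreover have "(R0 + ep / 8) * b * D = (R0 + ep / 16) * b * D + ep * b * D / 16" by (simp add: algebra_simps)
    ultimately show ?thesis using 1 2 by linarith
  qed
  then have "((R0 + ep / 16) * b * D + (2 * D + 4 * (real y * e0))) * ?n <= (real y * D) * ?n" by (rule mult_right_mono) simp
  then have "(R0 + ep / 16) * b * D * ?n + real (y * D * ?n + (D + y * (2 * e0)) * (2 * ?n)) <= real (y * D * (2 * ?n))"
    by (simp add: algebra_simps)
  then have "2 powr ((R0 + ep / 16) * b * D * ?n + real (y * D * ?n + (D + y * (2 * e0)) * (2 * ?n))) <= 2 powr real (y * D * (2 * ?n))"
    by (rule powr_mono) simp
  then have "2 powr ((R0 + ep / 16) * b * D * ?n) * 2 powr real (y * D * ?n + (D + y * (2 * e0)) * (2 * ?n))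
     <= card (CC n0) * 2 powr real (y * D * ?n + (D + y * (2 * e0)) * (2 * ?n))"
    using c unfolding powr_add by linarith
  then show ?thesis by (rule mult_right_le_imp_le) (rule powr_gt_zero[THEN iffD2], simp)
qed

text \<open>The zeros beyond the square cost a factor of at least \<open>1 - ep / 32\<close>, which
  the surplus \<open>ep / 16\<close> of the components pays for.\<close>

lemma rate_code:
  assumes n0: "2 <= n0" and N: "n0 * n0 <= N" and big: "(1 - ep / 32) * N <= real (n0 * n0)" and z: "0 < z"
  shows "R0 <= rate {..<q0 ^ z} N (code n0 N z)"
proof -
  have N0: "0 < N" using mult_le_mono[OF n0 n0] N by linarith
  have "R0 <= (R0 + ep / 16) * (1 - ep / 32)"
  proof -
    have "ep * (R0 + ep / 16) <= ep * 2" using R by (intro mult_left_mono) auto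
    then show ?thesis by (simp add: algebra_simps)
  qed
  then have "R0 * N <= (R0 + ep / 16) * (1 - ep / 32) * N" by (intro mult_right_mono) auto
  also have "... <= (R0 + ep / 16) * (n0 * n0)" unfolding mult.assoc using big R by (intro mult_left_mono) auto
  finally have RN: "R0 * N <= (R0 + ep / 16) * (n0 * n0)" .
  let ?E = "(R0 + ep / 16) * b * D * real (n0 * n0)"
  have bD: "0 < real (b * D)" using pos by simp
  have "R0 * N * (b * D) <= (R0 + ep / 16) * (n0 * n0) * (b * D)" using RN by (intro mult_right_mono) auto
  then have E: "R0 * N * (b * D) <= ?E" by (simp add: mult_ac)
  have "2 powr (real z * ?E) = (2 powr ?E) ^ z" by (rule powr_power[symmetric]) simp
  also have "... <= real (card (CC n0)) ^ z" using card_CC_bound[OF n0] by (intro power_mono) simp_all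
  also have "... = real (card (CC n0) ^ z)" by simp
  also have "... <= card (code n0 N z)" using card_code[OF N] by (rule of_nat_mono)
  finally have c: "2 powr (real z * ?E) <= card (code n0 N z)" .
  have cpos: "0 < real (card (code n0 N z))" by (rule less_le_trans[OF _ c]) simp
  have "real z * (R0 * N * (b * D)) <= real z * ?E" using E by (intro mult_left_mono) auto
  also have "... <= log 2 (card (code n0 N z))" using c cpos by (simp add: le_log_iff)
  finally have lg: "real z * (R0 * N * (b * D)) <= log 2 (card (code n0 N z))" .
  have q: "real (q0 ^ z) = 2 powr (real (b * D * z))"
    unfolding powr_realpow[OF zero_less_numeral] by (simp add: power_mult)
  have "log (real (q0 ^ z)) (card (code n0 N z)) = log 2 (card (code n0 N z)) / (b * D * z)"
    unfolding q using bD z by (simp add: log_def ln_powr)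
  moreover have "R0 * N <= log 2 (card (code n0 N z)) / (b * D * z)"
  proof -
    have "0 < real (b * D * z)" using bD z by simp
    moreover have "R0 * N * (b * D * z) <= log 2 (card (code n0 N z))" using lg by (simp add: mult_ac)
    ultimately show ?thesis by (simp only: pos_le_divide_eq)
  qed
  ultimately have "R0 * N <= log (real (q0 ^ z)) (card (code n0 N z))" by simp
  then show ?thesis using N0 by (simp add: rate_def le_divide_eq)
qed

end

text \<open>The numbers 1 and 10 are the two constants of the theorem; the product with 1 keeps the
  literal form of the claim.\<close>

definition good_q :: "real => real => prog => nat => bool" where
  "good_q R ep p q \<longleftrightarrow> (\<exists>N C. is_code {..<q} N C & R <= rate {..<q} N C &
     2 powr (real q powr (1 * (ep^2 / log 2 (1 / R)))) <= real N &
     list_decodes_within p q N C (1 - R - ep) ((real N * log 2 (1 / R) / ep^2) powr (10 * (1 / (R * ep)^2))))"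

text \<open>From \<open>ep <= 1 - R\<close> the product \<open>R * ep\<close> is at most
  \<open>R * (1 - R)\<close>, hence at most 1/4, and 10 times 16 is 160.\<close>

lemma exponent_large:
  fixes R ep :: real
  assumes "0 < R" "0 < ep" "ep <= 1 - R"
  shows "160 <= 10 * (1 / (R * ep)^2)"
proof -
  have "R * ep <= R * (1 - R)" using assms by (intro mult_left_mono) auto
  also have "... = 1 / 4 - (R - 1 / 2)^2" by (simp add: power2_eq_square algebra_simps)
  also have "... <= 1 / 4" by simp
  finally have "(R * ep)^2 <= (1 / 4)^2" using assms by (intro power_mono) auto
  then have "(R * ep)^2 <= 1 / 16" by (simp add: power2_eq_square)
  then have "1 / (1 / 16) <= 1 / (R * ep)^2" using assms by (intro divide_left_mono) auto
  then show ?thesis by simp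
qed

section \<open>Block length, radius and running time\<close>

context params
begin

text \<open>For fixed \<open>q\<close> all lower bounds on the length, the double exponential one
  included, are constants; \<open>bd\<close> is their sum, and \<open>L\<close> is taken beyond it
  among the exponents with rounding correction \<open>oo\<close>.\<close>

lemma good_alphabet:
  fixes p :: prog and k oo z :: nat
  assumes S: "infinite {L. nat \<lfloor>(1 - R0 - ep) * real (2 ^ L + nat \<lfloor>(1 - R0 - ep) * real (2 ^ L)\<rfloor>)\<rfloor>
      - nat \<lfloor>(1 - R0 - ep) * real (2 ^ L)\<rfloor> * (2 ^ L + nat \<lfloor>(1 - R0 - ep) * real (2 ^ L)\<rfloor>) div 2 ^ L = oo}"
    and p: "\<forall>q ys. let N = length ys; sg = run N ((!) ys) (prg4.MAIN D kap q0 t Gam MTp psi thr (D - e0) (2 ^ TT) TT mg (Suc mg ^ 2 ^ TT) kk oo) (env0 q N) (%_ _. 0) in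
      sg 31 0 <= N --> (\<exists>t s. exec p (input_state q ys) t s & t <= k * (N + 1) ^ 42 &
       output_list N s = map (%j. map (%i. sg 30 (j * N + i)) [0..<N]) [0..<sg 31 0])"
    and z: "0 < z"
  shows "good_q R0 ep p (q0 ^ z)"
proof -
  define rh where "rh = 1 - R0 - ep"
  have rh: "0 <= rh" "rh < 1" using R by (simp_all add: rh_def)
  define q where "q = q0 ^ z"
  define g where "g = log 2 (1 / R0) / ep^2"
  have g: "0 < g" using R by (simp add: g_def zero_less_log_cancel_iff)
  define T where "T = 2 powr (real q powr (1 * (ep^2 / log 2 (1 / R0))))"
  define bd where "bd = T + 1 / g^2 + k * 2 ^ 42 + (2 / (ep / 32))^2 + 16 + D + q0 + Gam + q + q0 * z"
  obtain M0 :: nat where M0: "bd <= M0" using real_arch_simple by blast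
  obtain L where L: "M0 <= L" "nat \<lfloor>rh * real (2 ^ L + nat \<lfloor>rh * real (2 ^ L)\<rfloor>)\<rfloor> - nat \<lfloor>rh * real (2 ^ L)\<rfloor> * (2 ^ L + nat \<lfloor>rh * real (2 ^ L)\<rfloor>) div 2 ^ L = oo"
    using S unfolding infinite_nat_iff_unbounded_le rh_def by blast
  define f where "f = nat \<lfloor>rh * real (2 ^ L)\<rfloor>"
  define N where "N = 2 ^ L + f"
  define Z where "Z = nat \<lfloor>rh * N\<rfloor>"
  have P0: "0 < (2::nat) ^ L" by simp
  note fl = floor_split[OF rh P0 f_def N_def]
  have "Z - f * N div 2 ^ L = oo" using L(2) unfolding Z_def N_def f_def .
  moreover have "f * N div 2 ^ L <= Z" using fl(2) unfolding Z_def .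
  moreover have "N - 2 ^ L = f" by (simp add: N_def)
  ultimately have Zo: "Z = oo + (N - 2 ^ L) * N div 2 ^ L" by simp
  have "M0 <= N" using L(1) less_exp[of L] unfolding N_def by linarith
  then have bN: "bd <= real N" using M0 by linarith
  have T0: "0 <= T" by (simp add: T_def)
  have g0: "0 <= 1 / g^2" by simp
  have e0': "0 <= (2 / (ep / 32))^2" by simp
  have lT: "T <= N" and lg: "1 / g^2 <= N" and le: "(2 / (ep / 32))^2 <= N"
    and lk: "real (k * 2 ^ 42) <= N" and l16: "16 <= real N" and lD: "real D <= N" and lq0: "real q0 <= N"
    and lG: "real Gam <= N" and lq: "real q <= N" and lz: "real (q0 * z) <= N"
    using bN T0 g0 e0' unfolding bd_def by (simp_all only: of_nat_add of_nat_mult of_nat_power of_nat_numeral) (smt (verit) of_nat_0_le_iff zero_le_power zero_le_mult_iff zero_le_numeral)+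
  have nN: "k * 2 ^ 42 <= N" "16 <= N" "D <= N" "q0 <= N" "Gam <= N" "q <= N" "q0 * z <= N"
    using lk lD lq0 lG lq lz of_nat_le_iff[of "k * 2 ^ 42" N, where ?'a = real] l16 by (simp_all only: of_nat_le_iff)
  have "0 < ep / 32" using R by simp
  from square_below[OF this le nN(2)] obtain n0 where n0: "4 <= n0" "n0 * n0 <= N" "N < (n0 + 1) * (n0 + 1)" "(1 - ep / 32) * N <= real (n0 * n0)" by blast
  have n02: "2 <= n0" using n0 by simp
  let ?n = "n0 * n0"
  have Zr: "real Z <= rh * N" unfolding Z_def using rh by (simp add: of_nat_nat)
  have "rh <= (rh + ep / 16) * (1 - ep / 32)"
  proof -
    have "ep * (rh + ep / 16) <= ep * 2" using R rh by (intro mult_left_mono) auto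
    then show ?thesis by (simp add: algebra_simps)
  qed
  then have "rh * N <= (rh + ep / 16) * (1 - ep / 32) * N" by (rule mult_right_mono) simp
  also have "... <= (rh + ep / 16) * real ?n" unfolding mult.assoc[of "rh + ep / 16"] using n0(4) R rh by (intro mult_left_mono) auto
  also have "... = real ?n - alx * real ?n" unfolding rh_def by (simp add: algebra_simps)
  finally have alxZ: "alx * real ?n + Z <= real ?n" using Zr by linarith
  have dec: "list_decodes_within p q N (code n0 N z) rh ((real N * log 2 (1 / R0) / ep^2) powr (10 * (1 / (R0 * ep)^2)))"
    unfolding list_decodes_within_def
  proof
    fix ys assume "ys \<in> words {..<q} N"
    then have W: "set ys \<subseteq> {..<q}" "length ys = N" by (simp_all add: words_def)
    have ys: "length ys = N" "\<And>r. r < N ==> ys ! r < q" using W subsetD[OF W(1) nth_mem] by simp_all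
    interpret F: full D kap q0 t Gam MTp psi thr "D - e0" "2 ^ TT" TT mg "Suc mg ^ 2 ^ TT" kk oo n0 ?n N z q Z L K e0 t lam dl ta alx "(!) ys"
    proof (rule full.intro)
      show "dec3 D kap q0 t Gam MTp psi thr (D - e0) (2 ^ TT) TT mg (Suc mg ^ 2 ^ TT) ?n (nb n0 kk) lam K Y N e0 dl ta alx t" for Y
        by (rule decoder[OF n02 n0(2) nN(3-5)])
    qed (use n0 nN D(1) q0_pos q_def fl(1) Zo alxZ ys in \<open>simp_all add: N_def[symmetric]\<close>, simp_all add: N_def)
    define sg where "sg = run N ((!) ys) F.MAIN (env0 q N) (%_ _. 0)"
    have env: "env0 q N 1 = N" "env0 q N 0 = q" by (simp_all add: env0_def)
    note M = F.run_MAIN[OF env sg_def]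
    obtain tm s where ex: "exec p (input_state q ys) tm s" "tm <= k * (N + 1) ^ 42"
      "output_list N s = map (%j. map (%i. sg 30 (j * N + i)) [0..<N]) [0..<sg 31 0]"
      using p[rule_format, of ys q] M(1) unfolding Let_def ys(1) sg_def by blast
    have out: "output_list N s = F.outs sg" unfolding ex(3) F.outs_def F.outw_def ..
    have "real tm <= real (k * (N + 1) ^ 42)" using ex(2) by (rule of_nat_mono)
    also have "... <= (N * g) powr (10 * (1 / (R0 * ep)^2))"
      by (rule time_bound[OF g exponent_large lg nN(1)]) (use R nN(2) in auto)
    also have "N * g = real N * log 2 (1 / R0) / ep^2" by (simp add: g_def)
    finally have tm: "real tm <= (real N * log 2 (1 / R0) / ep^2) powr (10 * (1 / (R0 * ep)^2))" .
    have ham: "real (hamming_dist (map h [0..<N]) ys) <= rh * N \<longleftrightarrow> F.errs h <= Z" for h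
    proof -
      have "{i. i < length (map h [0..<N]) & map h [0..<N] ! i ~= ys ! i} = {r. r < N & h r ~= ys ! r}" by auto
      then have "hamming_dist (map h [0..<N]) ys = F.errs h" unfolding hamming_dist_def F.errs_def by (rule arg_cong)
      \<comment> \<open>Error counts are integers, so the real radius may be replaced by its integer
        part.\<close>
      moreover have "real m <= rh * N \<longleftrightarrow> m <= Z" for m :: nat
        unfolding Z_def using Zr[unfolded Z_def] by (meson le_nat_floor of_nat_le_iff order_trans)
      ultimately show ?thesis by simp
    qed
    have cr: "F.cr = crr n0" by (intro ext) (simp add: F.cr_def crr_def)
    have cwd: "F.cwd h = cw ?n z h" for h by (intro ext) (simp add: F.cwd_def cw_def)
    have dis: "distinct (output_list N s)" unfolding out by (rule M(2))
    have "set (output_list N s) = close_codewords (code n0 N z) N rh ys"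
      unfolding out M(3) cr cwd close_codewords_def code_def using ham by auto
    then show "\<exists>t s. exec p (input_state q ys) t s &
        real t <= (real N * log 2 (1 / R0) / ep^2) powr (10 * (1 / (R0 * ep)^2)) &
        distinct (output_list N s) & set (output_list N s) = close_codewords (code n0 N z) N rh ys"
      using ex(1) tm dis by blast
  qed
  show ?thesis unfolding good_q_def q_def[symmetric]
  proof (intro exI conjI)
    show "is_code {..<q} N (code n0 N z)" unfolding q_def by (rule code_is_code)
    show "R0 <= rate {..<q} N (code n0 N z)" unfolding q_def by (rule rate_code[OF n02 n0(2,4) z])
    show "2 powr (real q powr (1 * (ep^2 / log 2 (1 / R0)))) <= real N" using lT by (simp only: T_def)
    show "list_decodes_within p q N (code n0 N z) (1 - R0 - ep) ((real N * log 2 (1 / R0) / ep^2) powr (10 * (1 / (R0 * ep)^2)))"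
      using dec by (simp only: rh_def)
  qed
qed

theorem decodable: "\<exists>p. infinite {q. (\<exists>m. q = 2 ^ m) & good_q R0 ep p q}"
proof -
  let ?rh = "1 - R0 - ep"
  have rh: "0 <= ?rh" "?rh < 1" using R by simp_all
  define f where "f L = nat \<lfloor>?rh * real (2 ^ L)\<rfloor>" for L :: nat
  define off where "off L = nat \<lfloor>?rh * real (2 ^ L + f L)\<rfloor> - f L * (2 ^ L + f L) div 2 ^ L" for L
  \<comment> \<open>The correction takes at most three values, so one of them occurs for infinitely
    many \<open>L\<close> and may be written into the program.\<close>
  have "off L <= 2" for L
    using floor_split(3)[OF rh, of "2 ^ L" "f L" "2 ^ L + f L"] unfolding off_def f_def by simp
  then have "finite (range off)" by (intro finite_subset[of "range off" "{..2}"]) auto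
  then obtain L0 where "infinite {L \<in> UNIV. off L = off L0}" using pigeonhole_infinite[OF infinite_UNIV_nat] by blast
  then have inf: "infinite {L. off L = off L0}" by simp
  interpret P: prg4 D kap q0 t Gam MTp psi thr "D - e0" "2 ^ TT" TT mg "Suc mg ^ 2 ^ TT" kk "off L0" .
  obtain p k where pk: "\<forall>q ys. let N = length ys; sg = run N ((!) ys) P.MAIN (env0 q N) (%_ _. 0) in
      sg 31 0 <= N --> (\<exists>t s. exec p (input_state q ys) t s & t <= k * (N + 1) ^ (dpc P.MAIN + 2) &
       output_list N s = map (%j. map (%i. sg 30 (j * N + i)) [0..<N]) [0..<sg 31 0])"
    using compile[of P.MAIN 31 30] by blast
  have pw: "k * (N + 1) ^ (dpc P.MAIN + 2) <= k * (N + 1) ^ 42" for N :: nat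
    using P.dpc_MAIN by (intro mult_le_mono2 power_increasing) auto
  have pk2: "\<forall>q ys. let N = length ys; sg = run N ((!) ys) P.MAIN (env0 q N) (%_ _. 0) in
      sg 31 0 <= N --> (\<exists>t s. exec p (input_state q ys) t s & t <= k * (N + 1) ^ 42 &
       output_list N s = map (%j. map (%i. sg 30 (j * N + i)) [0..<N]) [0..<sg 31 0])"
    unfolding Let_def
  proof (intro allI impI)
    fix q ys assume "run (length ys) ((!) ys) P.MAIN (env0 q (length ys)) (%_ _. 0) 31 0 <= length ys"
    then obtain t s where ts: "exec p (input_state q ys) t s" "t <= k * (length ys + 1) ^ (dpc P.MAIN + 2)"
      "output_list (length ys) s = map (%j. map (%i. run (length ys) ((!) ys) P.MAIN (env0 q (length ys)) (%_ _. 0) 30 (j * length ys + i))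
         [0..<length ys]) [0..<run (length ys) ((!) ys) P.MAIN (env0 q (length ys)) (%_ _. 0) 31 0]"
      using pk unfolding Let_def by blast
    show "\<exists>t s. exec p (input_state q ys) t s & t <= k * (length ys + 1) ^ 42 &
      output_list (length ys) s = map (%j. map (%i. run (length ys) ((!) ys) P.MAIN (env0 q (length ys)) (%_ _. 0) 30 (j * length ys + i))
         [0..<length ys]) [0..<run (length ys) ((!) ys) P.MAIN (env0 q (length ys)) (%_ _. 0) 31 0]"
      by (intro exI conjI) (rule ts(1), rule order_trans[OF ts(2) pw], rule ts(3))
  qed
  have "good_q R0 ep p (q0 ^ z)" if "0 < z" for z
    by (rule good_alphabet[OF inf[unfolded off_def f_def] pk2[unfolded off_def f_def] that])
  moreover have "q0 ^ z = 2 ^ (b * D * z)" for z by (simp only: power_mult)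
  ultimately have "(%z. q0 ^ z) ` {0<..} \<subseteq> {q. (\<exists>m. q = 2 ^ m) & good_q R0 ep p q}" by auto
  moreover have "infinite ((%z. q0 ^ z) ` {0<..})"
  proof -
    have "inj_on (%z. q0 ^ z) {0<..}" 
    proof (rule inj_onI)
      fix v w assume "q0 ^ v = q0 ^ w"
      moreover have "1 < q0" using q0_pos by linarith
      ultimately show "v = w" using power_inject_exp[of q0 v w] by blast
    qed
    then show ?thesis by (simp add: finite_image_iff infinite_Ioi)
  qed
  ultimately have "infinite {q. (\<exists>m. q = 2 ^ m) & good_q R0 ep p q}" by (rule infinite_super)
  then show ?thesis by blast
qed

end

text \<open>The bound on \<open>2 * kap\<close> balls is a fraction \<open>1 / 2 ^ s\<close> of the
  space. The gap between agreement \<open>R + ep / 2\<close> and outer rate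
  \<open>R + ep / 8\<close> gives \<open>s >= ep * b * D / 4\<close>, so a list size of at least
  \<open>8 / ep\<close> makes \<open>Suc K * s\<close> exceed the \<open>b * D\<close> bits needed
  to name a centre.\<close>

lemma inner_constants:
  fixes R ep :: real and b D y t K kap :: nat
  assumes R: "0 < R" "0 < ep" "ep <= 1 - R" and b: "64 / ep <= b" and D: "16 / ep <= D" and K: "8 / ep <= K"
    and t: "(R + ep / 2) * D <= t" "t <= D" and y: "y <= (R + ep / 8) * b + 1" and kap: "kap <= 2 ^ (y * D)"
  shows "8 * (2 * kap * (2 ^ D * (2 ^ b) ^ (D - t))) <= ((2::nat) ^ b) ^ D"
    "4 * ((2 ^ b) ^ D * (2 * kap * (2 ^ D * (2 ^ b) ^ (D - t))) ^ Suc K) <= (((2::nat) ^ b) ^ D) ^ Suc K"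
proof -
  have eb: "64 <= ep * b" "16 <= ep * D" using b D R by (simp_all add: field_simps)
  have e1: "ep < 1" using R by simp
  have "ep * b <= 1 * real b" "ep * D <= 1 * real D" using e1 by (intro mult_right_mono; simp)+
  then have bD: "64 <= real b" "16 <= real D" using eb by linarith+
  have "(R + ep / 2) * D * b <= real t * b" using t by (intro mult_right_mono) auto
  moreover have "real y * real D <= ((R + ep / 8) * b + 1) * D" using y by (intro mult_right_mono) auto
  moreover have "(R + ep / 2) * D * b - ((R + ep / 8) * b + 1) * D = 3 / 8 * (ep * b * D) - D" by (simp add: algebra_simps)
  moreover have "64 * real D <= ep * b * D" using eb by (intro mult_right_mono) auto
  ultimately have s0: "ep * b * D / 4 <= real t * b - real y * D - D - 1" using bD by linarith
  have p16: "16 * real D <= ep * b * D / 4" using \<open>64 * real D <= ep * b * D\<close> by simp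
  then have "real y * D + D + 1 <= real t * b" using s0 bD by linarith
  then have "real (y * D + D + 1) <= real (b * t)" by (simp add: mult.commute)
  then have le: "y * D + D + 1 <= b * t" by (simp only: of_nat_le_iff)
  define s where "s = b * t - (y * D + D + 1)"
  have s: "b * t = y * D + D + 1 + s" using le by (simp add: s_def)
  then have "real (b * t) = real (y * D + D + 1 + s)" by (rule arg_cong)
  then have sr: "ep * b * D / 4 <= real s" using s0 by (simp add: mult.commute)
  have "real 4 <= real s" using order_trans[OF p16 sr] bD by simp
  then have s4: "4 <= s" by (simp only: of_nat_le_iff)
  have btD: "b * D = b * t + b * (D - t)" using t(2) by (simp add: add_mult_distrib2[symmetric])
  have sD: "y * D + 1 + D + b * (D - t) + s = b * D" using s btD by linarith
  let ?B = "2 * kap * (2 ^ D * (2 ^ b) ^ (D - t))"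
  have "?B <= 2 * 2 ^ (y * D) * (2 ^ D * (2 ^ b) ^ (D - t))" using kap by (intro mult_le_mono) auto
  also have "... = 2 ^ (y * D + 1 + D + b * (D - t))" by (simp add: power_add power_mult)
  also have "y * D + 1 + D + b * (D - t) = b * D - s" using sD by linarith
  finally have B: "?B <= 2 ^ (b * D - s)" .
  have sl: "s <= b * D" using sD by linarith
  have "8 * ?B <= 2 ^ 3 * 2 ^ (b * D - s)" using B by simp
  also have "... = 2 ^ (3 + (b * D - s))" by (simp only: power_add)
  also have "... <= 2 ^ (b * D)" using s4 sl by (intro power_increasing) auto
  finally show "8 * ?B <= ((2::nat) ^ b) ^ D" by (simp only: power_mult)
  have "b * D + 2 <= Suc K * s"
  proof -
    have "8 / ep * (ep * b * D / 4) <= real (Suc K) * real s" using K sr R by (intro mult_mono) auto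
    moreover have "8 / ep * (ep * b * D / 4) = 2 * (real b * D)" using R by simp
    ultimately have "2 * (real b * D) <= real (Suc K) * real s" by linarith
    moreover have "64 * 16 <= real b * D" using bD by (intro mult_mono) auto
    ultimately have "real b * D + 2 <= real (Suc K) * real s" by linarith
    then have "real (b * D + 2) <= real (Suc K * s)" by (simp only: of_nat_add of_nat_mult of_nat_numeral)
    then show ?thesis by (simp only: of_nat_le_iff)
  qed
  then have ex: "2 + b * D + (b * D - s) * Suc K <= b * D * Suc K"
  proof -
    assume h: "b * D + 2 <= Suc K * s"
    have "(b * D - s) * Suc K + s * Suc K = b * D * Suc K" using sl by (simp only: add_mult_distrib[symmetric] le_add_diff_inverse2)
    then show ?thesis using h by (simp only: mult.commute[of s])
  qed
  have "4 * ((2 ^ b) ^ D * ?B ^ Suc K) <= 2 ^ 2 * (2 ^ (b * D) * (2 ^ (b * D - s)) ^ Suc K)"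
    using power_mono[OF B, of "Suc K"] by (simp add: power_mult)
  also have "... = 2 ^ (2 + b * D + (b * D - s) * Suc K)" by (simp only: power_add power_mult mult.assoc)
  also have "... <= 2 ^ (b * D * Suc K)" by (rule power_increasing[OF ex]) simp
  finally show "4 * ((2 ^ b) ^ D * ?B ^ Suc K) <= (((2::nat) ^ b) ^ D) ^ Suc K" by (simp only: power_mult)
qed

text \<open>The order of choice matters. List size, resolution of densities, test threshold and
  number of rounds depend on \<open>ep\<close> alone; then comes the degree, to make the spectral
  ratio small against \<open>2 ^ TT\<close>; then \<open>b\<close>, to provide enough slots; the
  codes come last.\<close>

lemma params_exist:
  assumes R: "0 < R0" "R0 < 1" "0 < ep" "ep <= 1 - R0"
  shows "\<exists>K mg Gam TT kk D b y kap t e0 thr psi phx bex dl x. params R0 ep K mg Gam TT kk D b y kap t e0 thr psi phx bex dl x"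
proof -
  define bex where "bex = (ep^2 / 2048)^2"
  define dl where "dl = bex / 16"
  have bex0: "0 < bex" "0 < dl" using R by (simp_all add: bex_def dl_def)
  obtain K :: nat where K: "8 / ep <= K" using real_arch_simple by blast
  have "0 < 8 / ep" using R by simp
  then have K0: "0 < real K" using K by linarith
  obtain mg :: nat where mg: "4 * real K / (bex / 16) + 1 <= mg" using real_arch_simple by blast
  have "0 <= 4 * real K / (bex / 16)" using bex0 by simp
  then have mg0: "4 * real K / (bex / 16) <= mg" "1 <= real mg" using mg by linarith+
  have "4 * real K <= mg * (bex / 16)" using mg0(1) bex0 by (simp add: field_simps)
  then have "4 * real K / real mg <= bex / 16" using mg0 by (simp add: divide_le_eq mult.commute)
  moreover have "4 * real K / (real mg)^2 <= 4 * real K / real mg"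
    using mg0 K0 by (intro divide_left_mono) (auto simp: power2_eq_square)
  ultimately have mg2: "4 * real K / (real mg)^2 <= bex / 16" by linarith
  obtain Gam :: nat where "8192 * real K / dl^2 <= Gam" using real_arch_simple by blast
  then have Gam: "8192 * real K <= Gam * dl^2" using bex0 by (simp add: divide_le_eq)
  define TT where "TT = 2 * K^2 * Gam^2 + 1"
  define m0 where "m0 = min (min (bex / 16) (dl / (128 * K))) (min ((ep / 128)^2 / 8) (1 / 2 ^ TT))"
  have m0: "0 < m0" using bex0 K0 R by (simp add: m0_def)
  let ?r = "(73 / 80 :: real)^2"
  have r: "0 < ?r" "?r < 1" by (simp_all add: power2_eq_square)
  obtain k1 where k1: "?r ^ k1 < m0" using real_arch_pow_inv[OF m0 r(2)] by blast
  obtain k2 where k2: "16 / ep < 8 ^ k2" using real_arch_pow[of "8::real" "16 / ep"] by auto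
  define kk where "kk = max k1 k2"
  define x where "x = ?r ^ kk"
  define D where "D = (8::nat) ^ kk"
  have "x <= ?r ^ k1" unfolding x_def kk_def using r by (intro power_decreasing) auto
  then have xm: "x <= m0" using k1 by simp
  have "(8::real) ^ k2 <= 8 ^ kk" unfolding kk_def by (intro power_increasing) auto
  moreover have "real D = 8 ^ kk" by (simp add: D_def)
  ultimately have D: "16 / ep <= D" using k2 by linarith
  define t where "t = nat \<lceil>(R0 + ep / 2) * D\<rceil>"
  define e0 where "e0 = nat \<lfloor>ep * D / 128\<rfloor>"
  define thr where "thr = nat \<lceil>mg * (t + ep * D / 16)\<rceil>"
  obtain b0 :: nat where b0: "64 / ep <= b0" using real_arch_simple by blast
  define b where "b = b0 + TT * Suc mg ^ (2 ^ TT)"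
  have "real b0 <= real b" unfolding b_def by (rule of_nat_mono) simp
  then have b: "64 / ep <= b" using b0 by linarith
  have D0: "1 <= D" by (simp add: D_def)
  have "b < 2 ^ b" by (rule less_exp)
  also have "(2::nat) ^ b <= 2 ^ (b * D)" using D0 by (intro power_increasing) auto
  finally have b2: "TT * Suc mg ^ (2 ^ TT) <= 2 ^ (b * D)" by (simp add: b_def)
  define y where "y = nat \<lceil>(R0 + ep / 8) * b\<rceil>"
  have "real y = of_int \<lceil>(R0 + ep / 8) * b\<rceil>" using R unfolding y_def by (simp add: of_nat_nat)
  then have y: "y <= (R0 + ep / 8) * b + 1" by linarith
  have "real t = of_int \<lceil>(R0 + ep / 2) * D\<rceil>" using R unfolding t_def by (simp add: of_nat_nat)
  then have t: "(R0 + ep / 2) * D <= t" "t <= (R0 + ep / 2) * D + 1" by linarith+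
  have tD: "t <= D"
  proof -
    have "(R0 + ep / 2) * D <= (1 - ep / 2) * D" using R by (intro mult_right_mono) auto
    also have "... = D - ep * D / 2" by (simp add: algebra_simps)
    finally have 1: "(R0 + ep / 2) * D <= D - ep * D / 2" .
    have "16 <= ep * D" using D R by (simp add: field_simps)
    then have "real t <= D" using t 1 by linarith
    then show ?thesis by simp
  qed
  have d: "0 < 2 * e0 + 1" by simp
  obtain kap psi where kp: "2 ^ (y * D) <= kap * (2 ^ D * 2 ^ (y * (2 * e0 + 1 - 1)))" "kap <= 2 ^ (y * D)"
    "\<forall>c<kap. \<forall>c'<kap. c ~= c' --> card {w. w < D & psi c w = psi c' w} + (2 * e0 + 1) <= D"
    "\<forall>n nbf. (\<forall>w<D. bij_betw (nbf w) {..<n} {..<n}) -->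
       kap ^ (2 * n) <= card {c \<in> {..<n} \<rightarrow>\<^sub>E {..<kap}. \<exists>c'. tanner n D nbf kap psi c c'} * 2 ^ (y * D * n)"
    using tanner_code_exists[OF d, of y D] by blast
  have kap0: "0 < kap"
  proof (rule ccontr)
    assume "\<not> 0 < kap" then show False using kp(1) by simp
  qed
  note I = inner_constants[OF R(1,3,4) b D K t(1) tD y kp(2)]
  have Q0: "0 < (2::nat) ^ b" "0 < 2 * kap" using kap0 by simp_all
  obtain phx where phx: "\<forall>c<kap. phx c < (2 ^ b) ^ D" "\<forall>c<kap. \<forall>c'<kap. c ~= c' --> agr D (2 ^ b) (phx c) (phx c') < t"
     "\<forall>u. card {c. c < kap & t <= agr D (2 ^ b) (phx c) u} <= K"
    using inner_code_exists[OF Q0 I order_refl] by blast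
  have "x * 2 ^ TT <= 1 / 2 ^ TT * 2 ^ TT" using xm by (intro mult_right_mono) (simp_all add: m0_def)
  then have x5: "x * 2 ^ TT <= 1" by simp
  have x4: "8 * x <= (ep / 128)^2" using xm unfolding m0_def by (simp add: min_le_iff_disj)
  have x2: "x <= bex / 16" "x <= dl / (128 * K)" using xm unfolding m0_def by simp_all
  have mgp: "0 < mg" using mg0(2) by simp
  have kp1: "2 ^ (y * D) <= kap * (2 ^ D * 2 ^ (y * (2 * e0)))" using kp(1) by simp
  have "params R0 ep K mg Gam TT kk D b y kap t e0 thr psi phx bex dl x"
  proof unfold_locales
    show "card {w. w < D & psi c w = psi c' w} + (2 * e0 + 1) <= D" if "c < kap" "c' < kap" "c ~= c'" for c c'
      using kp(3) that by blast
    show "kap ^ (2 * n) <= card {c \<in> {..<n} \<rightarrow>\<^sub>E {..<kap}. \<exists>c'. tanner n D nbf kap psi c c'} * 2 ^ (y * D * n)"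
      if "\<And>w. w < D ==> bij_betw (nbf w) {..<n} {..<n}" for n nbf using kp(4) that by blast
    show "phx c < (2 ^ b) ^ D" if "c < kap" for c using phx(1) that by blast
    show "agr D (2 ^ b) (phx c) (phx c') < t" if "c < kap" "c' < kap" "c ~= c'" for c c' using phx(2) that by blast
    show "card {c. c < kap & t <= agr D (2 ^ b) (phx c) u} <= K" for u using phx(3) by blast
  qed (rule R bex_def dl_def K mgp mg2 Gam TT_def D_def D x_def x2 x4 x5 t_def e0_def thr_def b b2 y_def kp1)+
  then show ?thesis by blast
qed

text \<open>The radius is negative and all lists are empty, so the code of all words serves, with a
  program that reports an empty list.\<close>

lemma trivial_radius:
  assumes R: "0 < R" "R < 1" "0 < ep" and e: "1 - R < ep"
  shows "infinite {q. (\<exists>m. q = 2 ^ m) & good_q R ep (Const 0 0) q}"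
proof -
  define g where "g = log 2 (1 / R) / ep^2"
  have g: "0 < g" using R by (simp add: g_def zero_less_log_cancel_iff)
  have "good_q R ep (Const 0 0) (2 ^ m)" if m: "0 < m" for m
  proof -
    define q where "q = (2::nat) ^ m"
    have q2: "1 < q" using one_less_power[of "2::nat" m] m by (simp add: q_def)
    define T where "T = 2 powr (real q powr (1 * (ep^2 / log 2 (1 / R))))"
    obtain N :: nat where "T + 1 / g + 1 <= N" using real_arch_simple by blast
    moreover have "0 <= T" "0 <= 1 / g" using g by (simp_all add: T_def)
    ultimately have N: "T <= N" "1 / g <= N" "1 <= real N" by linarith+
    let ?C = "words {..<q} N"
    have W: "?C = {xs. set xs \<subseteq> {..<q} & length xs = N}" by (simp add: words_def)
    have card: "card ?C = q ^ N" unfolding W by (simp add: card_lists_length_eq)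
    have rt: "rate {..<q} N ?C = 1"
      unfolding rate_def card using q2 N(3) by (simp add: log_nat_power)
    have "1 <= N * g" using N(2) g by (simp add: divide_le_eq)
    then have tm: "1 <= (real N * log 2 (1 / R) / ep^2) powr (10 * (1 / (R * ep)^2))"
      by (intro ge_one_powr_ge_zero) (simp_all add: g_def)
    have "list_decodes_within (Const 0 0) q N ?C (1 - R - ep) ((real N * log 2 (1 / R) / ep^2) powr (10 * (1 / (R * ep)^2)))"
      unfolding list_decodes_within_def
    proof
      fix ys
      obtain r m where rm: "input_state q ys = (r, m)" by (cases "input_state q ys") auto
      have neg: "(1 - R - ep) * N < 0" using e N(3) by (intro mult_neg_pos) auto
      have "close_codewords ?C N (1 - R - ep) ys = {}" unfolding close_codewords_def using neg by (auto simp: not_le intro: less_le_trans)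
      moreover have "output_list N (r(0 := 0), m) = []" by (simp add: output_list_def)
      ultimately show "\<exists>t s. exec (Const 0 0) (input_state q ys) t s &
          real t <= (real N * log 2 (1 / R) / ep^2) powr (10 * (1 / (R * ep)^2)) &
          distinct (output_list N s) & set (output_list N s) = close_codewords ?C N (1 - R - ep) ys"
        unfolding rm using exec.Const[of 0 0 r m] tm by (intro exI[of _ 1] exI[of _ "(r(0 := 0), m)"]) auto
    qed
    then show ?thesis unfolding good_q_def q_def[symmetric] using N(1) R rt
      by (intro exI[of _ N] exI[of _ ?C]) (simp add: is_code_def T_def)
  qed
  then have "(%m. 2 ^ m) ` {0<..} \<subseteq> {q. (\<exists>m. q = 2 ^ m) & good_q R ep (Const 0 0) q}" by auto
  moreover have "infinite ((%m. (2::nat) ^ m) ` {0<..})"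
  proof -
    have "inj_on (%m. (2::nat) ^ m) {0<..}" by (intro inj_onI) simp
    then show ?thesis by (simp add: finite_image_iff infinite_Ioi)
  qed
  ultimately show ?thesis by (rule infinite_super)
qed

theorem theorem7p1:
  "\<exists>c\<^sub>1 > 0. \<exists>c\<^sub>2 > 0. \<forall>R\<^sub>0 \<epsilon> :: real. 0 < R\<^sub>0 \<and> R\<^sub>0 < 1 \<and> 0 < \<epsilon> \<longrightarrow>
     (\<exists>p. infinite {q :: nat. (\<exists>m. q = 2 ^ m) \<and>
        (\<exists>N C. is_code {..<q} N C \<and>
           rate {..<q} N C \<ge> R\<^sub>0 \<and>
           real N \<ge> 2 powr (real q powr (c\<^sub>1 * (\<epsilon>\<^sup>2 / log 2 (1 / R\<^sub>0)))) \<and>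
           list_decodes_within p q N C (1 - R\<^sub>0 - \<epsilon>)
             ((real N * log 2 (1 / R\<^sub>0) / \<epsilon>\<^sup>2) powr (c\<^sub>2 * (1 / (R\<^sub>0 * \<epsilon>)\<^sup>2))))})"
proof (rule exI[of _ 1], rule conjI, simp, rule exI[of _ 10], rule conjI, simp, intro allI impI)
  fix R\<^sub>0 \<epsilon> :: real assume R: "0 < R\<^sub>0 \<and> R\<^sub>0 < 1 \<and> 0 < \<epsilon>"
  have "\<exists>p. infinite {q. (\<exists>m. q = 2 ^ m) \<and> good_q R\<^sub>0 \<epsilon> p q}"
  proof (cases "\<epsilon> \<le> 1 - R\<^sub>0")
    case True
    then obtain K mg Gam TT kk D b y kap t e0 thr psi \<phi> \<beta> \<delta> x where "params R\<^sub>0 \<epsilon> K mg Gam TT kk D b y kap t e0 thr psi \<phi> \<beta> \<delta> x"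
      using params_exist[of R\<^sub>0 \<epsilon>] R by blast
    then show ?thesis by (rule params.decodable)
  next
    case False
    then show ?thesis using trivial_radius[of R\<^sub>0 \<epsilon>] R by (intro exI[of _ "Const 0 0"]) auto
  qed
  then show "\<exists>p. infinite {q :: nat. (\<exists>m. q = 2 ^ m) \<and>
        (\<exists>N C. is_code {..<q} N C \<and> rate {..<q} N C \<ge> R\<^sub>0 \<and>
           real N \<ge> 2 powr (real q powr (1 * (\<epsilon>\<^sup>2 / log 2 (1 / R\<^sub>0)))) \<and>
           list_decodes_within p q N C (1 - R\<^sub>0 - \<epsilon>)
             ((real N * log 2 (1 / R\<^sub>0) / \<epsilon>\<^sup>2) powr (10 * (1 / (R\<^sub>0 * \<epsilon>)\<^sup>2))))}"
    unfolding good_q_def .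
qed

end
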